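(* Let $R$ be a standard graded Cohen-Macaulay ring of dimension $d>0$ with irrelevant maximal ideal $\mathfrak m$ and uncountable residue field $k=R_0=R/\mathfrak m$. If $R$ is of graded countable Cohen-Macaulay type, then $R$ is super-stretched.
   Context: A standard graded ring is a Noetherian commutative graded ring $R=\bigoplus_{i\ge 0}R_i$ with $R_0=k$ a field and $R=R_0[R_1]$; its irrelevant maximal ideal is $\mathfrak m=\bigoplus_{i\ge1}R_i$, and $R/\mathfrak m = k$. Graded countable Cohen-Macaulay type: a standard graded Cohen-Macaulay ring $R$ has graded countable Cohen-Macaulay type if there are only countably many (finitely many allowed) indecomposable objects, up to isomorphism and shift in degree, in the category whose objects are the finitely generated graded maximal Cohen-Macaulay $R$-modules and whose morphisms are graded $R$-homomorphisms of degree zero. The shift is $M(n)_i=M_{i+n}$; $M$ and $N$ are isomorphic up to shift if $M\simeq N(n)$ by a degree-zero isomorphism for some integer $n$. Super-stretched: a standard graded Cohen-Macaulay ring $R$ of dimension $d$ is super-stretched if for all homogeneous systems of parameters $x_1,\dots,x_d$ one has $\dim_k\left(R/(x_1,\dots,x_d)\right)_i\le 1$ for all $i\ge \sum_{j=1}^d\deg(x_j)-d+2$. *)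

theory Defs
  imports "HOL-Algebra.Algebra" "HOL-Library.Countable_Set" "HOL-Library.Extended_Nat"
begin

section \<open>Gradings\<close>

definition homogeneous_decomposition ::
    "('b, 'm) ring_scheme \<Rightarrow> ('i \<Rightarrow> 'b set) \<Rightarrow> 'b \<Rightarrow> ('i \<Rightarrow> 'b) \<Rightarrow> bool" where
  "homogeneous_decomposition M G x f \<longleftrightarrow>
     (\<forall>i. f i \<in> G i) \<and> finite {i. f i \<noteq> \<zero>\<^bsub>M\<^esub>} \<and> x = (\<Oplus>\<^bsub>M\<^esub>i\<in>{i. f i \<noteq> \<zero>\<^bsub>M\<^esub>}. f i)"

text \<open>The additive group of \<^term>\<open>M\<close> is the internal direct sum of the \<^term>\<open>G i\<close>; used for rings
  (index type \<^typ>\<open>nat\<close>) and for modules (index type \<^typ>\<open>int\<close>).\<close>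

definition is_grading :: "('b, 'm) ring_scheme \<Rightarrow> ('i \<Rightarrow> 'b set) \<Rightarrow> bool" where
  "is_grading M G \<longleftrightarrow>
     (\<forall>i. additive_subgroup (G i) M) \<and>
     (\<forall>x\<in>carrier M. \<exists>!f. homogeneous_decomposition M G x f)"

locale standard_graded_ring = cring R + noetherian_ring R for R (structure) +
  fixes G :: "nat \<Rightarrow> 'a set"
  assumes grading: "is_grading R G"
    and mult_graded: "\<lbrakk>x \<in> G i; y \<in> G j\<rbrakk> \<Longrightarrow> x \<otimes> y \<in> G (i + j)"
    and degree_zero_field: "subfield (G 0) R"
    and generated_in_degree_one: "generate_ring R (G 0 \<union> G 1) = carrier R"

definition irrelevant_ideal :: "('a, 'm) ring_scheme \<Rightarrow> (nat \<Rightarrow> 'a set) \<Rightarrow> 'a set" where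
  "irrelevant_ideal R G =
     {x \<in> carrier R. \<exists>f. homogeneous_decomposition R G x f \<and> f 0 = \<zero>\<^bsub>R\<^esub>}"

locale graded_module = module R M
  for R :: "('a, 'r) ring_scheme" (structure) and G :: "nat \<Rightarrow> 'a set"
    and M :: "('a, 'b, 'm) module_scheme" (structure) and Mg :: "int \<Rightarrow> 'b set" +
  assumes module_grading: "is_grading M Mg"
    and smult_graded: "\<lbrakk>r \<in> G i; x \<in> Mg j\<rbrakk> \<Longrightarrow> r \<odot>\<^bsub>M\<^esub> x \<in> Mg (int i + j)"

definition fg_module :: "('a, 'r) ring_scheme \<Rightarrow> ('a, 'b, 'm) module_scheme \<Rightarrow> bool" where
  "fg_module R M \<longleftrightarrow>
     (\<exists>A\<subseteq>carrier M. finite A \<and>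
        carrier M = {(\<Oplus>\<^bsub>M\<^esub>a\<in>A. c a \<odot>\<^bsub>M\<^esub> a) | c. c \<in> A \<rightarrow> carrier R})"

text \<open>The grading of the shifted module \<open>M(n)\<close>.\<close>

definition shift_grading :: "int \<Rightarrow> (int \<Rightarrow> 'b set) \<Rightarrow> int \<Rightarrow> 'b set" where
  "shift_grading n Mg = (\<lambda>i. Mg (i + n))"

definition module_hom ::
    "('a, 'r) ring_scheme \<Rightarrow> ('a, 'b, 'm) module_scheme \<Rightarrow> ('a, 'c, 'n) module_scheme \<Rightarrow> ('b \<Rightarrow> 'c) set"
  where
  "module_hom R M N =
     {h \<in> carrier M \<rightarrow> carrier N.
        (\<forall>x\<in>carrier M. \<forall>y\<in>carrier M. h (x \<oplus>\<^bsub>M\<^esub> y) = h x \<oplus>\<^bsub>N\<^esub> h y) \<and>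
        (\<forall>r\<in>carrier R. \<forall>x\<in>carrier M. h (r \<odot>\<^bsub>M\<^esub> x) = r \<odot>\<^bsub>N\<^esub> h x)}"

text \<open>Degree-zero homomorphisms; the inverse of a bijective one is automatically one as well.\<close>

definition graded_hom ::
    "('a, 'r) ring_scheme \<Rightarrow> ('a, 'b, 'm) module_scheme \<Rightarrow> (int \<Rightarrow> 'b set) \<Rightarrow>
     ('a, 'c, 'n) module_scheme \<Rightarrow> (int \<Rightarrow> 'c set) \<Rightarrow> ('b \<Rightarrow> 'c) set" where
  "graded_hom R M Mg N Ng = {h \<in> module_hom R M N. \<forall>i. h ` Mg i \<subseteq> Ng i}"

definition graded_isomorphic ::
    "('a, 'r) ring_scheme \<Rightarrow> ('a, 'b, 'm) module_scheme \<Rightarrow> (int \<Rightarrow> 'b set) \<Rightarrow>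
     ('a, 'c, 'n) module_scheme \<Rightarrow> (int \<Rightarrow> 'c set) \<Rightarrow> bool" where
  "graded_isomorphic R M Mg N Ng \<longleftrightarrow>
     (\<exists>h\<in>graded_hom R M Mg N Ng. bij_betw h (carrier M) (carrier N))"

definition isomorphic_up_to_shift ::
    "('a, 'r) ring_scheme \<Rightarrow> ('a, 'b, 'm) module_scheme \<Rightarrow> (int \<Rightarrow> 'b set) \<Rightarrow>
     ('a, 'c, 'n) module_scheme \<Rightarrow> (int \<Rightarrow> 'c set) \<Rightarrow> bool" where
  "isomorphic_up_to_shift R M Mg N Ng \<longleftrightarrow>
     (\<exists>n. graded_isomorphic R M Mg N (shift_grading n Ng))"


section \<open>Krull dimension, depth and Cohen-Macaulayness\<close>

definition krull_dim :: "('a, 'r) ring_scheme \<Rightarrow> enat" where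
  "krull_dim R =
     Sup {enat n | n. \<exists>p. (\<forall>i\<le>n. primeideal (p i) R) \<and> (\<forall>i<n. p i \<subset> p (Suc i))}"

text \<open>The submodule \<open>(x\<^sub>1, \<dots>, x\<^sub>n)M\<close>.\<close>

definition ideal_times_module ::
    "'a list \<Rightarrow> ('a, 'b, 'm) module_scheme \<Rightarrow> 'b set" where
  "ideal_times_module xs M =
     {(\<Oplus>\<^bsub>M\<^esub>j\<in>{..<length xs}. (xs ! j) \<odot>\<^bsub>M\<^esub> m j) | m. m \<in> {..<length xs} \<rightarrow> carrier M}"

text \<open>The middle conjunct says that \<^term>\<open>xs ! j\<close> is a nonzerodivisor on
  \<open>M/(x\<^sub>0, \<dots>, x\<^sub>j\<^sub>-\<^sub>1)M\<close>, written with representatives in \<^term>\<open>M\<close>.\<close>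

definition regular_sequence ::
    "('a, 'r) ring_scheme \<Rightarrow> ('a, 'b, 'm) module_scheme \<Rightarrow> 'a list \<Rightarrow> bool" where
  "regular_sequence R M xs \<longleftrightarrow>
     set xs \<subseteq> carrier R \<and>
     (\<forall>j<length xs. \<forall>m\<in>carrier M.
        (xs ! j) \<odot>\<^bsub>M\<^esub> m \<in> ideal_times_module (take j xs) M \<longrightarrow>
        m \<in> ideal_times_module (take j xs) M) \<and>
     ideal_times_module xs M \<noteq> carrier M"

definition depth ::
    "('a, 'r) ring_scheme \<Rightarrow> 'a set \<Rightarrow> ('a, 'b, 'm) module_scheme \<Rightarrow> enat" where
  "depth R I M = Sup {enat (length xs) | xs. set xs \<subseteq> I \<and> regular_sequence R M xs}"

definition self_module :: "('a, 'r) ring_scheme \<Rightarrow> ('a, 'a) module" where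
  "self_module R =
     \<lparr>carrier = carrier R, monoid.mult = (\<otimes>\<^bsub>R\<^esub>), one = \<one>\<^bsub>R\<^esub>, ring.zero = \<zero>\<^bsub>R\<^esub>,
      add = (\<oplus>\<^bsub>R\<^esub>), smult = (\<otimes>\<^bsub>R\<^esub>)\<rparr>"

text \<open>Depth is taken with respect to the irrelevant maximal ideal, along arbitrary, not necessarily
  homogeneous, regular sequences.\<close>

definition graded_cohen_macaulay :: "('a, 'r) ring_scheme \<Rightarrow> (nat \<Rightarrow> 'a set) \<Rightarrow> bool" where
  "graded_cohen_macaulay R G \<longleftrightarrow>
     depth R (irrelevant_ideal R G) (self_module R) = krull_dim R"

definition graded_mcm ::
    "('a, 'r) ring_scheme \<Rightarrow> (nat \<Rightarrow> 'a set) \<Rightarrow> ('a, 'b, 'm) module_scheme \<Rightarrow> (int \<Rightarrow> 'b set) \<Rightarrow> bool"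
  where
  "graded_mcm R G M Mg \<longleftrightarrow>
     graded_module R G M Mg \<and> fg_module R M \<and>
     depth R (irrelevant_ideal R G) M = krull_dim R"


section \<open>Graded countable Cohen-Macaulay type\<close>

text \<open>Indecomposability in the category of graded maximal Cohen-Macaulay modules: the summands in
  question are nonzero objects of that category, realised as graded submodules of \<^term>\<open>M\<close>.\<close>

definition indecomposable_graded_mcm ::
    "('a, 'r) ring_scheme \<Rightarrow> (nat \<Rightarrow> 'a set) \<Rightarrow> ('a, 'b, 'm) module_scheme \<Rightarrow> (int \<Rightarrow> 'b set) \<Rightarrow> bool"
  where
  "indecomposable_graded_mcm R G M Mg \<longleftrightarrow>
     graded_mcm R G M Mg \<and> carrier M \<noteq> {\<zero>\<^bsub>M\<^esub>} \<and>
     \<not> (\<exists>K L. submodule K R M \<and> submodule L R M \<and>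
          graded_mcm R G (M\<lparr>carrier := K\<rparr>) (\<lambda>i. K \<inter> Mg i) \<and>
          graded_mcm R G (M\<lparr>carrier := L\<rparr>) (\<lambda>i. L \<inter> Mg i) \<and>
          K \<noteq> {\<zero>\<^bsub>M\<^esub>} \<and> L \<noteq> {\<zero>\<^bsub>M\<^esub>} \<and>
          K \<inter> L = {\<zero>\<^bsub>M\<^esub>} \<and> K <+>\<^bsub>M\<^esub> L = carrier M)"

text \<open>HOL cannot quantify over modules of all carrier types inside a formula. Modules whose elements
  are sets of functions \<^typ>\<open>nat \<Rightarrow> 'a\<close> suffice, because they contain the quotients of the free
  modules \<open>R\<^sup>n\<close>; the lemma \<open>fg_graded_module_representable\<close> below shows that every finitely
  generated graded module, of whatever carrier type, is isomorphic to one of these.\<close>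

type_synonym 'a rep_graded_module =
  "('a, (nat \<Rightarrow> 'a) set) module \<times> (int \<Rightarrow> (nat \<Rightarrow> 'a) set set)"

definition graded_countable_cm_type :: "('a, 'r) ring_scheme \<Rightarrow> (nat \<Rightarrow> 'a set) \<Rightarrow> bool" where
  "graded_countable_cm_type R G \<longleftrightarrow>
     countable
       ({(M, Mg). indecomposable_graded_mcm R G M Mg} //
        {((M, Mg), (N, Ng)).
           indecomposable_graded_mcm R G M Mg \<and> indecomposable_graded_mcm R G N Ng \<and>
           isomorphic_up_to_shift R M Mg N Ng} :: 'a rep_graded_module set set)"


section \<open>Super-stretched rings\<close>

text \<open>The list \<^term>\<open>es\<close> records the degrees. They are required to be positive, so that the quotient
  by the ideal generated by \<^term>\<open>xs\<close> is not the zero ring (whose \<^const>\<open>krull_dim\<close> is \<open>0\<close>).\<close>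

definition homogeneous_sop ::
    "('a, 'r) ring_scheme \<Rightarrow> (nat \<Rightarrow> 'a set) \<Rightarrow> nat list \<Rightarrow> 'a list \<Rightarrow> bool" where
  "homogeneous_sop R G es xs \<longleftrightarrow>
     enat (length xs) = krull_dim R \<and> length es = length xs \<and>
     (\<forall>j<length xs. es ! j \<ge> 1 \<and> xs ! j \<in> G (es ! j)) \<and>
     krull_dim (R Quot (Idl\<^bsub>R\<^esub> (set xs))) = 0"

definition quotient_component ::
    "('a, 'r) ring_scheme \<Rightarrow> (nat \<Rightarrow> 'a set) \<Rightarrow> 'a set \<Rightarrow> nat \<Rightarrow> 'a set set" where
  "quotient_component R G I i = (\<lambda>r. I +>\<^bsub>R\<^esub> r) ` G i"

text \<open>The field \<open>k = R\<^sub>0\<close> acts on \<open>R/(x)\<close> through its (isomorphic) image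
  \<open>quotient_component R G I 0\<close>, over which \<^const>\<open>ring.dimension\<close> is taken.\<close>

definition super_stretched :: "('a, 'r) ring_scheme \<Rightarrow> (nat \<Rightarrow> 'a set) \<Rightarrow> bool" where
  "super_stretched R G \<longleftrightarrow>
     (\<forall>es xs. homogeneous_sop R G es xs \<longrightarrow>
        (let I = Idl\<^bsub>R\<^esub> (set xs) in
         \<forall>i. int i \<ge> int (sum_list es) - int (length xs) + 2 \<longrightarrow>
           (\<exists>n\<le>1. ring.dimension (R Quot I) n
              (quotient_component R G I 0) (quotient_component R G I i))))"


section \<open>Representability of finitely generated graded modules\<close>

lemma (in module) fg_inj_to_rep:
  assumes "fg_module R M"
  shows "\<exists>\<phi> :: 'c \<Rightarrow> (nat \<Rightarrow> 'a) set. inj_on \<phi> (carrier M)"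
proof -
  obtain A where A: "A \<subseteq> carrier M" "finite A"
    and gen: "carrier M = {(\<Oplus>\<^bsub>M\<^esub>a\<in>A. c a \<odot>\<^bsub>M\<^esub> a) | c. c \<in> A \<rightarrow> carrier R}"
    using assms unfolding fg_module_def by blast
  obtain idx :: "'c \<Rightarrow> nat" where idx: "inj_on idx A"
    using finite_imp_inj_to_nat_seg[OF A(2)] by blast
  define \<phi> where "\<phi> x = {f :: nat \<Rightarrow> 'a. x = (\<Oplus>\<^bsub>M\<^esub>a\<in>A. f (idx a) \<odot>\<^bsub>M\<^esub> a)}" for x
  have ne: "\<phi> x \<noteq> {}" if x: "x \<in> carrier M" for x
  proof -
    obtain c where c: "c \<in> A \<rightarrow> carrier R" "x = (\<Oplus>\<^bsub>M\<^esub>a\<in>A. c a \<odot>\<^bsub>M\<^esub> a)"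
      using x gen by blast
    have "(\<Oplus>\<^bsub>M\<^esub>a\<in>A. (c \<circ> inv_into A idx) (idx a) \<odot>\<^bsub>M\<^esub> a) = (\<Oplus>\<^bsub>M\<^esub>a\<in>A. c a \<odot>\<^bsub>M\<^esub> a)"
      using A c idx by (intro M.finsum_cong') (auto simp: Pi_def subset_iff)
    then have "(c \<circ> inv_into A idx) \<in> \<phi> x"
      unfolding \<phi>_def using c(2) by simp
    then show ?thesis by blast
  qed
  have "inj_on \<phi> (carrier M)"
  proof (rule inj_onI)
    fix x y assume "x \<in> carrier M" "y \<in> carrier M" "\<phi> x = \<phi> y"
    then obtain f where "f \<in> \<phi> x" "f \<in> \<phi> y" using ne by blast
    then show "x = y" unfolding \<phi>_def by simp
  qed
  then show ?thesis by blast
qed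

definition transport_module ::
    "('b \<Rightarrow> 'c) \<Rightarrow> ('a, 'b, 'm) module_scheme \<Rightarrow> ('a, 'c) module" where
  "transport_module \<phi> M =
     (let \<psi> = inv_into (carrier M) \<phi> in
      \<lparr>carrier = \<phi> ` carrier M, monoid.mult = (\<lambda>x y. x), one = \<phi> \<zero>\<^bsub>M\<^esub>, ring.zero = \<phi> \<zero>\<^bsub>M\<^esub>,
       add = (\<lambda>x y. \<phi> (\<psi> x \<oplus>\<^bsub>M\<^esub> \<psi> y)), smult = (\<lambda>r x. \<phi> (r \<odot>\<^bsub>M\<^esub> \<psi> x))\<rparr>)"

context graded_module
begin

context
  fixes \<phi> :: "'b \<Rightarrow> 'c"
  assumes inj: "inj_on \<phi> (carrier M)"
begin

lemma transport_simps:
  "carrier (transport_module \<phi> M) = \<phi> ` carrier M"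
  "\<zero>\<^bsub>transport_module \<phi> M\<^esub> = \<phi> \<zero>\<^bsub>M\<^esub>"
  "\<lbrakk>x \<in> carrier M; y \<in> carrier M\<rbrakk> \<Longrightarrow> \<phi> x \<oplus>\<^bsub>transport_module \<phi> M\<^esub> \<phi> y = \<phi> (x \<oplus>\<^bsub>M\<^esub> y)"
  "x \<in> carrier M \<Longrightarrow> r \<odot>\<^bsub>transport_module \<phi> M\<^esub> \<phi> x = \<phi> (r \<odot>\<^bsub>M\<^esub> x)"
  using inj by (simp_all add: transport_module_def Let_def)

lemma transport_is_module: "module R (transport_module \<phi> M)"
proof (rule moduleI)
  show "abelian_group (transport_module \<phi> M)"
  proof (rule abelian_groupI)
    fix x assume "x \<in> carrier (transport_module \<phi> M)"
    then obtain a where a: "a \<in> carrier M" "x = \<phi> a" by (auto simp: transport_simps)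
    then have "\<phi> (\<ominus>\<^bsub>M\<^esub> a) \<in> carrier (transport_module \<phi> M)"
      "\<phi> (\<ominus>\<^bsub>M\<^esub> a) \<oplus>\<^bsub>transport_module \<phi> M\<^esub> x = \<zero>\<^bsub>transport_module \<phi> M\<^esub>"
      by (auto simp: transport_simps M.l_neg)
    then show "\<exists>y\<in>carrier (transport_module \<phi> M).
        y \<oplus>\<^bsub>transport_module \<phi> M\<^esub> x = \<zero>\<^bsub>transport_module \<phi> M\<^esub>" by blast
  qed (auto simp: transport_simps M.a_ac)
qed (auto simp: transport_simps smult_l_distr smult_r_distr smult_assoc1 R.is_cring)

lemma transport_finsum:
  assumes "finite I" "f \<in> I \<rightarrow> carrier M"
  shows "(\<Oplus>\<^bsub>transport_module \<phi> M\<^esub>i\<in>I. \<phi> (f i)) = \<phi> (\<Oplus>\<^bsub>M\<^esub>i\<in>I. f i)"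
proof -
  interpret T: module R "transport_module \<phi> M" by (rule transport_is_module)
  show ?thesis using assms
  proof (induction I rule: finite_induct)
    case empty
    then show ?case by (simp add: transport_simps)
  next
    case (insert x F)
    then have "(\<lambda>i. \<phi> (f i)) \<in> F \<rightarrow> carrier (transport_module \<phi> M)"
      "\<phi> (f x) \<in> carrier (transport_module \<phi> M)"
      by (auto simp: transport_simps)
    with insert show ?case
      by (simp add: transport_simps Pi_def)
  qed
qed

lemma component_subset: "Mg i \<subseteq> carrier M"
proof -
  have "additive_subgroup (Mg i) M" using module_grading unfolding is_grading_def by simp
  then show ?thesis by (rule additive_subgroup.a_subset)
qed

lemma transport_decomposition:
  assumes f: "\<And>i. f i \<in> carrier M" and x: "x \<in> carrier M"
  shows "homogeneous_decomposition (transport_module \<phi> M) (\<lambda>i. \<phi> ` Mg i) (\<phi> x) (\<lambda>i. \<phi> (f i)) \<longleftrightarrow>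
    homogeneous_decomposition M Mg x f"
proof -
  have supp: "{i. \<phi> (f i) \<noteq> \<zero>\<^bsub>transport_module \<phi> M\<^esub>} = {i. f i \<noteq> \<zero>\<^bsub>M\<^esub>}"
    using f inj by (auto simp: transport_simps inj_on_eq_iff)
  have mem: "\<phi> (f i) \<in> \<phi> ` Mg i \<longleftrightarrow> f i \<in> Mg i" for i
    using f inj component_subset[of i] by (simp add: inj_on_image_mem_iff)
  have "\<phi> x = \<phi> (\<Oplus>\<^bsub>M\<^esub>i\<in>{i. f i \<noteq> \<zero>\<^bsub>M\<^esub>}. f i) \<longleftrightarrow>
      x = (\<Oplus>\<^bsub>M\<^esub>i\<in>{i. f i \<noteq> \<zero>\<^bsub>M\<^esub>}. f i)"
    using f x inj by (intro inj_on_eq_iff[OF inj]) auto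
  then show ?thesis
    using f unfolding homogeneous_decomposition_def supp mem
    by (auto simp: transport_finsum Pi_def)
qed

lemma transport_is_graded: "graded_module R G (transport_module \<phi> M) (\<lambda>i. \<phi> ` Mg i)"
proof -
  interpret T: module R "transport_module \<phi> M" by (rule transport_is_module)
  have sub: "additive_subgroup (Mg i) M" for i
    using module_grading unfolding is_grading_def by blast
  have hom: "\<phi> \<in> hom (add_monoid M) (add_monoid (transport_module \<phi> M))"
    by (rule homI) (auto simp: transport_simps)
  have "group_hom (add_monoid M) (add_monoid (transport_module \<phi> M)) \<phi>"
    by (intro group_hom.intro group_hom_axioms.intro hom M.a_group T.M.a_group)
  then have sub': "additive_subgroup (\<phi> ` Mg i) (transport_module \<phi> M)" for i
    using sub[of i] unfolding additive_subgroup_def by (rule group_hom.subgroup_img_is_subgroup)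
  have ex1: "\<exists>!g. homogeneous_decomposition (transport_module \<phi> M) (\<lambda>i. \<phi> ` Mg i) y g"
    if y: "y \<in> carrier (transport_module \<phi> M)" for y
  proof -
    obtain x where x: "x \<in> carrier M" "y = \<phi> x"
      using y by (auto simp: transport_simps)
    have ex: "\<exists>!f. homogeneous_decomposition M Mg x f"
      using module_grading x(1) unfolding is_grading_def by simp
    define f where "f = (THE f. homogeneous_decomposition M Mg x f)"
    have f: "homogeneous_decomposition M Mg x f"
      unfolding f_def by (rule theI'[OF ex])
    have uniq: "f' = f" if "homogeneous_decomposition M Mg x f'" for f'
      unfolding f_def by (rule the1_equality[OF ex, OF that, symmetric])
    have fc: "f i \<in> carrier M" for i
      using f component_subset[of i] unfolding homogeneous_decomposition_def by blast
    show ?thesis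
    proof (rule ex1I)
      show "homogeneous_decomposition (transport_module \<phi> M) (\<lambda>i. \<phi> ` Mg i) y (\<lambda>i. \<phi> (f i))"
        using transport_decomposition[OF fc x(1)] f x(2) by simp
    next
      fix g assume g: "homogeneous_decomposition (transport_module \<phi> M) (\<lambda>i. \<phi> ` Mg i) y g"
      define f' where "f' i = inv_into (carrier M) \<phi> (g i)" for i
      have gi: "g i \<in> \<phi> ` carrier M" for i
        using g component_subset[of i] unfolding homogeneous_decomposition_def by blast
      have f'c: "f' i \<in> carrier M" and gf': "g i = \<phi> (f' i)" for i
        unfolding f'_def using gi by (simp_all add: inv_into_into f_inv_into_f)
      have "homogeneous_decomposition M Mg x f'"
        using transport_decomposition[OF f'c x(1)] g unfolding x(2)
        by (simp flip: gf')
      then have "f' = f" by (rule uniq)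
      then show "g = (\<lambda>i. \<phi> (f i))" by (simp add: fun_eq_iff gf')
    qed
  qed
  have "is_grading (transport_module \<phi> M) (\<lambda>i. \<phi> ` Mg i)"
    unfolding is_grading_def using sub' ex1 by simp
  moreover have "r \<odot>\<^bsub>transport_module \<phi> M\<^esub> y \<in> \<phi> ` Mg (int i + j)"
    if "r \<in> G i" "y \<in> \<phi> ` Mg j" for r i y j
    using that component_subset[of j] smult_graded by (auto simp: transport_simps subset_iff)
  ultimately show ?thesis
    by (intro graded_module.intro graded_module_axioms.intro transport_is_module)
qed

lemma transport_isomorphic:
  "graded_isomorphic R M Mg (transport_module \<phi> M) (\<lambda>i. \<phi> ` Mg i)"
  unfolding graded_isomorphic_def graded_hom_def module_hom_def
  by (rule bexI[of _ \<phi>]) (auto simp: transport_simps inj intro: inj_on_imp_bij_betw)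

end

theorem fg_graded_module_representable:
  assumes "fg_module R M"
  shows "\<exists>(N :: ('a, (nat \<Rightarrow> 'a) set) module) Ng.
    graded_module R G N Ng \<and> graded_isomorphic R M Mg N Ng"
proof -
  obtain \<phi> :: "'b \<Rightarrow> (nat \<Rightarrow> 'a) set" where "inj_on \<phi> (carrier M)"
    using fg_inj_to_rep[OF assms] by blast
  from transport_is_graded[OF this] transport_isomorphic[OF this] show ?thesis by blast
qed

end

end

theory Submission
  imports Defs
begin

text \<open>Suppose that \<open>x\<^sub>0, \<dots>, x\<^sub>d\<^sub>-\<^sub>1\<close> is a homogeneous system of parameters, of degrees \<open>a\<^sub>j\<close>, and that
  \<open>u, v\<close> are forms of degree \<open>c \<ge> \<Sum>a\<^sub>j - d + 2\<close> which are linearly independent over \<open>k\<close> modulo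
  \<open>I = (x)\<close>. For \<open>\<alpha> \<in> k\<close> put \<open>J = I + (u + \<alpha> v)\<close>. Starting from \<open>J\<close> one takes \<open>d - 1\<close> successive syzygies,
  the \<open>i\<close>-th one over \<open>R/(x\<^sub>i\<^sub>+\<^sub>1, \<dots>, x\<^sub>d\<^sub>-\<^sub>1)\<close>, and obtains a graded maximal Cohen-Macaulay module \<open>M\<close>.
  It has an element \<open>e\<close> of degree \<open>\<Sum>a\<^sub>j\<close> such that \<open>J = (x M : e)\<close>. The generators of \<open>M\<close> other than \<open>e\<close>
  have degree at least \<open>c + d - 1 > \<Sum>a\<^sub>j\<close>, so \<open>M\<close> is one-dimensional in the degree of \<open>e\<close>. Hence \<open>e\<close> lies in
  an indecomposable summand \<open>K\<close> of \<open>M\<close>, and \<open>J = (x K : e)\<close> can be read off from \<open>K\<close> and its grading.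
  Different \<open>\<alpha>\<close> give different \<open>J\<close>, so uncountably many \<open>\<alpha>\<close> cannot share countably many \<open>K\<close> up to
  isomorphism and shift.

  That \<open>x\<close> is a regular sequence, in every order, follows from the Koszul complex: its homology is
  annihilated by \<open>I\<close>, and \<open>I\<close> contains powers of the elements of some regular sequence of length \<open>d\<close>.\<close>

section \<open>Submodules and linear combinations\<close>

text \<open>The changing rings serve to keep hold of \<open>e\<close>. Over R/(x_i, ..., x_(d-1))
  the module is killed by x_i, so when it is covered over R/(x_(i+1), ..., x_(d-1)), x_i times the
  basis vector above the old \<open>e\<close> is a relation; it is the new \<open>e\<close>. This
  adds a_i to the degree of \<open>e\<close>, makes one more parameter regular, and leaves the colon
  ideal unchanged. Minimality of the cover raises the lower bound for the remaining generators by
  one at each step, from c to c + d - 1, while \<open>e\<close> ends in degree a_0 + ... + a_(d-1):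
  comparing the two gives the bound sum - d + 2. Cancelling x_i in the presence of the other
  parameters requires regularity in every order; since R is not local, that is proved degree by
  degree. All quotients V/U are handled by representatives in free modules. Since the colon ideal
  depends on the degree in which it is taken, the counting at the end must match shifts as well as
  isomorphism classes.\<close>

definition comb ::
    "('a, 'b, 'm) module_scheme \<Rightarrow> ('i \<Rightarrow> 'a) \<Rightarrow> 'i set \<Rightarrow> 'b set \<Rightarrow> 'b set" where
  "comb M x T V = {(\<Oplus>\<^bsub>M\<^esub>t\<in>T. x t \<odot>\<^bsub>M\<^esub> w t) | w. w \<in> T \<rightarrow> V}"

text \<open>For finite A this is the submodule generated by A. On an infinite set
  \<open>finsum\<close> returns zero, so statements about \<open>lin\<close> and \<open>comb\<close>
  as generated objects assume finiteness. Indexing by sets allows parameters to be dropped or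
  reordered freely, and (x)V can be formed for a submodule V without changing the module
  record.\<close>

definition lin ::
    "('a, 'r) ring_scheme \<Rightarrow> ('a, 'b, 'm) module_scheme \<Rightarrow> 'b set \<Rightarrow> 'b set" where
  "lin R M A = {(\<Oplus>\<^bsub>M\<^esub>a\<in>A. c a \<odot>\<^bsub>M\<^esub> a) | c. c \<in> A \<rightarrow> carrier R}"

lemma fg_module_iff_lin:
  "fg_module R M \<longleftrightarrow> (\<exists>A\<subseteq>carrier M. finite A \<and> carrier M = lin R M A)"
  by (simp add: fg_module_def lin_def)

lemma ideal_times_module_eq_comb:
  "ideal_times_module xs M = comb M ((!) xs) {..<length xs} (carrier M)"
  by (simp add: ideal_times_module_def comb_def)

context module
begin

lemma submod_carrier: "submodule V R M \<Longrightarrow> v \<in> V \<Longrightarrow> v \<in> carrier M"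
  using submoduleE(1) by blast

lemma submod_zero: "submodule V R M \<Longrightarrow> \<zero>\<^bsub>M\<^esub> \<in> V"
  using subgroup.one_closed[OF submodule.axioms(1)] by fastforce

lemma submod_diff: "submodule V R M \<Longrightarrow> v \<in> V \<Longrightarrow> w \<in> V \<Longrightarrow> v \<ominus>\<^bsub>M\<^esub> w \<in> V"
  by (simp add: a_minus_def submoduleE(5) submoduleE(3))

lemmas submod = submod_carrier submod_zero submod_diff submoduleE(3,4,5)

lemma submod_finsum:
  assumes V: "submodule V R M" and f: "f \<in> T \<rightarrow> V"
  shows "(\<Oplus>\<^bsub>M\<^esub>t\<in>T. f t) \<in> V"
  using f
proof (induction T rule: infinite_finite_induct)
  case (insert t T)
  then have "f t \<in> V" "f \<in> T \<rightarrow> V" by auto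
  with insert V submod_carrier[OF V] show ?case
    by (subst M.finsum_insert) (auto intro: submod)
qed (simp_all add: submod_zero V)

lemma submod_Int: "submodule V R M \<Longrightarrow> submodule W R M \<Longrightarrow> submodule (V \<inter> W) R M"
  by (rule submoduleI) (auto intro: submod)

lemma zero_submodule: "submodule {\<zero>\<^bsub>M\<^esub>} R M"
  by (rule submoduleI) auto

lemma submod_sum_eq: "V <+>\<^bsub>M\<^esub> W = {v \<oplus>\<^bsub>M\<^esub> w | v w. v \<in> V \<and> w \<in> W}"
  by (auto simp: set_add_def')

lemma submod_sum:
  assumes V: "submodule V R M" and W: "submodule W R M"
  shows "submodule (V <+>\<^bsub>M\<^esub> W) R M"
proof (rule submoduleI)
  note c = submod_carrier[OF V] submod_carrier[OF W]
  show "V <+>\<^bsub>M\<^esub> W \<subseteq> carrier M"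
    by (auto simp: submod_sum_eq c)
  show "\<zero>\<^bsub>M\<^esub> \<in> V <+>\<^bsub>M\<^esub> W"
    unfolding submod_sum_eq using submod_zero[OF V] submod_zero[OF W] by force
  fix a assume "a \<in> V <+>\<^bsub>M\<^esub> W"
  then obtain v w where a: "a = v \<oplus>\<^bsub>M\<^esub> w" "v \<in> V" "w \<in> W" by (auto simp: submod_sum_eq)
  then have "\<ominus>\<^bsub>M\<^esub> a = (\<ominus>\<^bsub>M\<^esub> v) \<oplus>\<^bsub>M\<^esub> (\<ominus>\<^bsub>M\<^esub> w)"
    by (simp add: c M.minus_add)
  with a V W show "\<ominus>\<^bsub>M\<^esub> a \<in> V <+>\<^bsub>M\<^esub> W"
    unfolding submod_sum_eq by (auto intro: submod)
  {
    fix b assume "b \<in> V <+>\<^bsub>M\<^esub> W"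
    then obtain v' w' where b: "b = v' \<oplus>\<^bsub>M\<^esub> w'" "v' \<in> V" "w' \<in> W" by (auto simp: submod_sum_eq)
    have "a \<oplus>\<^bsub>M\<^esub> b = (v \<oplus>\<^bsub>M\<^esub> v') \<oplus>\<^bsub>M\<^esub> (w \<oplus>\<^bsub>M\<^esub> w')"
      using a b by (simp add: c M.a_ac)
    with a b V W show "a \<oplus>\<^bsub>M\<^esub> b \<in> V <+>\<^bsub>M\<^esub> W"
      unfolding submod_sum_eq by (blast intro: submod)
  }
  fix r assume r: "r \<in> carrier R"
  have "r \<odot>\<^bsub>M\<^esub> a = r \<odot>\<^bsub>M\<^esub> v \<oplus>\<^bsub>M\<^esub> r \<odot>\<^bsub>M\<^esub> w"
    using a r by (simp add: c smult_r_distr)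
  with a r V W show "r \<odot>\<^bsub>M\<^esub> a \<in> V <+>\<^bsub>M\<^esub> W"
    unfolding submod_sum_eq by (blast intro: submod)
qed

lemma submod_sum_left: "submodule V R M \<Longrightarrow> submodule W R M \<Longrightarrow> V \<subseteq> V <+>\<^bsub>M\<^esub> W"
  unfolding submod_sum_eq using submod_zero[of W] submod_carrier[of V] by force

lemma submod_sum_right: "submodule V R M \<Longrightarrow> submodule W R M \<Longrightarrow> W \<subseteq> V <+>\<^bsub>M\<^esub> W"
  unfolding submod_sum_eq using submod_zero[of V] submod_carrier[of W] by force

lemma submod_sum_least:
  "submodule Y R M \<Longrightarrow> V \<subseteq> Y \<Longrightarrow> W \<subseteq> Y \<Longrightarrow> V <+>\<^bsub>M\<^esub> W \<subseteq> Y"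
  unfolding submod_sum_eq by (auto intro: submod)

text \<open>\<open>finsum\<close> is a fold over the carrier of its module record, so shrinking the
  carrier produces a different term; the two sums agree by induction on the index set.\<close>

lemma finsum_carrier_update:
  assumes V: "submodule V R M" and f: "f \<in> T \<rightarrow> V"
  shows "(\<Oplus>\<^bsub>M\<lparr>carrier := V\<rparr>\<^esub>t\<in>T. f t) = (\<Oplus>\<^bsub>M\<^esub>t\<in>T. f t)"
proof -
  interpret N: module R "M\<lparr>carrier := V\<rparr>"
    by (rule submodule.submodule_is_module[OF V module_axioms])
  show ?thesis using f
  proof (induction T rule: infinite_finite_induct)
    case (insert t T)
    then have "f t \<in> V" "f \<in> T \<rightarrow> V" by auto
    moreover then have "f t \<in> carrier M" "f \<in> T \<rightarrow> carrier M" using submod_carrier[OF V] by auto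
    ultimately show ?case using insert
      by (simp add: N.finsum_insert M.finsum_insert)
  qed simp_all
qed

lemma comb_carrier_update:
  assumes V: "submodule V R M" and x: "x \<in> T \<rightarrow> carrier R" and W: "W \<subseteq> V"
  shows "comb (M\<lparr>carrier := V\<rparr>) x T W = comb M x T W"
proof -
  have "(\<Oplus>\<^bsub>M\<lparr>carrier := V\<rparr>\<^esub>t\<in>T. x t \<odot>\<^bsub>M\<^esub> w t) = (\<Oplus>\<^bsub>M\<^esub>t\<in>T. x t \<odot>\<^bsub>M\<^esub> w t)" if "w \<in> T \<rightarrow> W" for w
    using that x W by (intro finsum_carrier_update[OF V]) (auto intro: submod[OF V])
  then show ?thesis unfolding comb_def by (simp cong: rev_conj_cong)
qed

lemma lin_carrier_update:
  assumes V: "submodule V R M" and A: "A \<subseteq> V"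
  shows "lin R (M\<lparr>carrier := V\<rparr>) A = lin R M A"
proof -
  have "(\<Oplus>\<^bsub>M\<lparr>carrier := V\<rparr>\<^esub>a\<in>A. c a \<odot>\<^bsub>M\<^esub> a) = (\<Oplus>\<^bsub>M\<^esub>a\<in>A. c a \<odot>\<^bsub>M\<^esub> a)" if "c \<in> A \<rightarrow> carrier R" for c
    using that A by (intro finsum_carrier_update[OF V]) (auto intro: submod[OF V])
  then show ?thesis unfolding lin_def by (simp cong: rev_conj_cong)
qed

lemma comb_empty: "comb M x {} V = {\<zero>\<^bsub>M\<^esub>}"
  by (auto simp: comb_def)

lemma comb_insert:
  assumes "finite T" "t \<notin> T" "x \<in> insert t T \<rightarrow> carrier R" and V: "V \<subseteq> carrier M"
  shows "comb M x (insert t T) V = {x t \<odot>\<^bsub>M\<^esub> v \<oplus>\<^bsub>M\<^esub> u | v u. v \<in> V \<and> u \<in> comb M x T V}"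
proof (intro equalityI subsetI)
  fix y assume "y \<in> comb M x (insert t T) V"
  then obtain w where w: "w \<in> insert t T \<rightarrow> V" "y = (\<Oplus>\<^bsub>M\<^esub>s\<in>insert t T. x s \<odot>\<^bsub>M\<^esub> w s)"
    by (auto simp: comb_def)
  have "y = x t \<odot>\<^bsub>M\<^esub> w t \<oplus>\<^bsub>M\<^esub> (\<Oplus>\<^bsub>M\<^esub>s\<in>T. x s \<odot>\<^bsub>M\<^esub> w s)"
    unfolding w(2) using w(1) assms by (intro M.finsum_insert) (auto simp: Pi_iff subset_iff)
  with w(1) show "y \<in> {x t \<odot>\<^bsub>M\<^esub> v \<oplus>\<^bsub>M\<^esub> u | v u. v \<in> V \<and> u \<in> comb M x T V}"
    unfolding comb_def by blast
next
  fix y assume "y \<in> {x t \<odot>\<^bsub>M\<^esub> v \<oplus>\<^bsub>M\<^esub> u | v u. v \<in> V \<and> u \<in> comb M x T V}"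
  then obtain v w where w: "v \<in> V" "w \<in> T \<rightarrow> V"
    "y = x t \<odot>\<^bsub>M\<^esub> v \<oplus>\<^bsub>M\<^esub> (\<Oplus>\<^bsub>M\<^esub>s\<in>T. x s \<odot>\<^bsub>M\<^esub> w s)"
    by (auto simp: comb_def)
  have eq: "(\<Oplus>\<^bsub>M\<^esub>s\<in>T. x s \<odot>\<^bsub>M\<^esub> w s) = (\<Oplus>\<^bsub>M\<^esub>s\<in>T. x s \<odot>\<^bsub>M\<^esub> (w(t := v)) s)"
    using w assms by (intro M.finsum_cong') (auto simp: Pi_iff subset_iff)
  have "(\<Oplus>\<^bsub>M\<^esub>s\<in>insert t T. x s \<odot>\<^bsub>M\<^esub> (w(t := v)) s) =
     x t \<odot>\<^bsub>M\<^esub> (w(t := v)) t \<oplus>\<^bsub>M\<^esub> (\<Oplus>\<^bsub>M\<^esub>s\<in>T. x s \<odot>\<^bsub>M\<^esub> (w(t := v)) s)"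
    using w assms by (intro M.finsum_insert) (auto simp: Pi_iff subset_iff)
  with w eq have "y = (\<Oplus>\<^bsub>M\<^esub>s\<in>insert t T. x s \<odot>\<^bsub>M\<^esub> (w(t := v)) s)" by simp
  moreover have "w(t := v) \<in> insert t T \<rightarrow> V" using w by auto
  ultimately show "y \<in> comb M x (insert t T) V" unfolding comb_def by blast
qed

lemma comb_subset:
  assumes "submodule W R M" "\<And>t v. t \<in> T \<Longrightarrow> v \<in> V \<Longrightarrow> x t \<odot>\<^bsub>M\<^esub> v \<in> W"
  shows "comb M x T V \<subseteq> W"
  using assms by (auto simp: comb_def intro!: submod_finsum)

lemma comb_mono: "V \<subseteq> W \<Longrightarrow> comb M x T V \<subseteq> comb M x T W"
  by (auto simp: comb_def)

lemma comb_submodule: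
  assumes V: "submodule V R M" and x: "x \<in> T \<rightarrow> carrier R"
  shows "submodule (comb M x T V) R M"
proof (rule submoduleI)
  note c = submod_carrier[OF V]
  have cl: "(\<lambda>t. x t \<odot>\<^bsub>M\<^esub> w t) \<in> T \<rightarrow> carrier M" if "w \<in> T \<rightarrow> V" for w
    using that x c by (auto simp: Pi_iff)
  show "comb M x T V \<subseteq> carrier M"
    using cl by (auto simp: comb_def)
  have "(\<Oplus>\<^bsub>M\<^esub>t\<in>T. x t \<odot>\<^bsub>M\<^esub> \<zero>\<^bsub>M\<^esub>) = \<zero>\<^bsub>M\<^esub>"
    using x by (intro M.add.finprod_one_eqI) (auto simp: Pi_iff)
  then show "\<zero>\<^bsub>M\<^esub> \<in> comb M x T V"
    unfolding comb_def using submod_zero[OF V]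
    by (auto intro!: exI[of _ "\<lambda>_. \<zero>\<^bsub>M\<^esub>"])
  fix a assume "a \<in> comb M x T V"
  then obtain w where w: "w \<in> T \<rightarrow> V" "a = (\<Oplus>\<^bsub>M\<^esub>t\<in>T. x t \<odot>\<^bsub>M\<^esub> w t)" by (auto simp: comb_def)
  {
    fix b assume "b \<in> comb M x T V"
    then obtain w' where w': "w' \<in> T \<rightarrow> V" "b = (\<Oplus>\<^bsub>M\<^esub>t\<in>T. x t \<odot>\<^bsub>M\<^esub> w' t)"
      by (auto simp: comb_def)
    have "a \<oplus>\<^bsub>M\<^esub> b = (\<Oplus>\<^bsub>M\<^esub>t\<in>T. x t \<odot>\<^bsub>M\<^esub> w t \<oplus>\<^bsub>M\<^esub> x t \<odot>\<^bsub>M\<^esub> w' t)"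
      unfolding w(2) w'(2) using cl[OF w(1)] cl[OF w'(1)] by (simp add: M.finsum_addf)
    also have "\<dots> = (\<Oplus>\<^bsub>M\<^esub>t\<in>T. x t \<odot>\<^bsub>M\<^esub> (w t \<oplus>\<^bsub>M\<^esub> w' t))"
      using w(1) w'(1) c x by (intro M.finsum_cong') (auto simp: Pi_iff smult_r_distr)
    finally show "a \<oplus>\<^bsub>M\<^esub> b \<in> comb M x T V"
      using w(1) w'(1) V unfolding comb_def
      by (auto simp: Pi_iff intro!: exI[of _ "\<lambda>t. w t \<oplus>\<^bsub>M\<^esub> w' t"] submod)
  }
  {
    fix r assume r: "r \<in> carrier R"
    have "r \<odot>\<^bsub>M\<^esub> a = (\<Oplus>\<^bsub>M\<^esub>t\<in>T. x t \<odot>\<^bsub>M\<^esub> (r \<odot>\<^bsub>M\<^esub> w t))"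
    proof (cases "finite T")
      case True
      have "r \<odot>\<^bsub>M\<^esub> a = (\<Oplus>\<^bsub>M\<^esub>t\<in>T. r \<odot>\<^bsub>M\<^esub> (x t \<odot>\<^bsub>M\<^esub> w t))"
        unfolding w(2) using cl[OF w(1)] r True by (intro finsum_smult_ldistr)
      also have "\<dots> = (\<Oplus>\<^bsub>M\<^esub>t\<in>T. x t \<odot>\<^bsub>M\<^esub> (r \<odot>\<^bsub>M\<^esub> w t))"
        using w(1) c x r
        by (intro M.finsum_cong') (auto simp: Pi_iff R.m_comm simp flip: smult_assoc1)
      finally show ?thesis .
    qed (use w r in simp)
    then show "r \<odot>\<^bsub>M\<^esub> a \<in> comb M x T V"
      using w(1) V r unfolding comb_def
      by (auto simp: Pi_iff intro!: exI[of _ "\<lambda>t. r \<odot>\<^bsub>M\<^esub> w t"] submod)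
  }
  note sm = this
  have "a \<in> carrier M" using w cl by auto
  then have "\<ominus>\<^bsub>M\<^esub> a = (\<ominus> \<one>) \<odot>\<^bsub>M\<^esub> a" by (simp add: smult_l_minus)
  with sm show "\<ominus>\<^bsub>M\<^esub> a \<in> comb M x T V" by simp
qed

lemma comb_gen:
  assumes "finite T" "t \<in> T" and V: "submodule V R M" and x: "x \<in> T \<rightarrow> carrier R" and v: "v \<in> V"
  shows "x t \<odot>\<^bsub>M\<^esub> v \<in> comb M x T V"
proof -
  have T: "T = insert t (T - {t})" using assms by auto
  have x': "x \<in> T - {t} \<rightarrow> carrier R" using x by auto
  have "x t \<odot>\<^bsub>M\<^esub> v \<oplus>\<^bsub>M\<^esub> \<zero>\<^bsub>M\<^esub> \<in> comb M x (insert t (T - {t})) V"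
    using assms submod_zero[OF comb_submodule[OF V x']] submoduleE(1)[OF V]
    by (subst comb_insert) auto
  moreover have "x t \<odot>\<^bsub>M\<^esub> v \<in> carrier M"
    using x v \<open>t \<in> T\<close> submod_carrier[OF V] by auto
  ultimately show ?thesis using T by simp
qed

lemma comb_mono_index:
  assumes "finite T'" "T \<subseteq> T'" "submodule V R M" "x \<in> T' \<rightarrow> carrier R"
  shows "comb M x T V \<subseteq> comb M x T' V"
  using assms by (intro comb_subset comb_submodule comb_gen) auto

lemma comb_le:
  assumes "submodule V R M" "x \<in> T \<rightarrow> carrier R"
  shows "comb M x T V \<subseteq> V"
  using assms by (intro comb_subset) (auto intro: submod)

lemma lin_empty: "lin R M {} = {\<zero>\<^bsub>M\<^esub>}"
  by (auto simp: lin_def)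

lemma lin_insert:
  assumes "finite A" "a \<notin> A" "insert a A \<subseteq> carrier M"
  shows "lin R M (insert a A) = {r \<odot>\<^bsub>M\<^esub> a \<oplus>\<^bsub>M\<^esub> u | r u. r \<in> carrier R \<and> u \<in> lin R M A}"
proof (intro equalityI subsetI)
  fix y assume "y \<in> lin R M (insert a A)"
  then obtain c where c: "c \<in> insert a A \<rightarrow> carrier R" "y = (\<Oplus>\<^bsub>M\<^esub>s\<in>insert a A. c s \<odot>\<^bsub>M\<^esub> s)"
    by (auto simp: lin_def)
  have "y = c a \<odot>\<^bsub>M\<^esub> a \<oplus>\<^bsub>M\<^esub> (\<Oplus>\<^bsub>M\<^esub>s\<in>A. c s \<odot>\<^bsub>M\<^esub> s)"
    unfolding c(2) using c(1) assms by (intro M.finsum_insert) (auto simp: Pi_iff subset_iff)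
  with c(1) show "y \<in> {r \<odot>\<^bsub>M\<^esub> a \<oplus>\<^bsub>M\<^esub> u | r u. r \<in> carrier R \<and> u \<in> lin R M A}"
    unfolding lin_def by blast
next
  fix y assume "y \<in> {r \<odot>\<^bsub>M\<^esub> a \<oplus>\<^bsub>M\<^esub> u | r u. r \<in> carrier R \<and> u \<in> lin R M A}"
  then obtain r c where c: "r \<in> carrier R" "c \<in> A \<rightarrow> carrier R"
    "y = r \<odot>\<^bsub>M\<^esub> a \<oplus>\<^bsub>M\<^esub> (\<Oplus>\<^bsub>M\<^esub>s\<in>A. c s \<odot>\<^bsub>M\<^esub> s)"
    by (auto simp: lin_def)
  have eq: "(\<Oplus>\<^bsub>M\<^esub>s\<in>A. c s \<odot>\<^bsub>M\<^esub> s) = (\<Oplus>\<^bsub>M\<^esub>s\<in>A. (c(a := r)) s \<odot>\<^bsub>M\<^esub> s)"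
    using c assms by (intro M.finsum_cong') (auto simp: Pi_iff subset_iff)
  have "(\<Oplus>\<^bsub>M\<^esub>s\<in>insert a A. (c(a := r)) s \<odot>\<^bsub>M\<^esub> s) =
     (c(a := r)) a \<odot>\<^bsub>M\<^esub> a \<oplus>\<^bsub>M\<^esub> (\<Oplus>\<^bsub>M\<^esub>s\<in>A. (c(a := r)) s \<odot>\<^bsub>M\<^esub> s)"
    using c assms by (intro M.finsum_insert) (auto simp: Pi_iff subset_iff)
  with c eq have "y = (\<Oplus>\<^bsub>M\<^esub>s\<in>insert a A. (c(a := r)) s \<odot>\<^bsub>M\<^esub> s)" by simp
  moreover have "c(a := r) \<in> insert a A \<rightarrow> carrier R" using c by auto
  ultimately show "y \<in> lin R M (insert a A)" unfolding lin_def by blast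
qed

lemma lin_subset:
  assumes "submodule W R M" "A \<subseteq> W"
  shows "lin R M A \<subseteq> W"
  using assms by (auto simp: lin_def Pi_iff intro!: submod_finsum submod(5))

lemma lin_submodule:
  assumes "finite A" "A \<subseteq> carrier M"
  shows "submodule (lin R M A) R M"
  using assms
proof (induction A rule: finite_induct)
  case empty
  then show ?case by (simp add: lin_empty zero_submodule)
next
  case (insert a A)
  then have IH: "submodule (lin R M A) R M" and a: "a \<in> carrier M" by auto
  have "submodule {r \<odot>\<^bsub>M\<^esub> a | r. r \<in> carrier R} R M"
  proof (rule submoduleI)
    show "\<zero>\<^bsub>M\<^esub> \<in> {r \<odot>\<^bsub>M\<^esub> a | r. r \<in> carrier R}"
      using a smult_l_null[OF a, symmetric] by blast
  next
    fix x assume "x \<in> {r \<odot>\<^bsub>M\<^esub> a | r. r \<in> carrier R}"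
    then obtain r where "r \<in> carrier R" "x = r \<odot>\<^bsub>M\<^esub> a" by auto
    then show "\<ominus>\<^bsub>M\<^esub> x \<in> {r \<odot>\<^bsub>M\<^esub> a | r. r \<in> carrier R}"
      using a smult_l_minus by (metis (mono_tags, lifting) R.a_inv_closed mem_Collect_eq)
  next
    fix x y assume "x \<in> {r \<odot>\<^bsub>M\<^esub> a | r. r \<in> carrier R}" "y \<in> {r \<odot>\<^bsub>M\<^esub> a | r. r \<in> carrier R}"
    then show "x \<oplus>\<^bsub>M\<^esub> y \<in> {r \<odot>\<^bsub>M\<^esub> a | r. r \<in> carrier R}"
      using a by (auto simp flip: smult_l_distr)
  next
    fix s x assume "s \<in> carrier R" "x \<in> {r \<odot>\<^bsub>M\<^esub> a | r. r \<in> carrier R}"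
    then show "s \<odot>\<^bsub>M\<^esub> x \<in> {r \<odot>\<^bsub>M\<^esub> a | r. r \<in> carrier R}"
      using a by (auto simp flip: smult_assoc1)
  qed (use a in auto)
  from submod_sum[OF this IH] have
    "submodule ({r \<odot>\<^bsub>M\<^esub> a | r. r \<in> carrier R} <+>\<^bsub>M\<^esub> lin R M A) R M" .
  moreover have "lin R M (insert a A) = {r \<odot>\<^bsub>M\<^esub> a | r. r \<in> carrier R} <+>\<^bsub>M\<^esub> lin R M A"
    using insert by (subst lin_insert) (auto simp: submod_sum_eq)
  ultimately show ?case by simp
qed

lemma lin_superset:
  assumes "finite A" "A \<subseteq> carrier M"
  shows "A \<subseteq> lin R M A"
proof
  fix a assume a: "a \<in> A"
  have fin: "finite (A - {a})" and sub: "A - {a} \<subseteq> carrier M" and A: "A = insert a (A - {a})"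
    using assms a by auto
  have "\<one> \<odot>\<^bsub>M\<^esub> a \<oplus>\<^bsub>M\<^esub> \<zero>\<^bsub>M\<^esub> \<in> lin R M (insert a (A - {a}))"
    using assms a submod_zero[OF lin_submodule[OF fin sub]]
    by (subst lin_insert) blast+
  then show "a \<in> lin R M A" using a assms A by auto
qed

lemma lin_mono:
  assumes "finite B" "A \<subseteq> B" "B \<subseteq> carrier M"
  shows "lin R M A \<subseteq> lin R M B"
  using assms lin_superset[of B] by (intro lin_subset lin_submodule) auto

end

section \<open>Prime ideals, depth and noetherian modules\<close>

lemma (in cring) ideal_adjoin:
  assumes P: "ideal P R" and a: "a \<in> carrier R"
  shows "ideal (P <+>\<^bsub>R\<^esub> PIdl a) R" "P \<subseteq> P <+>\<^bsub>R\<^esub> PIdl a" "a \<in> P <+>\<^bsub>R\<^esub> PIdl a"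
    "z \<in> P <+>\<^bsub>R\<^esub> PIdl a \<longleftrightarrow> (\<exists>p\<in>P. \<exists>r\<in>carrier R. z = p \<oplus> r \<otimes> a)"
proof -
  interpret P: ideal P R by fact
  show mem: "z \<in> P <+>\<^bsub>R\<^esub> PIdl a \<longleftrightarrow> (\<exists>p\<in>P. \<exists>r\<in>carrier R. z = p \<oplus> r \<otimes> a)" for z
    by (auto simp: set_add_def' cgenideal_def)
  show "ideal (P <+>\<^bsub>R\<^esub> PIdl a) R" by (intro add_ideals P cgenideal_ideal a)
  show "P \<subseteq> P <+>\<^bsub>R\<^esub> PIdl a"
  proof
    fix p assume "p \<in> P"
    then have "p = p \<oplus> \<zero> \<otimes> a" using a P.Icarr by simp
    with \<open>p \<in> P\<close> show "p \<in> P <+>\<^bsub>R\<^esub> PIdl a" unfolding mem by blast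
  qed
  have "a = \<zero> \<oplus> \<one> \<otimes> a" using a by simp
  then show "a \<in> P <+>\<^bsub>R\<^esub> PIdl a" unfolding mem using P.zero_closed by blast
qed

text \<open>An ideal P maximal among those containing I and missing the multiplicative set S is
  prime: if a and b were outside P, both P + (a) and P + (b) would meet S, and the product of two
  such elements would lie in S and, as ab is in P, also in P. Chains contain their union because R
  is noetherian.\<close>

lemma (in cring) prime_avoiding:
  assumes noeth: "noetherian_ring R" and I: "ideal I R"
    and S: "S \<subseteq> carrier R" "\<one> \<in> S" "\<And>s t. s \<in> S \<Longrightarrow> t \<in> S \<Longrightarrow> s \<otimes> t \<in> S" and disj: "I \<inter> S = {}"
  shows "\<exists>P. primeideal P R \<and> I \<subseteq> P \<and> P \<inter> S = {}"
proof -
  interpret noetherian_ring R by fact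
  define \<A> where "\<A> = {J. ideal J R \<and> I \<subseteq> J \<and> J \<inter> S = {}}"
  have "\<exists>P\<in>\<A>. \<forall>Y\<in>\<A>. P \<subseteq> Y \<longrightarrow> Y = P"
  proof (rule subset_Zorn_nonempty)
    show "\<A> \<noteq> {}" using I disj unfolding \<A>_def by blast
    fix C assume "C \<noteq> {}" "subset.chain \<A> C"
    moreover then have "subset.chain {I. ideal I R} C"
      by (auto simp: pred_on.chain_def \<A>_def)
    ultimately show "\<Union>C \<in> \<A>"
      using ideal_chain_is_trivial by (auto simp: pred_on.chain_def)
  qed
  then obtain P where PA: "P \<in> \<A>" and Pmax: "\<forall>Y\<in>\<A>. P \<subseteq> Y \<longrightarrow> Y = P" by blast
  from PA have P: "ideal P R" "I \<subseteq> P" "P \<inter> S = {}" unfolding \<A>_def by auto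
  have max: "J = P" if "ideal J R" "P \<subseteq> J" "J \<inter> S = {}" for J
    using Pmax that P(2) unfolding \<A>_def by blast
  interpret P: ideal P R by (rule P(1))
  have "primeideal P R"
  proof (rule primeidealI)
    show "carrier R \<noteq> P" using P(3) S(2) by blast
    fix a b assume ab: "a \<in> carrier R" "b \<in> carrier R" "a \<otimes> b \<in> P"
    show "a \<in> P \<or> b \<in> P"
    proof (rule ccontr)
      assume neg: "\<not> (a \<in> P \<or> b \<in> P)"
      have "(P <+>\<^bsub>R\<^esub> PIdl c) \<inter> S \<noteq> {}" if "c \<in> carrier R" "c \<notin> P" for c
        using max[OF ideal_adjoin(1,2)[OF P(1) that(1)]] ideal_adjoin(3)[OF P(1) that(1)] that(2) by metis
      from this[OF ab(1)] this[OF ab(2)] neg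
      obtain y z where yz: "y \<in> P <+>\<^bsub>R\<^esub> PIdl a" "y \<in> S" "z \<in> P <+>\<^bsub>R\<^esub> PIdl b" "z \<in> S" by blast
      then obtain p r q s where e: "p \<in> P" "r \<in> carrier R" "p \<oplus> r \<otimes> a \<in> S"
        "q \<in> P" "s \<in> carrier R" "q \<oplus> s \<otimes> b \<in> S"
        unfolding ideal_adjoin(4)[OF P(1) ab(1)] ideal_adjoin(4)[OF P(1) ab(2)] by blast
      have c: "p \<in> carrier R" "q \<in> carrier R" using e P.Icarr by auto
      have "(p \<oplus> r \<otimes> a) \<otimes> (q \<oplus> s \<otimes> b) =
          p \<otimes> (q \<oplus> s \<otimes> b) \<oplus> ((r \<otimes> a) \<otimes> q \<oplus> (r \<otimes> s) \<otimes> (a \<otimes> b))"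
        using c e ab by algebra
      also have "\<dots> \<in> P"
        using P.I_r_closed[OF e(1), of "q \<oplus> s \<otimes> b"] P.I_l_closed[OF e(4), of "r \<otimes> a"]
          P.I_l_closed[OF ab(3), of "r \<otimes> s"] e ab c
        by (intro P.a_closed) auto
      finally show False using S(3)[OF e(3,6)] P(3) by blast
    qed
  qed (use P is_cring in auto)
  with P show ?thesis by blast
qed

lemma (in cring) prime_above:
  assumes "noetherian_ring R" "ideal I R" "\<one> \<notin> I"
  shows "\<exists>P. primeideal P R \<and> I \<subseteq> P"
  using prime_avoiding[OF assms(1,2), of "{\<one>}"] assms(3) by auto

lemma krull_dim_ge:
  assumes "\<And>i. i \<le> n \<Longrightarrow> primeideal (p i) R" "\<And>i. i < n \<Longrightarrow> p i \<subset> p (Suc i)"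
  shows "enat n \<le> krull_dim R"
  unfolding krull_dim_def using assms by (intro Sup_upper) blast

context module
begin

lemma comb_cong:
  assumes "\<And>t. t \<in> T \<Longrightarrow> x t = y t" "y \<in> T \<rightarrow> carrier R" "V \<subseteq> carrier M"
  shows "comb M x T V = comb M y T V"
proof -
  have "(\<Oplus>\<^bsub>M\<^esub>t\<in>T. x t \<odot>\<^bsub>M\<^esub> w t) = (\<Oplus>\<^bsub>M\<^esub>t\<in>T. y t \<odot>\<^bsub>M\<^esub> w t)" if "w \<in> T \<rightarrow> V" for w
    using that assms by (intro M.finsum_cong') (auto simp: Pi_iff subset_iff)
  then show ?thesis unfolding comb_def by (simp cong: rev_conj_cong)
qed

text \<open>The set is the annihilator of M/U, expressed with representatives in M so that no
  quotient module has to be formed.\<close>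

lemma ann_ideal:
  assumes "submodule U R M"
  shows "ideal {r \<in> carrier R. \<forall>m\<in>carrier M. r \<odot>\<^bsub>M\<^esub> m \<in> U} R"
proof (rule idealI)
  show "ring R" by (rule R.ring_axioms)
  show "subgroup {r \<in> carrier R. \<forall>m\<in>carrier M. r \<odot>\<^bsub>M\<^esub> m \<in> U} (add_monoid R)"
    using assms
    by (intro R.add.subgroupI)
      (auto simp: smult_l_distr smult_l_minus a_inv_def[symmetric] submod intro!: exI[of _ \<zero>])
next
  fix a x assume "a \<in> {r \<in> carrier R. \<forall>m\<in>carrier M. r \<odot>\<^bsub>M\<^esub> m \<in> U}" "x \<in> carrier R"
  then show "x \<otimes> a \<in> {r \<in> carrier R. \<forall>m\<in>carrier M. r \<odot>\<^bsub>M\<^esub> m \<in> U}"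
    and "a \<otimes> x \<in> {r \<in> carrier R. \<forall>m\<in>carrier M. r \<odot>\<^bsub>M\<^esub> m \<in> U}"
    using submod(5)[OF assms] by (auto simp: smult_assoc1)
qed

text \<open>The prime is chosen to avoid all products \<open>s x\<^sup>n\<close> with \<open>s \<notin> P\<close>. None of these annihilates \<open>M/U\<close>,
  because \<open>x\<close> is a nonzerodivisor there.\<close>

lemma prime_below_ann:
  assumes noeth: "noetherian_ring R" and U: "submodule U R M"
    and x: "x \<in> carrier R" "\<And>m. m \<in> carrier M \<Longrightarrow> x \<odot>\<^bsub>M\<^esub> m \<in> U \<Longrightarrow> m \<in> U"
    and P: "primeideal P R" "{r \<in> carrier R. \<forall>m\<in>carrier M. r \<odot>\<^bsub>M\<^esub> m \<in> U} \<subseteq> P" "x \<in> P"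
  shows "\<exists>Q. primeideal Q R \<and> {r \<in> carrier R. \<forall>m\<in>carrier M. r \<odot>\<^bsub>M\<^esub> m \<in> U} \<subseteq> Q \<and> Q \<subset> P"
proof -
  interpret P: primeideal P R by (rule P(1))
  define S where "S = {s \<otimes> x [^] (n::nat) | s n. s \<in> carrier R - P}"
  have one: "\<one> \<notin> P" using P.I_notcarr P.one_imp_carrier by blast
  have sub: "s \<in> S" if "s \<in> carrier R - P" for s
  proof -
    have "s = s \<otimes> x [^] (0::nat)" using that by simp
    with that show ?thesis unfolding S_def by blast
  qed
  have ann: "\<forall>m\<in>carrier M. s \<odot>\<^bsub>M\<^esub> m \<in> U"
    if s: "s \<in> carrier R" "\<forall>m\<in>carrier M. (s \<otimes> x [^] (n::nat)) \<odot>\<^bsub>M\<^esub> m \<in> U" for s n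
    using s(2)
  proof (induction n)
    case (Suc n)
    have "(s \<otimes> x [^] n) \<odot>\<^bsub>M\<^esub> m \<in> U" if "m \<in> carrier M" for m
    proof (rule x(2))
      have "x \<odot>\<^bsub>M\<^esub> ((s \<otimes> x [^] n) \<odot>\<^bsub>M\<^esub> m) = (s \<otimes> x [^] Suc n) \<odot>\<^bsub>M\<^esub> m"
        using s(1) x(1) that by (simp add: R.m_ac flip: smult_assoc1)
      then show "x \<odot>\<^bsub>M\<^esub> ((s \<otimes> x [^] n) \<odot>\<^bsub>M\<^esub> m) \<in> U" using Suc.prems that by simp
    qed (use s x that in auto)
    then show ?case by (intro Suc.IH) blast
  qed (use s in simp)
  have "\<exists>Q. primeideal Q R \<and> {r \<in> carrier R. \<forall>m\<in>carrier M. r \<odot>\<^bsub>M\<^esub> m \<in> U} \<subseteq> Q \<and> Q \<inter> S = {}"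
  proof (rule prime_avoiding[OF noeth ann_ideal[OF U]])
    show "S \<subseteq> carrier R" using x by (auto simp: S_def)
    show "\<one> \<in> S" using sub one by simp
    fix a b assume "a \<in> S" "b \<in> S"
    then obtain s n t m where e: "a = s \<otimes> x [^] (n::nat)" "s \<in> carrier R - P"
      "b = t \<otimes> x [^] (m::nat)" "t \<in> carrier R - P" unfolding S_def by blast
    then have "a \<otimes> b = (s \<otimes> t) \<otimes> x [^] (n + m)"
      using x(1) by (simp add: R.m_ac flip: nat_pow_mult)
    moreover have "s \<otimes> t \<in> carrier R - P" using e P.I_prime by auto
    ultimately show "a \<otimes> b \<in> S" unfolding S_def by blast
  next
    show "{r \<in> carrier R. \<forall>m\<in>carrier M. r \<odot>\<^bsub>M\<^esub> m \<in> U} \<inter> S = {}"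
      unfolding S_def using ann P(2) by blast
  qed
  then obtain Q where Q: "primeideal Q R" "{r \<in> carrier R. \<forall>m\<in>carrier M. r \<odot>\<^bsub>M\<^esub> m \<in> U} \<subseteq> Q" "Q \<inter> S = {}"
    by blast
  have "x = \<one> \<otimes> x [^] (1::nat)" using x by simp
  then have "x \<in> S" unfolding S_def using one by blast
  then have "x \<notin> Q" using Q by blast
  \<comment> \<open>Taking n = 0 puts every element outside P into S; taking s = 1 and n = 1 puts x
    there, which makes the inclusion strict.\<close>
  moreover have "Q \<subseteq> P"
    using Q(3) sub ideal.Icarr[OF primeideal.axioms(1)[OF Q(1)]] by blast
  ultimately show ?thesis using Q P by blast
qed

text \<open>Each element of the sequence is a nonzerodivisor on M/U_j and annihilates M/U_(j+1), so
  \<open>prime_below_ann\<close> supplies a prime strictly below any prime over the annihilator of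
  M/U_(j+1). Starting over M/(xs)M, which is nonzero, this yields a chain of n + 1 primes.\<close>

lemma regular_sequence_le_krull_dim:
  assumes noeth: "noetherian_ring R" and reg: "regular_sequence R M xs"
  shows "enat (length xs) \<le> krull_dim R"
proof -
  define n where "n = length xs"
  define U where "U j = ideal_times_module (take j xs) M" for j
  define ann where "ann j = {r \<in> carrier R. \<forall>m\<in>carrier M. r \<odot>\<^bsub>M\<^esub> m \<in> U j}" for j
  have xs: "xs ! j \<in> carrier R" if "j < n" for j
    using reg that nth_mem unfolding regular_sequence_def n_def by blast
  have U_comb: "U j = comb M ((!) xs) {..<j} (carrier M)" if "j \<le> n" for j
    using that xs unfolding U_def ideal_times_module_eq_comb n_def
    by (simp add: min_absorb2) (rule comb_cong, auto simp: n_def)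
  have U: "submodule (U j) R M" if "j \<le> n" for j
    unfolding U_comb[OF that] using that xs by (intro comb_submodule carrier_is_submodule) auto
  have nzd: "m \<in> U j" if "j < n" "m \<in> carrier M" "xs ! j \<odot>\<^bsub>M\<^esub> m \<in> U j" for j m
    using reg that unfolding regular_sequence_def n_def U_def by blast
  have mono: "U j \<subseteq> U (Suc j)" if "j < n" for j
    using that xs by (simp add: U_comb) (intro comb_mono_index carrier_is_submodule, auto)
  have mem: "xs ! j \<in> ann (Suc j)" if "j < n" for j
    using that xs unfolding ann_def
    by (auto simp: U_comb intro!: comb_gen carrier_is_submodule)
  have "U n \<noteq> carrier M" using reg unfolding regular_sequence_def U_def n_def by simp
  then have "\<one> \<notin> ann n"
    using submodule.axioms(1)[OF U[of n]] subgroup.subset unfolding ann_def by fastforce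
  then obtain P where P: "primeideal P R" "ann n \<subseteq> P"
    using R.prime_above[OF noeth ann_ideal[OF U[of n]]] unfolding ann_def by auto
  \<comment> \<open>The chain grows downwards: after k steps its smallest member still contains the
    annihilator of M/U_(n-k), which is what the next step requires.\<close>
  have "\<exists>p. (\<forall>i\<le>k. primeideal (p i) R) \<and> (\<forall>i<k. p i \<subset> p (Suc i)) \<and> ann (n - k) \<subseteq> p 0" if "k \<le> n" for k
    using that
  proof (induction k)
    case 0
    show ?case using P by (intro exI[of _ "\<lambda>_. P"]) auto
  next
    case (Suc k)
    then obtain p where p: "\<forall>i\<le>k. primeideal (p i) R" "\<forall>i<k. p i \<subset> p (Suc i)" "ann (n - k) \<subseteq> p 0"
      by auto
    define j where "j = n - Suc k"
    have j: "j < n" "n - k = Suc j" using Suc.prems unfolding j_def by auto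
    have "ann j \<subseteq> ann (Suc j)" using mono[OF j(1)] unfolding ann_def by blast
    then have "\<exists>Q. primeideal Q R \<and> ann j \<subseteq> Q \<and> Q \<subset> p 0"
      using p j mem[OF j(1)] unfolding ann_def
      by (intro prime_below_ann[OF noeth U[of j] xs[OF j(1)] nzd[OF j(1)]]) auto
    then obtain Q where Q: "primeideal Q R" "ann j \<subseteq> Q" "Q \<subset> p 0" by blast
    define q where "q i = (case i of 0 \<Rightarrow> Q | Suc i \<Rightarrow> p i)" for i
    have "primeideal (q i) R" if "i \<le> Suc k" for i
      using Q p that by (auto simp: q_def split: nat.split)
    moreover have "q i \<subset> q (Suc i)" if "i < Suc k" for i
      using Q p that by (auto simp: q_def split: nat.split)
    moreover have "ann (n - Suc k) \<subseteq> q 0" using Q unfolding q_def j_def by simp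
    ultimately show ?case by blast
  qed
  from this[of n] show ?thesis using krull_dim_ge unfolding n_def by blast
qed

text \<open>One half of every equality of depth and dimension: it remains to exhibit a regular
  sequence of length \<open>krull_dim R\<close> inside the ideal.\<close>

lemma depth_le_krull_dim:
  assumes "noetherian_ring R"
  shows "depth R I M \<le> krull_dim R"
  unfolding depth_def using regular_sequence_le_krull_dim[OF assms] by (intro Sup_least) blast

section \<open>Finite generation and the maximum condition over a noetherian ring\<close>

text \<open>The possible coefficients of a in elements of W, taken modulo A; they play the role of
  leading coefficients in the induction on generators that follows.\<close>

lemma coefficient_ideal:
  assumes A: "submodule A R M" and W: "submodule W R M" and ac: "a \<in> carrier M"
  shows "ideal {r \<in> carrier R. \<exists>u\<in>A. r \<odot>\<^bsub>M\<^esub> a \<oplus>\<^bsub>M\<^esub> u \<in> W} R"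
    (is "ideal ?I R")
proof (rule idealI)
  note c = submod_carrier[OF A]
  show "ring R" by (rule R.ring_axioms)
  have sm: "s \<otimes> r \<in> ?I" if "s \<in> carrier R" and r: "r \<in> ?I" for s r
  proof -
    obtain u where u: "r \<in> carrier R" "u \<in> A" "r \<odot>\<^bsub>M\<^esub> a \<oplus>\<^bsub>M\<^esub> u \<in> W"
      using r by blast
    have "s \<odot>\<^bsub>M\<^esub> (r \<odot>\<^bsub>M\<^esub> a \<oplus>\<^bsub>M\<^esub> u) = (s \<otimes> r) \<odot>\<^bsub>M\<^esub> a \<oplus>\<^bsub>M\<^esub> s \<odot>\<^bsub>M\<^esub> u"
      using that u c ac by (simp add: smult_r_distr smult_assoc1)
    moreover have "s \<odot>\<^bsub>M\<^esub> (r \<odot>\<^bsub>M\<^esub> a \<oplus>\<^bsub>M\<^esub> u) \<in> W" using submod(5)[OF W that(1) u(3)] .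
    ultimately show ?thesis using that(1) u submod(5)[OF A that(1) u(2)] by auto
  qed
  then show "x \<otimes> r \<in> ?I" "r \<otimes> x \<in> ?I" if "r \<in> ?I" "x \<in> carrier R" for r x
    using that R.m_comm[of r x] by auto
  show "subgroup ?I (add_monoid R)"
  proof (rule R.add.subgroupI)
    show "?I \<subseteq> carrier R" by auto
    have "\<zero> \<odot>\<^bsub>M\<^esub> a \<oplus>\<^bsub>M\<^esub> \<zero>\<^bsub>M\<^esub> \<in> W" using submod_zero[OF W] ac by simp
    then show "?I \<noteq> {}" using submod_zero[OF A] by blast
    show "\<ominus> r \<in> ?I" if "r \<in> ?I" for r
    proof -
      have "r \<in> carrier R" using that by blast
      then have "(\<ominus> \<one>) \<otimes> r = \<ominus> r" by (simp add: R.l_minus)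
      with sm[OF _ that, of "\<ominus> \<one>"] show ?thesis by simp
    qed
    fix r s assume "r \<in> ?I" "s \<in> ?I"
    then obtain u v where u: "r \<in> carrier R" "u \<in> A" "r \<odot>\<^bsub>M\<^esub> a \<oplus>\<^bsub>M\<^esub> u \<in> W"
      "s \<in> carrier R" "v \<in> A" "s \<odot>\<^bsub>M\<^esub> a \<oplus>\<^bsub>M\<^esub> v \<in> W" by blast
    have "(r \<odot>\<^bsub>M\<^esub> a \<oplus>\<^bsub>M\<^esub> u) \<oplus>\<^bsub>M\<^esub> (s \<odot>\<^bsub>M\<^esub> a \<oplus>\<^bsub>M\<^esub> v) = (r \<oplus> s) \<odot>\<^bsub>M\<^esub> a \<oplus>\<^bsub>M\<^esub> (u \<oplus>\<^bsub>M\<^esub> v)"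
      using u c ac by (simp add: smult_l_distr M.a_ac)
    with submod(6)[OF W u(3,6)] submod(6)[OF A u(2,5)] u(1,4)
    show "r \<oplus> s \<in> ?I" by auto
  qed
qed

text \<open>Induction on the generators: W is controlled by its intersection with the span of A and
  by the ideal of coefficients at the new generator a. Generators of the intersection, together with
  lifts of finitely many generators of that ideal, generate W.\<close>

lemma submodule_of_lin_fg:
  assumes noeth: "noetherian_ring R"
  shows "finite A \<Longrightarrow> A \<subseteq> carrier M \<Longrightarrow> submodule W R M \<Longrightarrow> W \<subseteq> lin R M A \<Longrightarrow>
    \<exists>B\<subseteq>W. finite B \<and> W = lin R M B"
proof (induction A arbitrary: W rule: finite_induct)
  case empty
  then have "W = {\<zero>\<^bsub>M\<^esub>}" using submod_zero[of W] by (auto simp: lin_empty)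
  then show ?case by (intro exI[of _ "{}"]) (simp add: lin_empty)
next
  case (insert a A)
  have A: "submodule (lin R M A) R M" and ac: "a \<in> carrier M"
    using insert lin_submodule by auto
  note W = \<open>submodule W R M\<close>
  obtain B where B: "B \<subseteq> W \<inter> lin R M A" "finite B" "W \<inter> lin R M A = lin R M B"
    using insert.IH[OF _ submod_Int[OF W A]] insert.prems(1) by blast
  have Wmem: "\<exists>r\<in>carrier R. \<exists>u\<in>lin R M A. w = r \<odot>\<^bsub>M\<^esub> a \<oplus>\<^bsub>M\<^esub> u" if "w \<in> W" for w
    using that insert.prems insert.hyps by (simp add: lin_insert) blast
  define I where "I = {r \<in> carrier R. \<exists>u\<in>lin R M A. r \<odot>\<^bsub>M\<^esub> a \<oplus>\<^bsub>M\<^esub> u \<in> W}"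
  note c = submod_carrier[OF A]
  have "ideal I R" unfolding I_def by (rule coefficient_ideal[OF A W ac])
  then obtain E where E: "E \<subseteq> carrier R" "finite E" "I = Idl E"
    using noetherian_ring.finetely_gen[OF noeth] by metis
  have "E \<subseteq> I" unfolding E(3) by (rule R.genideal_self[OF E(1)])
  then have "\<forall>r\<in>E. \<exists>u\<in>lin R M A. r \<odot>\<^bsub>M\<^esub> a \<oplus>\<^bsub>M\<^esub> u \<in> W" unfolding I_def by blast
  then obtain g where g: "\<And>r. r \<in> E \<Longrightarrow> g r \<in> lin R M A \<and> r \<odot>\<^bsub>M\<^esub> a \<oplus>\<^bsub>M\<^esub> g r \<in> W" by metis
  define B' where "B' = B \<union> (\<lambda>r. r \<odot>\<^bsub>M\<^esub> a \<oplus>\<^bsub>M\<^esub> g r) ` E"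
  have B': "B' \<subseteq> W" "finite B'" using B g E by (auto simp: B'_def)
  then have B'c: "B' \<subseteq> carrier M" using submod_carrier[OF W] by blast
  note L = lin_submodule[OF B'(2) B'c]
  define J where "J = {r \<in> carrier R. \<exists>u\<in>lin R M A. r \<odot>\<^bsub>M\<^esub> a \<oplus>\<^bsub>M\<^esub> u \<in> lin R M B'}"
  have LW: "lin R M B' \<subseteq> W" using B' W by (intro lin_subset)
  have "ideal J R" unfolding J_def by (rule coefficient_ideal[OF A L ac])
  have "E \<subseteq> J"
  proof
    fix r assume r: "r \<in> E"
    then have "r \<odot>\<^bsub>M\<^esub> a \<oplus>\<^bsub>M\<^esub> g r \<in> lin R M B'"
      using lin_superset[OF B'(2) B'c] by (auto simp: B'_def)
    with r g E show "r \<in> J" unfolding J_def by blast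
  qed
  with \<open>ideal J R\<close> have "I \<subseteq> J" unfolding E(3) by (rule R.genideal_minimal)
  have "W \<subseteq> lin R M B'"
  proof
    fix w assume w: "w \<in> W"
    obtain r u where r: "r \<in> carrier R" "u \<in> lin R M A" "w = r \<odot>\<^bsub>M\<^esub> a \<oplus>\<^bsub>M\<^esub> u"
      using Wmem[OF w] by blast
    then have "r \<in> I" using w unfolding I_def by blast
    \<comment> \<open>An element of the span of B' with the same coefficient r at a: its difference
      to w lies in W and in the span of A, hence in the span of B.\<close>
    then obtain u' where u': "u' \<in> lin R M A" "r \<odot>\<^bsub>M\<^esub> a \<oplus>\<^bsub>M\<^esub> u' \<in> lin R M B'"
      using \<open>I \<subseteq> J\<close> unfolding J_def by blast
    have "w \<ominus>\<^bsub>M\<^esub> (r \<odot>\<^bsub>M\<^esub> a \<oplus>\<^bsub>M\<^esub> u') = u \<ominus>\<^bsub>M\<^esub> u'"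
      using r u'(1) ac c by (simp add: a_minus_def M.minus_add M.a_ac M.r_neg1 M.r_neg)
    moreover have "w \<ominus>\<^bsub>M\<^esub> (r \<odot>\<^bsub>M\<^esub> a \<oplus>\<^bsub>M\<^esub> u') \<in> W"
      using w u'(2) LW by (intro submod_diff[OF W]) auto
    ultimately have "w \<ominus>\<^bsub>M\<^esub> (r \<odot>\<^bsub>M\<^esub> a \<oplus>\<^bsub>M\<^esub> u') \<in> lin R M B"
      using submod_diff[OF A r(2) u'(1)] unfolding B(3)[symmetric] by simp
    also have "lin R M B \<subseteq> lin R M B'"
      using B' B'c by (intro lin_mono) (auto simp: B'_def)
    finally have "(w \<ominus>\<^bsub>M\<^esub> (r \<odot>\<^bsub>M\<^esub> a \<oplus>\<^bsub>M\<^esub> u')) \<oplus>\<^bsub>M\<^esub> (r \<odot>\<^bsub>M\<^esub> a \<oplus>\<^bsub>M\<^esub> u') \<in> lin R M B'"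
      using submod(6)[OF L] u'(2) by blast
    moreover have "(w \<ominus>\<^bsub>M\<^esub> (r \<odot>\<^bsub>M\<^esub> a \<oplus>\<^bsub>M\<^esub> u')) \<oplus>\<^bsub>M\<^esub> (r \<odot>\<^bsub>M\<^esub> a \<oplus>\<^bsub>M\<^esub> u') = w"
      using submod_carrier[OF W w] submod_carrier[OF L u'(2)]
      by (simp add: a_minus_def M.a_assoc M.l_neg)
    ultimately show "w \<in> lin R M B'" by simp
  qed
  with LW B' show ?case by (intro exI[of _ B']) auto
qed

text \<open>The union of a chain is a submodule of a finitely generated module, hence finitely
  generated, hence equal to a member of the chain that contains its generators; so Zorn's lemma
  applies.\<close>

lemma maximal_submodule:
  assumes noeth: "noetherian_ring R" and fg: "fg_module R M"
    and ne: "\<A> \<noteq> {}" and sub: "\<And>V. V \<in> \<A> \<Longrightarrow> submodule V R M"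
  shows "\<exists>L\<in>\<A>. \<forall>L'\<in>\<A>. L \<subseteq> L' \<longrightarrow> L' = L"
proof (rule subset_Zorn_nonempty[OF ne])
  obtain A where A: "A \<subseteq> carrier M" "finite A" "carrier M = lin R M A"
    using fg unfolding fg_module_iff_lin by blast
  fix C assume C: "C \<noteq> {}" "subset.chain \<A> C"
  have CA: "V \<in> \<A>" if "V \<in> C" for V using that C(2) by (auto simp: pred_on.chain_def)
  have CS: "submodule V R M" if "V \<in> C" for V using that CA sub by blast
  have lin: "V \<subseteq> W \<or> W \<subseteq> V" if "V \<in> C" "W \<in> C" for V W
    using that C(2) unfolding pred_on.chain_def by blast
  have "submodule (\<Union>C) R M"
  proof (rule submoduleI)
    show "\<Union>C \<subseteq> carrier M" using CS submod_carrier by blast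
    show "\<zero>\<^bsub>M\<^esub> \<in> \<Union>C" using C(1) CS submod_zero by blast
    show "\<ominus>\<^bsub>M\<^esub> a \<in> \<Union>C" if "a \<in> \<Union>C" for a using that CS submod(4) by blast
    show "r \<odot>\<^bsub>M\<^esub> a \<in> \<Union>C" if "r \<in> carrier R" "a \<in> \<Union>C" for r a using that CS submod(5) by blast
    fix a b assume "a \<in> \<Union>C" "b \<in> \<Union>C"
    then obtain V W where VW: "V \<in> C" "W \<in> C" "a \<in> V" "b \<in> W" by blast
    from lin[OF VW(1,2)] show "a \<oplus>\<^bsub>M\<^esub> b \<in> \<Union>C"
    proof
      assume "V \<subseteq> W"
      with VW have "a \<oplus>\<^bsub>M\<^esub> b \<in> W" by (intro submod(6)[OF CS]) auto
      with VW show ?thesis by blast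
    next
      assume "W \<subseteq> V"
      with VW have "a \<oplus>\<^bsub>M\<^esub> b \<in> V" by (intro submod(6)[OF CS]) auto
      with VW show ?thesis by blast
    qed
  qed
  moreover then have "\<Union>C \<subseteq> lin R M A" using A submod_carrier by blast
  ultimately obtain B where B: "B \<subseteq> \<Union>C" "finite B" "\<Union>C = lin R M B"
    using submodule_of_lin_fg[OF noeth A(2,1)] by metis
  have "\<exists>V\<in>C. B \<subseteq> V"
    using B(2,1)
  proof (induction B rule: finite_induct)
    case empty
    then show ?case using C(1) by blast
  next
    case (insert b B)
    then obtain V W where "V \<in> C" "B \<subseteq> V" "W \<in> C" "b \<in> W" by blast
    with lin[of V W] show ?case by blast
  qed
  then obtain V where V: "V \<in> C" "B \<subseteq> V" by blast
  then have "\<Union>C \<subseteq> V" unfolding B(3) by (intro lin_subset CS)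
  with V(1) have "\<Union>C = V" by blast
  then show "\<Union>C \<in> \<A>" using CA V(1) by simp
qed

end

section \<open>The Koszul complex\<close>

context cring
begin

section \<open>Weakly regular sequences and their powers\<close>

lemma adjoin_commute:
  assumes U: "ideal U R" and "a \<in> carrier R" "b \<in> carrier R"
  shows "(U <+>\<^bsub>R\<^esub> PIdl a) <+>\<^bsub>R\<^esub> PIdl b = (U <+>\<^bsub>R\<^esub> PIdl b) <+>\<^bsub>R\<^esub> PIdl a"
proof -
  have "PIdl a \<subseteq> carrier R" "PIdl b \<subseteq> carrier R" "U \<subseteq> carrier R"
    using assms ideal.Icarr[OF U] by (auto simp: cgenideal_def)
  then show ?thesis
    unfolding set_add_def by (metis add.set_mult_assoc set_add_comm set_add_def)
qed

text \<open>Regularity on R/U without asking that the final quotient be nonzero; U is a parameter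
  because the recursion enlarges it.\<close>

primrec weakly_regular :: "'a set \<Rightarrow> 'a list \<Rightarrow> bool" where
  "weakly_regular U [] = True"
| "weakly_regular U (z # zs) =
     ((\<forall>r\<in>carrier R. z \<otimes> r \<in> U \<longrightarrow> r \<in> U) \<and> weakly_regular (U <+>\<^bsub>R\<^esub> PIdl z) zs)"

text \<open>Multiplication by a gives the exact sequence 0 -> R/(U,b) -> R/(U,ab) -> R/(U,a) -> 0,
  so an element that is a nonzerodivisor on both ends is one in the middle. For the tail the
  induction hypothesis is applied to U + (z), which requires a to remain a nonzerodivisor
  there.\<close>

lemma weakly_regular_mult:
  assumes "ideal U R" "a \<in> carrier R" "b \<in> carrier R" "set zs \<subseteq> carrier R"
    and "\<And>r. r \<in> carrier R \<Longrightarrow> a \<otimes> r \<in> U \<Longrightarrow> r \<in> U"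
    and "weakly_regular (U <+>\<^bsub>R\<^esub> PIdl a) zs" "weakly_regular (U <+>\<^bsub>R\<^esub> PIdl b) zs"
  shows "weakly_regular (U <+>\<^bsub>R\<^esub> PIdl (a \<otimes> b)) zs"
  using assms
proof (induction zs arbitrary: U)
  case (Cons z zs)
  interpret U: ideal U R by fact
  note U = Cons.prems(1) and ab = Cons.prems(2,3)
  have z: "z \<in> carrier R" and zs: "set zs \<subseteq> carrier R" using Cons.prems by auto
  have za: "r \<in> U <+>\<^bsub>R\<^esub> PIdl a" if "r \<in> carrier R" "z \<otimes> r \<in> U <+>\<^bsub>R\<^esub> PIdl a" for r
    using that Cons.prems(6) by simp
  have zb: "r \<in> U <+>\<^bsub>R\<^esub> PIdl b" if "r \<in> carrier R" "z \<otimes> r \<in> U <+>\<^bsub>R\<^esub> PIdl b" for r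
    using that Cons.prems(7) by simp
  note mem = ideal_adjoin(4)[OF U]
  have "r \<in> U <+>\<^bsub>R\<^esub> PIdl (a \<otimes> b)" if r: "r \<in> carrier R" "z \<otimes> r \<in> U <+>\<^bsub>R\<^esub> PIdl (a \<otimes> b)" for r
  proof -
    obtain u s where u: "u \<in> U" "s \<in> carrier R" "z \<otimes> r = u \<oplus> s \<otimes> (a \<otimes> b)"
      using r(2) ab by (auto simp: mem)
    then have "z \<otimes> r = u \<oplus> (s \<otimes> b) \<otimes> a" using ab by (simp add: m_ac)
    then have "z \<otimes> r \<in> U <+>\<^bsub>R\<^esub> PIdl a" using u ab by (auto simp: mem)
    from za[OF r(1) this] obtain u' r' where u': "u' \<in> U" "r' \<in> carrier R" "r = u' \<oplus> r' \<otimes> a"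
      using ab by (auto simp: mem)
    have c: "u \<in> carrier R" "u' \<in> carrier R" using u u' U.Icarr by auto
    have zr: "z \<otimes> r' \<ominus> s \<otimes> b \<in> carrier R" using z ab u(2) u'(2) by simp
    have "a \<otimes> (z \<otimes> r' \<ominus> s \<otimes> b) = z \<otimes> (u' \<oplus> r' \<otimes> a) \<ominus> s \<otimes> (a \<otimes> b) \<ominus> z \<otimes> u'"
      using c u'(2) u(2) z ab by algebra
    then have "a \<otimes> (z \<otimes> r' \<ominus> s \<otimes> b) = (u \<oplus> s \<otimes> (a \<otimes> b)) \<ominus> s \<otimes> (a \<otimes> b) \<ominus> z \<otimes> u'"
      by (simp only: u(3) flip: u'(3))
    then have "a \<otimes> (z \<otimes> r' \<ominus> s \<otimes> b) = u \<oplus> z \<otimes> \<ominus> u'"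
      using c u(2) z ab by (simp add: a_minus_def a_assoc r_neg r_minus)
    moreover have "u \<oplus> z \<otimes> \<ominus> u' \<in> U"
      using u(1) u'(1) z U.I_l_closed U.a_inv_closed by simp
    ultimately have "z \<otimes> r' \<ominus> s \<otimes> b \<in> U"
      using Cons.prems(5)[OF zr] by (simp only:)
    moreover have "z \<otimes> r' = (z \<otimes> r' \<ominus> s \<otimes> b) \<oplus> s \<otimes> b" using z ab u u' by algebra
    ultimately have "z \<otimes> r' \<in> U <+>\<^bsub>R\<^esub> PIdl b" using u(2) ab unfolding mem[OF ab(2)] by blast
    from zb[OF u'(2) this] obtain u'' t where t: "u'' \<in> U" "t \<in> carrier R" "r' = u'' \<oplus> t \<otimes> b"
      using ab by (auto simp: mem)
    have "u'' \<in> carrier R" using t U.Icarr by auto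
    then have "r = (u' \<oplus> u'' \<otimes> a) \<oplus> t \<otimes> (a \<otimes> b)"
      unfolding u'(3) t(3) using c t(2) ab by algebra
    moreover have "u' \<oplus> u'' \<otimes> a \<in> U" using t(1) u'(1) ab U.I_r_closed by simp
    ultimately show ?thesis using t(2) ab mem[of "a \<otimes> b"] by auto
  qed
  moreover have "weakly_regular ((U <+>\<^bsub>R\<^esub> PIdl (a \<otimes> b)) <+>\<^bsub>R\<^esub> PIdl z) zs"
  proof -
    have "weakly_regular ((U <+>\<^bsub>R\<^esub> PIdl z) <+>\<^bsub>R\<^esub> PIdl (a \<otimes> b)) zs"
    proof (rule Cons.IH[OF ideal_adjoin(1)[OF U z] ab zs])
      show "weakly_regular ((U <+>\<^bsub>R\<^esub> PIdl z) <+>\<^bsub>R\<^esub> PIdl a) zs"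
        "weakly_regular ((U <+>\<^bsub>R\<^esub> PIdl z) <+>\<^bsub>R\<^esub> PIdl b) zs"
        using Cons.prems(6,7) by (simp_all add: adjoin_commute[OF U z ab(1)] adjoin_commute[OF U z ab(2)])
      note rr = Cons.prems(5)
      \<comment> \<open>As a is a nonzerodivisor modulo U and z is one modulo U + (a), a is also one
        modulo U + (z): from ar = u + sz it follows that s lies in U + (a), and cancelling a leaves
        r in U + (z).\<close>
      fix r assume r: "r \<in> carrier R" "a \<otimes> r \<in> U <+>\<^bsub>R\<^esub> PIdl z"
      then obtain u s where u: "u \<in> U" "s \<in> carrier R" "a \<otimes> r = u \<oplus> s \<otimes> z"
        using z by (auto simp: mem)
      have uc: "u \<in> carrier R" using u U.Icarr by auto
      have "z \<otimes> s = (\<ominus> u) \<oplus> r \<otimes> a"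
      proof -
        have "z \<otimes> s = (\<ominus> u) \<oplus> (u \<oplus> s \<otimes> z)" using z u uc by algebra
        also have "\<dots> = (\<ominus> u) \<oplus> r \<otimes> a" unfolding u(3)[symmetric] using r ab by (simp add: m_comm)
        finally show ?thesis .
      qed
      then have "z \<otimes> s \<in> U <+>\<^bsub>R\<^esub> PIdl a" using u(1) r(1) ab unfolding mem[OF ab(1)] by blast
      from za[OF u(2) this] obtain u' s' where u': "u' \<in> U" "s' \<in> carrier R" "s = u' \<oplus> s' \<otimes> a"
        using ab by (auto simp: mem)
      have uc': "u' \<in> carrier R" using u' U.Icarr by auto
      have rz: "r \<ominus> s' \<otimes> z \<in> carrier R" using r(1) z u'(2) by simp
      have "a \<otimes> (r \<ominus> s' \<otimes> z) = a \<otimes> r \<ominus> (u' \<oplus> s' \<otimes> a) \<otimes> z \<oplus> u' \<otimes> z"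
        using z ab r(1) u'(2) uc' by algebra
      then have "a \<otimes> (r \<ominus> s' \<otimes> z) = (u \<oplus> s \<otimes> z) \<ominus> s \<otimes> z \<oplus> u' \<otimes> z"
        by (simp only: u(3) flip: u'(3))
      then have "a \<otimes> (r \<ominus> s' \<otimes> z) = u \<oplus> u' \<otimes> z"
        using z u(2) uc uc' by (simp add: a_minus_def a_assoc r_neg)
      moreover have "u \<oplus> u' \<otimes> z \<in> U" using u(1) u'(1) z U.I_r_closed by simp
      ultimately have "r \<ominus> s' \<otimes> z \<in> U" using rr[OF rz] by (simp only:)
      moreover have "r = (r \<ominus> s' \<otimes> z) \<oplus> s' \<otimes> z" using r(1) z u'(2) by algebra
      ultimately show "r \<in> U <+>\<^bsub>R\<^esub> PIdl z" using u'(2) z unfolding mem[OF z] by blast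
    qed
    then show ?thesis using adjoin_commute[OF U z, of "a \<otimes> b"] ab by simp
  qed
  ultimately show ?case by simp
qed simp

lemma weakly_regular_pow:
  assumes "ideal U R" "set (z # zs) \<subseteq> carrier R" "weakly_regular U (z # zs)"
  shows "weakly_regular U (z [^] Suc n # zs)"
proof (induction n)
  case 0
  then show ?case using assms by simp
next
  case (Suc n)
  have z: "z \<in> carrier R" "set zs \<subseteq> carrier R" using assms by auto
  have "r \<in> U" if r: "r \<in> carrier R" "z [^] Suc (Suc n) \<otimes> r \<in> U" for r
  proof -
    have "z \<otimes> (z [^] Suc n \<otimes> r) = z [^] Suc (Suc n) \<otimes> r" using r(1) z by (simp add: m_ac)
    with r assms(3) z have "z [^] Suc n \<otimes> r \<in> U" by simp
    with r(1) Suc show ?thesis by simp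
  qed
  moreover have "weakly_regular (U <+>\<^bsub>R\<^esub> PIdl (z [^] Suc n \<otimes> z)) zs"
  proof (rule weakly_regular_mult[OF assms(1) _ z])
    show "weakly_regular (U <+>\<^bsub>R\<^esub> PIdl (z [^] Suc n)) zs" "weakly_regular (U <+>\<^bsub>R\<^esub> PIdl z) zs"
      using Suc assms(3) by simp_all
    show "z [^] Suc n \<in> carrier R" using z(1) by (rule nat_pow_closed)
    show "r \<in> U" if "r \<in> carrier R" "z [^] Suc n \<otimes> r \<in> U" for r
      using Suc that by simp
  qed
  ultimately show ?case by simp
qed

text \<open>The first element is raised first; the remaining ones are then regular modulo the ideal
  enlarged by the power, and the induction continues over that ideal.\<close>

lemma weakly_regular_pows:
  "ideal U R \<Longrightarrow> set zs \<subseteq> carrier R \<Longrightarrow> weakly_regular U zs \<Longrightarrow>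
    weakly_regular U (map (\<lambda>z. z [^] Suc n) zs)"
proof (induction zs arbitrary: U)
  case (Cons z zs)
  have zn: "z [^] Suc n \<in> carrier R" using Cons.prems(2) by (intro nat_pow_closed) simp
  have w: "weakly_regular U (z [^] Suc n # zs)" by (rule weakly_regular_pow[OF Cons.prems])
  then have "weakly_regular (U <+>\<^bsub>R\<^esub> PIdl (z [^] Suc n)) (map (\<lambda>z. z [^] Suc n) zs)"
    using Cons.prems(2) by (intro Cons.IH[OF ideal_adjoin(1)[OF Cons.prems(1) zn]]) simp_all
  with w show ?case by (simp del: nat_pow_Suc)
qed simp

section \<open>Antisymmetric sums and signs\<close>

text \<open>Terms off the diagonal cancel in pairs. The diagonal is excluded because B j j = -B j j
  does not give zero in characteristic two.\<close>

lemma finsum_antisym: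
  assumes "finite A" "\<And>j l. B j l \<in> carrier R" "\<And>j l. j \<in> A \<Longrightarrow> l \<in> A \<Longrightarrow> j \<noteq> l \<Longrightarrow> B j l = \<ominus> B l j"
  shows "(\<Oplus>j\<in>A. \<Oplus>l\<in>A - {j}. B j l) = \<zero>"
  using assms(1,3)
proof (induction A rule: finite_induct)
  case (insert a A)
  have IH: "(\<Oplus>j\<in>A. \<Oplus>l\<in>A - {j}. B j l) = \<zero>"
    by (rule insert.IH) (use insert.prems in blast)
  have "(\<Oplus>j\<in>A. \<Oplus>l\<in>insert a A - {j}. B j l) = (\<Oplus>j\<in>A. B j a \<oplus> (\<Oplus>l\<in>A - {j}. B j l))"
  proof (intro finsum_cong')
    fix j assume j: "j \<in> A"
    then have "insert a A - {j} = insert a (A - {j})" using insert.hyps by auto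
    then show "(\<Oplus>l\<in>insert a A - {j}. B j l) = B j a \<oplus> (\<Oplus>l\<in>A - {j}. B j l)"
      using insert.hyps assms(2) by simp
  qed (use assms(2) in auto)
  also have "\<dots> = (\<Oplus>j\<in>A. B j a)"
    using IH assms(2) by (simp add: finsum_addf Pi_def)
  finally have "(\<Oplus>j\<in>insert a A. \<Oplus>l\<in>insert a A - {j}. B j l) = (\<Oplus>l\<in>A. B a l) \<oplus> (\<Oplus>j\<in>A. B j a)"
    using insert.hyps assms(2) by simp
  also have "\<dots> = (\<Oplus>l\<in>A. B a l \<oplus> B l a)" using assms(2) by (simp add: finsum_addf Pi_def)
  also have "\<dots> = \<zero>"
  proof (rule add.finprod_one_eqI)
    fix l assume l: "l \<in> A"
    then have "B a l = \<ominus> B l a" by (intro insert.prems) (use insert.hyps in auto)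
    then show "B a l \<oplus> B l a = \<zero>" using assms(2) by (simp add: l_neg)
  qed
  finally show ?case .
qed simp

text \<open>The factor (-1)^p with p given as a parity, so that signs multiply by exclusive
  or.\<close>

definition sg :: "bool \<Rightarrow> 'a \<Rightarrow> 'a" where "sg p r = (if p then \<ominus> r else r)"

lemma sg_simps [simp]:
  "r \<in> carrier R \<Longrightarrow> sg p r \<in> carrier R"
  "sg False r = r"
  "r \<in> carrier R \<Longrightarrow> sg p (sg q r) = sg (p \<noteq> q) r"
  "r \<in> carrier R \<Longrightarrow> s \<in> carrier R \<Longrightarrow> s \<otimes> sg p r = sg p (s \<otimes> r)"
  "r \<in> carrier R \<Longrightarrow> s \<in> carrier R \<Longrightarrow> sg p (r \<oplus> s) = sg p r \<oplus> sg p s"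
  "sg p \<zero> = \<zero>"
  by (auto simp: sg_def r_minus minus_add)

lemma sg_finsum:
  assumes "f \<in> A \<rightarrow> carrier R"
  shows "sg p (\<Oplus>j\<in>A. f j) = (\<Oplus>j\<in>A. sg p (f j))"
  using assms by (induction A rule: infinite_finite_induct) (auto simp: Pi_def)

lemma sg_ideal: "ideal U R \<Longrightarrow> r \<in> U \<Longrightarrow> sg p r \<in> U"
  by (auto simp: sg_def additive_subgroup.a_inv_closed ideal.axioms(1))

end

text \<open>The parity of the position of j relative to S in increasing order, that is, the sign by
  which e_j wedge e_S differs from the basis element of the enlarged set.\<close>

definition par :: "nat \<Rightarrow> nat set \<Rightarrow> bool" where "par j S = odd (card {l\<in>S. l < j})"

lemma par_insert:
  assumes "finite S" "l \<notin> S"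
  shows "par j (insert l S) = (par j S \<noteq> (l < j))"
proof (cases "l < j")
  case True
  have "{i \<in> insert l S. i < j} = insert l {i\<in>S. i < j}" using True by auto
  then show ?thesis using assms True by (simp add: par_def)
next
  case False
  then have "{i \<in> insert l S. i < j} = {i\<in>S. i < j}" by auto
  then show ?thesis using False by (simp add: par_def)
qed

text \<open>Of two distinct indices exactly one counts for the other, so the two orders of insertion
  differ by one sign. This gives both the vanishing of the squared differential and the homotopy
  formula.\<close>

lemma par_swap:
  assumes "finite S" "l \<notin> S" "j \<notin> S" "j \<noteq> l"
  shows "(par j S \<noteq> par l (insert j S)) = (\<not> (par l S \<noteq> par j (insert l S)))"
proof -
  have "(j < l) = (\<not> l < j)" using assms(4) by auto
  then show ?thesis using par_insert[of S j l] par_insert[of S l j] assms by argo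
qed

context cring
begin

text \<open>The Koszul complex on \<open>x\<^sub>0, \<dots>, x\<^sub>d\<^sub>-\<^sub>1\<close>: chains of degree \<open>k\<close> are functions on the
  \<open>k\<close>-element subsets of \<open>{..<d}\<close>.\<close>

definition koszul :: "(nat \<Rightarrow> 'a) \<Rightarrow> nat \<Rightarrow> (nat set \<Rightarrow> 'a) \<Rightarrow> nat set \<Rightarrow> 'a" where
  "koszul x d c S = (\<Oplus>j\<in>{..<d} - S. sg (par j S) (x j \<otimes> c (insert j S)))"

text \<open>Exterior multiplication by the basis element e_i, with the sign that restores increasing
  order.\<close>

definition wedge :: "nat \<Rightarrow> (nat set \<Rightarrow> 'a) \<Rightarrow> nat set \<Rightarrow> 'a" where
  "wedge i c S = (if i \<in> S then sg (par i (S - {i})) (c (S - {i})) else \<zero>)"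

lemma wedge_closed: "(\<And>S. c S \<in> carrier R) \<Longrightarrow> wedge i c S \<in> carrier R"
  by (simp add: wedge_def)

context
  fixes x :: "nat \<Rightarrow> 'a" and d :: nat
  assumes x: "\<And>j. j < d \<Longrightarrow> x j \<in> carrier R"
begin

lemma koszul_closed: "(\<And>S. c S \<in> carrier R) \<Longrightarrow> koszul x d c S \<in> carrier R"
  unfolding koszul_def by (intro finsum_closed) (auto simp: x)

lemma koszul_cong:
  assumes "\<And>j. j < d \<Longrightarrow> j \<notin> S \<Longrightarrow> c (insert j S) = b (insert j S)" "\<And>S. b S \<in> carrier R"
  shows "koszul x d c S = koszul x d b S"
  unfolding koszul_def using assms by (intro finsum_cong') (auto simp: x)

lemma koszul_add:
  assumes "\<And>S. c S \<in> carrier R" "\<And>S. b S \<in> carrier R"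
  shows "koszul x d (\<lambda>S. c S \<oplus> b S) S = koszul x d c S \<oplus> koszul x d b S"
proof -
  have "koszul x d (\<lambda>S. c S \<oplus> b S) S =
     (\<Oplus>j\<in>{..<d} - S. sg (par j S) (x j \<otimes> c (insert j S)) \<oplus> sg (par j S) (x j \<otimes> b (insert j S)))"
    unfolding koszul_def using assms x by (intro finsum_cong') (auto simp: r_distr)
  also have "\<dots> = koszul x d c S \<oplus> koszul x d b S"
    unfolding koszul_def using assms x by (intro finsum_addf) auto
  finally show ?thesis .
qed

lemma koszul_smult:
  assumes "\<And>S. c S \<in> carrier R" "r \<in> carrier R"
  shows "koszul x d (\<lambda>S. r \<otimes> c S) S = r \<otimes> koszul x d c S"
proof -
  have "r \<otimes> koszul x d c S = (\<Oplus>j\<in>{..<d} - S. r \<otimes> sg (par j S) (x j \<otimes> c (insert j S)))"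
    unfolding koszul_def using assms x by (intro finsum_rdistr) auto
  also have "\<dots> = koszul x d (\<lambda>S. r \<otimes> c S) S"
    unfolding koszul_def using assms x by (intro finsum_cong') (auto simp: m_lcomm)
  finally show ?thesis by simp
qed

lemma koszul_ideal:
  assumes U: "ideal U R" and c: "\<And>j. j < d \<Longrightarrow> j \<notin> S \<Longrightarrow> c (insert j S) \<in> U"
  shows "koszul x d c S \<in> U"
proof -
  interpret U: ideal U R by fact
  have fs: "(\<Oplus>j\<in>A. f j) \<in> U" if "finite A" "\<And>j. j \<in> A \<Longrightarrow> f j \<in> U" for A and f :: "nat \<Rightarrow> 'a"
    using that
  proof (induction A rule: finite_induct)
    case (insert a A)
    then have "f \<in> A \<rightarrow> carrier R" "f a \<in> carrier R" using U.Icarr by blast+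
    then show ?case using insert by simp
  qed simp
  show ?thesis unfolding koszul_def
    by (rule fs) (auto intro!: sg_ideal[OF U] U.I_l_closed c x)
qed

text \<open>Inserting j then l and inserting l then j give the same product with opposite signs, by
  \<open>par_swap\<close>, so the double sum is antisymmetric.\<close>

lemma koszul_koszul:
  assumes c: "\<And>S. c S \<in> carrier R" and S: "S \<subseteq> {..<d}"
  shows "koszul x d (koszul x d c) S = \<zero>"
proof -
  have fin: "finite S" using S finite_subset by blast
  \<comment> \<open>The value zero outside the range makes B a total function into the ring, as
    \<open>finsum_antisym\<close> requires.\<close>
  define B where "B j l = (if j < d \<and> l < d then
    sg (par j S \<noteq> par l (insert j S)) (x j \<otimes> (x l \<otimes> c (insert l (insert j S)))) else \<zero>)" for j l
  have B: "B j l \<in> carrier R" for j l using x c by (auto simp: B_def)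
  have "koszul x d (koszul x d c) S = (\<Oplus>j\<in>{..<d} - S. \<Oplus>l\<in>({..<d} - S) - {j}. B j l)"
    unfolding koszul_def
  proof (intro finsum_cong')
    fix j assume j: "j \<in> {..<d} - S"
    have eq: "{..<d} - insert j S = ({..<d} - S) - {j}" by auto
    have f: "(\<lambda>l. sg (par l (insert j S)) (x l \<otimes> c (insert l (insert j S)))) \<in> ({..<d} - S) - {j} \<rightarrow> carrier R"
      using x c by auto
    have "sg (par j S) (x j \<otimes> (\<Oplus>l\<in>({..<d} - S) - {j}. sg (par l (insert j S)) (x l \<otimes> c (insert l (insert j S)))))
      = sg (par j S) (\<Oplus>l\<in>({..<d} - S) - {j}. x j \<otimes> sg (par l (insert j S)) (x l \<otimes> c (insert l (insert j S))))"
      using f j x by (subst finsum_rdistr) auto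
    also have "\<dots> = (\<Oplus>l\<in>({..<d} - S) - {j}. sg (par j S) (x j \<otimes> sg (par l (insert j S)) (x l \<otimes> c (insert l (insert j S)))))"
      using f j x by (intro sg_finsum) auto
    also have "\<dots> = (\<Oplus>l\<in>({..<d} - S) - {j}. B j l)"
      using j x c by (intro finsum_cong') (auto simp: B_def)
    finally show "sg (par j S) (x j \<otimes> (\<Oplus>l\<in>{..<d} - insert j S. sg (par l (insert j S)) (x l \<otimes> c (insert l (insert j S)))))
      = (\<Oplus>l\<in>({..<d} - S) - {j}. B j l)" unfolding eq .
  qed (use B in auto)
  also have "\<dots> = \<zero>"
  proof (rule finsum_antisym)
    fix j l assume jl: "j \<in> {..<d} - S" "l \<in> {..<d} - S" "j \<noteq> l"
    have "insert l (insert j S) = insert j (insert l S)" by auto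
    moreover have "(par j S \<noteq> par l (insert j S)) = (\<not> (par l S \<noteq> par j (insert l S)))"
      using jl fin by (intro par_swap) auto
    moreover have "x j \<otimes> (x l \<otimes> y) = x l \<otimes> (x j \<otimes> y)" "x l \<otimes> (x j \<otimes> y) \<in> carrier R"
      if "y \<in> carrier R" for y
      using jl x that by (simp_all add: m_lcomm)
    ultimately show "B j l = \<ominus> B l j"
      using jl c unfolding B_def sg_def by simp
  qed (use B in auto)
  finally show ?thesis .
qed

text \<open>If i is not in S, the second summand vanishes and only j = i contributes to the first.
  If i is in S, the terms with j different from i cancel between the two summands, and the second
  one contributes x_i c S.\<close>

lemma koszul_wedge:
  assumes c: "\<And>S. c S \<in> carrier R" and S: "S \<subseteq> {..<d}" and i: "i < d"
  shows "koszul x d (wedge i c) S \<oplus> wedge i (koszul x d c) S = x i \<otimes> c S"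
proof -
  have fin: "finite S" using S finite_subset by blast
  show ?thesis
  proof (cases "i \<in> S")
    case False
    have "koszul x d (wedge i c) S = (\<Oplus>j\<in>{..<d} - S. if i = j then x j \<otimes> c S else \<zero>)"
      unfolding koszul_def using x c False
      by (intro finsum_cong') (auto simp: wedge_def)
    also have "\<dots> = x i \<otimes> c S"
      using False i x c by (intro add.finprod_singleton) auto
    finally show ?thesis using False i x c by (simp add: wedge_def)
  next
    case True
    define S' where "S' = S - {i}"
    have S': "S = insert i S'" "i \<notin> S'" "finite S'" using True fin by (auto simp: S'_def)
    have eq: "{..<d} - S' = insert i ({..<d} - S)" using i S' by auto
    have f: "(\<lambda>j. sg (par j S') (x j \<otimes> c (insert j S'))) \<in> {..<d} - S \<rightarrow> carrier R" using x c by auto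
    have "koszul x d (wedge i c) S =
      (\<Oplus>j\<in>{..<d} - S. sg (\<not> (par i S' \<noteq> par j S')) (x j \<otimes> c (insert j S')))"
      unfolding koszul_def
    proof (intro finsum_cong')
      fix j assume j: "j \<in> {..<d} - S"
      then have ji: "j \<noteq> i" "j \<notin> S'" using True S' by auto
      have "insert j S - {i} = insert j S'" using ji S' by auto
      moreover have "(par j S \<noteq> par i (insert j S')) = (\<not> (par i S' \<noteq> par j S'))"
        using par_swap[of S' j i] ji S'(2,3) unfolding S'(1) by auto
      ultimately show "sg (par j S) (x j \<otimes> wedge i c (insert j S)) =
          sg (\<not> (par i S' \<noteq> par j S')) (x j \<otimes> c (insert j S'))"
        using j x c True by (simp add: wedge_def)
    qed (use x c in auto)
    also have "\<dots> = (\<Oplus>j\<in>{..<d} - S. \<ominus> sg (par i S' \<noteq> par j S') (x j \<otimes> c (insert j S')))"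
      using x c by (intro finsum_cong') (auto simp: sg_def)
    also have "\<dots> = \<ominus> (\<Oplus>j\<in>{..<d} - S. sg (par i S' \<noteq> par j S') (x j \<otimes> c (insert j S')))"
    proof -
      have "sg True (\<Oplus>j\<in>{..<d} - S. sg (par i S' \<noteq> par j S') (x j \<otimes> c (insert j S'))) =
        (\<Oplus>j\<in>{..<d} - S. sg True (sg (par i S' \<noteq> par j S') (x j \<otimes> c (insert j S'))))"
        using x c by (intro sg_finsum) auto
      then show ?thesis by (simp only: sg_def if_True)
    qed
    finally have 1: "koszul x d (wedge i c) S =
      \<ominus> (\<Oplus>j\<in>{..<d} - S. sg (par i S' \<noteq> par j S') (x j \<otimes> c (insert j S')))" .
    have "wedge i (koszul x d c) S = sg (par i S') (koszul x d c S')"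
      using True by (simp add: wedge_def S'_def)
    also have "koszul x d c S' = sg (par i S') (x i \<otimes> c S) \<oplus> (\<Oplus>j\<in>{..<d} - S. sg (par j S') (x j \<otimes> c (insert j S')))"
      unfolding koszul_def eq using True x c i f S' by (subst finsum_insert) auto
    also have "sg (par i S') \<dots> = x i \<otimes> c S \<oplus> (\<Oplus>j\<in>{..<d} - S. sg (par i S' \<noteq> par j S') (x j \<otimes> c (insert j S')))"
    proof -
      have "sg (par i S') (\<Oplus>j\<in>{..<d} - S. sg (par j S') (x j \<otimes> c (insert j S'))) =
        (\<Oplus>j\<in>{..<d} - S. sg (par i S' \<noteq> par j S') (x j \<otimes> c (insert j S')))"
        using f x c by (subst sg_finsum) (auto intro!: finsum_cong')
      then show ?thesis using x[OF i] c finsum_closed[OF f] by simp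
    qed
    finally have 2: "wedge i (koszul x d c) S =
      x i \<otimes> c S \<oplus> (\<Oplus>j\<in>{..<d} - S. sg (par i S' \<noteq> par j S') (x j \<otimes> c (insert j S')))" .
    have "(\<Oplus>j\<in>{..<d} - S. sg (par i S' \<noteq> par j S') (x j \<otimes> c (insert j S'))) \<in> carrier R"
      using x c by (intro finsum_closed) auto
    moreover have "(\<ominus> t) \<oplus> (y \<oplus> t) = y" if "t \<in> carrier R" "y \<in> carrier R" for t y
      using that by algebra
    ultimately show ?thesis unfolding 1 2 using x[OF i] c[of S] by simp
  qed
qed

section \<open>Null-homotopic elements and Koszul homology\<close>

text \<open>The second conjunct says that h raises the degree by one and respects every ideal. Hence
  the same h works for the Koszul complex of any R/U whose chains are represented by functions into
  R.\<close>

definition homotopy :: "'a \<Rightarrow> ((nat set \<Rightarrow> 'a) \<Rightarrow> nat set \<Rightarrow> 'a) \<Rightarrow> bool" where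
  "homotopy y h \<longleftrightarrow>
     (\<forall>c. (\<forall>S. c S \<in> carrier R) \<longrightarrow> (\<forall>S. h c S \<in> carrier R) \<and>
        (\<forall>S\<subseteq>{..<d}. koszul x d (h c) S \<oplus> h (koszul x d c) S = y \<otimes> c S)) \<and>
     (\<forall>c U k. ideal U R \<longrightarrow> (\<forall>S\<subseteq>{..<d}. card S = k \<longrightarrow> c S \<in> U) \<longrightarrow>
        (\<forall>S\<subseteq>{..<d}. card S = Suc k \<longrightarrow> h c S \<in> U))"

definition null_homotopic :: "'a \<Rightarrow> bool" where
  "null_homotopic y \<longleftrightarrow> y \<in> carrier R \<and> (\<exists>h. homotopy y h)"

lemma homotopyD:
  assumes "homotopy y h"
  shows "\<And>c S. (\<And>S. c S \<in> carrier R) \<Longrightarrow> h c S \<in> carrier R"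
    and "\<And>c S. (\<And>S. c S \<in> carrier R) \<Longrightarrow> S \<subseteq> {..<d} \<Longrightarrow>
      koszul x d (h c) S \<oplus> h (koszul x d c) S = y \<otimes> c S"
    and "\<And>c U k S. ideal U R \<Longrightarrow> (\<And>S. S \<subseteq> {..<d} \<Longrightarrow> card S = k \<Longrightarrow> c S \<in> U) \<Longrightarrow>
      S \<subseteq> {..<d} \<Longrightarrow> card S = Suc k \<Longrightarrow> h c S \<in> U"
proof -
  fix c :: "nat set \<Rightarrow> 'a" and S assume c: "\<And>S. c S \<in> carrier R"
  show "h c S \<in> carrier R" using assms c unfolding homotopy_def by blast
  show "koszul x d (h c) S \<oplus> h (koszul x d c) S = y \<otimes> c S" if "S \<subseteq> {..<d}"
    using assms c that unfolding homotopy_def by blast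
next
  fix c :: "nat set \<Rightarrow> 'a" and U k S
  assume U: "ideal U R" and c: "\<And>S. S \<subseteq> {..<d} \<Longrightarrow> card S = k \<Longrightarrow> c S \<in> U"
    and S: "S \<subseteq> {..<d}" "card S = Suc k"
  have "\<forall>S\<subseteq>{..<d}. card S = k \<longrightarrow> c S \<in> U" using c by blast
  then show "h c S \<in> U" using assms U S unfolding homotopy_def by blast
qed

lemma null_homotopic_gen:
  assumes i: "i < d"
  shows "null_homotopic (x i)"
  unfolding null_homotopic_def homotopy_def
proof (intro conjI exI[of _ "wedge i"] allI impI)
  show "x i \<in> carrier R" using x i .
  fix c :: "nat set \<Rightarrow> 'a" and S assume c: "\<forall>S. c S \<in> carrier R"
  then show "wedge i c S \<in> carrier R" using wedge_closed by blast
  assume "S \<subseteq> {..<d}"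
  with c i show "koszul x d (wedge i c) S \<oplus> wedge i (koszul x d c) S = x i \<otimes> c S"
    by (intro koszul_wedge) auto
next
  fix c :: "nat set \<Rightarrow> 'a" and U k S
  assume U: "ideal U R" and c: "\<forall>S\<subseteq>{..<d}. card S = k \<longrightarrow> c S \<in> U"
    and S: "S \<subseteq> {..<d}" "card S = Suc k"
  show "wedge i c S \<in> U"
  proof (cases "i \<in> S")
    case True
    then have "c (S - {i}) \<in> U" using S c by (auto intro!: c[rule_format])
    with True show ?thesis using U by (simp add: wedge_def sg_ideal)
  next
    case False
    then show ?thesis using U additive_subgroup.zero_closed ideal.axioms(1) by (fastforce simp: wedge_def)
  qed
qed

text \<open>Homotopies for two elements add up to one for their sum. Together with scaling, this
  makes every linear combination of the x_i act as zero on Koszul homology.\<close>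

lemma null_homotopic_add:
  assumes y: "null_homotopic y" and z: "null_homotopic z"
  shows "null_homotopic (y \<oplus> z)"
proof -
  have yz: "y \<in> carrier R" "z \<in> carrier R" using y z unfolding null_homotopic_def by auto
  obtain h where "homotopy y h" using y unfolding null_homotopic_def by blast
  note h = homotopyD[OF this]
  obtain g where "homotopy z g" using z unfolding null_homotopic_def by blast
  note g = homotopyD[OF this]
  show ?thesis
    unfolding null_homotopic_def homotopy_def
  proof (intro conjI exI[of _ "\<lambda>c S. h c S \<oplus> g c S"] allI impI)
    show "y \<oplus> z \<in> carrier R" using yz by simp
    fix c :: "nat set \<Rightarrow> 'a" and S assume c': "\<forall>S. c S \<in> carrier R"
    then have c: "\<And>S. c S \<in> carrier R" by blast
    show "h c S \<oplus> g c S \<in> carrier R" using h(1) g(1) c by simp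
    assume S: "S \<subseteq> {..<d}"
    note hc = h(1)[of c, OF c] and gc = g(1)[of c, OF c]
    note kc = koszul_closed[of c, OF c]
    have "koszul x d (\<lambda>S. h c S \<oplus> g c S) S \<oplus> (h (koszul x d c) S \<oplus> g (koszul x d c) S) =
      (koszul x d (h c) S \<oplus> h (koszul x d c) S) \<oplus> (koszul x d (g c) S \<oplus> g (koszul x d c) S)"
      using koszul_closed[of "h c", OF hc] koszul_closed[of "g c", OF gc]
        h(1)[of "koszul x d c", OF kc] g(1)[of "koszul x d c", OF kc]
      by (simp add: koszul_add[OF hc gc] a_ac)
    also have "\<dots> = (y \<oplus> z) \<otimes> c S"
      using h(2)[of c, OF c S] g(2)[of c, OF c S] yz c by (simp add: l_distr)
    finally show "koszul x d (\<lambda>S. h c S \<oplus> g c S) S \<oplus> (h (koszul x d c) S \<oplus> g (koszul x d c) S) =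
      (y \<oplus> z) \<otimes> c S" .
  next
    fix c U k S
    assume U: "ideal U R" and c: "\<forall>S\<subseteq>{..<d}. card S = k \<longrightarrow> c S \<in> U"
      and S: "S \<subseteq> {..<d}" "card S = Suc k"
    have "h c S \<in> U" using c S by (intro h(3)[OF U]) auto
    moreover have "g c S \<in> U" using c S by (intro g(3)[OF U]) auto
    ultimately show "h c S \<oplus> g c S \<in> U"
      using U additive_subgroup.a_closed ideal.axioms(1) by fastforce
  qed
qed

lemma null_homotopic_smult:
  assumes y: "null_homotopic y" and r: "r \<in> carrier R"
  shows "null_homotopic (r \<otimes> y)"
proof -
  have yc: "y \<in> carrier R" using y unfolding null_homotopic_def by auto
  obtain h where "homotopy y h" using y unfolding null_homotopic_def by blast
  note h = homotopyD[OF this]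
  show ?thesis
    unfolding null_homotopic_def homotopy_def
  proof (intro conjI exI[of _ "\<lambda>c S. r \<otimes> h c S"] allI impI)
    show "r \<otimes> y \<in> carrier R" using yc r by simp
    fix c :: "nat set \<Rightarrow> 'a" and S assume c': "\<forall>S. c S \<in> carrier R"
    then have c: "\<And>S. c S \<in> carrier R" by blast
    show "r \<otimes> h c S \<in> carrier R" using h(1) c r by simp
    assume S: "S \<subseteq> {..<d}"
    note hc = h(1)[of c, OF c]
    note kc = koszul_closed[of c, OF c]
    have "koszul x d (\<lambda>S. r \<otimes> h c S) S \<oplus> r \<otimes> h (koszul x d c) S =
      r \<otimes> (koszul x d (h c) S \<oplus> h (koszul x d c) S)"
      using koszul_closed[of "h c", OF hc] h(1)[of "koszul x d c", OF kc] r
      by (simp add: koszul_smult[OF hc r] r_distr)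
    also have "\<dots> = (r \<otimes> y) \<otimes> c S"
      using h(2)[of c, OF c S] yc c r by (simp add: m_assoc)
    finally show "koszul x d (\<lambda>S. r \<otimes> h c S) S \<oplus> r \<otimes> h (koszul x d c) S = (r \<otimes> y) \<otimes> c S" .
  next
    fix c U k S
    assume U: "ideal U R" and c: "\<forall>S\<subseteq>{..<d}. card S = k \<longrightarrow> c S \<in> U"
      and S: "S \<subseteq> {..<d}" "card S = Suc k"
    have "h c S \<in> U" using c S by (intro h(3)[OF U]) auto
    with r show "r \<otimes> h c S \<in> U" using ideal.I_l_closed[OF U] by blast
  qed
qed

text \<open>Vanishing of the Koszul homology of \<open>R/U\<close> in degree \<open>k + 1\<close>, with representatives in \<open>R\<close>.\<close>

definition koszul_exact :: "nat \<Rightarrow> 'a set \<Rightarrow> bool" where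
  "koszul_exact k U \<longleftrightarrow>
     (\<forall>c. (\<forall>S. c S \<in> carrier R) \<longrightarrow> (\<forall>S\<subseteq>{..<d}. card S = k \<longrightarrow> koszul x d c S \<in> U) \<longrightarrow>
        (\<exists>b. (\<forall>S. b S \<in> carrier R) \<and>
           (\<forall>S\<subseteq>{..<d}. card S = Suc k \<longrightarrow> c S \<ominus> koszul x d b S \<in> U)))"

text \<open>The long exact sequence of 0 -> R/U -> R/U -> R/(U,y) -> 0, written out. Multiplication
  by y is zero on homology because y is null-homotopic, so the homology of R/U in degree k + 1 is a
  quotient of that of R/(U,y) in degree k + 2.\<close>

lemma koszul_exact_descend:
  assumes U: "ideal U R" and y: "null_homotopic y"
    and nzd: "\<And>r. r \<in> carrier R \<Longrightarrow> y \<otimes> r \<in> U \<Longrightarrow> r \<in> U"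
    and ex: "koszul_exact (Suc k) (U <+>\<^bsub>R\<^esub> PIdl y)"
  shows "koszul_exact k U"
  unfolding koszul_exact_def
proof (intro allI impI)
  interpret U: ideal U R by fact
  fix c :: "nat set \<Rightarrow> 'a"
  assume "\<forall>S. c S \<in> carrier R" and "\<forall>S\<subseteq>{..<d}. card S = k \<longrightarrow> koszul x d c S \<in> U"
  then have c: "\<And>S. c S \<in> carrier R"
    and cyc: "\<And>S. S \<subseteq> {..<d} \<Longrightarrow> card S = k \<Longrightarrow> koszul x d c S \<in> U" by auto
  have yc: "y \<in> carrier R" using y unfolding null_homotopic_def by blast
  note mem = ideal_adjoin(4)[OF U yc]
  obtain h where "homotopy y h" using y unfolding null_homotopic_def by blast
  note h = homotopyD[OF this]
  note hc = h(1)[of c, OF c]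
  have hk: "h (koszul x d c) S \<in> U" if "S \<subseteq> {..<d}" "card S = Suc k" for S
    by (rule h(3)[OF U _ that]) (rule cyc)
  have kh: "koszul x d (h c) S = y \<otimes> c S \<ominus> h (koszul x d c) S" if "S \<subseteq> {..<d}" "card S = Suc k" for S
  proof -
    have "koszul x d (h c) S \<in> carrier R" by (rule koszul_closed) (rule hc)
    then show ?thesis
      using h(2)[of c, OF c that(1), symmetric] U.Icarr[OF hk[OF that]] by (simp add: a_minus_def a_assoc r_neg)
  qed
  \<comment> \<open>The chain h c is a cycle modulo U + (y), one degree higher: its boundary is y c
    minus h of the boundary of c, and the latter term lies in U.\<close>
  have "koszul x d (h c) S \<in> U <+>\<^bsub>R\<^esub> PIdl y" if "S \<subseteq> {..<d}" "card S = Suc k" for S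
  proof -
    have "koszul x d (h c) S = (\<ominus> h (koszul x d c) S) \<oplus> c S \<otimes> y"
      unfolding kh[OF that] using c yc U.Icarr[OF hk[OF that]] by (simp add: a_minus_def a_comm m_comm)
    then show ?thesis using hk[OF that] c U.a_inv_closed unfolding mem by blast
  qed
  then obtain b' where b': "\<And>S. b' S \<in> carrier R"
    "\<And>S. S \<subseteq> {..<d} \<Longrightarrow> card S = Suc (Suc k) \<Longrightarrow> h c S \<ominus> koszul x d b' S \<in> U <+>\<^bsub>R\<^esub> PIdl y"
    using ex hc unfolding koszul_exact_def by metis
  have "\<exists>u q. u \<in> U \<and> q \<in> carrier R \<and>
      (S \<subseteq> {..<d} \<longrightarrow> card S = Suc (Suc k) \<longrightarrow> h c S \<ominus> koszul x d b' S = u \<oplus> q \<otimes> y)" for S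
  proof (cases "S \<subseteq> {..<d} \<and> card S = Suc (Suc k)")
    case True
    then show ?thesis using b'(2)[of S] unfolding mem by blast
  next
    case False
    then show ?thesis using U.zero_closed zero_closed by blast
  qed
  then obtain u q where uq: "\<And>S. u S \<in> U" "\<And>S. q S \<in> carrier R"
    "\<And>S. S \<subseteq> {..<d} \<Longrightarrow> card S = Suc (Suc k) \<Longrightarrow> h c S \<ominus> koszul x d b' S = u S \<oplus> q S \<otimes> y" by metis
  have uc: "u S \<in> carrier R" for S using U.Icarr[OF uq(1)] .
  have kb: "koszul x d b' S \<in> carrier R" for S by (rule koszul_closed) (rule b'(1))
  have hcS: "h c S = koszul x d b' S \<oplus> (u S \<oplus> y \<otimes> q S)" if "S \<subseteq> {..<d}" "card S = Suc (Suc k)" for S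
  proof -
    have "h c S = koszul x d b' S \<oplus> (h c S \<ominus> koszul x d b' S)"
      using hc kb by (simp add: a_minus_def a_lcomm r_neg)
    then show ?thesis unfolding uq(3)[OF that] using uq(2) yc by (simp add: m_comm)
  qed
  \<comment> \<open>The chain q is the one sought. Taking boundaries in the decomposition of h c
    into the boundary of b', u and y q gives y c = y times the boundary of q modulo U, and y can be
    cancelled.\<close>
  have "c S \<ominus> koszul x d q S \<in> U" if S: "S \<subseteq> {..<d}" "card S = Suc k" for S
  proof (rule nzd)
    have fin: "finite S" using S(1) finite_subset by blast
    have kq: "koszul x d q S \<in> carrier R" by (rule koszul_closed) (rule uq(2))
    then show "c S \<ominus> koszul x d q S \<in> carrier R" using c by simp
    have "koszul x d (h c) S = koszul x d (\<lambda>S. koszul x d b' S \<oplus> (u S \<oplus> y \<otimes> q S)) S"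
    proof (rule koszul_cong)
      fix j assume "j < d" "j \<notin> S"
      then show "h c (insert j S) = koszul x d b' (insert j S) \<oplus> (u (insert j S) \<oplus> y \<otimes> q (insert j S))"
        using S fin by (intro hcS) auto
    qed (use kb uc uq(2) yc in auto)
    also have "\<dots> = koszul x d (koszul x d b') S \<oplus> (koszul x d u S \<oplus> y \<otimes> koszul x d q S)"
      using kb uc uq(2) yc by (simp add: koszul_add koszul_smult)
    also have "\<dots> = koszul x d u S \<oplus> y \<otimes> koszul x d q S"
      using koszul_koszul[OF b'(1) S(1)] koszul_closed[OF uc] kq yc by simp
    finally have "y \<otimes> c S \<ominus> h (koszul x d c) S = koszul x d u S \<oplus> y \<otimes> koszul x d q S"
      unfolding kh[OF S] .
    then have "(y \<otimes> c S \<ominus> h (koszul x d c) S) \<oplus> (h (koszul x d c) S \<ominus> y \<otimes> koszul x d q S) =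
      (koszul x d u S \<oplus> y \<otimes> koszul x d q S) \<oplus> (h (koszul x d c) S \<ominus> y \<otimes> koszul x d q S)" by simp
    moreover have "(p \<ominus> s) \<oplus> (s \<ominus> t) = p \<ominus> t" "(p \<oplus> t) \<oplus> (s \<ominus> t) = p \<oplus> s"
      if "p \<in> carrier R" "s \<in> carrier R" "t \<in> carrier R" for p s t
      using that by algebra+
    moreover have "h (koszul x d c) S \<in> carrier R" using U.Icarr[OF hk[OF S]] .
    ultimately have "y \<otimes> c S \<ominus> y \<otimes> koszul x d q S = koszul x d u S \<oplus> h (koszul x d c) S"
      using c yc kq koszul_closed[OF uc] by simp
    moreover have "y \<otimes> (c S \<ominus> koszul x d q S) = y \<otimes> c S \<ominus> y \<otimes> koszul x d q S"
      using c yc kq by (simp add: a_minus_def r_distr r_minus)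
    moreover have "koszul x d u S \<in> U" by (rule koszul_ideal[OF U]) (rule uq(1))
    ultimately show "y \<otimes> (c S \<ominus> koszul x d q S) \<in> U" using hk[OF S] by simp
  qed
  with uq(2) show "\<exists>b. (\<forall>S. b S \<in> carrier R) \<and>
      (\<forall>S\<subseteq>{..<d}. card S = Suc k \<longrightarrow> c S \<ominus> koszul x d b S \<in> U)" by blast
qed

text \<open>Each element of zs lowers by one the degree from which homology vanishes, and in degrees
  above d there are no chains at all.\<close>

lemma koszul_exact_regular:
  assumes "ideal U R" "weakly_regular U zs" "\<And>z. z \<in> set zs \<Longrightarrow> null_homotopic z" "d \<le> k + length zs"
  shows "koszul_exact k U"
  using assms
proof (induction zs arbitrary: U k)
  case Nil
  have "\<not> card S = Suc k" if "S \<subseteq> {..<d}" for S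
    using card_mono[OF _ that] Nil by simp
  then show ?case unfolding koszul_exact_def by (metis zero_closed)
next
  case (Cons z zs)
  have z: "null_homotopic z" using Cons.prems by simp
  then have zc: "z \<in> carrier R" unfolding null_homotopic_def by simp
  show ?case
  proof (rule koszul_exact_descend[OF Cons.prems(1) z])
    show "koszul_exact (Suc k) (U <+>\<^bsub>R\<^esub> PIdl z)"
      using Cons.prems by (intro Cons.IH ideal_adjoin(1) zc) auto
    show "r \<in> U" if "r \<in> carrier R" "z \<otimes> r \<in> U" for r using Cons.prems(2) that by simp
  qed
qed

text \<open>Vanishing of the first Koszul homology group, unpacked: a relation is a 1-cycle, and a
  2-chain bounding it amounts to an antisymmetric matrix.\<close>

lemma relations_are_koszul:
  assumes ex: "koszul_exact 0 {\<zero>}" and m: "\<And>j. j < d \<Longrightarrow> m j \<in> carrier R"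
    and rel: "(\<Oplus>j\<in>{..<d}. x j \<otimes> m j) = \<zero>"
  shows "\<exists>a. (\<forall>l j. a l j \<in> carrier R) \<and> (\<forall>l j. l \<noteq> j \<longrightarrow> a l j = \<ominus> a j l) \<and>
    (\<forall>l<d. m l = (\<Oplus>j\<in>{..<d} - {l}. x j \<otimes> a l j))"
proof -
  \<comment> \<open>The relation as a chain: its value at {l} is m l and it is zero on all other
    sets, so its boundary at the empty set is the given sum.\<close>
  define c where "c S = (if \<exists>j<d. S = {j} then m (the_elem S) else \<zero>)" for S
  have c: "c S \<in> carrier R" for S using m by (auto simp: c_def)
  have "koszul x d c {} = (\<Oplus>j\<in>{..<d}. x j \<otimes> m j)"
    unfolding koszul_def using x m by (intro finsum_cong') (auto simp: c_def par_def)
  with rel have "\<forall>S\<subseteq>{..<d}. card S = 0 \<longrightarrow> koszul x d c S \<in> {\<zero>}"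
    using finite_subset[of _ "{..<d}"] by auto
  then obtain b where b: "\<And>S. b S \<in> carrier R"
    "\<And>S. S \<subseteq> {..<d} \<Longrightarrow> card S = Suc 0 \<Longrightarrow> c S \<ominus> koszul x d b S \<in> {\<zero>}"
    using ex c unfolding koszul_exact_def by metis
  \<comment> \<open>The chain b does not see the order of l and j; the sign of inserting j into {l}
    turns it into an antisymmetric matrix.\<close>
  define a where "a l j = sg (l < j) (b {j, l})" for l j
  have "a l j = \<ominus> a j l" if "l \<noteq> j" for l j
    using that b(1) unfolding a_def sg_def by (auto simp: insert_commute)
  moreover have "m l = (\<Oplus>j\<in>{..<d} - {l}. x j \<otimes> a l j)" if l: "l < d" for l
  proof -
    have "c {l} = koszul x d b {l}"
      using b(2)[of "{l}"] l c koszul_closed[OF b(1)] by (simp add: r_right_minus_eq)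
    also have "\<dots> = (\<Oplus>j\<in>{..<d} - {l}. x j \<otimes> a l j)"
      unfolding koszul_def
    proof (intro finsum_cong')
      fix j assume j: "j \<in> {..<d} - {l}"
      have "par j {l} = (l < j)" using par_insert[of "{}" l j] by (simp add: par_def)
      then show "sg (par j {l}) (x j \<otimes> b {j, l}) = x j \<otimes> a l j"
        using j x b(1) by (simp add: a_def)
    qed (use x b(1) in \<open>auto simp: a_def\<close>)
    finally show ?thesis using l by (auto simp: c_def)
  qed
  moreover have "a l j \<in> carrier R" for l j using b(1) by (simp add: a_def)
  ultimately show ?thesis by blast
qed

end

end

section \<open>Homogeneous components\<close>

definition hcomp :: "('b, 'm) ring_scheme \<Rightarrow> ('i \<Rightarrow> 'b set) \<Rightarrow> 'b \<Rightarrow> 'i \<Rightarrow> 'b" where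
  "hcomp M H x = (THE f. homogeneous_decomposition M H x f)"

text \<open>The index type is left open: R is graded by natural numbers, modules by
  integers.\<close>

locale graded_group = abelian_group M for M :: "('b, 'm) ring_scheme" (structure) and H :: "'i \<Rightarrow> 'b set" +
  assumes is_grad: "is_grading M H"
begin

lemma H_subgroup: "additive_subgroup (H i) M"
  using is_grad unfolding is_grading_def by blast

lemma H_carrier: "x \<in> H i \<Longrightarrow> x \<in> carrier M"
  using additive_subgroup.a_subset[OF H_subgroup] by blast

lemma H_zero [simp]: "\<zero> \<in> H i"
  by (rule additive_subgroup.zero_closed[OF H_subgroup])

lemma H_add: "x \<in> H i \<Longrightarrow> y \<in> H i \<Longrightarrow> x \<oplus> y \<in> H i"
  by (rule additive_subgroup.a_closed[OF H_subgroup])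

lemma H_neg: "x \<in> H i \<Longrightarrow> \<ominus> x \<in> H i"
  using subgroup.m_inv_closed[OF additive_subgroup.a_subgroup[OF H_subgroup]] by (simp add: a_inv_def)

lemma hcomp_decomposition:
  assumes "x \<in> carrier M"
  shows "homogeneous_decomposition M H x (hcomp M H x)"
proof -
  have "\<exists>!f. homogeneous_decomposition M H x f"
    using is_grad assms unfolding is_grading_def by blast
  from theI'[OF this] show ?thesis unfolding hcomp_def .
qed

lemma hcomp_in: "x \<in> carrier M \<Longrightarrow> hcomp M H x i \<in> H i"
  using hcomp_decomposition unfolding homogeneous_decomposition_def by blast

lemma hcomp_closed [simp]: "x \<in> carrier M \<Longrightarrow> hcomp M H x i \<in> carrier M"
  using hcomp_in H_carrier by blast

lemma hcomp_finite: "x \<in> carrier M \<Longrightarrow> finite {i. hcomp M H x i \<noteq> \<zero>}"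
  using hcomp_decomposition unfolding homogeneous_decomposition_def by blast

lemma hcomp_sum: "x \<in> carrier M \<Longrightarrow> x = (\<Oplus>i\<in>{i. hcomp M H x i \<noteq> \<zero>}. hcomp M H x i)"
  using hcomp_decomposition unfolding homogeneous_decomposition_def by blast

lemma hcomp_eqI:
  assumes "homogeneous_decomposition M H x f" "x \<in> carrier M"
  shows "hcomp M H x = f"
proof -
  have "\<exists>!f. homogeneous_decomposition M H x f"
    using is_grad assms(2) unfolding is_grading_def by blast
  with theI'[OF this] show ?thesis unfolding hcomp_def using assms(1) by blast
qed

lemma hcomp_finsum_homogeneous:
  assumes A: "finite A" and f: "\<And>i. i \<in> A \<Longrightarrow> f i \<in> H i"
  shows "hcomp M H (\<Oplus>i\<in>A. f i) = (\<lambda>i. if i \<in> A then f i else \<zero>)"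
proof (rule hcomp_eqI)
  have fc: "f \<in> A \<rightarrow> carrier M" using f H_carrier by blast
  then show "(\<Oplus>i\<in>A. f i) \<in> carrier M" by simp
  have "(\<Oplus>i\<in>A. f i) = (\<Oplus>i\<in>{i. (if i \<in> A then f i else \<zero>) \<noteq> \<zero>}. if i \<in> A then f i else \<zero>)"
    using A fc by (intro add.finprod_mono_neutral_cong_right) (auto split: if_splits)
  moreover have "finite {i. (if i \<in> A then f i else \<zero>) \<noteq> \<zero>}"
    using A by (rule rev_finite_subset) auto
  ultimately show "homogeneous_decomposition M H (\<Oplus>i\<in>A. f i) (\<lambda>i. if i \<in> A then f i else \<zero>)"
    unfolding homogeneous_decomposition_def using f by auto
qed

lemma hcomp_homogeneous:
  assumes "x \<in> H i"
  shows "hcomp M H x j = (if j = i then x else \<zero>)"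
  using hcomp_finsum_homogeneous[of "{i}" "\<lambda>_. x"] assms H_carrier by auto

lemma hcomp_sum_superset:
  assumes "x \<in> carrier M" "finite A" "{i. hcomp M H x i \<noteq> \<zero>} \<subseteq> A"
  shows "x = (\<Oplus>i\<in>A. hcomp M H x i)"
proof -
  have "(\<Oplus>i\<in>A. hcomp M H x i) = (\<Oplus>i\<in>{i. hcomp M H x i \<noteq> \<zero>}. hcomp M H x i)"
    using assms by (intro add.finprod_mono_neutral_cong_right) auto
  with hcomp_sum[OF assms(1)] show ?thesis by simp
qed

lemma hcomp_add:
  assumes "x \<in> carrier M" "y \<in> carrier M"
  shows "hcomp M H (x \<oplus> y) i = hcomp M H x i \<oplus> hcomp M H y i"
proof -
  define A where "A = {i. hcomp M H x i \<noteq> \<zero>} \<union> {i. hcomp M H y i \<noteq> \<zero>}"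
  have A: "finite A" using assms hcomp_finite by (simp add: A_def)
  have "x \<oplus> y = (\<Oplus>i\<in>A. hcomp M H x i) \<oplus> (\<Oplus>i\<in>A. hcomp M H y i)"
    using hcomp_sum_superset[OF assms(1) A] hcomp_sum_superset[OF assms(2) A] by (auto simp: A_def)
  also have "\<dots> = (\<Oplus>i\<in>A. hcomp M H x i \<oplus> hcomp M H y i)"
    using assms by (subst finsum_addf) auto
  finally have "hcomp M H (x \<oplus> y) = (\<lambda>i. if i \<in> A then hcomp M H x i \<oplus> hcomp M H y i else \<zero>)"
    using hcomp_finsum_homogeneous[OF A, of "\<lambda>i. hcomp M H x i \<oplus> hcomp M H y i"] assms
    by (simp add: H_add hcomp_in)
  then show ?thesis by (auto simp: A_def)
qed

lemma hcomp_zero [simp]: "hcomp M H \<zero> i = \<zero>"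
  using hcomp_homogeneous[of \<zero>] by simp

lemma hcomp_finsum:
  assumes "f \<in> A \<rightarrow> carrier M"
  shows "hcomp M H (\<Oplus>a\<in>A. f a) i = (\<Oplus>a\<in>A. hcomp M H (f a) i)"
  using assms by (induction A rule: infinite_finite_induct) (auto simp: hcomp_add Pi_def)

lemma hcomp_neg:
  assumes "x \<in> carrier M"
  shows "hcomp M H (\<ominus> x) i = \<ominus> hcomp M H x i"
proof -
  have "hcomp M H (\<ominus> x) i \<oplus> hcomp M H x i = \<zero>"
    using hcomp_add[of "\<ominus> x" x i] assms by (simp add: l_neg)
  then show ?thesis using assms by (simp add: minus_equality)
qed

end

text \<open>The grading of R extended by zero to negative degrees, so that degrees can be subtracted
  without truncation.\<close>

definition int_grading :: "('a, 'r) ring_scheme \<Rightarrow> (nat \<Rightarrow> 'a set) \<Rightarrow> int \<Rightarrow> 'a set" where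
  "int_grading R G i = (if 0 \<le> i then G (nat i) else {\<zero>\<^bsub>R\<^esub>})"

definition int_comp :: "('a, 'r) ring_scheme \<Rightarrow> (nat \<Rightarrow> 'a set) \<Rightarrow> int \<Rightarrow> 'a \<Rightarrow> 'a" where
  "int_comp R G i r = (if 0 \<le> i then hcomp R G r (nat i) else \<zero>\<^bsub>R\<^esub>)"

section \<open>The ring as a module over itself, and ideals generated by families\<close>

lemma (in cring) self_module_simps [simp]:
  "carrier (self_module R) = carrier R" "\<zero>\<^bsub>self_module R\<^esub> = \<zero>"
  "x \<oplus>\<^bsub>self_module R\<^esub> y = x \<oplus> y" "r \<odot>\<^bsub>self_module R\<^esub> y = r \<otimes> y"
  "finsum (self_module R) f A = finsum R f A" "\<ominus>\<^bsub>self_module R\<^esub> x = \<ominus> x"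
  by (simp_all add: self_module_def finsum_def finprod_def a_inv_def m_inv_def)

lemma (in cring) self_module: "module R (self_module R)"
proof (rule moduleI)
  show "abelian_group (self_module R)"
  proof (rule abelian_groupI)
    fix x assume "x \<in> carrier (self_module R)"
    then show "\<exists>y\<in>carrier (self_module R). y \<oplus>\<^bsub>self_module R\<^esub> x = \<zero>\<^bsub>self_module R\<^esub>"
      by (auto intro!: bexI[of _ "\<ominus> x"] simp: l_neg)
  qed (auto simp: a_ac)
qed (auto simp: is_cring l_distr r_distr m_assoc)

lemma (in cring) submodule_self_iff: "submodule I R (self_module R) \<longleftrightarrow> ideal I R"
proof
  interpret S: module R "self_module R" by (rule self_module)
  assume I: "submodule I R (self_module R)"
  note sm = S.submod[OF I] S.submoduleE(2)[OF I]
  show "ideal I R"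
  proof (rule idealI)
    show "ring R" by (rule ring_axioms)
    show "subgroup I (add_monoid R)"
      using sm by (intro add.subgroupI) (auto simp flip: a_inv_def)
    show "y \<otimes> a \<in> I" if "a \<in> I" "y \<in> carrier R" for a y using sm(5) that by simp
    show "a \<otimes> y \<in> I" if "a \<in> I" "y \<in> carrier R" for a y using sm(5)[of y a] sm(1)[of a] that m_comm[of a y] by simp
  qed
next
  interpret S: module R "self_module R" by (rule self_module)
  assume I: "ideal I R"
  then interpret ideal I R .
  show "submodule I R (self_module R)"
    by (rule S.submoduleI) (auto intro: Icarr I_l_closed)
qed

context cring
begin

text \<open>For finite T this is the ideal generated by the x_t, kept in the form of explicit
  combinations because coefficients will be compared degree by degree.\<close>

definition gen_ideal :: "('i \<Rightarrow> 'a) \<Rightarrow> 'i set \<Rightarrow> 'a set" where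
  "gen_ideal x T = {(\<Oplus>t\<in>T. x t \<otimes> r t) | r. r \<in> T \<rightarrow> carrier R}"

lemma gen_ideal_eq_comb: "gen_ideal x T = comb (self_module R) x T (carrier R)"
  by (simp add: gen_ideal_def comb_def)

lemma gen_ideal_ideal:
  assumes "x \<in> T \<rightarrow> carrier R"
  shows "ideal (gen_ideal x T) R"
proof -
  interpret S: module R "self_module R" by (rule self_module)
  show ?thesis
    unfolding submodule_self_iff[symmetric] gen_ideal_eq_comb
    using S.comb_submodule[OF S.carrier_is_submodule assms] by simp
qed

lemma gen_ideal_memI:
  assumes "finite T" "x \<in> T \<rightarrow> carrier R" "t \<in> T" "r \<in> carrier R"
  shows "x t \<otimes> r \<in> gen_ideal x T"
proof -
  interpret S: module R "self_module R" by (rule self_module)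
  show ?thesis
    using S.comb_gen[OF assms(1,3) S.carrier_is_submodule assms(2)] assms(4)
    unfolding gen_ideal_eq_comb by simp
qed

lemma gen_ideal_gen:
  assumes "finite T" "x \<in> T \<rightarrow> carrier R" "t \<in> T"
  shows "x t \<in> gen_ideal x T"
  using gen_ideal_memI[OF assms one_closed] assms(2,3) by (simp add: Pi_iff)

lemma gen_ideal_subset:
  assumes "ideal I R" "\<And>t. t \<in> T \<Longrightarrow> x t \<in> I"
  shows "gen_ideal x T \<subseteq> I"
proof -
  interpret S: module R "self_module R" by (rule self_module)
  show ?thesis unfolding gen_ideal_eq_comb
    using assms submodule_self_iff by (intro S.comb_subset) (auto intro: ideal.I_r_closed)
qed

lemma gen_ideal_mono:
  assumes "finite T'" "T \<subseteq> T'" "x \<in> T' \<rightarrow> carrier R"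
  shows "gen_ideal x T \<subseteq> gen_ideal x T'"
  using assms by (intro gen_ideal_subset gen_ideal_ideal gen_ideal_gen) auto

lemma gen_ideal_eq_Idl:
  assumes "finite T" "x \<in> T \<rightarrow> carrier R"
  shows "gen_ideal x T = Idl (x ` T)"
proof
  have sub: "x ` T \<subseteq> carrier R" using assms by auto
  show "gen_ideal x T \<subseteq> Idl (x ` T)"
    using genideal_self[OF sub] by (intro gen_ideal_subset genideal_ideal sub) auto
  show "Idl (x ` T) \<subseteq> gen_ideal x T"
    using assms by (intro genideal_minimal gen_ideal_ideal) (auto intro: gen_ideal_gen)
qed

end

sublocale standard_graded_ring \<subseteq> RG: graded_group R G
  by unfold_locales (rule grading)

section \<open>Homogeneous components with integer degrees\<close>

context standard_graded_ring
begin

abbreviation Gz :: "int \<Rightarrow> 'a set" where "Gz \<equiv> int_grading R G"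
abbreviation cz :: "int \<Rightarrow> 'a \<Rightarrow> 'a" where "cz \<equiv> int_comp R G"

lemma Gz_nat [simp]: "Gz (int n) = G n"
  by (simp add: int_grading_def)

lemma Gz_neg: "i < 0 \<Longrightarrow> Gz i = {\<zero>}"
  by (simp add: int_grading_def)

lemma Gz_carrier: "r \<in> Gz i \<Longrightarrow> r \<in> carrier R"
  by (auto simp: int_grading_def RG.H_carrier split: if_splits)

lemma Gz_zero [simp]: "\<zero> \<in> Gz i"
  by (auto simp: int_grading_def)

lemma Gz_add: "r \<in> Gz i \<Longrightarrow> s \<in> Gz i \<Longrightarrow> r \<oplus> s \<in> Gz i"
  by (auto simp: int_grading_def RG.H_add split: if_splits)

lemma Gz_neg_closed: "r \<in> Gz i \<Longrightarrow> \<ominus> r \<in> Gz i"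
  by (auto simp: int_grading_def RG.H_neg split: if_splits)

lemma Gz_mult:
  assumes "r \<in> Gz i" "s \<in> Gz j"
  shows "r \<otimes> s \<in> Gz (i + j)"
proof (cases "0 \<le> i \<and> 0 \<le> j")
  case True
  then show ?thesis
    using assms mult_graded[of r "nat i" s "nat j"] by (simp add: int_grading_def nat_add_distrib)
next
  case False
  then have "r = \<zero> \<or> s = \<zero>" using assms by (auto simp: int_grading_def split: if_splits)
  then show ?thesis using assms Gz_carrier by auto
qed

lemma cz_closed [simp]: "r \<in> carrier R \<Longrightarrow> cz i r \<in> carrier R"
  by (simp add: int_comp_def)

lemma cz_in: "r \<in> carrier R \<Longrightarrow> cz i r \<in> Gz i"
  by (auto simp: int_comp_def int_grading_def RG.hcomp_in)

lemma cz_add: "r \<in> carrier R \<Longrightarrow> s \<in> carrier R \<Longrightarrow> cz i (r \<oplus> s) = cz i r \<oplus> cz i s"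
  by (simp add: int_comp_def RG.hcomp_add)

lemma cz_zero [simp]: "cz i \<zero> = \<zero>"
  by (simp add: int_comp_def)

lemma cz_neg: "r \<in> carrier R \<Longrightarrow> cz i (\<ominus> r) = \<ominus> cz i r"
  by (simp add: int_comp_def RG.hcomp_neg)

lemma cz_finsum: "f \<in> A \<rightarrow> carrier R \<Longrightarrow> cz i (\<Oplus>a\<in>A. f a) = (\<Oplus>a\<in>A. cz i (f a))"
  by (simp add: int_comp_def RG.hcomp_finsum)

lemma cz_homogeneous: "r \<in> Gz i \<Longrightarrow> cz j r = (if j = i then r else \<zero>)"
  by (auto simp: int_comp_def int_grading_def RG.hcomp_homogeneous split: if_splits)

lemma cz_sum:
  assumes "r \<in> carrier R"
  shows "\<exists>N. r = (\<Oplus>i\<in>{..<N}. cz (int i) r)"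
proof -
  obtain N where "{i. hcomp R G r i \<noteq> \<zero>} \<subseteq> {..<N}"
    using RG.hcomp_finite[OF assms] finite_nat_iff_bounded by blast
  from RG.hcomp_sum_superset[OF assms _ this] show ?thesis by (auto simp: int_comp_def)
qed

text \<open>By additivity r may be taken homogeneous, and then both sides vanish unless the degrees
  of the factors add up to i.\<close>

lemma cz_mult:
  assumes a: "a \<in> Gz e" and r: "r \<in> carrier R"
  shows "cz i (a \<otimes> r) = a \<otimes> cz (i - e) r"
proof -
  note ac = Gz_carrier[OF a]
  obtain N where N: "r = (\<Oplus>j\<in>{..<N}. cz (int j) r)" using cz_sum[OF r] by blast
  have *: "cz i (a \<otimes> cz j r) = a \<otimes> cz (i - e) (cz j r)" for j
  proof (cases "i = e + j")
    case True
    then show ?thesis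
      using cz_homogeneous[OF Gz_mult[OF a cz_in[OF r, of j]]] cz_homogeneous[OF cz_in[OF r, of j]] by simp
  next
    case False
    then have "i - e \<noteq> j" by simp
    then show ?thesis
      using False cz_homogeneous[OF Gz_mult[OF a cz_in[OF r, of j]]] cz_homogeneous[OF cz_in[OF r, of j]] ac by simp
  qed
  have "cz i (a \<otimes> (\<Oplus>j\<in>{..<N}. cz (int j) r)) = (\<Oplus>j\<in>{..<N}. cz i (a \<otimes> cz (int j) r))"
    using r ac by (simp add: finsum_rdistr cz_finsum)
  also have "\<dots> = (\<Oplus>j\<in>{..<N}. a \<otimes> cz (i - e) (cz (int j) r))" by (simp only: *)
  also have "\<dots> = a \<otimes> cz (i - e) (\<Oplus>j\<in>{..<N}. cz (int j) r)"
    using r ac by (simp add: finsum_rdistr cz_finsum)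
  finally show ?thesis using N by simp
qed

text \<open>Taking components of arbitrary coefficients gives homogeneous ones of the complementary
  degrees; in particular homogeneous generators make the ideal homogeneous.\<close>

lemma cz_gen_ideal:
  assumes x: "\<And>t. t \<in> T \<Longrightarrow> x t \<in> Gz (a t)" and r: "r \<in> gen_ideal x T"
  shows "\<exists>s. (\<forall>t\<in>T. s t \<in> Gz (i - a t)) \<and> cz i r = (\<Oplus>t\<in>T. x t \<otimes> s t)"
proof -
  obtain s where s: "s \<in> T \<rightarrow> carrier R" "r = (\<Oplus>t\<in>T. x t \<otimes> s t)"
    using r by (auto simp: gen_ideal_def)
  have xc: "x t \<in> carrier R" if "t \<in> T" for t using x[OF that] Gz_carrier by blast
  have "cz i r = (\<Oplus>t\<in>T. cz i (x t \<otimes> s t))"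
    unfolding s(2) using s(1) xc by (intro cz_finsum) auto
  also have "\<dots> = (\<Oplus>t\<in>T. x t \<otimes> cz (i - a t) (s t))"
    using s(1) xc by (intro finsum_cong') (auto simp: cz_mult[OF x] Pi_iff)
  finally show ?thesis using s(1) cz_in by (intro exI[of _ "\<lambda>t. cz (i - a t) (s t)"]) auto
qed

lemma cz_gen_ideal_mem:
  assumes x: "\<And>t. t \<in> T \<Longrightarrow> x t \<in> Gz (a t)" and r: "r \<in> gen_ideal x T"
  shows "cz i r \<in> gen_ideal x T"
proof -
  obtain s where "\<forall>t\<in>T. s t \<in> Gz (i - a t)" "cz i r = (\<Oplus>t\<in>T. x t \<otimes> s t)"
    using cz_gen_ideal[where i = i, OF x r] by blast
  then show ?thesis unfolding gen_ideal_def using Gz_carrier by blast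
qed

lemma ideal_finsum:
  assumes "ideal I R" "\<And>a. a \<in> A \<Longrightarrow> f a \<in> I"
  shows "(\<Oplus>a\<in>A. f a) \<in> I"
proof -
  interpret S: module R "self_module R" by (rule self_module)
  show ?thesis using S.submod_finsum[of I f A] submodule_self_iff assms by auto
qed

lemma mem_of_cz:
  assumes "ideal I R" "r \<in> carrier R" "\<And>i. cz (int i) r \<in> I"
  shows "r \<in> I"
proof -
  obtain N where "r = (\<Oplus>i\<in>{..<N}. cz (int i) r)" using cz_sum[OF assms(2)] by blast
  moreover have "(\<Oplus>i\<in>{..<N}. cz (int i) r) \<in> I" by (rule ideal_finsum[OF assms(1,3)])
  ultimately show ?thesis by simp
qed

end

section \<open>Homogeneous systems of parameters\<close>

text \<open>One direction of the correspondence between primes above I and primes of R/I. The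
  membership test keeps images of distinct primes distinct, so that chains above I give chains in
  R/I.\<close>

lemma (in ideal) prime_image_quotient:
  assumes cr: "cring R" and P: "primeideal P R" and sub: "I \<subseteq> P"
  shows "primeideal ((+>) I ` P) (R Quot I)"
    "r \<in> carrier R \<Longrightarrow> I +> r \<in> (+>) I ` P \<longleftrightarrow> r \<in> P"
proof -
  interpret cring R by fact
  interpret P: primeideal P R by fact
  have Qc: "cring (R Quot I)" by (rule quotient_is_cring[OF cr])
  then have Qr: "ring (R Quot I)" by (rule cring.axioms)
  note hom_mult = ring_hom_mult[OF rcos_ring_hom]
  have ca: "carrier (R Quot I) = (+>) I ` carrier R"
    by (auto simp: FactRing_def A_RCOSETS_def')
  show mem: "I +> r \<in> (+>) I ` P \<longleftrightarrow> r \<in> P" if r: "r \<in> carrier R" for r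
  proof
    assume "I +> r \<in> (+>) I ` P"
    then obtain p where p: "p \<in> P" "I +> r = I +> p" by blast
    have "r \<ominus> p \<in> I" using p P.Icarr r quotient_eq_iff_same_a_r_cos[OF is_ideal r, of p] by simp
    then have "r \<ominus> p \<in> P" using sub by blast
    with p have "(r \<ominus> p) \<oplus> p \<in> P" by simp
    moreover have "(r \<ominus> p) \<oplus> p = r" using r P.Icarr[OF p(1)] by (simp add: a_minus_def a_assoc l_neg)
    ultimately show "r \<in> P" by simp
  qed blast
  show "primeideal ((+>) I ` P) (R Quot I)"
  proof (rule primeidealI)
    show "ideal ((+>) I ` P) (R Quot I)"
    proof (rule idealI)
      show "ring (R Quot I)" by (rule Qr)
      have "subgroup P (add_monoid R)" by (rule P.a_subgroup)
      moreover have "group_hom (add_monoid R) (add_monoid (R Quot I)) ((+>) I)"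
        using rcos_ring_hom Qr unfolding ring_hom_def
        by (intro group_hom.intro group_hom_axioms.intro a_group abelian_group.a_group ring.is_abelian_group)
          (auto simp: hom_def)
      ultimately show "subgroup ((+>) I ` P) (add_monoid (R Quot I))"
        by (rule group_hom.subgroup_img_is_subgroup[rotated])
      fix a y assume a: "a \<in> (+>) I ` P" and "y \<in> carrier (R Quot I)"
      then obtain p r where pr: "a = I +> p" "p \<in> P" "y = I +> r" "r \<in> carrier R" unfolding ca by blast
      then have "y \<otimes>\<^bsub>R Quot I\<^esub> a = I +> (r \<otimes> p)" "a \<otimes>\<^bsub>R Quot I\<^esub> y = I +> (p \<otimes> r)"
        using hom_mult P.Icarr by simp_all
      moreover have "r \<otimes> p \<in> P" "p \<otimes> r \<in> P" using pr P.I_l_closed P.I_r_closed by auto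
      ultimately show "y \<otimes>\<^bsub>R Quot I\<^esub> a \<in> (+>) I ` P" "a \<otimes>\<^bsub>R Quot I\<^esub> y \<in> (+>) I ` P" by auto
    qed
    show "cring (R Quot I)" by (rule Qc)
    have "\<one> \<notin> P" using P.I_notcarr P.one_imp_carrier by blast
    then have "I +> \<one> \<notin> (+>) I ` P" using mem by simp
    then show "carrier (R Quot I) \<noteq> (+>) I ` P" unfolding ca by blast
    fix a b assume "a \<in> carrier (R Quot I)" "b \<in> carrier (R Quot I)" and ab: "a \<otimes>\<^bsub>R Quot I\<^esub> b \<in> (+>) I ` P"
    then obtain r s where rs: "a = I +> r" "r \<in> carrier R" "b = I +> s" "s \<in> carrier R" unfolding ca by blast
    then have "a \<otimes>\<^bsub>R Quot I\<^esub> b = I +> (r \<otimes> s)" using hom_mult by simp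
    with ab rs mem[of "r \<otimes> s"] have "r \<otimes> s \<in> P" by simp
    then show "a \<in> (+>) I ` P \<or> b \<in> (+>) I ` P" using P.I_prime rs by blast
  qed
qed

lemma (in cring) krull_dim_quotient_zeroD:
  assumes I: "ideal I R" and dim: "krull_dim (R Quot I) = 0"
    and P: "primeideal P R" "primeideal Q R" "I \<subseteq> P" "P \<subseteq> Q"
  shows "P = Q"
proof (rule ccontr)
  assume "P \<noteq> Q"
  then obtain r where r: "r \<in> Q" "r \<notin> P" using P by blast
  interpret I: ideal I R by fact
  have rc: "r \<in> carrier R" using r ideal.Icarr[OF primeideal.axioms(1)[OF P(2)]] by blast
  note iP = I.prime_image_quotient[OF is_cring P(1,3)]
  have IQ: "I \<subseteq> Q" using P by blast
  note iQ = I.prime_image_quotient[OF is_cring P(2) IQ]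
  have "I +> r \<in> (+>) I ` Q" "I +> r \<notin> (+>) I ` P" using iP(2)[OF rc] iQ(2)[OF rc] r by simp_all
  then have "(+>) I ` P \<subset> (+>) I ` Q" using P(4) by blast
  then have "enat 1 \<le> krull_dim (R Quot I)"
    using iP(1) iQ(1)
    by (intro krull_dim_ge[of 1 "\<lambda>i. if i = 0 then (+>) I ` P else (+>) I ` Q"]) auto
  with dim show False by (simp add: zero_enat_def)
qed

context standard_graded_ring
begin

lemma Gz_pow: "z \<in> Gz e \<Longrightarrow> z [^] (n::nat) \<in> Gz (int n * e)"
proof (induction n)
  case 0
  have "\<one> \<in> G 0" using subringE(3)[OF subfieldE(1)[OF degree_zero_field]] .
  then show ?case using Gz_nat[of 0] by simp
next
  case (Suc n)
  then have "z [^] n \<otimes> z \<in> Gz (int n * e + e)" by (intro Gz_mult) auto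
  then show ?case by (simp add: algebra_simps)
qed

context
  fixes x :: "nat \<Rightarrow> 'a" and a :: "nat \<Rightarrow> nat" and d :: nat
  assumes xG: "\<And>j. j < d \<Longrightarrow> x j \<in> G (a j)"
    and dim0: "krull_dim (R Quot gen_ideal x {..<d}) = 0"
begin

lemma xGz: "j < d \<Longrightarrow> x j \<in> Gz (int (a j))"
  using xG by simp

lemma xc: "j < d \<Longrightarrow> x j \<in> carrier R"
  using xG RG.H_carrier by blast

lemma gen_ideal_sub: "T \<subseteq> {..<d} \<Longrightarrow> ideal (gen_ideal x T) R"
  using xc by (intro gen_ideal_ideal) auto

text \<open>A prime avoiding all \<open>z\<^sup>n (1 - r z)\<close> does not become improper when \<open>z\<close> is adjoined to it, which
  contradicts dimension zero.\<close>

lemma homogeneous_power_in: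
  assumes z: "z \<in> Gz e" and e: "0 < e"
  shows "\<exists>n::nat. z [^] n \<in> gen_ideal x {..<d}"
proof (rule ccontr)
  assume neg: "\<not> ?thesis"
  have zc: "z \<in> carrier R" using z Gz_carrier by blast
  define I where "I = gen_ideal x {..<d}"
  have I: "ideal I R" unfolding I_def by (rule gen_ideal_sub) simp
  define S where "S = {z [^] (n::nat) \<otimes> (\<one> \<ominus> r \<otimes> z) | n r. r \<in> carrier R}"
  have S1: "\<one> \<ominus> r \<otimes> z \<in> S" if r: "r \<in> carrier R" for r
  proof -
    have "\<one> \<ominus> r \<otimes> z = z [^] (0::nat) \<otimes> (\<one> \<ominus> r \<otimes> z)" using r zc by simp
    then show ?thesis unfolding S_def using r by blast
  qed
  have "\<exists>P. primeideal P R \<and> I \<subseteq> P \<and> P \<inter> S = {}"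
  proof (rule prime_avoiding[OF noetherian_ring_axioms I])
    show "S \<subseteq> carrier R" unfolding S_def using zc by auto
    have "\<one> \<ominus> \<zero> \<otimes> z = \<one>" using zc by (simp add: a_minus_def)
    then show "\<one> \<in> S" using S1[of \<zero>] by simp
    fix s t assume "s \<in> S" "t \<in> S"
    then obtain n r m q where e: "s = z [^] (n::nat) \<otimes> (\<one> \<ominus> r \<otimes> z)" "r \<in> carrier R"
      "t = z [^] (m::nat) \<otimes> (\<one> \<ominus> q \<otimes> z)" "q \<in> carrier R" unfolding S_def by blast
    have "(p \<otimes> (\<one> \<ominus> r \<otimes> z)) \<otimes> (p' \<otimes> (\<one> \<ominus> q \<otimes> z)) = (p \<otimes> p') \<otimes> (\<one> \<ominus> (r \<oplus> q \<ominus> r \<otimes> q \<otimes> z) \<otimes> z)"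
      if "p \<in> carrier R" "p' \<in> carrier R" for p p' using that e(2,4) zc by algebra
    then have "s \<otimes> t = z [^] (n + m) \<otimes> (\<one> \<ominus> (r \<oplus> q \<ominus> r \<otimes> q \<otimes> z) \<otimes> z)"
      unfolding e(1,3) using zc by (simp add: nat_pow_mult)
    moreover have "r \<oplus> q \<ominus> r \<otimes> q \<otimes> z \<in> carrier R" using e zc by simp
    ultimately show "s \<otimes> t \<in> S" unfolding S_def by blast
  next
    \<comment> \<open>I is homogeneous, so it would contain the component of this element in degree
      n e. That component is z^n, since the other term is a multiple of z^(n+1) and starts in degree
      (n + 1) e.\<close>
    have "z [^] n \<otimes> (\<one> \<ominus> r \<otimes> z) \<notin> I" if r: "r \<in> carrier R" for n :: nat and r
    proof
      assume mem: "z [^] n \<otimes> (\<one> \<ominus> r \<otimes> z) \<in> I"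
      have zn: "z [^] n \<in> carrier R" "z [^] Suc n \<in> carrier R" using zc by (auto simp del: nat_pow_Suc)
      have "z [^] n \<otimes> (\<one> \<ominus> r \<otimes> z) = z [^] n \<oplus> \<ominus> (z [^] Suc n \<otimes> r)"
        using zn(1) zc r by (simp add: a_minus_def r_distr r_minus m_ac)
      then have "cz (int n * e) (z [^] n \<otimes> (\<one> \<ominus> r \<otimes> z)) =
          cz (int n * e) (z [^] n) \<oplus> \<ominus> cz (int n * e) (z [^] Suc n \<otimes> r)"
        using zn r by (simp add: cz_add cz_neg del: nat_pow_Suc)
      also have "cz (int n * e) (z [^] Suc n \<otimes> r) = z [^] Suc n \<otimes> cz (int n * e - int (Suc n) * e) r"
        using cz_mult[OF Gz_pow[OF z] r] .
      also have "cz (int n * e - int (Suc n) * e) r = \<zero>"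
        using e by (simp add: int_comp_def algebra_simps)
      also have "cz (int n * e) (z [^] n) = z [^] n"
        using cz_homogeneous[OF Gz_pow[OF z]] by simp
      finally have "cz (int n * e) (z [^] n \<otimes> (\<one> \<ominus> r \<otimes> z)) = z [^] n"
        using zn zc by (simp add: r_null del: nat_pow_Suc)
      moreover have "cz (int n * e) (z [^] n \<otimes> (\<one> \<ominus> r \<otimes> z)) \<in> I"
        unfolding I_def using mem unfolding I_def
        by (rule cz_gen_ideal_mem[of "{..<d}" x "\<lambda>j. int (a j)", rotated]) (use xGz in simp)
      ultimately have "z [^] n \<in> I" by simp
      with neg show False unfolding I_def by blast
    qed
    then show "I \<inter> S = {}" unfolding S_def by blast
  qed
  then obtain Q where Q: "primeideal Q R" "I \<subseteq> Q" "Q \<inter> S = {}" by blast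
  interpret Q: primeideal Q R by (rule Q(1))
  have zQ: "z \<notin> Q"
  proof
    assume "z \<in> Q"
    have "z \<otimes> (\<one> \<ominus> \<zero> \<otimes> z) = z [^] (1::nat) \<otimes> (\<one> \<ominus> \<zero> \<otimes> z)" using zc by simp
    then have "z \<otimes> (\<one> \<ominus> \<zero> \<otimes> z) \<in> S" unfolding S_def by blast
    moreover have "z \<otimes> (\<one> \<ominus> \<zero> \<otimes> z) = z" using zc by (simp add: a_minus_def)
    ultimately show False using \<open>z \<in> Q\<close> Q(3) by auto
  qed
  note adj = ideal_adjoin[OF Q.is_ideal zc]
  have "\<one> \<notin> Q <+>\<^bsub>R\<^esub> PIdl z"
  proof
    assume "\<one> \<in> Q <+>\<^bsub>R\<^esub> PIdl z"
    then obtain q r where qr: "q \<in> Q" "r \<in> carrier R" "\<one> = q \<oplus> r \<otimes> z" unfolding adj(4) by blast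
    have "q \<in> carrier R" using qr Q.Icarr by blast
    then have "(q \<oplus> r \<otimes> z) \<ominus> r \<otimes> z = q" using qr(2) zc by (simp add: a_minus_def a_assoc r_neg)
    then have "\<one> \<ominus> r \<otimes> z = q" unfolding qr(3)[symmetric] .
    with S1[OF qr(2)] qr(1) Q(3) show False by auto
  qed
  then obtain P where P: "primeideal P R" "Q <+>\<^bsub>R\<^esub> PIdl z \<subseteq> P"
    using prime_above[OF noetherian_ring_axioms adj(1)] by blast
  have "Q = P"
    using krull_dim_quotient_zeroD[OF I _ Q(1) P(1) Q(2)] dim0 adj(2) P(2) unfolding I_def by blast
  with P(2) adj(3) zQ show False by blast
qed

text \<open>Homogeneous elements of positive degree are nilpotent modulo I, so a prime over I
  contains every component of y and hence y itself; no such prime can avoid all powers of y.\<close>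

lemma irrelevant_power_in:
  assumes y: "y \<in> irrelevant_ideal R G"
  shows "\<exists>n::nat. y [^] n \<in> gen_ideal x {..<d}"
proof (rule ccontr)
  assume neg: "\<not> ?thesis"
  define I where "I = gen_ideal x {..<d}"
  have I: "ideal I R" unfolding I_def by (rule gen_ideal_sub) simp
  obtain f where f: "y \<in> carrier R" "homogeneous_decomposition R G y f" "f 0 = \<zero>"
    using y unfolding irrelevant_ideal_def by blast
  have y0: "hcomp R G y 0 = \<zero>" using RG.hcomp_eqI[OF f(2,1)] f(3) by simp
  have "\<exists>P. primeideal P R \<and> I \<subseteq> P \<and> P \<inter> {y [^] n | n::nat. True} = {}"
  proof (rule prime_avoiding[OF noetherian_ring_axioms I])
    show "\<one> \<in> {y [^] n | n::nat. True}" using nat_pow_0[of y] by (metis (mono_tags, lifting) mem_Collect_eq)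
    show "s \<otimes> t \<in> {y [^] n | n::nat. True}" if "s \<in> {y [^] n | n::nat. True}" "t \<in> {y [^] n | n::nat. True}" for s t
      using that f(1) nat_pow_mult[of y] by auto
  qed (use f(1) neg in \<open>auto simp: I_def\<close>)
  then obtain P where P: "primeideal P R" "I \<subseteq> P" "P \<inter> {y [^] n | n::nat. True} = {}" by blast
  interpret P: primeideal P R by (rule P(1))
  have "y [^] (1::nat) \<notin> P" using P(3) by blast
  then have "y \<notin> P" using f(1) by simp
  moreover have "y \<in> P"
  proof (rule mem_of_cz[OF P.is_ideal f(1)])
    fix i :: nat
    show "cz (int i) y \<in> P"
    proof (cases "i = 0")
      case True
      then show ?thesis using y0 by (simp add: int_comp_def)
    next
      case False
      then obtain n :: nat where n: "cz (int i) y [^] n \<in> I"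
        using homogeneous_power_in[OF cz_in[OF f(1), of "int i"]] unfolding I_def by auto
      have c: "cz (int i) y \<in> carrier R" using f(1) by simp
      have "cz (int i) y \<in> P" if "cz (int i) y [^] m \<in> P" for m :: nat
        using that
      proof (induction m)
        case 0
        then show ?case using P.one_imp_carrier c by simp
      next
        case (Suc m)
        then have "cz (int i) y [^] m \<in> P \<or> cz (int i) y \<in> P"
          using c by (intro P.I_prime) simp_all
        then show ?case using Suc.IH by blast
      qed
      then show ?thesis using n P(2) by blast
    qed
  qed
  ultimately show False by simp
qed

end

end

section \<open>From depth to permutable regularity of the parameters\<close>

text \<open>A supremum of natural numbers that equals a positive d is attained. For d = 0 this can
  fail, because the supremum of the empty set is also zero.\<close>

lemma (in module) depth_attained:
  assumes "depth R I M = enat d" "0 < d"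
  shows "\<exists>xs. length xs = d \<and> set xs \<subseteq> I \<and> regular_sequence R M xs"
proof -
  define A where "A = {enat (length xs) | xs. set xs \<subseteq> I \<and> regular_sequence R M xs}"
  have sup: "Sup A = enat d" using assms(1) unfolding depth_def A_def .
  have "\<not> (\<forall>a\<in>A. a \<le> enat (d - 1))"
  proof
    assume "\<forall>a\<in>A. a \<le> enat (d - 1)"
    then have "Sup A \<le> enat (d - 1)" by (intro Sup_least) blast
    with sup assms(2) show False by simp
  qed
  then obtain a where a: "a \<in> A" "\<not> a \<le> enat (d - 1)" by blast
  then have "a \<le> enat d" using sup Sup_upper[OF a(1)] by simp
  obtain xs where xs: "a = enat (length xs)" "set xs \<subseteq> I" "regular_sequence R M xs"
    using a(1) unfolding A_def by blast
  with a(2) \<open>a \<le> enat d\<close> have "length xs = d" by simp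
  with xs show ?thesis by blast
qed

context cring
begin

lemma weakly_regularI:
  assumes "\<And>j r. j < length zs \<Longrightarrow> r \<in> carrier R \<Longrightarrow>
    zs ! j \<otimes> r \<in> foldl (\<lambda>U z. U <+>\<^bsub>R\<^esub> PIdl z) U (take j zs) \<Longrightarrow>
    r \<in> foldl (\<lambda>U z. U <+>\<^bsub>R\<^esub> PIdl z) U (take j zs)"
  shows "weakly_regular U zs"
  using assms
proof (induction zs arbitrary: U)
  case (Cons z zs)
  have "r \<in> U" if "r \<in> carrier R" "z \<otimes> r \<in> U" for r
    using Cons.prems[of 0 r] that by simp
  moreover have "weakly_regular (U <+>\<^bsub>R\<^esub> PIdl z) zs"
  proof (rule Cons.IH)
    fix j r assume "j < length zs" "r \<in> carrier R"
      "zs ! j \<otimes> r \<in> foldl (\<lambda>U z. U <+>\<^bsub>R\<^esub> PIdl z) (U <+>\<^bsub>R\<^esub> PIdl z) (take j zs)"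
    then show "r \<in> foldl (\<lambda>U z. U <+>\<^bsub>R\<^esub> PIdl z) (U <+>\<^bsub>R\<^esub> PIdl z) (take j zs)"
      using Cons.prems[of "Suc j" r] by simp
  qed
  ultimately show ?case by simp
qed simp

text \<open>The ideals (z_0, ..., z_(j-1)) appear as sets of sums on one side and as iterated
  adjunctions on the other; once these agree, the regularity conditions are identical.\<close>

lemma weakly_regular_of_regular_sequence:
  assumes reg: "regular_sequence R (self_module R) zs"
  shows "weakly_regular {\<zero>} zs"
proof -
  interpret S: module R "self_module R" by (rule self_module)
  have zs: "set zs \<subseteq> carrier R" using reg unfolding regular_sequence_def by blast
  have eq: "ideal_times_module (take j zs) (self_module R) = foldl (\<lambda>U z. U <+>\<^bsub>R\<^esub> PIdl z) {\<zero>} (take j zs)"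
    if "j \<le> length zs" for j
    using that
  proof (induction j)
    case 0
    then show ?case by (simp add: ideal_times_module_eq_comb S.comb_empty)
  next
    case (Suc j)
    then have j: "j < length zs" by simp
    have z: "zs ! i \<in> carrier R" if "i < length zs" for i using zs that nth_mem by blast
    have c: "ideal_times_module (take i zs) (self_module R) = comb (self_module R) ((!) zs) {..<i} (carrier R)"
      if "i \<le> length zs" for i
      unfolding ideal_times_module_eq_comb using that z
      by (simp add: min_absorb2) (rule S.comb_cong, auto)
    have "ideal_times_module (take (Suc j) zs) (self_module R) =
        {zs ! j \<otimes> v \<oplus> u | v u. v \<in> carrier R \<and> u \<in> ideal_times_module (take j zs) (self_module R)}"
      using S.comb_insert[of "{..<j}" j "(!) zs" "carrier R"] z j by (simp add: c lessThan_Suc Pi_iff)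
    also have "\<dots> = ideal_times_module (take j zs) (self_module R) <+>\<^bsub>R\<^esub> PIdl (zs ! j)"
    proof -
      have "u \<in> carrier R" if "u \<in> ideal_times_module (take j zs) (self_module R)" for u
        using that j z S.submod_carrier[OF S.comb_submodule[OF S.carrier_is_submodule, of "(!) zs" "{..<j}"]]
        by (simp add: c Pi_iff)
      then have "zs ! j \<otimes> v \<oplus> u = u \<oplus> v \<otimes> zs ! j"
        if "v \<in> carrier R" "u \<in> ideal_times_module (take j zs) (self_module R)" for u v
        using that z[OF j] by (simp add: a_comm m_comm)
      then have "{zs ! j \<otimes> v \<oplus> u | v u. v \<in> carrier R \<and> u \<in> ideal_times_module (take j zs) (self_module R)} =
        {u \<oplus> v \<otimes> zs ! j | v u. v \<in> carrier R \<and> u \<in> ideal_times_module (take j zs) (self_module R)}"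
        by (simp cong: rev_conj_cong)
      then show ?thesis by (auto simp: set_add_def' cgenideal_def)
    qed
    finally show ?case using Suc j by (simp add: take_Suc_conv_app_nth)
  qed
  show ?thesis
  proof (rule weakly_regularI)
    fix j r assume j: "j < length zs" "r \<in> carrier R"
      "zs ! j \<otimes> r \<in> foldl (\<lambda>U z. U <+>\<^bsub>R\<^esub> PIdl z) {\<zero>} (take j zs)"
    have "\<forall>m\<in>carrier R. zs ! j \<otimes> m \<in> ideal_times_module (take j zs) (self_module R) \<longrightarrow>
        m \<in> ideal_times_module (take j zs) (self_module R)"
      using reg j(1) unfolding regular_sequence_def self_module_simps by blast
    then show "r \<in> foldl (\<lambda>U z. U <+>\<^bsub>R\<^esub> PIdl z) {\<zero>} (take j zs)"
      using j(2,3) unfolding eq[OF less_imp_le[OF j(1)]] by blast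
  qed
qed

lemma ideal_pow_mono:
  assumes "ideal I R" "y \<in> carrier R" "y [^] (n::nat) \<in> I" "n \<le> m"
  shows "y [^] m \<in> I"
proof -
  have "y [^] m = y [^] (m - n) \<otimes> y [^] n" using assms(2,4) by (simp add: nat_pow_mult)
  then show ?thesis using ideal.I_l_closed[OF assms(1,3)] assms(2) by simp
qed

end

context standard_graded_ring
begin

context
  fixes x :: "nat \<Rightarrow> 'a" and a :: "nat \<Rightarrow> nat" and d :: nat
  assumes xG: "\<And>j. j < d \<Longrightarrow> x j \<in> G (a j)"
    and dim0: "krull_dim (R Quot gen_ideal x {..<d}) = 0"
    and dpos: "0 < d"
    and dep: "depth R (irrelevant_ideal R G) (self_module R) = enat d"
begin

lemma x_carrier: "j < d \<Longrightarrow> x j \<in> carrier R"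
  using xG RG.H_carrier by blast

lemma null_homotopic_gen_ideal:
  assumes "y \<in> gen_ideal x {..<d}"
  shows "null_homotopic x d y"
proof -
  have sum: "null_homotopic x d (\<Oplus>t\<in>T. x t \<otimes> r t)" if "finite T" "T \<subseteq> {..<d}" "r \<in> T \<rightarrow> carrier R" for T r
    using that
  proof (induction T rule: finite_induct)
    case empty
    \<comment> \<open>The empty sum is treated as a multiple of x_0, which is available since d is
      positive.\<close>
    have "null_homotopic x d (\<zero> \<otimes> x 0)"
      using dpos by (intro null_homotopic_smult null_homotopic_gen x_carrier) auto
    then show ?case using x_carrier dpos by simp
  next
    case (insert t T)
    have t: "t < d" "r t \<in> carrier R" using insert by auto
    have "(\<lambda>t. x t \<otimes> r t) \<in> T \<rightarrow> carrier R" using insert x_carrier by auto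
    then have "(\<Oplus>t\<in>insert t T. x t \<otimes> r t) = r t \<otimes> x t \<oplus> (\<Oplus>t\<in>T. x t \<otimes> r t)"
      using insert t x_carrier by (simp add: m_comm)
    moreover have "null_homotopic x d (r t \<otimes> x t)"
      using t by (intro null_homotopic_smult null_homotopic_gen x_carrier) auto
    moreover have "null_homotopic x d (\<Oplus>t\<in>T. x t \<otimes> r t)" using insert by auto
    ultimately show ?case using null_homotopic_add[OF x_carrier] by simp
  qed
  show ?thesis using assms unfolding gen_ideal_def by (auto intro!: sum)
qed

lemma koszul_exact_zero: "koszul_exact x d 0 {\<zero>}"
proof -
  interpret S: module R "self_module R" by (rule self_module)
  obtain ys where ys: "length ys = d" "set ys \<subseteq> irrelevant_ideal R G" "regular_sequence R (self_module R) ys"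
    using S.depth_attained[OF dep dpos] by blast
  have yc: "set ys \<subseteq> carrier R" using ys(2) unfolding irrelevant_ideal_def by blast
  have "\<exists>n. \<forall>y\<in>set ys. y [^] (n::nat) \<in> gen_ideal x {..<d}"
  proof -
    have "\<forall>y\<in>set ys. \<exists>n::nat. y [^] n \<in> gen_ideal x {..<d}"
      using irrelevant_power_in[OF xG dim0] ys(2) by blast
    then obtain n :: "'a \<Rightarrow> nat" where n: "\<And>y. y \<in> set ys \<Longrightarrow> y [^] n y \<in> gen_ideal x {..<d}" by metis
    \<comment> \<open>One exponent for the whole sequence: the largest works, since ideals absorb
      higher powers.\<close>
    have "y [^] Max (n ` set ys) \<in> gen_ideal x {..<d}" if y: "y \<in> set ys" for y
      using ideal_pow_mono[OF gen_ideal_sub[OF xG dim0 order_refl] _ n[OF y]] y yc by auto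
    then show ?thesis by blast
  qed
  then obtain n :: nat where n: "\<And>y. y \<in> set ys \<Longrightarrow> y [^] n \<in> gen_ideal x {..<d}" by blast
  show ?thesis
  proof (rule koszul_exact_regular[OF x_carrier zeroideal])
    \<comment> \<open>The exponent is Suc n because \<open>weakly_regular_pows\<close> is stated for
      positive exponents.\<close>
    show "weakly_regular {\<zero>} (map (\<lambda>z. z [^] Suc n) ys)"
      by (intro weakly_regular_pows zeroideal yc weakly_regular_of_regular_sequence ys(3))
    show "d \<le> 0 + length (map (\<lambda>z. z [^] Suc n) ys)" using ys(1) by simp
    fix z assume "z \<in> set (map (\<lambda>z. z [^] Suc n) ys)"
    then obtain y where y: "y \<in> set ys" "z = y [^] Suc n" by auto
    then have "z \<in> gen_ideal x {..<d}"
      using ideal_pow_mono[OF gen_ideal_sub[OF xG dim0 order_refl] _ n[OF y(1)], of "Suc n"] yc by auto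
    then show "null_homotopic x d z" by (rule null_homotopic_gen_ideal)
  qed
qed

text \<open>The first Koszul homology of the subfamily indexed by T vanishes in every degree N.
  Degrees are recorded because elements are removed from the family by induction on N.\<close>

definition koszul_relations :: "nat set \<Rightarrow> bool" where
  "koszul_relations T \<longleftrightarrow> (\<forall>N m. (\<forall>l\<in>T. m l \<in> Gz (N - int (a l))) \<longrightarrow> (\<Oplus>l\<in>T. x l \<otimes> m l) = \<zero> \<longrightarrow>
     (\<exists>b. (\<forall>l\<in>T. \<forall>j\<in>T. b l j \<in> Gz (N - int (a l) - int (a j))) \<and>
        (\<forall>l\<in>T. \<forall>j\<in>T. l \<noteq> j \<longrightarrow> b l j = \<ominus> b j l) \<and>
        (\<forall>l\<in>T. m l = (\<Oplus>j\<in>T - {l}. x j \<otimes> b l j))))"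

lemma koszul_relationsE:
  assumes "koszul_relations T" "\<forall>l\<in>T. m l \<in> Gz (N - int (a l))" "(\<Oplus>l\<in>T. x l \<otimes> m l) = \<zero>"
  obtains b where "\<forall>l\<in>T. \<forall>j\<in>T. b l j \<in> Gz (N - int (a l) - int (a j))"
    "\<forall>l\<in>T. \<forall>j\<in>T. l \<noteq> j \<longrightarrow> b l j = \<ominus> b j l"
    "\<forall>l\<in>T. m l = (\<Oplus>j\<in>T - {l}. x j \<otimes> b l j)"
  using assms(1)[unfolded koszul_relations_def, rule_format, of m N] assms(2,3) by blast

text \<open>Replacing each entry of the antisymmetric matrix by its component in degree N - a_l -
  a_j keeps it antisymmetric, as that degree is symmetric in l and j.\<close>

lemma koszul_relations_all: "koszul_relations {..<d}"
  unfolding koszul_relations_def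
proof (intro allI impI)
  fix N m assume m: "\<forall>l\<in>{..<d}. m l \<in> Gz (N - int (a l))" and rel: "(\<Oplus>l\<in>{..<d}. x l \<otimes> m l) = \<zero>"
  have mc: "m l \<in> carrier R" if "l < d" for l using m that Gz_carrier by blast
  obtain b where b: "\<And>l j. b l j \<in> carrier R" "\<And>l j. l \<noteq> j \<Longrightarrow> b l j = \<ominus> b j l"
    "\<And>l. l < d \<Longrightarrow> m l = (\<Oplus>j\<in>{..<d} - {l}. x j \<otimes> b l j)"
    using relations_are_koszul[OF x_carrier koszul_exact_zero mc rel] by blast
  define b' where "b' l j = cz (N - int (a l) - int (a j)) (b l j)" for l j
  have "b' l j = \<ominus> b' j l" if "l \<noteq> j" for l j
  proof -
    have "b' l j = cz (N - int (a l) - int (a j)) (\<ominus> b j l)" unfolding b'_def using b(2)[OF that] by simp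
    also have "\<dots> = \<ominus> b' j l" unfolding b'_def cz_neg[OF b(1)] by (simp add: algebra_simps)
    finally show ?thesis .
  qed
  moreover have "m l = (\<Oplus>j\<in>{..<d} - {l}. x j \<otimes> b' l j)" if l: "l < d" for l
  proof -
    have "m l = cz (N - int (a l)) (m l)" using cz_homogeneous[of "m l" "N - int (a l)"] m l by simp
    also have "\<dots> = (\<Oplus>j\<in>{..<d} - {l}. cz (N - int (a l)) (x j \<otimes> b l j))"
      using arg_cong[OF b(3)[OF l], of "cz (N - int (a l))"] cz_finsum[of "\<lambda>j. x j \<otimes> b l j" "{..<d} - {l}" "N - int (a l)"] b(1) x_carrier
      by (simp add: Pi_iff)
    also have "\<dots> = (\<Oplus>j\<in>{..<d} - {l}. x j \<otimes> b' l j)"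
      unfolding b'_def using b(1) x_carrier xG
      by (intro finsum_cong') (auto intro!: cz_mult)
    finally show ?thesis .
  qed
  moreover have "b' l j \<in> Gz (N - int (a l) - int (a j))" for l j unfolding b'_def by (intro cz_in b)
  ultimately show "\<exists>b. (\<forall>l\<in>{..<d}. \<forall>j\<in>{..<d}. b l j \<in> Gz (N - int (a l) - int (a j))) \<and>
        (\<forall>l\<in>{..<d}. \<forall>j\<in>{..<d}. l \<noteq> j \<longrightarrow> b l j = \<ominus> b j l) \<and>
        (\<forall>l\<in>{..<d}. m l = (\<Oplus>j\<in>{..<d} - {l}. x j \<otimes> b l j))" by blast
qed

text \<open>Dropping \<open>x\<^sub>t\<close> from the list: a relation on the remaining elements is, up to Koszul relations, \<open>x\<^sub>t\<close>
  times a relation of smaller degree, so induction on the degree applies.\<close>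

lemma koszul_relations_remove:
  assumes ins: "koszul_relations (insert t T)" and t: "t \<notin> T" "insert t T \<subseteq> {..<d}" and apos: "0 < a t"
  shows "koszul_relations T"
proof -
  have fT: "finite T" and td: "t < d" using t(2) finite_subset[of T] by auto
  have xT: "x l \<in> carrier R" if "l \<in> insert t T" for l using that t(2) x_carrier by auto
  define concl where "concl N m \<longleftrightarrow> (\<exists>b. (\<forall>l\<in>T. \<forall>j\<in>T. b l j \<in> Gz (N - int (a l) - int (a j))) \<and>
        (\<forall>l\<in>T. \<forall>j\<in>T. l \<noteq> j \<longrightarrow> b l j = \<ominus> b j l) \<and>
        (\<forall>l\<in>T. m l = (\<Oplus>j\<in>T - {l}. x j \<otimes> b l j)))" for N m
  have zero: "concl N m" if m: "\<And>l. l \<in> T \<Longrightarrow> m l \<in> Gz (N - int (a l))" and "N < 0" for N m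
  proof -
    have "m l = (\<Oplus>j\<in>T - {l}. x j \<otimes> \<zero>)" if "l \<in> T" for l
    proof -
      have "(\<Oplus>j\<in>T - {l}. x j \<otimes> \<zero>) = \<zero>" using xT by (intro add.finprod_one_eqI) auto
      moreover have "m l = \<zero>" using m[OF that] Gz_neg[of "N - int (a l)"] \<open>N < 0\<close> by auto
      ultimately show ?thesis by simp
    qed
    then show ?thesis unfolding concl_def by (intro exI[of _ "\<lambda>_ _. \<zero>"]) auto
  qed
  have main: "concl (int N) m" if "\<And>l. l \<in> T \<Longrightarrow> m l \<in> Gz (int N - int (a l))" "(\<Oplus>l\<in>T. x l \<otimes> m l) = \<zero>" for N :: nat and m
    using that
  proof (induction N arbitrary: m rule: less_induct)
    case (less N)
    \<comment> \<open>The relation over T is read as one over the larger family with coefficient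
      zero at t.\<close>
    define m0 where "m0 = m(t := \<zero>)"
    have mc: "m l \<in> carrier R" if "l \<in> T" for l using less.prems(1)[OF that] Gz_carrier by blast
    have m0: "\<forall>l\<in>insert t T. m0 l \<in> Gz (int N - int (a l))" using less.prems(1) by (auto simp: m0_def)
    have m0c: "m0 l \<in> carrier R" if "l \<in> insert t T" for l using m0 that Gz_carrier by blast
    have "(\<Oplus>l\<in>insert t T. x l \<otimes> m0 l) = x t \<otimes> m0 t \<oplus> (\<Oplus>l\<in>T. x l \<otimes> m0 l)"
      using fT t xT m0c by (intro finsum_insert) auto
    also have "(\<Oplus>l\<in>T. x l \<otimes> m0 l) = (\<Oplus>l\<in>T. x l \<otimes> m l)"
      using t xT mc by (intro finsum_cong') (auto simp: m0_def)
    finally have rel0: "(\<Oplus>l\<in>insert t T. x l \<otimes> m0 l) = \<zero>" using less.prems(2) xT by (simp add: m0_def)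
    obtain b where b: "\<forall>l\<in>insert t T. \<forall>j\<in>insert t T. b l j \<in> Gz (int N - int (a l) - int (a j))"
      "\<forall>l\<in>insert t T. \<forall>j\<in>insert t T. l \<noteq> j \<longrightarrow> b l j = \<ominus> b j l"
      "\<forall>l\<in>insert t T. m0 l = (\<Oplus>j\<in>insert t T - {l}. x j \<otimes> b l j)"
      by (rule koszul_relationsE[OF ins m0 rel0])
    have bc: "b l j \<in> carrier R" if "l \<in> insert t T" "j \<in> insert t T" for l j
      using b(1) that Gz_carrier by blast
    have ml: "m l = x t \<otimes> b l t \<oplus> (\<Oplus>j\<in>T - {l}. x j \<otimes> b l j)" if l: "l \<in> T" for l
    proof -
      have "l \<noteq> t" using l t by auto
      then have "insert t T - {l} = insert t (T - {l})" by auto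
      then have "m0 l = (\<Oplus>j\<in>insert t (T - {l}). x j \<otimes> b l j)" using b(3) l by simp
      also have "\<dots> = x t \<otimes> b l t \<oplus> (\<Oplus>j\<in>T - {l}. x j \<otimes> b l j)"
        using fT t xT bc l by (intro finsum_insert) auto
      finally show ?thesis using \<open>l \<noteq> t\<close> by (simp add: m0_def)
    qed
    \<comment> \<open>The coefficient at t is zero, so row t of b is a relation over T; by
      antisymmetry so is column t, and its degree is N - a_t.\<close>
    have "(\<Oplus>l\<in>T. x l \<otimes> b l t) = (\<Oplus>l\<in>T. \<ominus> (x l \<otimes> b t l))"
    proof (intro finsum_cong')
      fix l assume l: "l \<in> T"
      then have "b l t = \<ominus> b t l" using b(2) t by auto
      then show "x l \<otimes> b l t = \<ominus> (x l \<otimes> b t l)" using l xT bc by (simp add: r_minus)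
    qed (use xT bc in auto)
    also have "\<dots> = (\<Oplus>l\<in>T. (\<ominus> \<one>) \<otimes> (x l \<otimes> b t l))"
      using xT bc by (intro finsum_cong') (auto simp: l_minus)
    also have "\<dots> = (\<ominus> \<one>) \<otimes> (\<Oplus>l\<in>T. x l \<otimes> b t l)"
      using xT bc fT by (intro finsum_rdistr[symmetric]) auto
    also have "(\<Oplus>l\<in>T. x l \<otimes> b t l) = \<zero>"
    proof -
      have "insert t T - {t} = T" using t by auto
      then show ?thesis using b(3) by (simp add: m0_def)
    qed
    finally have rel': "(\<Oplus>l\<in>T. x l \<otimes> b l t) = \<zero>" by simp
    have deg': "b l t \<in> Gz ((int N - int (a t)) - int (a l))" if "l \<in> T" for l
    proof -
      have "b l t \<in> Gz (int N - int (a l) - int (a t))" using b(1) that by blast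
      moreover have "int N - int (a l) - int (a t) = (int N - int (a t)) - int (a l)" by simp
      ultimately show ?thesis by metis
    qed
    \<comment> \<open>Positivity of a_t makes the degree drop; if it becomes negative, all
      coefficients are zero.\<close>
    have "concl (int N - int (a t)) (\<lambda>l. b l t)"
    proof (cases "a t \<le> N")
      case True
      then have eq: "int N - int (a t) = int (N - a t)" by simp
      show ?thesis unfolding eq
        using True apos deg' rel' unfolding eq by (intro less.IH) auto
    next
      case False
      then show ?thesis using deg' by (intro zero) auto
    qed
    then obtain c where c: "\<And>l j. l \<in> T \<Longrightarrow> j \<in> T \<Longrightarrow> c l j \<in> Gz ((int N - int (a t)) - int (a l) - int (a j))"
      "\<And>l j. l \<in> T \<Longrightarrow> j \<in> T \<Longrightarrow> l \<noteq> j \<Longrightarrow> c l j = \<ominus> c j l"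
      "\<And>l. l \<in> T \<Longrightarrow> b l t = (\<Oplus>j\<in>T - {l}. x j \<otimes> c l j)"
      unfolding concl_def by blast
    have cc: "c l j \<in> carrier R" if "l \<in> T" "j \<in> T" for l j using c(1)[OF that] Gz_carrier by blast
    \<comment> \<open>Substituting the Koszul expression of b l t into that of m l moves the terms
      with x_t into the matrix b + x_t c.\<close>
    show "concl (int N) m"
      unfolding concl_def
    proof (intro exI[of _ "\<lambda>l j. b l j \<oplus> x t \<otimes> c l j"] conjI ballI impI)
      fix l j assume lj: "l \<in> T" "j \<in> T"
      have "x t \<otimes> c l j \<in> Gz (int (a t) + ((int N - int (a t)) - int (a l) - int (a j)))"
        using xG[OF td] c(1)[OF lj] by (intro Gz_mult) auto
      moreover have "int (a t) + ((int N - int (a t)) - int (a l) - int (a j)) = int N - int (a l) - int (a j)" by simp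
      ultimately have "x t \<otimes> c l j \<in> Gz (int N - int (a l) - int (a j))" by metis
      then show "b l j \<oplus> x t \<otimes> c l j \<in> Gz (int N - int (a l) - int (a j))"
        using b(1) lj by (intro Gz_add) auto
      assume "l \<noteq> j"
      then have "b l j = \<ominus> b j l" "c l j = \<ominus> c j l" using b(2) c(2)[OF lj] lj by blast+
      then show "b l j \<oplus> x t \<otimes> c l j = \<ominus> (b j l \<oplus> x t \<otimes> c j l)"
        using bc[of j l] cc[of j l] lj xT[of t] by (simp add: minus_add r_minus)
    next
      fix l assume l: "l \<in> T"
      have "x t \<otimes> b l t = (\<Oplus>j\<in>T - {l}. x t \<otimes> (x j \<otimes> c l j))"
        unfolding c(3)[OF l] using xT cc l fT by (intro finsum_rdistr) auto
      then have "m l = (\<Oplus>j\<in>T - {l}. x t \<otimes> (x j \<otimes> c l j)) \<oplus> (\<Oplus>j\<in>T - {l}. x j \<otimes> b l j)"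
        using ml[OF l] by simp
      also have "\<dots> = (\<Oplus>j\<in>T - {l}. x t \<otimes> (x j \<otimes> c l j) \<oplus> x j \<otimes> b l j)"
        using xT cc bc l by (intro finsum_addf[symmetric]) auto
      also have "\<dots> = (\<Oplus>j\<in>T - {l}. x j \<otimes> (b l j \<oplus> x t \<otimes> c l j))"
      proof (intro finsum_cong')
        fix j assume j: "j \<in> T - {l}"
        have "x t \<in> carrier R" "x j \<in> carrier R" "c l j \<in> carrier R" "b l j \<in> carrier R"
          using xT cc bc l j by auto
        then show "x t \<otimes> (x j \<otimes> c l j) \<oplus> x j \<otimes> b l j = x j \<otimes> (b l j \<oplus> x t \<otimes> c l j)"
          by (simp add: r_distr m_lcomm a_comm)
      qed (use xT cc bc l in auto)
      finally show "m l = (\<Oplus>j\<in>T - {l}. x j \<otimes> (b l j \<oplus> x t \<otimes> c l j))" .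
    qed
  qed
  show ?thesis
    unfolding koszul_relations_def
  proof (intro allI impI)
    fix N m assume m: "\<forall>l\<in>T. m l \<in> Gz (N - int (a l))" and rel: "(\<Oplus>l\<in>T. x l \<otimes> m l) = \<zero>"
    have "concl N m"
    proof (cases "0 \<le> N")
      case True
      then show ?thesis using main[of m "nat N"] m rel by simp
    next
      case False
      then show ?thesis using m by (intro zero) auto
    qed
    then show "\<exists>b. (\<forall>l\<in>T. \<forall>j\<in>T. b l j \<in> Gz (N - int (a l) - int (a j))) \<and>
        (\<forall>l\<in>T. \<forall>j\<in>T. l \<noteq> j \<longrightarrow> b l j = \<ominus> b j l) \<and>
        (\<forall>l\<in>T. m l = (\<Oplus>j\<in>T - {l}. x j \<otimes> b l j))" unfolding concl_def .
  qed
qed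

lemma koszul_relations_subset:
  assumes "\<And>j. j < d \<Longrightarrow> 0 < a j" "T \<subseteq> {..<d}"
  shows "koszul_relations T"
proof -
  have "koszul_relations ({..<d} - B)" if "finite B" "B \<subseteq> {..<d}" for B
    using that
  proof (induction B rule: finite_induct)
    case empty
    then show ?case using koszul_relations_all by simp
  next
    case (insert t B)
    have "insert t ({..<d} - insert t B) = {..<d} - B" using insert by auto
    with insert have "koszul_relations (insert t ({..<d} - insert t B))" by simp
    then show ?case by (rule koszul_relations_remove) (use insert assms(1) in auto)
  qed
  from this[of "{..<d} - T"] show ?thesis using assms(2) by (simp add: double_diff)
qed

text \<open>That x_t r lies in (x_l : l in T) is a relation over T with t added whose coefficient at
  t is r, and in a Koszul relation this coefficient lies in (x_l : l in T). The argument is carried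
  out for each component of r.\<close>

theorem sop_permutably_regular:
  assumes apos: "\<And>j. j < d \<Longrightarrow> 0 < a j" and T: "T \<subseteq> {..<d}" "t < d" "t \<notin> T"
    and r: "r \<in> carrier R" "x t \<otimes> r \<in> gen_ideal x T"
  shows "r \<in> gen_ideal x T"
proof (rule mem_of_cz[OF gen_ideal_sub[OF xG dim0 T(1)] r(1)])
  fix i :: nat
  have fT: "finite T" using T(1) finite_subset by blast
  have xT: "x l \<in> Gz (int (a l))" if "l \<in> T" for l using that T(1) xG by auto
  have xTc: "x l \<in> carrier R" if "l \<in> insert t T" for l using that T x_carrier by auto
  \<comment> \<open>The degree of the relation whose coefficient at t is the component of r in
    degree i.\<close>
  define N where "N = int i + int (a t)"
  obtain s where s: "\<forall>l\<in>T. s l \<in> Gz (N - int (a l))" "cz N (x t \<otimes> r) = (\<Oplus>l\<in>T. x l \<otimes> s l)"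
    using cz_gen_ideal[where i = N, OF xT r(2)] by blast
  have sc: "s l \<in> carrier R" if "l \<in> T" for l using s(1) that Gz_carrier by blast
  have "cz N (x t \<otimes> r) = x t \<otimes> cz (int i) r"
    using cz_mult[of "x t" "int (a t)" r N] xG[OF T(2)] r(1) by (simp add: N_def)
  with s(2) have eq: "x t \<otimes> cz (int i) r = (\<Oplus>l\<in>T. x l \<otimes> s l)" by simp
  define m where "m l = (if l = t then cz (int i) r else \<ominus> s l)" for l
  have mdeg: "\<forall>l\<in>insert t T. m l \<in> Gz (N - int (a l))"
    using s(1) cz_in[OF r(1), of "int i"] by (auto simp: m_def N_def Gz_neg_closed simp del: Gz_nat)
  have mc: "m l \<in> carrier R" if "l \<in> insert t T" for l using mdeg that Gz_carrier by blast
  have "(\<Oplus>l\<in>insert t T. x l \<otimes> m l) = x t \<otimes> m t \<oplus> (\<Oplus>l\<in>T. x l \<otimes> m l)"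
    using fT T(3) xTc mc by (intro finsum_insert) auto
  also have "(\<Oplus>l\<in>T. x l \<otimes> m l) = (\<Oplus>l\<in>T. (\<ominus> \<one>) \<otimes> (x l \<otimes> s l))"
    using T(3) xTc sc by (intro finsum_cong') (auto simp: m_def l_minus r_minus)
  also have "\<dots> = (\<ominus> \<one>) \<otimes> (\<Oplus>l\<in>T. x l \<otimes> s l)"
    using xTc sc fT by (intro finsum_rdistr[symmetric]) auto
  also have "x t \<otimes> m t \<oplus> (\<ominus> \<one>) \<otimes> (\<Oplus>l\<in>T. x l \<otimes> s l) = \<zero>"
  proof -
    have "(\<Oplus>l\<in>T. x l \<otimes> s l) \<in> carrier R" using xTc sc by (intro finsum_closed) auto
    then show ?thesis using eq by (simp add: m_def l_minus r_neg)
  qed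
  finally have rel: "(\<Oplus>l\<in>insert t T. x l \<otimes> m l) = \<zero>" .
  have kr: "koszul_relations (insert t T)"
    using T by (intro koszul_relations_subset apos) auto
  obtain b where b: "\<forall>l\<in>insert t T. \<forall>j\<in>insert t T. b l j \<in> Gz (N - int (a l) - int (a j))"
    "\<forall>l\<in>insert t T. m l = (\<Oplus>j\<in>insert t T - {l}. x j \<otimes> b l j)"
    by (rule koszul_relationsE[OF kr mdeg rel])
  have "insert t T - {t} = T" using T(3) by auto
  then have "cz (int i) r = (\<Oplus>j\<in>T. x j \<otimes> b t j)" using b(2) by (simp add: m_def)
  moreover have "b t \<in> T \<rightarrow> carrier R" using b(1) Gz_carrier by blast
  ultimately show "cz (int i) r \<in> gen_ideal x T" unfolding gen_ideal_def by blast
qed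

end

end

section \<open>Syzygies\<close>

lemma (in abelian_group) add_diff_cancel_left':
  assumes "a \<in> carrier G" "b \<in> carrier G"
  shows "(a \<oplus> b) \<ominus> a = b"
proof -
  have "(a \<oplus> b) \<ominus> a = (b \<oplus> a) \<oplus> \<ominus> a" using assms by (simp add: a_minus_def a_comm)
  then show ?thesis using assms by (simp add: a_assoc r_neg)
qed

locale module_homomorphism = M: module R M + N: module R N
  for R :: "('a, 'r) ring_scheme" and M :: "('a, 'b, 'm) module_scheme"
    and N :: "('a, 'c, 'n) module_scheme" +
  fixes h
  assumes hom: "h \<in> module_hom R M N"
begin

lemma closed [simp]: "v \<in> carrier M \<Longrightarrow> h v \<in> carrier N"
  using hom unfolding module_hom_def by blast

lemma add: "v \<in> carrier M \<Longrightarrow> w \<in> carrier M \<Longrightarrow> h (v \<oplus>\<^bsub>M\<^esub> w) = h v \<oplus>\<^bsub>N\<^esub> h w"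
  using hom unfolding module_hom_def by blast

lemma smult: "r \<in> carrier R \<Longrightarrow> v \<in> carrier M \<Longrightarrow> h (r \<odot>\<^bsub>M\<^esub> v) = r \<odot>\<^bsub>N\<^esub> h v"
  using hom unfolding module_hom_def by blast

lemma zero [simp]: "h \<zero>\<^bsub>M\<^esub> = \<zero>\<^bsub>N\<^esub>"
  using smult[of "\<zero>\<^bsub>R\<^esub>" "\<zero>\<^bsub>M\<^esub>"] by simp

lemma neg: "v \<in> carrier M \<Longrightarrow> h (\<ominus>\<^bsub>M\<^esub> v) = \<ominus>\<^bsub>N\<^esub> h v"
  using smult[of "\<ominus>\<^bsub>R\<^esub> \<one>\<^bsub>R\<^esub>" v] by (simp add: M.smult_l_minus N.smult_l_minus)

lemma diff: "v \<in> carrier M \<Longrightarrow> w \<in> carrier M \<Longrightarrow> h (v \<ominus>\<^bsub>M\<^esub> w) = h v \<ominus>\<^bsub>N\<^esub> h w"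
  by (simp add: a_minus_def add neg)

lemma finsum:
  assumes "f \<in> A \<rightarrow> carrier M"
  shows "h (\<Oplus>\<^bsub>M\<^esub>i\<in>A. f i) = (\<Oplus>\<^bsub>N\<^esub>i\<in>A. h (f i))"
  using assms
  by (induction A rule: infinite_finite_induct) (auto simp: add Pi_def)

lemma preimage_submodule:
  assumes W: "submodule W R N"
  shows "submodule {v \<in> carrier M. h v \<in> W} R M"
  by (rule M.submoduleI) (auto simp: add smult neg N.submod[OF W])

lemma image_submodule:
  assumes V: "submodule V R M"
  shows "submodule (h ` V) R N"
proof (rule N.submoduleI)
  note c = M.submod_carrier[OF V]
  show "h ` V \<subseteq> carrier N" using c by auto
  show "\<zero>\<^bsub>N\<^esub> \<in> h ` V" using M.submod_zero[OF V] zero by (metis imageI)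
  show "\<ominus>\<^bsub>N\<^esub> a \<in> h ` V" if "a \<in> h ` V" for a
    using that c M.submod(4)[OF V] by (auto simp: neg[symmetric])
  show "a \<oplus>\<^bsub>N\<^esub> b \<in> h ` V" if "a \<in> h ` V" "b \<in> h ` V" for a b
    using that c M.submod(6)[OF V] by (auto simp: add[symmetric])
  show "r \<odot>\<^bsub>N\<^esub> a \<in> h ` V" if "r \<in> carrier R" "a \<in> h ` V" for r a
    using that c M.submod(5)[OF V] by (auto simp: smult[symmetric])
qed

lemma comb_image:
  assumes W: "W \<subseteq> carrier M" and x: "x \<in> T \<rightarrow> carrier R"
  shows "h ` comb M x T W = comb N x T (h ` W)"
proof (intro equalityI subsetI)
  have eq: "h (\<Oplus>\<^bsub>M\<^esub>t\<in>T. x t \<odot>\<^bsub>M\<^esub> w t) = (\<Oplus>\<^bsub>N\<^esub>t\<in>T. x t \<odot>\<^bsub>N\<^esub> h (w t))" if w: "w \<in> T \<rightarrow> W" for w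
  proof -
    have c: "w t \<in> carrier M" "x t \<in> carrier R" if "t \<in> T" for t using w W x that by auto
    have "h (\<Oplus>\<^bsub>M\<^esub>t\<in>T. x t \<odot>\<^bsub>M\<^esub> w t) = (\<Oplus>\<^bsub>N\<^esub>t\<in>T. h (x t \<odot>\<^bsub>M\<^esub> w t))"
      using c by (intro finsum) auto
    also have "\<dots> = (\<Oplus>\<^bsub>N\<^esub>t\<in>T. x t \<odot>\<^bsub>N\<^esub> h (w t))"
      using c by (intro N.M.finsum_cong') (auto simp: smult)
    finally show ?thesis .
  qed
  {
    fix v assume "v \<in> h ` comb M x T W"
    then obtain w where w: "w \<in> T \<rightarrow> W" "v = h (\<Oplus>\<^bsub>M\<^esub>t\<in>T. x t \<odot>\<^bsub>M\<^esub> w t)" by (auto simp: comb_def)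
    then have "v = (\<Oplus>\<^bsub>N\<^esub>t\<in>T. x t \<odot>\<^bsub>N\<^esub> h (w t))" "(\<lambda>t. h (w t)) \<in> T \<rightarrow> h ` W" using eq by auto
    then show "v \<in> comb N x T (h ` W)"
      unfolding comb_def by (intro CollectI exI[of _ "\<lambda>t. h (w t)"] conjI)
  }
  fix v assume "v \<in> comb N x T (h ` W)"
  then obtain u where u: "u \<in> T \<rightarrow> h ` W" "v = (\<Oplus>\<^bsub>N\<^esub>t\<in>T. x t \<odot>\<^bsub>N\<^esub> u t)" by (auto simp: comb_def)
  then have "\<forall>t\<in>T. \<exists>w\<in>W. u t = h w" by auto
  then obtain w where w: "\<And>t. t \<in> T \<Longrightarrow> w t \<in> W \<and> u t = h (w t)" by metis
  then have wW: "w \<in> T \<rightarrow> W" by auto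
  have "v = (\<Oplus>\<^bsub>N\<^esub>t\<in>T. x t \<odot>\<^bsub>N\<^esub> h (w t))"
    unfolding u(2) using w W x by (intro N.M.finsum_cong') (auto simp: Pi_iff subset_iff)
  with eq[OF wW] have "v = h (\<Oplus>\<^bsub>M\<^esub>t\<in>T. x t \<odot>\<^bsub>M\<^esub> w t)" by simp
  with wW show "v \<in> h ` comb M x T W" unfolding comb_def by blast
qed

end

lemma (in module) mult_hom: "r \<in> carrier R \<Longrightarrow> (\<lambda>v. r \<odot>\<^bsub>M\<^esub> v) \<in> module_hom R M M"
  unfolding module_hom_def by (auto simp: smult_r_distr smult_assoc1[symmetric] R.m_comm)

text \<open>One step of the construction of the Cohen-Macaulay module: \<open>V\<close> represents the module
  \<open>V/U\<close> over \<open>R/(x\<^sub>i, \<dots>, x\<^sub>d\<^sub>-\<^sub>1)\<close>, and \<open>E \<rightarrow> V/U\<close> is a free cover whose kernel is taken over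
  \<open>R/(x\<^sub>i\<^sub>+\<^sub>1, \<dots>, x\<^sub>d\<^sub>-\<^sub>1)\<close>.\<close>

locale syzygy_step = module_homomorphism R E F \<rho>
  for R :: "('a, 'r) ring_scheme" and E :: "('a, 'b, 'm) module_scheme"
    and F :: "('a, 'c, 'n) module_scheme" and \<rho> +
  fixes V :: "'c set" and x :: "nat \<Rightarrow> 'a" and i d :: nat
  assumes V: "submodule V R F"
    and x: "\<And>j. j < d \<Longrightarrow> x j \<in> carrier R" and i: "i < d"
    and image_in: "\<And>w. w \<in> carrier E \<Longrightarrow> \<rho> w \<in> V"
    and base_in: "comb F x {i..<d} (carrier F) \<subseteq> V"
    and surj: "\<And>v. v \<in> V \<Longrightarrow> \<exists>w\<in>carrier E. \<exists>u\<in>comb F x {i..<d} (carrier F). v = \<rho> w \<oplus>\<^bsub>F\<^esub> u"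
    and regular_E: "\<And>T t w. T \<subseteq> {..<d} \<Longrightarrow> t < d \<Longrightarrow> t \<notin> T \<Longrightarrow> w \<in> carrier E \<Longrightarrow>
      x t \<odot>\<^bsub>E\<^esub> w \<in> comb E x T (carrier E) \<Longrightarrow> w \<in> comb E x T (carrier E)"
    and regular_V: "\<And>t v. t < i \<Longrightarrow> v \<in> V \<Longrightarrow>
      x t \<odot>\<^bsub>F\<^esub> v \<in> comb F x {..<t} V <+>\<^bsub>F\<^esub> comb F x {i..<d} (carrier F) \<Longrightarrow>
      v \<in> comb F x {..<t} V <+>\<^bsub>F\<^esub> comb F x {i..<d} (carrier F)"
begin

abbreviation "U \<equiv> comb F x {i..<d} (carrier F)"
text \<open>\<open>W t\<close> is the preimage in F of (x_0, ..., x_(t-1))(V/U). \<open>W' t\<close>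
  plays the same part for V'/U', the kernel of the cover of V/U by E/U'.\<close>

abbreviation "W t \<equiv> comb F x {..<t} V <+>\<^bsub>F\<^esub> U"
definition "V' = {w \<in> carrier E. \<rho> w \<in> U}"
abbreviation "U' \<equiv> comb E x {Suc i..<d} (carrier E)"
abbreviation "W' t \<equiv> comb E x {..<t} V' <+>\<^bsub>E\<^esub> U'"

lemma xT: "T \<subseteq> {..<d} \<Longrightarrow> x \<in> T \<rightarrow> carrier R"
  using x by auto

lemma U: "submodule U R F"
  using x by (intro N.comb_submodule N.carrier_is_submodule) auto

lemma V': "submodule V' R E"
  unfolding V'_def by (rule preimage_submodule[OF U])

lemma V'_carrier: "w \<in> V' \<Longrightarrow> w \<in> carrier E"
  unfolding V'_def by simp

lemma E_comb: "T \<subseteq> {..<d} \<Longrightarrow> submodule (comb E x T (carrier E)) R E"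
  by (intro M.comb_submodule M.carrier_is_submodule xT)

lemma V'_comb: "t \<le> d \<Longrightarrow> submodule (comb E x {..<t} V') R E"
  by (intro M.comb_submodule V' xT) auto

lemma U': "submodule U' R E"
  using i by (intro E_comb) auto

lemma W: "t \<le> d \<Longrightarrow> submodule (W t) R F"
  by (intro N.submod_sum N.comb_submodule V U xT) auto

lemma W': "t \<le> d \<Longrightarrow> submodule (W' t) R E"
  by (intro M.submod_sum V'_comb U')

lemma smult_U: "s < d \<Longrightarrow> i \<le> s \<Longrightarrow> v \<in> carrier F \<Longrightarrow> x s \<odot>\<^bsub>F\<^esub> v \<in> U"
  by (intro N.comb_gen N.carrier_is_submodule xT) auto

text \<open>x_i annihilates F/U, so multiples of x_i in E lie in the kernel; the distinguished
  element of the next module arises in this way.\<close>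

lemma smult_V': "w \<in> carrier E \<Longrightarrow> x i \<odot>\<^bsub>E\<^esub> w \<in> V'"
  unfolding V'_def using i x by (auto simp: smult smult_U)

lemma U'_V': "U' \<subseteq> V'"
  using i x by (intro M.comb_subset V') (auto simp: V'_def smult smult_U)

lemma image_comb:
  assumes t: "t \<le> i" and w: "w \<in> comb E x ({..<t} \<union> {Suc i..<d}) (carrier E)"
  shows "\<rho> w \<in> W t"
proof -
  have td: "t \<le> d" using t i by simp
  have "comb E x ({..<t} \<union> {Suc i..<d}) (carrier E) \<subseteq> {w \<in> carrier E. \<rho> w \<in> W t}"
  proof (rule M.comb_subset[OF preimage_submodule[OF W[OF td]]])
    fix s v assume s: "s \<in> {..<t} \<union> {Suc i..<d}" and v: "v \<in> carrier E"
    have sd: "s < d" using s t i by auto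
    have sub: "submodule (comb F x {..<t} V) R F" using td by (intro N.comb_submodule V xT) auto
    have "x s \<odot>\<^bsub>F\<^esub> \<rho> v \<in> W t"
    proof (cases "s < t")
      case True
      then have "x s \<odot>\<^bsub>F\<^esub> \<rho> v \<in> comb F x {..<t} V"
        using td v by (intro N.comb_gen V xT image_in) auto
      then show ?thesis using N.submod_sum_left[OF sub U] by blast
    next
      case False
      then have "x s \<odot>\<^bsub>F\<^esub> \<rho> v \<in> U" using s sd v by (intro smult_U) auto
      then show ?thesis using N.submod_sum_right[OF sub U] by blast
    qed
    then show "x s \<odot>\<^bsub>E\<^esub> v \<in> {w \<in> carrier E. \<rho> w \<in> W t}"
      using sd v x by (simp add: smult)
  qed
  with w show ?thesis by blast
qed

text \<open>V is the image of E plus U, so combinations of x_0, ..., x_(t-1) with coefficients in V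
  lift to E up to an element of U.\<close>

lemma lift:
  assumes t: "t \<le> i" and v: "v \<in> W t"
  shows "\<exists>y\<in>comb E x {..<t} (carrier E). \<exists>u\<in>U. v = \<rho> y \<oplus>\<^bsub>F\<^esub> u"
proof -
  have td: "{..<t} \<subseteq> {..<d}" using t i by auto
  note im = image_submodule[OF E_comb[OF td]]
  have "comb F x {..<t} V \<subseteq> \<rho> ` comb E x {..<t} (carrier E) <+>\<^bsub>F\<^esub> U"
  proof (rule N.comb_subset[OF N.submod_sum[OF im U]])
    fix s v assume s: "s \<in> {..<t}" and "v \<in> V"
    then obtain w u where w: "w \<in> carrier E" "u \<in> U" "v = \<rho> w \<oplus>\<^bsub>F\<^esub> u" using surj by blast
    have xs: "x s \<in> carrier R" using s td x by auto
    have "x s \<odot>\<^bsub>F\<^esub> v = \<rho> (x s \<odot>\<^bsub>E\<^esub> w) \<oplus>\<^bsub>F\<^esub> x s \<odot>\<^bsub>F\<^esub> u"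
      unfolding w(3) using w(1) xs N.submod_carrier[OF U w(2)] by (simp add: N.smult_r_distr smult)
    moreover have "x s \<odot>\<^bsub>E\<^esub> w \<in> comb E x {..<t} (carrier E)"
      using s w(1) td by (intro M.comb_gen M.carrier_is_submodule xT) auto
    moreover have "x s \<odot>\<^bsub>F\<^esub> u \<in> U" using N.submod(5)[OF U xs w(2)] .
    ultimately show "x s \<odot>\<^bsub>F\<^esub> v \<in> \<rho> ` comb E x {..<t} (carrier E) <+>\<^bsub>F\<^esub> U"
      unfolding N.submod_sum_eq by blast
  qed
  moreover have "U \<subseteq> \<rho> ` comb E x {..<t} (carrier E) <+>\<^bsub>F\<^esub> U"
    by (rule N.submod_sum_right[OF im U])
  ultimately have "W t \<subseteq> \<rho> ` comb E x {..<t} (carrier E) <+>\<^bsub>F\<^esub> U"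
    by (intro N.submod_sum_least N.submod_sum[OF im U])
  with v show ?thesis unfolding N.submod_sum_eq by blast
qed

text \<open>Since x_0, ..., x_(t-1) is regular on V/U, the sequence 0 -> V'/U' -> E/U' -> V/U -> 0
  stays exact modulo these elements. By induction on t: if x_t q + w1 lies in V', regularity puts
  the image of q into W t, and lifting it writes q as an element of V' plus a combination of earlier
  parameters.\<close>

lemma comb_Int_V':
  assumes "t \<le> i" "w \<in> V'" "w \<in> comb E x ({..<t} \<union> {Suc i..<d}) (carrier E)"
  shows "w \<in> W' t"
  using assms
proof (induction t arbitrary: w)
  case 0
  then have "w \<in> U'" by simp
  then show ?case using M.submod_sum_right[OF V'_comb U'] by blast
next
  case (Suc t)
  define B where "B = {..<t} \<union> {Suc i..<d}"
  have t: "t < i" "t < d" "t \<le> i" "t \<le> d" using Suc.prems(1) i by auto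
  have B: "finite B" "t \<notin> B" "B \<subseteq> {..<d}" "{..<Suc t} \<union> {Suc i..<d} = insert t B" "insert t B \<subseteq> {..<d}"
    using t unfolding B_def by auto
  obtain q w1 where q: "q \<in> carrier E" "w1 \<in> comb E x B (carrier E)" "w = x t \<odot>\<^bsub>E\<^esub> q \<oplus>\<^bsub>E\<^esub> w1"
    using Suc.prems(3) unfolding B(4) M.comb_insert[OF B(1,2) xT[OF B(5)] order_refl] by blast
  have xt: "x t \<in> carrier R" using x t by blast
  have w1c: "w1 \<in> carrier E" using M.submod_carrier[OF E_comb[OF B(3)] q(2)] .
  have r1: "\<rho> w1 \<in> W t" using image_comb[OF t(3)] q(2) unfolding B_def by blast
  have "\<rho> w \<in> W t"
    using Suc.prems(2) N.submod_sum_right[OF N.comb_submodule[OF V xT] U, of "{..<t}"] t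
    unfolding V'_def by auto
  then have "\<rho> w \<ominus>\<^bsub>F\<^esub> \<rho> w1 \<in> W t" using r1 by (intro N.submod(3)[OF W[OF t(4)]])
  also have "\<rho> w \<ominus>\<^bsub>F\<^esub> \<rho> w1 = x t \<odot>\<^bsub>F\<^esub> \<rho> q"
    unfolding q(3) using q(1) w1c xt
    by (simp add: add smult a_minus_def N.M.a_assoc N.M.r_neg)
  finally have "\<rho> q \<in> W t" by (rule regular_V[OF t(1) image_in[OF q(1)]])
  then obtain y u where y: "y \<in> comb E x {..<t} (carrier E)" "u \<in> U" "\<rho> q = \<rho> y \<oplus>\<^bsub>F\<^esub> u"
    using lift[OF t(3)] by blast
  have tsub: "{..<t} \<subseteq> {..<d}" using t by auto
  have yc: "y \<in> carrier E" using M.submod_carrier[OF E_comb[OF tsub] y(1)] .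
  have uc: "u \<in> carrier F" using N.submod_carrier[OF U y(2)] .
  have "\<rho> (q \<ominus>\<^bsub>E\<^esub> y) = u"
    using diff[OF q(1) yc] N.M.add_diff_cancel_left'[of "\<rho> y" u] yc uc y(3) by simp
  then have w': "q \<ominus>\<^bsub>E\<^esub> y \<in> V'" unfolding V'_def using q(1) yc y(2) by simp
  \<comment> \<open>What remains after splitting off x_t (q - y). It lies in V' and involves only
    parameters x_s with s < t or s > i, so the induction hypothesis applies.\<close>
  define w2 where "w2 = x t \<odot>\<^bsub>E\<^esub> y \<oplus>\<^bsub>E\<^esub> w1"
  have weq: "w = x t \<odot>\<^bsub>E\<^esub> (q \<ominus>\<^bsub>E\<^esub> y) \<oplus>\<^bsub>E\<^esub> w2"
    unfolding q(3) w2_def using q(1) yc w1c xt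
    by (simp add: a_minus_def M.smult_r_distr M.smult_r_minus M.M.a_assoc M.M.r_neg1)
  have xw': "x t \<odot>\<^bsub>E\<^esub> (q \<ominus>\<^bsub>E\<^esub> y) \<in> comb E x {..<Suc t} V'"
    using t w' by (intro M.comb_gen V' xT) auto
  have xwV: "x t \<odot>\<^bsub>E\<^esub> (q \<ominus>\<^bsub>E\<^esub> y) \<in> V'" using M.submod(5)[OF V' xt w'] .
  have w2c: "w2 \<in> carrier E" unfolding w2_def using yc w1c xt by simp
  have "w2 = w \<ominus>\<^bsub>E\<^esub> x t \<odot>\<^bsub>E\<^esub> (q \<ominus>\<^bsub>E\<^esub> y)"
    unfolding weq using w2c V'_carrier[OF xwV] by (simp add: M.M.add_diff_cancel_left')
  then have "w2 \<in> V'" using M.submod(3)[OF V' Suc.prems(2) xwV] by simp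
  moreover have "w2 \<in> comb E x B (carrier E)"
  proof -
    have "comb E x {..<t} (carrier E) \<subseteq> comb E x B (carrier E)"
      using B by (intro M.comb_mono_index M.carrier_is_submodule xT) (auto simp: B_def)
    then show ?thesis unfolding w2_def
      using y(1) q(2) xt M.submod(5,6)[OF E_comb[OF B(3)]] by blast
  qed
  ultimately have "w2 \<in> W' t" using Suc.IH[OF t(3)] unfolding B_def by blast
  moreover have "W' t \<subseteq> W' (Suc t)"
  proof -
    have "comb E x {..<t} V' \<subseteq> comb E x {..<Suc t} V'"
      using t by (intro M.comb_mono_index V' xT) auto
    then show ?thesis unfolding M.submod_sum_eq by blast
  qed
  moreover have "x t \<odot>\<^bsub>E\<^esub> (q \<ominus>\<^bsub>E\<^esub> y) \<in> W' (Suc t)"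
    using xw' M.submod_sum_left[OF V'_comb U', of "Suc t"] t by auto
  moreover have "submodule (W' (Suc t)) R E" using t by (intro W') auto
  ultimately show ?case unfolding weq using M.submod(6) by blast
qed

lemma W'_comb:
  assumes "t \<le> Suc i"
  shows "W' t \<subseteq> comb E x ({..<t} \<union> {Suc i..<d}) (carrier E)"
proof (rule M.submod_sum_least)
  have sub: "{..<t} \<union> {Suc i..<d} \<subseteq> {..<d}" using assms i by auto
  show "submodule (comb E x ({..<t} \<union> {Suc i..<d}) (carrier E)) R E" by (rule E_comb[OF sub])
  have "comb E x {..<t} V' \<subseteq> comb E x {..<t} (carrier E)"
    using V'_carrier by (intro M.comb_mono) auto
  also have "\<dots> \<subseteq> comb E x ({..<t} \<union> {Suc i..<d}) (carrier E)"
    using sub by (intro M.comb_mono_index M.carrier_is_submodule xT) auto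
  finally show "comb E x {..<t} V' \<subseteq> comb E x ({..<t} \<union> {Suc i..<d}) (carrier E)" .
  show "U' \<subseteq> comb E x ({..<t} \<union> {Suc i..<d}) (carrier E)"
    using sub by (intro M.comb_mono_index M.carrier_is_submodule xT) auto
qed

text \<open>Regularity is borrowed from the free module E, where the parameters are regular in any
  order, and brought back to V' by \<open>comb_Int_V'\<close>. The range now includes t = i: one
  regular element has been gained.\<close>

lemma regular_V':
  assumes t: "t < Suc i" and w: "w \<in> V'" "x t \<odot>\<^bsub>E\<^esub> w \<in> W' t"
  shows "w \<in> W' t"
proof (rule comb_Int_V')
  show "t \<le> i" using t by simp
  show "w \<in> comb E x ({..<t} \<union> {Suc i..<d}) (carrier E)"
  proof (rule regular_E)
    show "x t \<odot>\<^bsub>E\<^esub> w \<in> comb E x ({..<t} \<union> {Suc i..<d}) (carrier E)"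
      using w(2) W'_comb[of t] t by auto
  qed (use t i V'_carrier[OF w(1)] in auto)
qed (rule w)

text \<open>Forwards, x_i cancels in E modulo the other parameters, and applying \<rho> sends the
  part in V' into U. Backwards, r e differs from a combination y of x_0, ..., x_(i-1) by an element
  of V', and x_i y is a combination of the same x_s whose coefficients are multiples of x_i and
  hence lie in V'.\<close>

lemma colon:
  assumes e: "e \<in> carrier E" and r: "r \<in> carrier R"
  shows "r \<odot>\<^bsub>E\<^esub> (x i \<odot>\<^bsub>E\<^esub> e) \<in> W' (Suc i) \<longleftrightarrow> r \<odot>\<^bsub>F\<^esub> \<rho> e \<in> W i"
proof
  have xi: "x i \<in> carrier R" using x i by blast
  have isub: "{..<i} \<subseteq> {..<d}" using i by auto
  have id: "i \<le> d" using i by simp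
  define B where "B = {..<i} \<union> {Suc i..<d}"
  have B: "finite B" "B \<subseteq> {..<d}" "i \<notin> B" "{..<i} \<subseteq> B" "{Suc i..<d} \<subseteq> B" using i unfolding B_def by auto
  have eqr: "r \<odot>\<^bsub>E\<^esub> (x i \<odot>\<^bsub>E\<^esub> e) = x i \<odot>\<^bsub>E\<^esub> (r \<odot>\<^bsub>E\<^esub> e)"
    using xi r e by (simp add: M.smult_assoc1[symmetric] M.R.m_comm)
  {
    assume "r \<odot>\<^bsub>E\<^esub> (x i \<odot>\<^bsub>E\<^esub> e) \<in> W' (Suc i)"
    then obtain z u where z: "z \<in> comb E x {..<Suc i} V'" "u \<in> U'" "x i \<odot>\<^bsub>E\<^esub> (r \<odot>\<^bsub>E\<^esub> e) = z \<oplus>\<^bsub>E\<^esub> u"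
      unfolding eqr unfolding M.submod_sum_eq by blast
    have xI: "x \<in> insert i {..<i} \<rightarrow> carrier R" using i by (intro xT) auto
    obtain w z' where w: "w \<in> V'" "z' \<in> comb E x {..<i} V'" "z = x i \<odot>\<^bsub>E\<^esub> w \<oplus>\<^bsub>E\<^esub> z'"
      using z(1) M.comb_insert[of "{..<i}" i x V', OF _ _ xI] V'_carrier
      unfolding lessThan_Suc by auto
    have cB: "comb E x {..<i} V' \<subseteq> comb E x B (carrier E)" "U' \<subseteq> comb E x B (carrier E)"
    proof -
      have "comb E x {..<i} V' \<subseteq> comb E x {..<i} (carrier E)"
        using V'_carrier by (intro M.comb_mono) auto
      also have "\<dots> \<subseteq> comb E x B (carrier E)"
        using B by (intro M.comb_mono_index M.carrier_is_submodule xT)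
      finally show "comb E x {..<i} V' \<subseteq> comb E x B (carrier E)" .
      show "U' \<subseteq> comb E x B (carrier E)"
        using B by (intro M.comb_mono_index M.carrier_is_submodule xT)
    qed
    have wc: "w \<in> carrier E" using V'_carrier w(1) .
    have sB: "submodule (comb E x B (carrier E)) R E" by (rule E_comb[OF B(2)])
    have zu: "z' \<in> comb E x B (carrier E)" "u \<in> comb E x B (carrier E)" using w(2) z(2) cB by auto
    note zuc = M.submod_carrier[OF sB zu(1)] M.submod_carrier[OF sB zu(2)]
    have "x i \<odot>\<^bsub>E\<^esub> (r \<odot>\<^bsub>E\<^esub> e \<ominus>\<^bsub>E\<^esub> w) = x i \<odot>\<^bsub>E\<^esub> (r \<odot>\<^bsub>E\<^esub> e) \<ominus>\<^bsub>E\<^esub> x i \<odot>\<^bsub>E\<^esub> w"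
      using xi r e wc by (simp add: a_minus_def M.smult_r_distr M.smult_r_minus)
    also have "\<dots> = z' \<oplus>\<^bsub>E\<^esub> u"
      unfolding z(3) w(3) using xi wc zuc M.M.add_diff_cancel_left'[of "x i \<odot>\<^bsub>E\<^esub> w" "z' \<oplus>\<^bsub>E\<^esub> u"]
      by (simp add: M.M.a_assoc)
    also have "\<dots> \<in> comb E x B (carrier E)" using M.submod(6)[OF sB zu] .
    finally have xrw: "x i \<odot>\<^bsub>E\<^esub> (r \<odot>\<^bsub>E\<^esub> e \<ominus>\<^bsub>E\<^esub> w) \<in> comb E x B (carrier E)" .
    have "r \<odot>\<^bsub>E\<^esub> e \<ominus>\<^bsub>E\<^esub> w \<in> comb E x B (carrier E)"
      by (rule regular_E[OF B(2) i B(3) _ xrw]) (use r e wc in simp)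
    then have m: "\<rho> (r \<odot>\<^bsub>E\<^esub> e \<ominus>\<^bsub>E\<^esub> w) \<in> W i" unfolding B_def by (intro image_comb) auto
    have "\<rho> w \<in> W i"
      using w(1) N.submod_sum_right[OF N.comb_submodule[OF V xT[OF isub]] U] unfolding V'_def by blast
    with m have "\<rho> (r \<odot>\<^bsub>E\<^esub> e \<ominus>\<^bsub>E\<^esub> w) \<oplus>\<^bsub>F\<^esub> \<rho> w \<in> W i" by (rule N.submod(6)[OF W[OF id]])
    also have "\<rho> (r \<odot>\<^bsub>E\<^esub> e \<ominus>\<^bsub>E\<^esub> w) \<oplus>\<^bsub>F\<^esub> \<rho> w = r \<odot>\<^bsub>F\<^esub> \<rho> e"
      using r e wc by (simp add: a_minus_def add neg smult N.M.a_assoc N.M.l_neg)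
    finally show "r \<odot>\<^bsub>F\<^esub> \<rho> e \<in> W i" .
  }
  assume "r \<odot>\<^bsub>F\<^esub> \<rho> e \<in> W i"
  then obtain y u where y: "y \<in> comb E x {..<i} (carrier E)" "u \<in> U" "r \<odot>\<^bsub>F\<^esub> \<rho> e = \<rho> y \<oplus>\<^bsub>F\<^esub> u"
    using lift[OF order_refl] by blast
  have yc: "y \<in> carrier E" using M.submod_carrier[OF E_comb[OF isub] y(1)] .
  have uc: "u \<in> carrier F" using N.submod_carrier[OF U y(2)] .
  have "\<rho> (r \<odot>\<^bsub>E\<^esub> e \<ominus>\<^bsub>E\<^esub> y) = u"
    using diff[of "r \<odot>\<^bsub>E\<^esub> e" y] N.M.add_diff_cancel_left'[of "\<rho> y" u] r e yc uc y(3) by (simp add: smult)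
  then have w: "r \<odot>\<^bsub>E\<^esub> e \<ominus>\<^bsub>E\<^esub> y \<in> V'" unfolding V'_def using r e yc y(2) by simp
  interpret m: module_homomorphism R E E "\<lambda>v. x i \<odot>\<^bsub>E\<^esub> v"
    by unfold_locales (rule M.mult_hom[OF xi])
  have iS: "{..<Suc i} \<subseteq> {..<d}" using i by auto
  have sI: "submodule (comb E x {..<Suc i} V') R E" by (intro M.comb_submodule V' xT iS)
  have "comb E x {..<i} (carrier E) \<subseteq> {v \<in> carrier E. x i \<odot>\<^bsub>E\<^esub> v \<in> comb E x {..<Suc i} V'}"
  proof (rule M.comb_subset[OF m.preimage_submodule[OF sI]])
    fix s v assume s: "s \<in> {..<i}" and v: "v \<in> carrier E"
    have xs: "x s \<in> carrier R" using s i x by auto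
    have "x i \<odot>\<^bsub>E\<^esub> (x s \<odot>\<^bsub>E\<^esub> v) = x s \<odot>\<^bsub>E\<^esub> (x i \<odot>\<^bsub>E\<^esub> v)"
      using xi xs v by (simp add: M.smult_assoc1[symmetric] M.R.m_comm)
    moreover have "x s \<odot>\<^bsub>E\<^esub> (x i \<odot>\<^bsub>E\<^esub> v) \<in> comb E x {..<Suc i} V'"
      using s by (intro M.comb_gen V' xT iS smult_V' v) auto
    ultimately show "x s \<odot>\<^bsub>E\<^esub> v \<in> {v \<in> carrier E. x i \<odot>\<^bsub>E\<^esub> v \<in> comb E x {..<Suc i} V'}"
      using xs v by simp
  qed
  then have xy: "x i \<odot>\<^bsub>E\<^esub> y \<in> comb E x {..<Suc i} V'" using y(1) by blast
  have xw: "x i \<odot>\<^bsub>E\<^esub> (r \<odot>\<^bsub>E\<^esub> e \<ominus>\<^bsub>E\<^esub> y) \<in> comb E x {..<Suc i} V'"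
    by (intro M.comb_gen V' xT iS w) auto
  have "x i \<odot>\<^bsub>E\<^esub> (r \<odot>\<^bsub>E\<^esub> e) = x i \<odot>\<^bsub>E\<^esub> (r \<odot>\<^bsub>E\<^esub> e \<ominus>\<^bsub>E\<^esub> y) \<oplus>\<^bsub>E\<^esub> x i \<odot>\<^bsub>E\<^esub> y"
    using xi r e yc by (simp add: a_minus_def M.smult_r_distr M.smult_r_minus M.M.a_assoc M.M.l_neg)
  then have "r \<odot>\<^bsub>E\<^esub> (x i \<odot>\<^bsub>E\<^esub> e) \<in> comb E x {..<Suc i} V'"
    unfolding eqr using M.submod(6)[OF sI xw xy] by simp
  then show "r \<odot>\<^bsub>E\<^esub> (x i \<odot>\<^bsub>E\<^esub> e) \<in> W' (Suc i)"
    using M.submod_sum_left[OF sI U'] by blast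
qed

end

section \<open>Graded free modules\<close>

text \<open>Vectors are functions that vanish from n on, so that equality of vectors is equality of
  functions. The fields \<open>mult\<close> and \<open>one\<close> of the record are placeholders; a
  module uses only the additive part and \<open>smult\<close>.\<close>

definition free_module :: "('a, 'r) ring_scheme \<Rightarrow> nat \<Rightarrow> ('a, nat \<Rightarrow> 'a) module" where
  "free_module R n =
     \<lparr>carrier = {v. (\<forall>l<n. v l \<in> carrier R) \<and> (\<forall>l\<ge>n. v l = \<zero>\<^bsub>R\<^esub>)},
      monoid.mult = (\<lambda>v w. v), one = (\<lambda>l. \<zero>\<^bsub>R\<^esub>), ring.zero = (\<lambda>l. \<zero>\<^bsub>R\<^esub>),
      add = (\<lambda>v w l. v l \<oplus>\<^bsub>R\<^esub> w l), smult = (\<lambda>r v l. r \<otimes>\<^bsub>R\<^esub> v l)\<rparr>"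

definition unit_vector :: "('a, 'r) ring_scheme \<Rightarrow> nat \<Rightarrow> nat \<Rightarrow> 'a" where
  "unit_vector R i l = (if l = i then \<one>\<^bsub>R\<^esub> else \<zero>\<^bsub>R\<^esub>)"

context cring
begin

lemma free_mem: "v \<in> carrier (free_module R n) \<longleftrightarrow> (\<forall>l<n. v l \<in> carrier R) \<and> (\<forall>l\<ge>n. v l = \<zero>)"
  by (simp add: free_module_def)

lemma free_simps [simp]:
  "\<zero>\<^bsub>free_module R n\<^esub> = (\<lambda>l. \<zero>)" "v \<oplus>\<^bsub>free_module R n\<^esub> w = (\<lambda>l. v l \<oplus> w l)"
  "r \<odot>\<^bsub>free_module R n\<^esub> v = (\<lambda>l. r \<otimes> v l)"
  by (simp_all add: free_module_def)

lemma free_coord: "v \<in> carrier (free_module R n) \<Longrightarrow> v l \<in> carrier R"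
  by (cases "l < n") (auto simp: free_mem)

lemma free_module: "module R (free_module R n)"
proof (rule moduleI)
  show "abelian_group (free_module R n)"
  proof (rule abelian_groupI)
    fix v assume v: "v \<in> carrier (free_module R n)"
    then have "(\<lambda>l. \<ominus> v l) \<in> carrier (free_module R n)" by (auto simp: free_mem)
    moreover have "(\<lambda>l. \<ominus> v l) \<oplus>\<^bsub>free_module R n\<^esub> v = \<zero>\<^bsub>free_module R n\<^esub>"
      using free_coord[OF v] by (auto simp: l_neg)
    ultimately show "\<exists>w\<in>carrier (free_module R n). w \<oplus>\<^bsub>free_module R n\<^esub> v = \<zero>\<^bsub>free_module R n\<^esub>" by blast
    show "\<zero>\<^bsub>free_module R n\<^esub> \<oplus>\<^bsub>free_module R n\<^esub> v = v" using free_coord[OF v] by auto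
    fix w assume w: "w \<in> carrier (free_module R n)"
    show "v \<oplus>\<^bsub>free_module R n\<^esub> w \<in> carrier (free_module R n)" using v w by (auto simp: free_mem)
    show "v \<oplus>\<^bsub>free_module R n\<^esub> w = w \<oplus>\<^bsub>free_module R n\<^esub> v"
      using free_coord[OF v] free_coord[OF w] by (auto simp: a_comm)
    fix u assume u: "u \<in> carrier (free_module R n)"
    show "v \<oplus>\<^bsub>free_module R n\<^esub> w \<oplus>\<^bsub>free_module R n\<^esub> u = v \<oplus>\<^bsub>free_module R n\<^esub> (w \<oplus>\<^bsub>free_module R n\<^esub> u)"
      using free_coord[OF v] free_coord[OF w] free_coord[OF u] by (auto simp: a_assoc)
  qed (auto simp: free_mem)
next
  fix r s v assume r: "r \<in> carrier R" and v: "v \<in> carrier (free_module R n)"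
  show "r \<odot>\<^bsub>free_module R n\<^esub> v \<in> carrier (free_module R n)" using r v by (auto simp: free_mem)
  {
    fix w assume w: "w \<in> carrier (free_module R n)"
    show "r \<odot>\<^bsub>free_module R n\<^esub> (v \<oplus>\<^bsub>free_module R n\<^esub> w) = r \<odot>\<^bsub>free_module R n\<^esub> v \<oplus>\<^bsub>free_module R n\<^esub> r \<odot>\<^bsub>free_module R n\<^esub> w"
      using r free_coord[OF v] free_coord[OF w] by (auto simp: r_distr)
  }
  assume s: "s \<in> carrier R"
  show "(r \<oplus> s) \<odot>\<^bsub>free_module R n\<^esub> v = r \<odot>\<^bsub>free_module R n\<^esub> v \<oplus>\<^bsub>free_module R n\<^esub> s \<odot>\<^bsub>free_module R n\<^esub> v"
    using r s free_coord[OF v] by (auto simp: l_distr)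
  show "(r \<otimes> s) \<odot>\<^bsub>free_module R n\<^esub> v = r \<odot>\<^bsub>free_module R n\<^esub> (s \<odot>\<^bsub>free_module R n\<^esub> v)"
    using r s free_coord[OF v] by (auto simp: m_assoc)
next
  fix v assume v: "v \<in> carrier (free_module R n)"
  show "\<one> \<odot>\<^bsub>free_module R n\<^esub> v = v" using free_coord[OF v] by auto
qed (rule is_cring)

lemma free_finsum:
  assumes "f \<in> A \<rightarrow> carrier (free_module R n)"
  shows "(\<Oplus>\<^bsub>free_module R n\<^esub>i\<in>A. f i) l = (\<Oplus>i\<in>A. f i l)"
proof -
  interpret F: module R "free_module R n" by (rule free_module)
  show ?thesis using assms
  proof (induction A rule: infinite_finite_induct)
    case (insert i A)
    then have "f \<in> A \<rightarrow> carrier (free_module R n)" "f i \<in> carrier (free_module R n)"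
      "(\<lambda>i. f i l) \<in> A \<rightarrow> carrier R" "f i l \<in> carrier R" by (auto intro: free_coord)
    then show ?case using insert by (simp add: F.M.finsum_insert)
  qed simp_all
qed

text \<open>Sums and multiples are formed coordinatewise, so coefficients found for each coordinate
  can be assembled into vectors: (x)R^n consists of the vectors with all coordinates in the
  ideal.\<close>

lemma free_comb:
  assumes x: "x \<in> T \<rightarrow> carrier R"
  shows "v \<in> comb (free_module R n) x T (carrier (free_module R n)) \<longleftrightarrow>
    v \<in> carrier (free_module R n) \<and> (\<forall>l<n. v l \<in> gen_ideal x T)"
proof -
  interpret F: module R "free_module R n" by (rule free_module)
  have fs: "(\<Oplus>\<^bsub>free_module R n\<^esub>t\<in>T. x t \<odot>\<^bsub>free_module R n\<^esub> w t) l = (\<Oplus>t\<in>T. x t \<otimes> w t l)"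
    if "w \<in> T \<rightarrow> carrier (free_module R n)" for w l
  proof -
    have "(\<lambda>t. x t \<odot>\<^bsub>free_module R n\<^esub> w t) \<in> T \<rightarrow> carrier (free_module R n)"
      using that x F.smult_closed by (intro funcsetI) (simp add: Pi_iff del: free_simps)
    from free_finsum[OF this, of l] show ?thesis by simp
  qed
  show ?thesis
  proof (intro iffI conjI allI impI)
    assume v: "v \<in> comb (free_module R n) x T (carrier (free_module R n))"
    show "v \<in> carrier (free_module R n)"
      by (rule F.submod_carrier[OF F.comb_submodule[OF F.carrier_is_submodule x] v])
    obtain w where w: "w \<in> T \<rightarrow> carrier (free_module R n)"
      "v = (\<Oplus>\<^bsub>free_module R n\<^esub>t\<in>T. x t \<odot>\<^bsub>free_module R n\<^esub> w t)"
      using v unfolding comb_def by blast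
    fix l
    have "(\<lambda>t. w t l) \<in> T \<rightarrow> carrier R" using w(1) free_coord by auto
    then show "v l \<in> gen_ideal x T"
      unfolding w(2) fs[OF w(1)] gen_ideal_def by (intro CollectI exI[of _ "\<lambda>t. w t l"] conjI refl)
  next
    assume v: "v \<in> carrier (free_module R n) \<and> (\<forall>l<n. v l \<in> gen_ideal x T)"
    then have "\<forall>l. \<exists>r. l < n \<longrightarrow> r \<in> T \<rightarrow> carrier R \<and> v l = (\<Oplus>t\<in>T. x t \<otimes> r t)"
      unfolding gen_ideal_def by blast
    then obtain r where r: "\<And>l. l < n \<Longrightarrow> r l \<in> T \<rightarrow> carrier R \<and> v l = (\<Oplus>t\<in>T. x t \<otimes> r l t)" by metis
    define w where "w t l = (if l < n \<and> t \<in> T then r l t else \<zero>)" for t l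
    have w: "w \<in> T \<rightarrow> carrier (free_module R n)"
      using r by (auto simp: w_def free_mem Pi_iff)
    have "v l = (\<Oplus>t\<in>T. x t \<otimes> w t l)" for l
    proof (cases "l < n")
      case True
      then have "(\<Oplus>t\<in>T. x t \<otimes> w t l) = (\<Oplus>t\<in>T. x t \<otimes> r l t)"
        using r[OF True] x by (intro finsum_cong') (auto simp: w_def Pi_iff)
      then show ?thesis using r[OF True] by simp
    next
      case False
      then have "(\<Oplus>t\<in>T. x t \<otimes> w t l) = \<zero>"
        using x by (intro add.finprod_one_eqI) (auto simp: w_def Pi_iff)
      then show ?thesis using v False by (simp add: free_mem)
    qed
    then have "v = (\<Oplus>\<^bsub>free_module R n\<^esub>t\<in>T. x t \<odot>\<^bsub>free_module R n\<^esub> w t)"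
      using fs[OF w] by auto
    then show "v \<in> comb (free_module R n) x T (carrier (free_module R n))"
      unfolding comb_def using w by blast
  qed
qed

lemma unit_vector_mem: "i < n \<Longrightarrow> unit_vector R i \<in> carrier (free_module R n)"
  by (auto simp: free_mem unit_vector_def)

lemma free_expand:
  assumes v: "v \<in> carrier (free_module R n)"
  shows "v = (\<Oplus>\<^bsub>free_module R n\<^esub>i\<in>{..<n}. v i \<odot>\<^bsub>free_module R n\<^esub> unit_vector R i)"
proof
  fix l
  have "(\<lambda>i. v i \<odot>\<^bsub>free_module R n\<^esub> unit_vector R i) \<in> {..<n} \<rightarrow> carrier (free_module R n)"
    using v by (auto simp: free_mem unit_vector_def)
  from free_finsum[OF this, of l]
  have "(\<Oplus>\<^bsub>free_module R n\<^esub>i\<in>{..<n}. v i \<odot>\<^bsub>free_module R n\<^esub> unit_vector R i) l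
    = (\<Oplus>i\<in>{..<n}. v i \<otimes> unit_vector R i l)" by simp
  also have "\<dots> = (\<Oplus>i\<in>{..<n}. if l = i then v i else \<zero>)"
    using free_coord[OF v] by (intro finsum_cong') (auto simp: unit_vector_def)
  also have "\<dots> = v l"
  proof (cases "l < n")
    case True
    then show ?thesis using free_coord[OF v] by (intro add.finprod_singleton) auto
  next
    case False
    then have "(\<Oplus>i\<in>{..<n}. if l = i then v i else \<zero>) = \<zero>" by (intro add.finprod_one_eqI) auto
    then show ?thesis using False v by (simp add: free_mem)
  qed
  finally show "v l = (\<Oplus>\<^bsub>free_module R n\<^esub>i\<in>{..<n}. v i \<odot>\<^bsub>free_module R n\<^esub> unit_vector R i) l" by simp
qed

lemma free_submodule_fg:
  assumes noeth: "noetherian_ring R" and V: "submodule V R (free_module R n)"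
  shows "\<exists>B\<subseteq>V. finite B \<and> V = lin R (free_module R n) B"
proof -
  interpret F: module R "free_module R n" by (rule free_module)
  define A where "A = unit_vector R ` {..<n}"
  have A: "finite A" "A \<subseteq> carrier (free_module R n)" using unit_vector_mem by (auto simp: A_def)
  note L = F.lin_submodule[OF A]
  have "carrier (free_module R n) \<subseteq> lin R (free_module R n) A"
  proof
    fix v assume v: "v \<in> carrier (free_module R n)"
    have "(\<Oplus>\<^bsub>free_module R n\<^esub>i\<in>{..<n}. v i \<odot>\<^bsub>free_module R n\<^esub> unit_vector R i) \<in> lin R (free_module R n) A"
    proof (rule F.submod_finsum[OF L], rule funcsetI)
      fix i assume "i \<in> {..<n}"
      then have "unit_vector R i \<in> lin R (free_module R n) A"
        using F.lin_superset[OF A] by (auto simp: A_def)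
      then show "v i \<odot>\<^bsub>free_module R n\<^esub> unit_vector R i \<in> lin R (free_module R n) A"
        by (rule F.submod(5)[OF L free_coord[OF v]])
    qed
    then show "v \<in> lin R (free_module R n) A" using free_expand[OF v] by simp
  qed
  then show ?thesis
    using F.submodule_of_lin_fg[OF noeth A V] F.submod_carrier[OF V] by blast
qed

end

context standard_graded_ring
begin

section \<open>Free modules graded by the degrees of their basis vectors\<close>

definition vdeg :: "(nat \<Rightarrow> int) \<Rightarrow> nat \<Rightarrow> int \<Rightarrow> (nat \<Rightarrow> 'a) set" where
  "vdeg ds n j = {v \<in> carrier (free_module R n). \<forall>l<n. v l \<in> Gz (j - ds l)}"

definition vcomp :: "(nat \<Rightarrow> int) \<Rightarrow> int \<Rightarrow> (nat \<Rightarrow> 'a) \<Rightarrow> nat \<Rightarrow> 'a" where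
  "vcomp ds j v = (\<lambda>l. cz (j - ds l) (v l))"

lemma vdeg_coord: "v \<in> vdeg ds n j \<Longrightarrow> v l \<in> Gz (j - ds l)"
  by (cases "l < n") (auto simp: vdeg_def free_mem)

lemma cz_sum_shift:
  assumes r: "r \<in> carrier R" and A: "finite A" "\<And>i. hcomp R G r i \<noteq> \<zero> \<Longrightarrow> k + int i \<in> A"
  shows "(\<Oplus>j\<in>A. cz (j - k) r) = r"
proof -
  define S where "S = {i. hcomp R G r i \<noteq> \<zero>}"
  have S: "finite S" unfolding S_def by (rule RG.hcomp_finite[OF r])
  have "(\<Oplus>j\<in>A. cz (j - k) r) = (\<Oplus>j\<in>(\<lambda>i. k + int i) ` S. cz (j - k) r)"
  proof (rule add.finprod_mono_neutral_cong_right[OF A(1)])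
    show "(\<lambda>i. k + int i) ` S \<subseteq> A" using A(2) by (auto simp: S_def)
    fix j assume "j \<in> A - (\<lambda>i. k + int i) ` S"
    then have j: "j \<notin> (\<lambda>i. k + int i) ` S" by blast
    show "cz (j - k) r = \<zero>"
    proof (rule ccontr)
      assume nz: "cz (j - k) r \<noteq> \<zero>"
      then have "0 \<le> j - k" "nat (j - k) \<in> S" unfolding int_comp_def S_def by (auto split: if_splits)
      then have "j = k + int (nat (j - k))" by simp
      with \<open>nat (j - k) \<in> S\<close> j show False by blast
    qed
  qed (use r in auto)
  also have "\<dots> = (\<Oplus>i\<in>S. cz (k + int i - k) r)"
    by (rule finsum_reindex) (use r in \<open>auto simp: inj_on_def\<close>)
  also have "\<dots> = (\<Oplus>i\<in>S. hcomp R G r i)" by (simp add: int_comp_def)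
  also have "\<dots> = r" unfolding S_def using RG.hcomp_sum[OF r] by simp
  finally show ?thesis .
qed

lemma vcomp_mem: "v \<in> carrier (free_module R n) \<Longrightarrow> vcomp ds j v \<in> vdeg ds n j"
  by (auto simp: vdeg_def vcomp_def free_mem cz_in)

lemma vdeg_carrier: "v \<in> vdeg ds n j \<Longrightarrow> v \<in> carrier (free_module R n)"
  by (simp add: vdeg_def)

lemma vcomp_homogeneous: "v \<in> vdeg ds n j \<Longrightarrow> vcomp ds k v = (if k = j then v else (\<lambda>l. \<zero>))"
  using cz_homogeneous[OF vdeg_coord[of v ds n j]] by (auto simp: vcomp_def)

lemma free_decomposition_unique:
  assumes f: "homogeneous_decomposition (free_module R n) (vdeg ds n) v f"
  shows "f = (\<lambda>j. vcomp ds j v)"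
proof -
  define S where "S = {j. f j \<noteq> \<zero>\<^bsub>free_module R n\<^esub>}"
  have fj: "f j \<in> vdeg ds n j" for j using f unfolding homogeneous_decomposition_def by blast
  have S: "finite S" "v = (\<Oplus>\<^bsub>free_module R n\<^esub>j\<in>S. f j)"
    using f unfolding homogeneous_decomposition_def S_def by blast+
  have fS: "f \<in> S \<rightarrow> carrier (free_module R n)" using fj vdeg_carrier by blast
  have fc: "f j l \<in> carrier R" for j l using free_coord[OF vdeg_carrier[OF fj]] .
  show ?thesis
  proof (intro ext)
    fix k l
    have "vcomp ds k v l = cz (k - ds l) (\<Oplus>j\<in>S. f j l)"
      unfolding vcomp_def S(2) free_finsum[OF fS] ..
    also have "\<dots> = (\<Oplus>j\<in>S. cz (k - ds l) (f j l))" using fc by (intro cz_finsum) auto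
    also have "\<dots> = (\<Oplus>j\<in>S. if k = j then f j l else \<zero>)"
      using fc cz_homogeneous[OF vdeg_coord[OF fj]] by (intro finsum_cong') auto
    also have "\<dots> = f k l"
    proof (cases "k \<in> S")
      case True
      then show ?thesis using S fc by (intro add.finprod_singleton) auto
    next
      case False
      then have "(\<Oplus>j\<in>S. if k = j then f j l else \<zero>) = \<zero>" by (intro add.finprod_one_eqI) auto
      then show ?thesis using False by (simp add: S_def)
    qed
    finally show "f k l = vcomp ds k v l" by simp
  qed
qed

lemma free_grading: "is_grading (free_module R n) (vdeg ds n)"
  unfolding is_grading_def
proof (intro conjI allI ballI)
  interpret F: module R "free_module R n" by (rule free_module)
  fix j
  show "additive_subgroup (vdeg ds n j) (free_module R n)"
  proof (rule additive_subgroup.intro, rule F.M.add.subgroupI)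
    show "vdeg ds n j \<subseteq> carrier (free_module R n)" by (auto simp: vdeg_def)
    have "\<zero>\<^bsub>free_module R n\<^esub> \<in> vdeg ds n j" by (simp add: vdeg_def free_mem)
    then show "vdeg ds n j \<noteq> {}" by blast
    fix v assume v: "v \<in> vdeg ds n j"
    have "\<ominus>\<^bsub>free_module R n\<^esub> v = (\<ominus> \<one>) \<odot>\<^bsub>free_module R n\<^esub> v"
      using F.smult_l_minus[of \<one> v] F.smult_one[of v] vdeg_carrier[OF v] by (simp del: free_simps)
    also have "\<dots> = (\<lambda>l. \<ominus> v l)" using free_coord[OF vdeg_carrier[OF v]] by (auto simp: l_minus)
    finally have "\<ominus>\<^bsub>free_module R n\<^esub> v = (\<lambda>l. \<ominus> v l)" .
    then show "\<ominus>\<^bsub>free_module R n\<^esub> v \<in> vdeg ds n j"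
      using v by (auto simp: vdeg_def free_mem Gz_neg_closed)
    fix w assume "w \<in> vdeg ds n j"
    with v show "v \<oplus>\<^bsub>free_module R n\<^esub> w \<in> vdeg ds n j" by (auto simp: vdeg_def free_mem Gz_add)
  qed
next
  interpret F: module R "free_module R n" by (rule free_module)
  fix v assume v: "v \<in> carrier (free_module R n)"
  \<comment> \<open>All total degrees occurring in v: a component of degree i in coordinate l has
    total degree ds l + i.\<close>
  define A where "A = (\<Union>l<n. (\<lambda>i. ds l + int i) ` {i. hcomp R G (v l) i \<noteq> \<zero>})"
  have A: "finite A" unfolding A_def using RG.hcomp_finite free_coord[OF v] by auto
  have vc: "(\<lambda>j. vcomp ds j v) \<in> B \<rightarrow> carrier (free_module R n)" for B
    using vcomp_mem[OF v] vdeg_carrier by blast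
  have supp: "{j. vcomp ds j v \<noteq> \<zero>\<^bsub>free_module R n\<^esub>} \<subseteq> A"
  proof
    fix j assume "j \<in> {j. vcomp ds j v \<noteq> \<zero>\<^bsub>free_module R n\<^esub>}"
    then obtain l where l: "cz (j - ds l) (v l) \<noteq> \<zero>" by (auto simp: vcomp_def fun_eq_iff)
    then have ln: "l < n" using v by (cases "l < n") (auto simp: free_mem)
    from l have "0 \<le> j - ds l" "hcomp R G (v l) (nat (j - ds l)) \<noteq> \<zero>"
      by (auto simp: int_comp_def split: if_splits)
    moreover from this(1) have "j = ds l + int (nat (j - ds l))" by simp
    ultimately show "j \<in> A" unfolding A_def using ln by blast
  qed
  have "v l = (\<Oplus>\<^bsub>free_module R n\<^esub>j\<in>A. vcomp ds j v) l" for l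
  proof -
    have "(\<Oplus>\<^bsub>free_module R n\<^esub>j\<in>A. vcomp ds j v) l = (\<Oplus>j\<in>A. cz (j - ds l) (v l))"
      using free_finsum[OF vc, of A l] by (simp add: vcomp_def)
    also have "\<dots> = v l"
    proof (cases "l < n")
      case True
      then show ?thesis by (intro cz_sum_shift A free_coord[OF v]) (auto simp: A_def)
    next
      case False
      then show ?thesis using v by (simp add: free_mem)
    qed
    finally show ?thesis by simp
  qed
  then have "v = (\<Oplus>\<^bsub>free_module R n\<^esub>j\<in>A. vcomp ds j v)" by blast
  also have "\<dots> = (\<Oplus>\<^bsub>free_module R n\<^esub>j\<in>{j. vcomp ds j v \<noteq> \<zero>\<^bsub>free_module R n\<^esub>}. vcomp ds j v)"
    using A supp vc by (intro F.M.add.finprod_mono_neutral_cong_right) auto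
  finally have ex: "homogeneous_decomposition (free_module R n) (vdeg ds n) v (\<lambda>j. vcomp ds j v)"
    unfolding homogeneous_decomposition_def
    using vcomp_mem[OF v] finite_subset[OF supp A] by blast
  show "\<exists>!f. homogeneous_decomposition (free_module R n) (vdeg ds n) v f"
    using ex free_decomposition_unique by blast
qed

lemma free_graded_group: "graded_group (free_module R n) (vdeg ds n)"
proof -
  interpret F: module R "free_module R n" by (rule free_module)
  show ?thesis by unfold_locales (rule free_grading)
qed

lemma free_hcomp:
  assumes v: "v \<in> carrier (free_module R n)"
  shows "hcomp (free_module R n) (vdeg ds n) v j = vcomp ds j v"
proof -
  interpret F: graded_group "free_module R n" "vdeg ds n" by (rule free_graded_group)
  show ?thesis using free_decomposition_unique[OF F.hcomp_decomposition[OF v]] by simp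
qed

end

context standard_graded_ring
begin

lemma vcomp_smult:
  assumes v: "v \<in> vdeg ds n k" and r: "r \<in> carrier R"
  shows "vcomp ds j (r \<odot>\<^bsub>free_module R n\<^esub> v) = cz (j - k) r \<odot>\<^bsub>free_module R n\<^esub> v"
proof
  fix l
  have vl: "v l \<in> carrier R" using free_coord[OF vdeg_carrier[OF v]] .
  have "cz (j - ds l) (v l \<otimes> r) = v l \<otimes> cz (j - ds l - (k - ds l)) r"
    by (rule cz_mult[OF vdeg_coord[OF v] r])
  then show "vcomp ds j (r \<odot>\<^bsub>free_module R n\<^esub> v) l = (cz (j - k) r \<odot>\<^bsub>free_module R n\<^esub> v) l"
    using r vl by (simp add: vcomp_def m_comm)
qed

end

section \<open>The iterated syzygies\<close>

text \<open>Besides their degrees, regularity in every order is what the syzygy construction uses of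
  the parameters; \<open>sop_regular_parameters\<close> supplies it.\<close>

locale regular_parameters = standard_graded_ring R G for R (structure) and G +
  fixes x :: "nat \<Rightarrow> 'a" and a :: "nat \<Rightarrow> nat" and d :: nat
  assumes x_degree: "\<And>j. j < d \<Longrightarrow> x j \<in> G (a j)"
    and regular: "\<And>T t r. T \<subseteq> {..<d} \<Longrightarrow> t < d \<Longrightarrow> t \<notin> T \<Longrightarrow> r \<in> carrier R \<Longrightarrow>
      x t \<otimes> r \<in> gen_ideal x T \<Longrightarrow> r \<in> gen_ideal x T"
begin

lemma x_closed: "j < d \<Longrightarrow> x j \<in> carrier R"
  using x_degree RG.H_carrier by blast

lemma x_funcset: "T \<subseteq> {..<d} \<Longrightarrow> x \<in> T \<rightarrow> carrier R"
  using x_closed by auto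

lemma gen_ideal_cz: "T \<subseteq> {..<d} \<Longrightarrow> r \<in> gen_ideal x T \<Longrightarrow> cz j r \<in> gen_ideal x T"
  using x_degree by (intro cz_gen_ideal_mem[of T x "\<lambda>j. int (a j)"]) auto

lemma free_regular:
  assumes T: "T \<subseteq> {..<d}" "t < d" "t \<notin> T" and w: "w \<in> carrier (free_module R n)"
    and m: "x t \<odot>\<^bsub>free_module R n\<^esub> w \<in> comb (free_module R n) x T (carrier (free_module R n))"
  shows "w \<in> comb (free_module R n) x T (carrier (free_module R n))"
  using m w regular[OF T free_coord[OF w]] unfolding free_comb[OF x_funcset[OF T(1)]] by auto

lemma free_comb_vcomp:
  assumes T: "T \<subseteq> {..<d}" and v: "v \<in> comb (free_module R n) x T (carrier (free_module R n))"
  shows "vcomp ds j v \<in> comb (free_module R n) x T (carrier (free_module R n))"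
  using v vdeg_carrier[OF vcomp_mem] gen_ideal_cz[OF T] unfolding free_comb[OF x_funcset[OF T]]
  by (auto simp: vcomp_def)

end

text \<open>The module after step \<open>i\<close> is \<open>V/U\<close> with \<open>U = (x\<^sub>i, \<dots>, x\<^sub>d\<^sub>-\<^sub>1) R\<^sup>n \<subseteq> V \<subseteq> R\<^sup>n\<close>, where the basis
  vectors of \<open>R\<^sup>n\<close> have the degrees \<open>ds\<close>; at \<open>i = d\<close> it is \<open>V\<close> itself. The image of \<open>e\<close> generates a free
  \<open>R/(x\<^sub>i, \<dots>, x\<^sub>d\<^sub>-\<^sub>1)\<close>-submodule.\<close>

locale stage = regular_parameters R G x a d for R (structure) and G x a d +
  fixes c :: int and J :: "'a set" and i n :: nat and ds :: "nat \<Rightarrow> int" and V :: "(nat \<Rightarrow> 'a) set"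
    and e :: "nat \<Rightarrow> 'a"
  assumes V: "submodule V R (free_module R n)"
    and V_comp: "\<And>v j. v \<in> V \<Longrightarrow> vcomp ds j v \<in> V"
    and base: "comb (free_module R n) x {i..<d} (carrier (free_module R n)) \<subseteq> V"
    and e: "e \<in> V" "e \<in> vdeg ds n (int (\<Sum>l<i. a l))"
    and free: "\<And>r. r \<in> carrier R \<Longrightarrow>
      r \<odot>\<^bsub>free_module R n\<^esub> e \<in> comb (free_module R n) x {i..<d} (carrier (free_module R n)) \<Longrightarrow>
      r \<in> gen_ideal x {i..<d}"
    and low: "\<And>v j. v \<in> V \<Longrightarrow> v \<in> vdeg ds n j \<Longrightarrow> j < c + int i - 1 \<Longrightarrow>
      \<exists>r\<in>carrier R. \<exists>u\<in>comb (free_module R n) x {i..<d} (carrier (free_module R n)).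
        v = r \<odot>\<^bsub>free_module R n\<^esub> e \<oplus>\<^bsub>free_module R n\<^esub> u"
    and colon: "\<And>r. r \<in> carrier R \<Longrightarrow>
      r \<odot>\<^bsub>free_module R n\<^esub> e \<in> comb (free_module R n) x {..<i} V <+>\<^bsub>free_module R n\<^esub>
        comb (free_module R n) x {i..<d} (carrier (free_module R n)) \<longleftrightarrow> r \<in> J"
    and reg: "\<And>t v. t < i \<Longrightarrow> v \<in> V \<Longrightarrow>
      x t \<odot>\<^bsub>free_module R n\<^esub> v \<in> comb (free_module R n) x {..<t} V <+>\<^bsub>free_module R n\<^esub>
        comb (free_module R n) x {i..<d} (carrier (free_module R n)) \<Longrightarrow>
      v \<in> comb (free_module R n) x {..<t} V <+>\<^bsub>free_module R n\<^esub>
        comb (free_module R n) x {i..<d} (carrier (free_module R n))"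
begin

abbreviation "F \<equiv> free_module R n"
abbreviation "U \<equiv> comb F x {i..<d} (carrier F)"

sublocale F: module R F by (rule free_module)
sublocale FG: graded_group F "vdeg ds n" by (rule free_graded_group)

lemma V_carrier: "v \<in> V \<Longrightarrow> v \<in> carrier F"
  by (rule F.submod_carrier[OF V])

lemma U_sub: "submodule U R F"
  by (intro F.comb_submodule F.carrier_is_submodule x_funcset) auto

text \<open>Homogeneous elements that together with e generate V modulo U. They can be taken in
  degrees at least c + i - 1, since below that bound the assumption \<open>low\<close> leaves only
  multiples of e.\<close>

definition complements_e :: "(nat \<Rightarrow> 'a) set \<Rightarrow> bool" where
  "complements_e C \<longleftrightarrow> finite C \<and> C \<subseteq> V \<and> (\<forall>g\<in>C. \<exists>j\<ge>c + int i - 1. g \<in> vdeg ds n j) \<and>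
     V \<subseteq> lin R F (insert e C) <+>\<^bsub>F\<^esub> U"

lemma complements_e_exists: "\<exists>C. complements_e C"
proof -
  obtain B where B: "B \<subseteq> V" "finite B" "V = lin R F B"
    using free_submodule_fg[OF noetherian_ring_axioms V] by blast
  define C where "C = (\<Union>b\<in>B. (\<lambda>j. vcomp ds j b) ` {j. vcomp ds j b \<noteq> \<zero>\<^bsub>F\<^esub>}) \<inter> {g. \<exists>j\<ge>c + int i - 1. g \<in> vdeg ds n j}"
  have fin: "finite {j. vcomp ds j b \<noteq> \<zero>\<^bsub>F\<^esub>}" if "b \<in> B" for b
    using FG.hcomp_finite[OF V_carrier] free_hcomp[OF V_carrier] B(1) that by auto
  have C: "finite C" "C \<subseteq> V" using fin B V_comp unfolding C_def by auto
  have eC: "finite (insert e C)" "insert e C \<subseteq> carrier F" using C e(1) V_carrier by auto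
  define Z where "Z = lin R F (insert e C) <+>\<^bsub>F\<^esub> U"
  note L = F.lin_submodule[OF eC]
  have Z: "submodule Z R F" unfolding Z_def by (rule F.submod_sum[OF L U_sub])
  have LZ: "lin R F (insert e C) \<subseteq> Z" unfolding Z_def by (rule F.submod_sum_left[OF L U_sub])
  have UZ: "U \<subseteq> Z" unfolding Z_def by (rule F.submod_sum_right[OF L U_sub])
  have "b \<in> Z" if b: "b \<in> B" for b
  proof -
    have bV: "b \<in> V" using b B by blast
    \<comment> \<open>Components of low degree are multiples of e modulo U; the other nonzero ones
      belong to C.\<close>
    have comp: "vcomp ds j b \<in> Z" for j
    proof (cases "j < c + int i - 1")
      case True
      obtain r u where ru: "r \<in> carrier R" "u \<in> U" "vcomp ds j b = r \<odot>\<^bsub>F\<^esub> e \<oplus>\<^bsub>F\<^esub> u"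
        using low[OF V_comp[OF bV] vcomp_mem[OF V_carrier[OF bV]] True] by blast
      have "e \<in> Z" using F.lin_superset[OF eC] LZ by blast
      then show ?thesis unfolding ru(3) using ru(1,2) UZ F.submod(5,6)[OF Z] by blast
    next
      case False
      show ?thesis
      proof (cases "vcomp ds j b = \<zero>\<^bsub>F\<^esub>")
        case True
        then show ?thesis using F.submod_zero[OF Z] by simp
      next
        case nz: False
        have "c + int i - 1 \<le> j" using False by simp
        then have "vcomp ds j b \<in> C" unfolding C_def using b nz vcomp_mem[OF V_carrier[OF bV]] by blast
        then show ?thesis using F.lin_superset[OF eC] LZ by blast
      qed
    qed
    have "b = (\<Oplus>\<^bsub>F\<^esub>j\<in>{j. vcomp ds j b \<noteq> \<zero>\<^bsub>F\<^esub>}. vcomp ds j b)"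
      using FG.hcomp_sum[OF V_carrier[OF bV]] unfolding free_hcomp[OF V_carrier[OF bV]] .
    moreover have "(\<Oplus>\<^bsub>F\<^esub>j\<in>{j. vcomp ds j b \<noteq> \<zero>\<^bsub>F\<^esub>}. vcomp ds j b) \<in> Z"
      by (rule F.submod_finsum[OF Z]) (use comp in blast)
    ultimately show ?thesis by simp
  qed
  then have "V \<subseteq> Z" unfolding B(3) by (intro F.lin_subset Z) blast
  with C have "complements_e C" unfolding complements_e_def Z_def C_def by blast
  then show ?thesis by blast
qed

text \<open>In a complement of least cardinality no member is redundant. Irredundancy is what
  forbids unit coefficients in the relations, see \<open>coefficient_zero\<close>.\<close>

lemma minimal_complement:
  "\<exists>C. complements_e C \<and> (\<forall>g\<in>C. g \<notin> lin R F (insert e (C - {g})) <+>\<^bsub>F\<^esub> U)"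
proof -
  obtain C where C: "complements_e C" and min: "\<And>C'. complements_e C' \<Longrightarrow> card C \<le> card C'"
    using ex_has_least_nat[of complements_e _ card] complements_e_exists by blast
  have "g \<notin> lin R F (insert e (C - {g})) <+>\<^bsub>F\<^esub> U" if g: "g \<in> C" for g
  proof
    assume gin: "g \<in> lin R F (insert e (C - {g})) <+>\<^bsub>F\<^esub> U"
    have fC: "finite C" "C \<subseteq> V" using C unfolding complements_e_def by auto
    have eC: "finite (insert e (C - {g}))" "insert e (C - {g}) \<subseteq> carrier F"
      using fC e(1) V_carrier by auto
    define Z where "Z = lin R F (insert e (C - {g})) <+>\<^bsub>F\<^esub> U"
    note L = F.lin_submodule[OF eC]
    have Z: "submodule Z R F" unfolding Z_def by (rule F.submod_sum[OF L U_sub])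
    have LZ: "lin R F (insert e (C - {g})) \<subseteq> Z" unfolding Z_def by (rule F.submod_sum_left[OF L U_sub])
    have UZ: "U \<subseteq> Z" unfolding Z_def by (rule F.submod_sum_right[OF L U_sub])
    have "insert e C \<subseteq> Z" using F.lin_superset[OF eC] LZ gin unfolding Z_def[symmetric] by blast
    then have "lin R F (insert e C) <+>\<^bsub>F\<^esub> U \<subseteq> Z"
      by (intro F.submod_sum_least Z UZ F.lin_subset)
    then have "complements_e (C - {g})"
      using C unfolding complements_e_def Z_def by blast
    then have "card C \<le> card (C - {g})" by (rule min)
    then show False using card_Diff1_less[OF fC(1) g] by simp
  qed
  with C show ?thesis by blast
qed

end

text \<open>An irredundant complement of e, enumerated with degrees. The free cover has coordinate 0
  for e and coordinate l + 1 for g l; injectivity of g makes removing a vector from the set the same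
  as removing its index.\<close>

locale stage_cover = stage +
  fixes m :: nat and g :: "nat \<Rightarrow> nat \<Rightarrow> 'a" and b :: "nat \<Rightarrow> int"
  assumes g: "\<And>l. l < m \<Longrightarrow> g l \<in> V" "\<And>l. l < m \<Longrightarrow> g l \<in> vdeg ds n (b l)"
      "\<And>l. l < m \<Longrightarrow> c + int i - 1 \<le> b l"
    and g_inj: "inj_on g {..<m}"
    and gen: "V \<subseteq> lin R F (insert e (g ` {..<m})) <+>\<^bsub>F\<^esub> U"
    and minimal: "\<And>l. l < m \<Longrightarrow> g l \<notin> lin R F (insert e (g ` {..<m} - {g l})) <+>\<^bsub>F\<^esub> U"
    and i: "i < d"
begin

abbreviation "E \<equiv> free_module R (Suc m)"
definition "\<rho> w = w 0 \<odot>\<^bsub>F\<^esub> e \<oplus>\<^bsub>F\<^esub> (\<Oplus>\<^bsub>F\<^esub>l\<in>{..<m}. w (Suc l) \<odot>\<^bsub>F\<^esub> g l)"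
definition "es l = (case l of 0 \<Rightarrow> int (\<Sum>l<i. a l) | Suc k \<Rightarrow> b k)"

sublocale E: module R E by (rule free_module)
sublocale EG: graded_group E "vdeg es (Suc m)" by (rule free_graded_group)

lemma e_carrier: "e \<in> carrier F"
  using e(1) V_carrier by blast

lemma g_carrier: "l < m \<Longrightarrow> g l \<in> carrier F"
  using g(1) V_carrier by blast

lemma smult_F_closed: "r \<in> carrier R \<Longrightarrow> v \<in> carrier F \<Longrightarrow> r \<odot>\<^bsub>F\<^esub> v \<in> carrier F"
  by (rule F.smult_closed)

lemma wg_funcset: "w \<in> carrier E \<Longrightarrow> (\<lambda>l. w (Suc l) \<odot>\<^bsub>F\<^esub> g l) \<in> {..<m} \<rightarrow> carrier F"
  by (intro funcsetI smult_F_closed g_carrier free_coord) auto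

lemma rho_hom: "\<rho> \<in> module_hom R E F"
  unfolding module_hom_def
proof (intro CollectI conjI ballI funcsetI)
  fix w assume w: "w \<in> carrier E"
  show "\<rho> w \<in> carrier F"
    unfolding \<rho>_def using w e_carrier wg_funcset
    by (intro F.M.a_closed smult_F_closed F.M.finsum_closed free_coord)
  {
    fix w' assume w': "w' \<in> carrier E"
    have "\<rho> (w \<oplus>\<^bsub>E\<^esub> w') = (w 0 \<odot>\<^bsub>F\<^esub> e \<oplus>\<^bsub>F\<^esub> w' 0 \<odot>\<^bsub>F\<^esub> e) \<oplus>\<^bsub>F\<^esub>
        (\<Oplus>\<^bsub>F\<^esub>l\<in>{..<m}. w (Suc l) \<odot>\<^bsub>F\<^esub> g l \<oplus>\<^bsub>F\<^esub> w' (Suc l) \<odot>\<^bsub>F\<^esub> g l)"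
    proof -
      have "(\<Oplus>\<^bsub>F\<^esub>l\<in>{..<m}. (w \<oplus>\<^bsub>E\<^esub> w') (Suc l) \<odot>\<^bsub>F\<^esub> g l) =
          (\<Oplus>\<^bsub>F\<^esub>l\<in>{..<m}. w (Suc l) \<odot>\<^bsub>F\<^esub> g l \<oplus>\<^bsub>F\<^esub> w' (Suc l) \<odot>\<^bsub>F\<^esub> g l)"
      proof (intro F.M.finsum_cong' refl funcsetI)
        fix l assume "l \<in> {..<m}"
        then have gl: "g l \<in> carrier F" using g_carrier by blast
        show "(w \<oplus>\<^bsub>E\<^esub> w') (Suc l) \<odot>\<^bsub>F\<^esub> g l = w (Suc l) \<odot>\<^bsub>F\<^esub> g l \<oplus>\<^bsub>F\<^esub> w' (Suc l) \<odot>\<^bsub>F\<^esub> g l"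
          using F.smult_l_distr[OF free_coord[OF w, of "Suc l"] free_coord[OF w', of "Suc l"] gl] by simp
        show "w (Suc l) \<odot>\<^bsub>F\<^esub> g l \<oplus>\<^bsub>F\<^esub> w' (Suc l) \<odot>\<^bsub>F\<^esub> g l \<in> carrier F"
          using w w' gl by (intro F.M.a_closed smult_F_closed free_coord)
      qed
      moreover have "(w \<oplus>\<^bsub>E\<^esub> w') 0 \<odot>\<^bsub>F\<^esub> e = w 0 \<odot>\<^bsub>F\<^esub> e \<oplus>\<^bsub>F\<^esub> w' 0 \<odot>\<^bsub>F\<^esub> e"
        using F.smult_l_distr[OF free_coord[OF w, of 0] free_coord[OF w', of 0] e_carrier] by simp
      ultimately show ?thesis unfolding \<rho>_def by metis
    qed
    also have "\<dots> = (w 0 \<odot>\<^bsub>F\<^esub> e \<oplus>\<^bsub>F\<^esub> w' 0 \<odot>\<^bsub>F\<^esub> e) \<oplus>\<^bsub>F\<^esub>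
        ((\<Oplus>\<^bsub>F\<^esub>l\<in>{..<m}. w (Suc l) \<odot>\<^bsub>F\<^esub> g l) \<oplus>\<^bsub>F\<^esub> (\<Oplus>\<^bsub>F\<^esub>l\<in>{..<m}. w' (Suc l) \<odot>\<^bsub>F\<^esub> g l))"
      using F.M.finsum_addf[OF wg_funcset[OF w] wg_funcset[OF w']] by (simp only:)
    also have "\<dots> = \<rho> w \<oplus>\<^bsub>F\<^esub> \<rho> w'"
    proof -
      have assoc4: "(p \<oplus>\<^bsub>F\<^esub> p') \<oplus>\<^bsub>F\<^esub> (q \<oplus>\<^bsub>F\<^esub> q') = (p \<oplus>\<^bsub>F\<^esub> q) \<oplus>\<^bsub>F\<^esub> (p' \<oplus>\<^bsub>F\<^esub> q')"
        if "p \<in> carrier F" "p' \<in> carrier F" "q \<in> carrier F" "q' \<in> carrier F" for p p' q q'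
        using that by (simp add: F.M.a_ac del: free_simps)
      then show ?thesis unfolding \<rho>_def
        using w w' e_carrier by (intro assoc4 smult_F_closed free_coord F.M.finsum_closed wg_funcset)
    qed
    finally show "\<rho> (w \<oplus>\<^bsub>E\<^esub> w') = \<rho> w \<oplus>\<^bsub>F\<^esub> \<rho> w'" .
  }
  fix r assume r: "r \<in> carrier R"
  have sm: "(r \<odot>\<^bsub>E\<^esub> w) l \<odot>\<^bsub>F\<^esub> v = r \<odot>\<^bsub>F\<^esub> (w l \<odot>\<^bsub>F\<^esub> v)" if "v \<in> carrier F" for l v
    using F.smult_assoc1[OF r free_coord[OF w, of l] that] by simp
  have "(\<Oplus>\<^bsub>F\<^esub>l\<in>{..<m}. (r \<odot>\<^bsub>E\<^esub> w) (Suc l) \<odot>\<^bsub>F\<^esub> g l) = (\<Oplus>\<^bsub>F\<^esub>l\<in>{..<m}. r \<odot>\<^bsub>F\<^esub> (w (Suc l) \<odot>\<^bsub>F\<^esub> g l))"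
  proof (intro F.M.finsum_cong' refl funcsetI)
    fix l assume "l \<in> {..<m}"
    then have gl: "g l \<in> carrier F" using g_carrier by blast
    show "(r \<odot>\<^bsub>E\<^esub> w) (Suc l) \<odot>\<^bsub>F\<^esub> g l = r \<odot>\<^bsub>F\<^esub> (w (Suc l) \<odot>\<^bsub>F\<^esub> g l)" by (rule sm[OF gl])
    show "r \<odot>\<^bsub>F\<^esub> (w (Suc l) \<odot>\<^bsub>F\<^esub> g l) \<in> carrier F"
      by (rule smult_F_closed[OF r smult_F_closed[OF free_coord[OF w] gl]])
  qed
  with sm[OF e_carrier, of 0]
  have "\<rho> (r \<odot>\<^bsub>E\<^esub> w) = r \<odot>\<^bsub>F\<^esub> (w 0 \<odot>\<^bsub>F\<^esub> e) \<oplus>\<^bsub>F\<^esub> (\<Oplus>\<^bsub>F\<^esub>l\<in>{..<m}. r \<odot>\<^bsub>F\<^esub> (w (Suc l) \<odot>\<^bsub>F\<^esub> g l))"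
    unfolding \<rho>_def by metis
  also have "\<dots> = r \<odot>\<^bsub>F\<^esub> \<rho> w"
    unfolding \<rho>_def
    using F.finsum_smult_ldistr[OF _ r wg_funcset[OF w]]
      F.smult_r_distr[OF r smult_F_closed[OF free_coord[OF w] e_carrier] F.M.finsum_closed[OF wg_funcset[OF w]]]
    by (simp del: free_simps)
  finally show "\<rho> (r \<odot>\<^bsub>E\<^esub> w) = r \<odot>\<^bsub>F\<^esub> \<rho> w" .
qed

sublocale rho: module_homomorphism R E F \<rho>
  by unfold_locales (rule rho_hom)

lemma unit_mem: "l \<le> m \<Longrightarrow> unit_vector R l \<in> carrier E"
  by (intro unit_vector_mem) simp

lemma rho_unit_0: "\<rho> (unit_vector R 0) = e"
proof -
  have "(\<Oplus>\<^bsub>F\<^esub>l\<in>{..<m}. unit_vector R 0 (Suc l) \<odot>\<^bsub>F\<^esub> g l) = \<zero>\<^bsub>F\<^esub>"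
    using F.smult_l_null[OF g_carrier]
    by (intro F.M.add.finprod_one_eqI) (simp add: unit_vector_def del: free_simps)
  moreover have "unit_vector R 0 0 \<odot>\<^bsub>F\<^esub> e = e"
    using F.smult_one[OF e_carrier] by (simp add: unit_vector_def del: free_simps)
  ultimately show ?thesis unfolding \<rho>_def using F.M.r_zero[OF e_carrier] by (simp del: free_simps)
qed

lemma rho_unit_Suc:
  assumes k: "k < m"
  shows "\<rho> (unit_vector R (Suc k)) = g k"
proof -
  have "(\<Oplus>\<^bsub>F\<^esub>l\<in>{..<m}. unit_vector R (Suc k) (Suc l) \<odot>\<^bsub>F\<^esub> g l) = (\<Oplus>\<^bsub>F\<^esub>l\<in>{..<m}. if k = l then g l else \<zero>\<^bsub>F\<^esub>)"
    using F.smult_l_null[OF g_carrier] F.smult_one[OF g_carrier] g_carrier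
    by (intro F.M.finsum_cong') (auto simp: unit_vector_def simp del: free_simps)
  also have "\<dots> = g k"
    using k g_carrier by (intro F.M.add.finprod_singleton) auto
  finally have "(\<Oplus>\<^bsub>F\<^esub>l\<in>{..<m}. unit_vector R (Suc k) (Suc l) \<odot>\<^bsub>F\<^esub> g l) = g k" .
  moreover have "unit_vector R (Suc k) 0 \<odot>\<^bsub>F\<^esub> e = \<zero>\<^bsub>F\<^esub>"
    using F.smult_l_null[OF e_carrier] by (simp add: unit_vector_def del: free_simps)
  ultimately show ?thesis unfolding \<rho>_def using F.M.l_zero[OF g_carrier[OF k]] by (simp del: free_simps)
qed

lemma rho_in:
  assumes w: "w \<in> carrier E"
  shows "\<rho> w \<in> V"
  unfolding \<rho>_def
proof (rule F.submod(6)[OF V F.submod(5)[OF V free_coord[OF w] e(1)]])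
  show "(\<Oplus>\<^bsub>F\<^esub>l\<in>{..<m}. w (Suc l) \<odot>\<^bsub>F\<^esub> g l) \<in> V"
    using F.submod(5)[OF V free_coord[OF w] g(1)] by (intro F.submod_finsum[OF V] funcsetI) blast
qed

lemma rho_surj:
  assumes v: "v \<in> V"
  shows "\<exists>w\<in>carrier E. \<exists>u\<in>U. v = \<rho> w \<oplus>\<^bsub>F\<^esub> u"
proof -
  have I: "submodule (\<rho> ` carrier E) R F" by (intro rho.image_submodule E.carrier_is_submodule)
  have "e \<in> \<rho> ` carrier E" using rho_unit_0 unit_mem[of 0] by (metis imageI le0)
  moreover have "g l \<in> \<rho> ` carrier E" if "l < m" for l
    using rho_unit_Suc[OF that] unit_mem[of "Suc l"] that by (metis imageI Suc_leI)
  ultimately have "lin R F (insert e (g ` {..<m})) \<subseteq> \<rho> ` carrier E"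
    by (intro F.lin_subset I) auto
  then show ?thesis using v gen unfolding F.submod_sum_eq by blast
qed

sublocale step: syzygy_step R E F \<rho> V x i d
proof (intro syzygy_step.intro syzygy_step_axioms.intro rho.module_homomorphism_axioms)
  show "submodule V R F" by (rule V)
  show "x j \<in> carrier R" if "j < d" for j using that by (rule x_closed)
  show "i < d" by (rule i)
  show "\<rho> w \<in> V" if "w \<in> carrier E" for w using that by (rule rho_in)
  show "U \<subseteq> V" by (rule base)
  show "\<exists>w\<in>carrier E. \<exists>u\<in>U. v = \<rho> w \<oplus>\<^bsub>F\<^esub> u" if "v \<in> V" for v using that by (rule rho_surj)
  show "w \<in> comb E x T (carrier E)" if "T \<subseteq> {..<d}" "t < d" "t \<notin> T" "w \<in> carrier E"
    "x t \<odot>\<^bsub>E\<^esub> w \<in> comb E x T (carrier E)" for T t w using that by (rule free_regular)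
  show "v \<in> comb F x {..<t} V <+>\<^bsub>F\<^esub> U" if "t < i" "v \<in> V" "x t \<odot>\<^bsub>F\<^esub> v \<in> comb F x {..<t} V <+>\<^bsub>F\<^esub> U" for t v
    using that by (rule reg)
qed

text \<open>The degrees \<open>es\<close> of the basis vectors are those of their images, so the
  cover preserves degrees and its kernel is graded.\<close>

lemma rho_vcomp:
  assumes w: "w \<in> carrier E"
  shows "\<rho> (vcomp es j w) = vcomp ds j (\<rho> w)"
proof -
  have we: "w 0 \<odot>\<^bsub>F\<^esub> e \<in> carrier F" by (rule smult_F_closed[OF free_coord[OF w] e_carrier])
  have wg: "w (Suc l) \<odot>\<^bsub>F\<^esub> g l \<in> carrier F" if "l < m" for l
    by (rule smult_F_closed[OF free_coord[OF w] g_carrier[OF that]])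
  note sumc = F.M.finsum_closed[OF wg_funcset[OF w]]
  have "vcomp ds j (\<rho> w) = vcomp ds j (w 0 \<odot>\<^bsub>F\<^esub> e) \<oplus>\<^bsub>F\<^esub> vcomp ds j (\<Oplus>\<^bsub>F\<^esub>l\<in>{..<m}. w (Suc l) \<odot>\<^bsub>F\<^esub> g l)"
    using FG.hcomp_add[OF we sumc, of j] unfolding \<rho>_def free_hcomp[OF we] free_hcomp[OF sumc]
    using free_hcomp[OF F.M.a_closed[OF we sumc]] by metis
  also have "vcomp ds j (\<Oplus>\<^bsub>F\<^esub>l\<in>{..<m}. w (Suc l) \<odot>\<^bsub>F\<^esub> g l) =
      (\<Oplus>\<^bsub>F\<^esub>l\<in>{..<m}. hcomp F (vdeg ds n) (w (Suc l) \<odot>\<^bsub>F\<^esub> g l) j)"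
    using FG.hcomp_finsum[OF wg_funcset[OF w], of j] unfolding free_hcomp[OF sumc] .
  also have "\<dots> = (\<Oplus>\<^bsub>F\<^esub>l\<in>{..<m}. vcomp es j w (Suc l) \<odot>\<^bsub>F\<^esub> g l)"
  proof (intro F.M.finsum_cong' refl wg_funcset vdeg_carrier[OF vcomp_mem[OF w]])
    fix l assume "l \<in> {..<m}"
    then have l: "l < m" by simp
    have "hcomp F (vdeg ds n) (w (Suc l) \<odot>\<^bsub>F\<^esub> g l) j = vcomp ds j (w (Suc l) \<odot>\<^bsub>F\<^esub> g l)"
      by (rule free_hcomp[OF wg[OF l]])
    also have "\<dots> = cz (j - b l) (w (Suc l)) \<odot>\<^bsub>F\<^esub> g l"
      by (rule vcomp_smult[OF g(2)[OF l] free_coord[OF w]])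
    finally show "hcomp F (vdeg ds n) (w (Suc l) \<odot>\<^bsub>F\<^esub> g l) j = vcomp es j w (Suc l) \<odot>\<^bsub>F\<^esub> g l"
      by (simp add: vcomp_def es_def)
  qed
  also have "vcomp ds j (w 0 \<odot>\<^bsub>F\<^esub> e) = vcomp es j w 0 \<odot>\<^bsub>F\<^esub> e"
    using vcomp_smult[OF e(2) free_coord[OF w]] by (simp add: vcomp_def es_def)
  finally show ?thesis unfolding \<rho>_def by simp
qed

text \<open>In degree at most c + i - 1 the coefficient of g k has degree at most zero. If it were
  nonzero it would be a unit of the field, and the relation could be solved for g k modulo U,
  against irredundancy. This gains the one degree by which the bound grows at each stage.\<close>

lemma coefficient_zero:
  assumes w: "w \<in> carrier E" "\<rho> w \<in> U" "w \<in> vdeg es (Suc m) j" and j: "j \<le> c + int i - 1" and k: "k < m"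
  shows "w (Suc k) = \<zero>"
proof (rule ccontr)
  assume nz: "w (Suc k) \<noteq> \<zero>"
  have deg: "w (Suc k) \<in> Gz (j - b k)" using vdeg_coord[OF w(3), of "Suc k"] by (simp add: es_def)
  have "\<not> j - b k < 0" using deg nz Gz_neg by auto
  then have "j - b k = int 0" using g(3)[OF k] j by simp
  then have "w (Suc k) \<in> G 0 - {\<zero>}" using deg nz Gz_nat[of 0] by simp
  note inv = subfield_m_inv[OF degree_zero_field this]
  define q where "q = inv (w (Suc k))"
  have q: "q \<in> carrier R" "q \<otimes> w (Suc k) = \<one>"
    using inv RG.H_carrier unfolding q_def by auto
  define C where "C = insert e (g ` {..<m} - {g k})"
  have C: "finite C" "C \<subseteq> carrier F" using e_carrier g_carrier unfolding C_def by auto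
  define Z where "Z = lin R F C <+>\<^bsub>F\<^esub> U"
  note L = F.lin_submodule[OF C]
  have Z: "submodule Z R F" unfolding Z_def by (rule F.submod_sum[OF L U_sub])
  have CZ: "C \<subseteq> Z" using F.lin_superset[OF C] F.submod_sum_left[OF L U_sub] unfolding Z_def by blast
  have UZ: "U \<subseteq> Z" unfolding Z_def by (rule F.submod_sum_right[OF L U_sub])
  have wZ: "w (Suc l) \<odot>\<^bsub>F\<^esub> g l \<in> Z" if "l \<in> {..<m} - {k}" for l
  proof -
    have "g l \<in> C" using that g_inj k unfolding C_def inj_on_def by auto
    then show ?thesis using CZ F.submod(5)[OF Z free_coord[OF w(1)]] by blast
  qed
  have eZ: "w 0 \<odot>\<^bsub>F\<^esub> e \<in> Z"
    by (rule F.submod(5)[OF Z free_coord[OF w(1)]]) (use CZ in \<open>auto simp: C_def\<close>)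
  define s where "s = (\<Oplus>\<^bsub>F\<^esub>l\<in>{..<m} - {k}. w (Suc l) \<odot>\<^bsub>F\<^esub> g l)"
  have sZ: "s \<in> Z" unfolding s_def by (rule F.submod_finsum[OF Z]) (use wZ in blast)
  have kk: "{..<m} = insert k ({..<m} - {k})" using k by auto
  have gk: "w (Suc k) \<odot>\<^bsub>F\<^esub> g k \<in> carrier F"
    by (rule smult_F_closed[OF free_coord[OF w(1)] g_carrier[OF k]])
  have "(\<Oplus>\<^bsub>F\<^esub>l\<in>{..<m}. w (Suc l) \<odot>\<^bsub>F\<^esub> g l) = w (Suc k) \<odot>\<^bsub>F\<^esub> g k \<oplus>\<^bsub>F\<^esub> s"
    unfolding s_def using wg_funcset[OF w(1)] gk
    by (subst kk, intro F.M.finsum_insert) auto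
  then have rho: "\<rho> w = w 0 \<odot>\<^bsub>F\<^esub> e \<oplus>\<^bsub>F\<^esub> (w (Suc k) \<odot>\<^bsub>F\<^esub> g k \<oplus>\<^bsub>F\<^esub> s)" unfolding \<rho>_def by (simp only:)
  have rZ: "\<rho> w \<in> Z" using w(2) UZ by blast
  have eq: "(p \<oplus>\<^bsub>F\<^esub> (y \<oplus>\<^bsub>F\<^esub> t)) \<ominus>\<^bsub>F\<^esub> (p \<oplus>\<^bsub>F\<^esub> t) = y"
    if "p \<in> carrier F" "y \<in> carrier F" "t \<in> carrier F" for p y t
  proof -
    have "p \<oplus>\<^bsub>F\<^esub> (y \<oplus>\<^bsub>F\<^esub> t) = (p \<oplus>\<^bsub>F\<^esub> t) \<oplus>\<^bsub>F\<^esub> y" using that by (simp add: F.M.a_ac del: free_simps)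
    then show ?thesis using F.M.add_diff_cancel_left'[of "p \<oplus>\<^bsub>F\<^esub> t" y] F.M.a_closed that by metis
  qed
  note Zc = F.submod_carrier[OF Z]
  have "\<rho> w \<ominus>\<^bsub>F\<^esub> (w 0 \<odot>\<^bsub>F\<^esub> e \<oplus>\<^bsub>F\<^esub> s) = w (Suc k) \<odot>\<^bsub>F\<^esub> g k"
    unfolding rho by (rule eq[OF Zc[OF eZ] gk Zc[OF sZ]])
  moreover have "\<rho> w \<ominus>\<^bsub>F\<^esub> (w 0 \<odot>\<^bsub>F\<^esub> e \<oplus>\<^bsub>F\<^esub> s) \<in> Z"
    by (rule F.submod(3)[OF Z rZ F.submod(6)[OF Z eZ sZ]])
  ultimately have "q \<odot>\<^bsub>F\<^esub> (w (Suc k) \<odot>\<^bsub>F\<^esub> g k) \<in> Z" using F.submod(5)[OF Z q(1)] by metis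
  moreover have "q \<odot>\<^bsub>F\<^esub> (w (Suc k) \<odot>\<^bsub>F\<^esub> g k) = g k"
    using F.smult_assoc1[OF q(1) free_coord[OF w(1)] g_carrier[OF k]] F.smult_one[OF g_carrier[OF k]] q(2) by metis
  ultimately have "g k \<in> Z" by metis
  then show False using minimal[OF k] unfolding Z_def C_def by blast
qed

text \<open>The new distinguished element is x_i times the basis vector over e: it maps to x_i e,
  which lies in U, and its degree is that of e plus a_i.\<close>

lemma next_stage: "stage R G x a d c J (Suc i) (Suc m) es step.V' (x i \<odot>\<^bsub>E\<^esub> unit_vector R 0)"
proof (intro stage.intro stage_axioms.intro regular_parameters_axioms)
  have xi: "x i \<in> carrier R" using x_closed[OF i] .
  have Ssub: "{Suc i..<d} \<subseteq> {..<d}" by auto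
  note u0 = unit_mem[OF le0]
  let ?e = "x i \<odot>\<^bsub>E\<^esub> unit_vector R 0"
  have U'_mem: "v \<in> step.U' \<longleftrightarrow> v \<in> carrier E \<and> (\<forall>l<Suc m. v l \<in> gen_ideal x {Suc i..<d})" for v
    by (rule free_comb[OF x_funcset[OF Ssub]])
  have zero_I: "\<zero> \<in> gen_ideal x {Suc i..<d}"
    using gen_ideal_ideal[OF x_funcset[OF Ssub]] additive_subgroup.zero_closed ideal.axioms(1) by blast
  show "submodule step.V' R E" by (rule step.V')
  show "vcomp es j v \<in> step.V'" if v: "v \<in> step.V'" for v j
  proof -
    have vE: "v \<in> carrier E" and r: "\<rho> v \<in> U" using v unfolding step.V'_def by auto
    have "vcomp ds j (\<rho> v) \<in> U" by (rule free_comb_vcomp[OF _ r]) auto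
    then show ?thesis
      unfolding step.V'_def using rho_vcomp[OF vE] vdeg_carrier[OF vcomp_mem[OF vE]] by simp
  qed
  show "step.U' \<subseteq> step.V'" by (rule step.U'_V')
  show "?e \<in> step.V'" by (rule step.smult_V'[OF u0])
  show "?e \<in> vdeg es (Suc m) (int (\<Sum>l<Suc i. a l))"
  proof -
    have "?e l \<in> Gz (int (\<Sum>l<Suc i. a l) - es l)" for l
      using x_degree[OF i] xi by (cases l) (auto simp: unit_vector_def es_def simp flip: Gz_nat)
    then show ?thesis unfolding vdeg_def using E.smult_closed[OF xi u0] by blast
  qed
  \<comment> \<open>Coordinate 0 says that x_i r lies in (x_(i+1), ..., x_(d-1)), and x_i is regular
    modulo these.\<close>
  show "r \<in> gen_ideal x {Suc i..<d}" if r: "r \<in> carrier R" "r \<odot>\<^bsub>E\<^esub> ?e \<in> step.U'" for r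
  proof -
    have "(r \<odot>\<^bsub>E\<^esub> ?e) 0 \<in> gen_ideal x {Suc i..<d}" using r(2) unfolding U'_mem by blast
    then have "x i \<otimes> r \<in> gen_ideal x {Suc i..<d}" using r(1) xi by (simp add: unit_vector_def m_comm)
    then show ?thesis by (intro regular[OF Ssub i _ r(1)]) auto
  qed
  show "r \<odot>\<^bsub>E\<^esub> ?e \<in> comb E x {..<Suc i} step.V' <+>\<^bsub>E\<^esub> step.U' \<longleftrightarrow> r \<in> J" if r: "r \<in> carrier R" for r
    using step.colon[OF u0 r] colon[OF r] unfolding rho_unit_0 by blast
  show "v \<in> comb E x {..<t} step.V' <+>\<^bsub>E\<^esub> step.U'"
    if "t < Suc i" "v \<in> step.V'" "x t \<odot>\<^bsub>E\<^esub> v \<in> comb E x {..<t} step.V' <+>\<^bsub>E\<^esub> step.U'" for t v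
    using that by (rule step.regular_V')
  show "\<exists>r\<in>carrier R. \<exists>u\<in>step.U'. v = r \<odot>\<^bsub>E\<^esub> ?e \<oplus>\<^bsub>E\<^esub> u"
    if v: "v \<in> step.V'" "v \<in> vdeg es (Suc m) j" "j < c + int (Suc i) - 1" for v j
  proof -
    have vE: "v \<in> carrier E" and r: "\<rho> v \<in> U" using v(1) unfolding step.V'_def by auto
    have v0: "v 0 \<in> carrier R" using free_coord[OF vE] .
    have z: "v (Suc k) = \<zero>" if "k < m" for k
      using coefficient_zero[OF vE r v(2) _ that] v(3) by simp
    have "(\<Oplus>\<^bsub>F\<^esub>l\<in>{..<m}. v (Suc l) \<odot>\<^bsub>F\<^esub> g l) = \<zero>\<^bsub>F\<^esub>"
      using z F.smult_l_null[OF g_carrier] by (intro F.M.add.finprod_one_eqI) (simp del: free_simps)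
    then have "\<rho> v = v 0 \<odot>\<^bsub>F\<^esub> e"
      unfolding \<rho>_def using F.M.r_zero[OF smult_F_closed[OF v0 e_carrier]] by (simp only:)
    \<comment> \<open>Only coordinate 0 of v survives, and freeness of e modulo U puts it into (x_i,
      ..., x_(d-1)). Splitting off the multiple of x_i yields a multiple of the new element; the
      rest lies in U'.\<close>
    with r have "v 0 \<odot>\<^bsub>F\<^esub> e \<in> U" by metis
    then have v0I: "v 0 \<in> gen_ideal x {i..<d}" by (rule free[OF v0])
    interpret S: module R "self_module R" by (rule self_module)
    have ins: "{i..<d} = insert i {Suc i..<d}" using i by auto
    have xins: "x \<in> insert i {Suc i..<d} \<rightarrow> carrier R" using i by (intro x_funcset) auto
    obtain q z0 where q: "q \<in> carrier R" "z0 \<in> gen_ideal x {Suc i..<d}" "v 0 = x i \<otimes> q \<oplus> z0"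
      using v0I S.comb_insert[of "{Suc i..<d}" i x "carrier R", OF _ _ xins]
      unfolding ins gen_ideal_eq_comb by auto
    have z0c: "z0 \<in> carrier R"
      using q(2) ideal.Icarr[OF gen_ideal_ideal[OF x_funcset[OF Ssub]]] by blast
    define u where "u l = (if l = 0 then z0 else \<zero>)" for l :: nat
    have "u \<in> step.U'"
      unfolding U'_mem using q(2) z0c zero_I by (auto simp: u_def free_mem)
    moreover have "v = q \<odot>\<^bsub>E\<^esub> ?e \<oplus>\<^bsub>E\<^esub> u"
    proof
      fix l
      show "v l = (q \<odot>\<^bsub>E\<^esub> ?e \<oplus>\<^bsub>E\<^esub> u) l"
      proof (cases l)
        case 0
        then show ?thesis using q xi by (simp add: unit_vector_def u_def m_comm)
      next
        case (Suc k)
        have "v (Suc k) = \<zero>" using z vE by (cases "k < m") (auto simp: free_mem)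
        then show ?thesis using Suc q(1) xi by (simp add: unit_vector_def u_def)
      qed
    qed
    ultimately show ?thesis using q(1) by blast
  qed
qed

end

lemma (in stage) next_stage_exists:
  assumes i: "i < d"
  shows "\<exists>n' ds' V' e'. stage R G x a d c J (Suc i) n' ds' V' e'"
proof -
  obtain C where C: "complements_e C" and min: "\<And>g. g \<in> C \<Longrightarrow> g \<notin> lin R F (insert e (C - {g})) <+>\<^bsub>F\<^esub> U"
    using minimal_complement by blast
  have fC: "finite C" using C unfolding complements_e_def by blast
  obtain g where g: "bij_betw g {..<card C} C"
    using ex_bij_betw_nat_finite[OF fC] unfolding atLeast0LessThan by blast
  have gC: "g ` {..<card C} = C" "inj_on g {..<card C}" using g unfolding bij_betw_def by auto
  have "\<forall>l. \<exists>j. l < card C \<longrightarrow> c + int i - 1 \<le> j \<and> g l \<in> vdeg ds n j"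
    using C gC(1) unfolding complements_e_def by blast
  then obtain b where b: "\<And>l. l < card C \<Longrightarrow> c + int i - 1 \<le> b l \<and> g l \<in> vdeg ds n (b l)" by metis
  interpret stage_cover R G x a d c J i n ds V e "card C" g b
  proof (intro stage_cover.intro stage_cover_axioms.intro stage_axioms)
    fix l assume l: "l < card C"
    then have lC: "g l \<in> C" using gC(1) by blast
    show "g l \<in> V" using lC C unfolding complements_e_def by blast
    show "g l \<in> vdeg ds n (b l)" "c + int i - 1 \<le> b l" using b[OF l] by auto
    show "g l \<notin> lin R F (insert e (g ` {..<card C} - {g l})) <+>\<^bsub>F\<^esub> U"
      unfolding gC(1) by (rule min[OF lC])
  next
    show "V \<subseteq> lin R F (insert e (g ` {..<card C})) <+>\<^bsub>F\<^esub> U"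
      using C unfolding gC(1) complements_e_def by blast
  qed (use gC i in auto)
  show ?thesis using next_stage by blast
qed

context regular_parameters
begin

text \<open>The stages begin at 1 with J/(x_1, ..., x_(d-1)) inside R/(x_1, ..., x_(d-1)),
  represented in R^1 with e = x_0. As x_0 is regular there and J contains the other parameters, r
  x_0 lies in x_0 J + (x_1, ..., x_(d-1)) exactly if r lies in J.\<close>

lemma final_stage_exists:
  assumes J: "ideal J R" "gen_ideal x {..<d} \<subseteq> J" "\<And>r j. r \<in> J \<Longrightarrow> cz j r \<in> J"
    and J_low: "\<And>r j. r \<in> J \<Longrightarrow> r \<in> Gz j \<Longrightarrow> j < c \<Longrightarrow> r \<in> gen_ideal x {..<d}"
    and d: "0 < d"
  shows "\<exists>n ds V e. stage R G x a d c J d n ds V e"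
proof -
  interpret J: ideal J R by (rule J(1))
  interpret F: module R "free_module R 1" by (rule free_module)
  interpret S: module R "self_module R" by (rule self_module)
  define V where "V = {v \<in> carrier (free_module R 1). v 0 \<in> J}"
  define e where "e = x 0 \<odot>\<^bsub>free_module R 1\<^esub> unit_vector R 0"
  let ?F = "free_module R 1" and ?U = "comb (free_module R 1) x {1..<d} (carrier (free_module R 1))"
  have x0: "x 0 \<in> carrier R" using x_closed d by blast
  have sub: "{1..<d} \<subseteq> {..<d}" by auto
  have U_mem: "v \<in> ?U \<longleftrightarrow> v \<in> carrier ?F \<and> v 0 \<in> gen_ideal x {1..<d}" for v
    unfolding free_comb[OF x_funcset[OF sub]] by auto
  have UI: "ideal (gen_ideal x {1..<d}) R" by (rule gen_ideal_ideal[OF x_funcset[OF sub]])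
  have "gen_ideal x {1..<d} \<subseteq> gen_ideal x {..<d}" using x_closed by (intro gen_ideal_mono) auto
  then have UJ: "gen_ideal x {1..<d} \<subseteq> J" using J(2) by blast
  have Usub: "submodule ?U R ?F" by (intro F.comb_submodule F.carrier_is_submodule x_funcset sub)
  have u0: "unit_vector R 0 \<in> carrier ?F" by (rule unit_vector_mem) simp
  have ec: "e \<in> carrier ?F" unfolding e_def by (rule F.smult_closed[OF x0 u0])
  have e0: "e 0 = x 0" using x0 by (simp add: e_def unit_vector_def)
  have neg: "(\<ominus>\<^bsub>?F\<^esub> v) 0 = \<ominus> v 0" if "v \<in> carrier ?F" for v
  proof -
    have "\<ominus>\<^bsub>?F\<^esub> v = (\<ominus> \<one>) \<odot>\<^bsub>?F\<^esub> v"
      using F.smult_l_minus[of \<one> v] F.smult_one[of v] that by (simp del: free_simps)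
    then show ?thesis using free_coord[OF that] by (simp add: l_minus)
  qed
  have V: "submodule V R ?F"
  proof (rule F.submoduleI)
    show "V \<subseteq> carrier ?F" by (auto simp: V_def)
    show "\<zero>\<^bsub>?F\<^esub> \<in> V" by (auto simp: V_def free_mem)
    fix v assume v: "v \<in> V"
    then show "\<ominus>\<^bsub>?F\<^esub> v \<in> V" using neg[of v] F.M.a_inv_closed unfolding V_def by (auto simp del: free_simps)
    show "r \<odot>\<^bsub>?F\<^esub> v \<in> V" if "r \<in> carrier R" for r
      using v that J.I_l_closed by (auto simp: V_def free_mem)
    show "v \<oplus>\<^bsub>?F\<^esub> w \<in> V" if "w \<in> V" for w
      using v that by (auto simp: V_def free_mem)
  qed
  have eV: "e \<in> V"
    unfolding V_def using ec e0 J(2) gen_ideal_gen[of "{..<d}" x 0] x_funcset d by auto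
  have W0: "comb ?F x {..<0} V <+>\<^bsub>?F\<^esub> ?U = ?U"
  proof -
    have "comb ?F x {..<0} V = {\<zero>\<^bsub>?F\<^esub>}" unfolding lessThan_0 by (rule F.comb_empty)
    then show ?thesis
      using F.M.l_zero F.submod_carrier[OF Usub] unfolding F.submod_sum_eq by (force simp del: free_simps)
  qed
  have "stage R G x a d c J 1 1 (\<lambda>_. 0) V e"
  proof (intro stage.intro stage_axioms.intro regular_parameters_axioms)
    show "submodule V R ?F" by (rule V)
    show "vcomp (\<lambda>_. 0) j v \<in> V" if "v \<in> V" for v j
    proof -
      have "v \<in> carrier ?F" "v 0 \<in> J" using that by (auto simp: V_def)
      moreover have "vcomp (\<lambda>_. 0) j v 0 = cz j (v 0)" by (simp add: vcomp_def)
      ultimately show ?thesis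
        unfolding V_def using vdeg_carrier[OF vcomp_mem] J(3) by (metis (mono_tags, lifting) mem_Collect_eq)
    qed
    show "?U \<subseteq> V" using UJ U_mem unfolding V_def by blast
    show "e \<in> V" by (rule eV)
    show "e \<in> vdeg (\<lambda>_. 0) 1 (int (\<Sum>l<1. a l))"
      using ec e0 x_degree[OF d] unfolding vdeg_def by simp
    show "r \<in> gen_ideal x {1..<d}" if r: "r \<in> carrier R" "r \<odot>\<^bsub>?F\<^esub> e \<in> ?U" for r
    proof -
      have "x 0 \<otimes> r \<in> gen_ideal x {1..<d}" using r e0 x0 unfolding U_mem by (simp add: m_comm)
      then show ?thesis by (intro regular[OF sub d _ r(1)]) auto
    qed
    show "\<exists>r\<in>carrier R. \<exists>u\<in>?U. v = r \<odot>\<^bsub>?F\<^esub> e \<oplus>\<^bsub>?F\<^esub> u"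
      if v: "v \<in> V" "v \<in> vdeg (\<lambda>_. 0) 1 j" "j < c + int 1 - 1" for v j
    proof -
      have vc: "v \<in> carrier ?F" and "v 0 \<in> J" using v(1) by (auto simp: V_def)
      \<comment> \<open>The bound at stage 1 is c itself. Below degree c the elements of J lie in I
        = (x_0) + (x_1, ..., x_(d-1)), so they are multiples of e = x_0 modulo U.\<close>
      then have "v 0 \<in> gen_ideal x {..<d}"
        using J_low[of "v 0" j] vdeg_coord[OF v(2), of 0] v(3) by simp
      moreover have ins: "{..<d} = insert 0 {1..<d}" using d by auto
      moreover have "x \<in> insert 0 {1..<d} \<rightarrow> carrier R" using d by (intro x_funcset) auto
      ultimately obtain q z0 where q: "q \<in> carrier R" "z0 \<in> gen_ideal x {1..<d}" "v 0 = x 0 \<otimes> q \<oplus> z0"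
        using S.comb_insert[of "{1..<d}" 0 x "carrier R"] unfolding gen_ideal_eq_comb by auto
      have z0c: "z0 \<in> carrier R" using q(2) ideal.Icarr[OF UI] by blast
      define u where "u l = (if l = 0 then z0 else \<zero>)" for l :: nat
      have "u \<in> carrier ?F" "u 0 = z0" using z0c by (auto simp: u_def free_mem)
      then have "u \<in> ?U" using q(2) U_mem by blast
      moreover have "v = q \<odot>\<^bsub>?F\<^esub> e \<oplus>\<^bsub>?F\<^esub> u"
      proof
        fix l
        show "v l = (q \<odot>\<^bsub>?F\<^esub> e \<oplus>\<^bsub>?F\<^esub> u) l"
        proof (cases "l = 0")
          case True
          then show ?thesis using q x0 e0 by (simp add: u_def m_comm)
        next
          case False
          then have "1 \<le> l" by simp
          then have "v l = \<zero>" "e l = \<zero>" using vc ec unfolding free_mem by blast+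
          then show ?thesis using False q(1) by (simp add: u_def)
        qed
      qed
      ultimately show ?thesis using q(1) by blast
    qed
    show "r \<odot>\<^bsub>?F\<^esub> e \<in> comb ?F x {..<1} V <+>\<^bsub>?F\<^esub> ?U \<longleftrightarrow> r \<in> J" if r: "r \<in> carrier R" for r
    proof -
      have i0: "{..<1::nat} = insert 0 {}" by auto
      have rz: "x 0 \<odot>\<^bsub>?F\<^esub> v \<oplus>\<^bsub>?F\<^esub> \<zero>\<^bsub>?F\<^esub> = x 0 \<odot>\<^bsub>?F\<^esub> v" if "v \<in> V" for v
        by (rule F.M.r_zero[OF F.smult_closed[OF x0 F.submod_carrier[OF V that]]])
      have "comb ?F x {..<1} V = {x 0 \<odot>\<^bsub>?F\<^esub> v \<oplus>\<^bsub>?F\<^esub> u | v u. v \<in> V \<and> u \<in> comb ?F x {} V}"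
        unfolding i0 using x0 F.submoduleE(1)[OF V] by (intro F.comb_insert) auto
      also have "\<dots> = {x 0 \<odot>\<^bsub>?F\<^esub> v | v. v \<in> V}"
        unfolding F.comb_empty
      proof (intro equalityI subsetI)
        fix y assume "y \<in> {x 0 \<odot>\<^bsub>?F\<^esub> v \<oplus>\<^bsub>?F\<^esub> u | v u. v \<in> V \<and> u \<in> {\<zero>\<^bsub>?F\<^esub>}}"
        then obtain v where "v \<in> V" "y = x 0 \<odot>\<^bsub>?F\<^esub> v \<oplus>\<^bsub>?F\<^esub> \<zero>\<^bsub>?F\<^esub>" by blast
        then show "y \<in> {x 0 \<odot>\<^bsub>?F\<^esub> v | v. v \<in> V}" using rz by blast
      next
        fix y assume "y \<in> {x 0 \<odot>\<^bsub>?F\<^esub> v | v. v \<in> V}"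
        then obtain v where v: "v \<in> V" "y = x 0 \<odot>\<^bsub>?F\<^esub> v" by blast
        then have "y = x 0 \<odot>\<^bsub>?F\<^esub> v \<oplus>\<^bsub>?F\<^esub> \<zero>\<^bsub>?F\<^esub>" using rz by metis
        with v show "y \<in> {x 0 \<odot>\<^bsub>?F\<^esub> v \<oplus>\<^bsub>?F\<^esub> u | v u. v \<in> V \<and> u \<in> {\<zero>\<^bsub>?F\<^esub>}}" by blast
      qed
      finally have c1: "comb ?F x {..<1} V = {x 0 \<odot>\<^bsub>?F\<^esub> v | v. v \<in> V}" .
      show ?thesis
      proof
        assume "r \<odot>\<^bsub>?F\<^esub> e \<in> comb ?F x {..<1} V <+>\<^bsub>?F\<^esub> ?U"
        then obtain v u where vu: "v \<in> V" "u \<in> ?U" "r \<odot>\<^bsub>?F\<^esub> e = x 0 \<odot>\<^bsub>?F\<^esub> v \<oplus>\<^bsub>?F\<^esub> u"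
          unfolding c1 F.submod_sum_eq by blast
        have v0: "v 0 \<in> J" "v 0 \<in> carrier R" using vu(1) J.Icarr by (auto simp: V_def)
        have u0: "u 0 \<in> gen_ideal x {1..<d}" "u 0 \<in> carrier R"
          using vu(2) ideal.Icarr[OF UI] unfolding U_mem by auto
        have "r \<otimes> x 0 = x 0 \<otimes> v 0 \<oplus> u 0" using fun_cong[OF vu(3), of 0] e0 by simp
        then have "x 0 \<otimes> r = x 0 \<otimes> v 0 \<oplus> u 0" using r x0 by (simp add: m_comm)
        then have "x 0 \<otimes> (r \<ominus> v 0) = u 0"
          using r x0 v0(2) u0(2) add_diff_cancel_left'[of "x 0 \<otimes> v 0" "u 0"]
          by (simp add: a_minus_def r_distr r_minus)
        then have xr: "x 0 \<otimes> (r \<ominus> v 0) \<in> gen_ideal x {1..<d}" using u0(1) by simp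
        have "r \<ominus> v 0 \<in> gen_ideal x {1..<d}"
          by (rule regular[OF sub d _ _ xr]) (use r v0(2) in simp_all)
        then have "(r \<ominus> v 0) \<oplus> v 0 \<in> J" using UJ v0(1) by (intro J.a_closed) auto
        then show "r \<in> J" using r v0(2) by (simp add: a_minus_def a_assoc l_neg)
      next
        assume rJ: "r \<in> J"
        define v where "v = r \<odot>\<^bsub>?F\<^esub> unit_vector R 0"
        have "v \<in> V" unfolding V_def v_def using F.smult_closed[OF r u0] rJ r by (simp add: unit_vector_def)
        moreover have "r \<odot>\<^bsub>?F\<^esub> e = x 0 \<odot>\<^bsub>?F\<^esub> v"
          unfolding v_def e_def using r x0 by (auto simp: unit_vector_def m_comm)
        ultimately have "r \<odot>\<^bsub>?F\<^esub> e \<in> comb ?F x {..<1} V" unfolding c1 by blast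
        moreover have "submodule (comb ?F x {..<1} V) R ?F" using d by (intro F.comb_submodule V x_funcset) auto
        ultimately show "r \<odot>\<^bsub>?F\<^esub> e \<in> comb ?F x {..<1} V <+>\<^bsub>?F\<^esub> ?U"
          using F.submod_sum_left[OF _ Usub] by blast
      qed
    qed
    show "v \<in> comb ?F x {..<t} V <+>\<^bsub>?F\<^esub> ?U"
      if "t < 1" "v \<in> V" "x t \<odot>\<^bsub>?F\<^esub> v \<in> comb ?F x {..<t} V <+>\<^bsub>?F\<^esub> ?U" for t v
    proof -
      have t: "t = 0" using that(1) by simp
      have "v \<in> carrier ?F" using that(2) by (simp add: V_def)
      then show ?thesis using that(3) free_regular[OF sub d, of v 1] unfolding t W0 by simp
    qed
  qed
  then have "\<exists>n ds V e. stage R G x a d c J (Suc 0) n ds V e" by (metis One_nat_def)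
  \<comment> \<open>Since the start is stage 1, k counts the syzygies taken; k = d - 1 gives the
    last stage.\<close>
  then have "\<exists>n ds V e. stage R G x a d c J (Suc k) n ds V e" if "Suc k \<le> d" for k
    using that
  proof (induction k)
    case (Suc k)
    then obtain n ds V e where "stage R G x a d c J (Suc k) n ds V e" by auto
    from stage.next_stage_exists[OF this] Suc.prems show ?case by simp
  qed
  from this[of "d - 1"] d show ?thesis by simp
qed

end

section \<open>Indecomposable summands\<close>

lemma (in module_homomorphism) lin_image:
  assumes "finite A" "A \<subseteq> carrier M" "carrier M = lin R M A"
  shows "h ` carrier M = lin R N (h ` A)"
proof
  have hA: "finite (h ` A)" "h ` A \<subseteq> carrier N" using assms by auto
  have "lin R M A \<subseteq> {v \<in> carrier M. h v \<in> lin R N (h ` A)}"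
    using assms N.lin_superset[OF hA]
    by (intro M.lin_subset preimage_submodule N.lin_submodule hA) auto
  then show "h ` carrier M \<subseteq> lin R N (h ` A)" using assms(3) by blast
  show "lin R N (h ` A) \<subseteq> h ` carrier M"
    using assms by (intro N.lin_subset image_submodule M.carrier_is_submodule) auto
qed

context module
begin

lemma sub_module: "submodule V R M \<Longrightarrow> module R (M\<lparr>carrier := V\<rparr>)"
  using submodule.submodule_is_module module_axioms by blast

lemma submod_sum_comm:
  assumes V: "submodule V R M" and W: "submodule W R M"
  shows "V <+>\<^bsub>M\<^esub> W = W <+>\<^bsub>M\<^esub> V"
  using submod_sum_least[OF submod_sum[OF W V] submod_sum_right[OF W V] submod_sum_left[OF W V]]
    submod_sum_least[OF submod_sum[OF V W] submod_sum_right[OF V W] submod_sum_left[OF V W]]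
  by (rule equalityI)

lemma submodule_of_sub:
  assumes K: "submodule K R M" and K': "submodule K' R (M\<lparr>carrier := K\<rparr>)"
  shows "K' \<subseteq> K" "submodule K' R M"
proof -
  interpret N: module R "M\<lparr>carrier := K\<rparr>" by (rule sub_module[OF K])
  note sm = N.submoduleE[OF K'] N.submod_zero[OF K']
  show sub: "K' \<subseteq> K" using sm(1) by simp
  then have c: "v \<in> carrier M" if "v \<in> K'" for v using that submod_carrier[OF K] by blast
  show "submodule K' R M"
  proof (rule submoduleI)
    show "K' \<subseteq> carrier M" using c by blast
    show "\<zero>\<^bsub>M\<^esub> \<in> K'" using sm by simp
    show sm': "r \<odot>\<^bsub>M\<^esub> v \<in> K'" if "r \<in> carrier R" "v \<in> K'" for r v using sm(4)[OF that] by simp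
    show "v \<oplus>\<^bsub>M\<^esub> w \<in> K'" if "v \<in> K'" "w \<in> K'" for v w using sm(5)[OF that] by simp
    show "\<ominus>\<^bsub>M\<^esub> v \<in> K'" if "v \<in> K'" for v
      using sm'[of "\<ominus> \<one>" v] that c by (simp add: smult_l_minus)
  qed
qed

lemma ideal_times_module_sub:
  assumes K: "submodule K R M" and xs: "set xs \<subseteq> carrier R" and t: "t \<le> length xs"
  shows "ideal_times_module (take t xs) (M\<lparr>carrier := K\<rparr>) = comb M ((!) xs) {..<t} K"
proof -
  have x: "xs ! j \<in> carrier R" if "j < t" for j
    using that t xs nth_mem[of j xs] by auto
  have "ideal_times_module (take t xs) (M\<lparr>carrier := K\<rparr>) = comb (M\<lparr>carrier := K\<rparr>) ((!) (take t xs)) {..<t} K"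
    unfolding ideal_times_module_eq_comb using t by (simp add: min_absorb2)
  also have "\<dots> = comb M ((!) (take t xs)) {..<t} K"
    using x by (intro comb_carrier_update K) auto
  also have "\<dots> = comb M ((!) xs) {..<t} K"
    using x submoduleE(1)[OF K] by (intro comb_cong) auto
  finally show ?thesis .
qed

end

section \<open>Graded submodules\<close>

context graded_module
begin

lemma graded_group: "graded_group M Mg"
  by unfold_locales (rule module_grading)

sublocale gr: graded_group M Mg
  by (rule graded_group)

definition graded_submodule :: "'b set \<Rightarrow> bool" where
  "graded_submodule K \<longleftrightarrow> submodule K R M \<and> (\<forall>v\<in>K. \<forall>i. hcomp M Mg v i \<in> K)"

lemma decomposition_sub_iff:
  assumes K: "submodule K R M" and f: "\<And>i. f i \<in> K"
  shows "homogeneous_decomposition (M\<lparr>carrier := K\<rparr>) (\<lambda>i. K \<inter> Mg i) v f \<longleftrightarrow>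
    homogeneous_decomposition M Mg v f"
  using finsum_carrier_update[OF K, of f] f
  unfolding homogeneous_decomposition_def by auto

lemma graded_submodule_is_graded:
  assumes gK: "graded_submodule K" and G: "\<And>i. G i \<subseteq> carrier R"
  shows "graded_module R G (M\<lparr>carrier := K\<rparr>) (\<lambda>i. K \<inter> Mg i)"
proof -
  have K: "submodule K R M" and comp: "\<And>v i. v \<in> K \<Longrightarrow> hcomp M Mg v i \<in> K"
    using gK unfolding graded_submodule_def by auto
  have "additive_subgroup (K \<inter> Mg i) (M\<lparr>carrier := K\<rparr>)" for i
  proof (rule additive_subgroup.intro)
    have "subgroup K (add_monoid M)" by (rule submodule.axioms(1)[OF K])
    moreover have "subgroup (Mg i) (add_monoid M)" by (rule additive_subgroup.a_subgroup[OF gr.H_subgroup])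
    ultimately have "subgroup (K \<inter> Mg i) ((add_monoid M)\<lparr>carrier := K\<rparr>)"
      using M.add.subgroup_incl M.add.subgroups_Inter_pair by blast
    then show "subgroup (K \<inter> Mg i) (add_monoid (M\<lparr>carrier := K\<rparr>))" by simp
  qed
  moreover have "\<exists>!f. homogeneous_decomposition (M\<lparr>carrier := K\<rparr>) (\<lambda>i. K \<inter> Mg i) v f"
    if "v \<in> carrier (M\<lparr>carrier := K\<rparr>)" for v
  proof -
    have v: "v \<in> K" "v \<in> carrier M" using that submod_carrier[OF K] by auto
    have ex: "homogeneous_decomposition (M\<lparr>carrier := K\<rparr>) (\<lambda>i. K \<inter> Mg i) v (hcomp M Mg v)"
      using gr.hcomp_decomposition[OF v(2)] decomposition_sub_iff[OF K comp[OF v(1)], of v] by simp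
    moreover have "f = hcomp M Mg v"
      if f: "homogeneous_decomposition (M\<lparr>carrier := K\<rparr>) (\<lambda>i. K \<inter> Mg i) v f" for f
    proof -
      have "f i \<in> K" for i using f unfolding homogeneous_decomposition_def by blast
      then have "homogeneous_decomposition M Mg v f" using f decomposition_sub_iff[OF K, of f v] by simp
      then show ?thesis using gr.hcomp_eqI v(2) by simp
    qed
    ultimately show ?thesis by blast
  qed
  ultimately have "is_grading (M\<lparr>carrier := K\<rparr>) (\<lambda>i. K \<inter> Mg i)"
    unfolding is_grading_def by blast
  moreover have "r \<odot>\<^bsub>M\<lparr>carrier := K\<rparr>\<^esub> v \<in> K \<inter> Mg (int i + j)" if "r \<in> G i" "v \<in> K \<inter> Mg j" for r i v j
    using smult_graded[of r i v j] submod(5)[OF K, of r v] that G[of i] by auto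
  ultimately show ?thesis
    by (intro graded_module.intro graded_module_axioms.intro sub_module K)
qed

text \<open>A decomposition inside K is also one in M, so by uniqueness the components in M of an
  element of K lie in K.\<close>

lemma graded_submoduleI:
  assumes K: "submodule K R M" and g: "graded_module R G (M\<lparr>carrier := K\<rparr>) (\<lambda>i. K \<inter> Mg i)"
  shows "graded_submodule K"
  unfolding graded_submodule_def
proof (intro conjI K ballI allI)
  fix v i assume v: "v \<in> K"
  interpret N: graded_module R G "M\<lparr>carrier := K\<rparr>" "\<lambda>i. K \<inter> Mg i" by (rule g)
  obtain f where f: "homogeneous_decomposition (M\<lparr>carrier := K\<rparr>) (\<lambda>i. K \<inter> Mg i) v f"
    using N.module_grading v unfolding is_grading_def by auto
  then have fK: "f i \<in> K" for i unfolding homogeneous_decomposition_def by blast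
  then have "homogeneous_decomposition M Mg v f" using f decomposition_sub_iff[OF K, of f v] by simp
  then show "hcomp M Mg v i \<in> K" using gr.hcomp_eqI submod_carrier[OF K v] fK by simp
qed

lemma graded_submodule_zero: "graded_submodule {\<zero>\<^bsub>M\<^esub>}"
  unfolding graded_submodule_def using zero_submodule by simp

lemma graded_submodule_carrier: "graded_submodule (carrier M)"
  unfolding graded_submodule_def using carrier_is_submodule by simp

lemma graded_submodule_sum:
  assumes K: "graded_submodule K" and L: "graded_submodule L"
  shows "graded_submodule (K <+>\<^bsub>M\<^esub> L)"
proof -
  have sub: "submodule K R M" "submodule L R M" using K L unfolding graded_submodule_def by auto
  have "hcomp M Mg v i \<in> K <+>\<^bsub>M\<^esub> L" if v: "v \<in> K <+>\<^bsub>M\<^esub> L" for v i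
  proof -
    obtain k l where kl: "k \<in> K" "l \<in> L" "v = k \<oplus>\<^bsub>M\<^esub> l" using v unfolding submod_sum_eq by blast
    then have "hcomp M Mg v i = hcomp M Mg k i \<oplus>\<^bsub>M\<^esub> hcomp M Mg l i"
      using gr.hcomp_add submod_carrier sub by simp
    moreover have "hcomp M Mg k i \<in> K" "hcomp M Mg l i \<in> L"
      using kl K L unfolding graded_submodule_def by auto
    ultimately show ?thesis unfolding submod_sum_eq by blast
  qed
  then show ?thesis unfolding graded_submodule_def using submod_sum[OF sub] by blast
qed

end

text \<open>Collects what the last stage provides, in terms that do not mention its construction.
  The condition that 1 is not in J keeps e outside (xs)T.\<close>

locale pointed_cm_module = standard_graded_ring R G + graded_module R G T Tg
  for R :: "('a, 'r) ring_scheme" (structure) and G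
    and T :: "('a, 'b, 'm) module_scheme" (structure) and Tg +
  fixes xs :: "'a list" and s :: int and e :: 'b and J :: "'a set"
  assumes fg: "fg_module R T"
    and dim: "krull_dim R = enat (length xs)"
    and xs_irrelevant: "set xs \<subseteq> irrelevant_ideal R G"
    and regular: "\<And>t v. t < length xs \<Longrightarrow> v \<in> carrier T \<Longrightarrow>
      (xs ! t) \<odot>\<^bsub>T\<^esub> v \<in> comb T ((!) xs) {..<t} (carrier T) \<Longrightarrow> v \<in> comb T ((!) xs) {..<t} (carrier T)"
    and e: "e \<in> Tg s"
    and span: "\<And>z. z \<in> Tg s \<Longrightarrow> \<exists>r\<in>G 0. z = r \<odot>\<^bsub>T\<^esub> e"
    and colon: "\<And>r. r \<in> carrier R \<Longrightarrow>
      r \<odot>\<^bsub>T\<^esub> e \<in> comb T ((!) xs) {..<length xs} (carrier T) \<longleftrightarrow> r \<in> J"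
    and proper: "\<one>\<^bsub>R\<^esub> \<notin> J"
begin

lemma xs_carrier: "set xs \<subseteq> carrier R"
  using xs_irrelevant unfolding irrelevant_ideal_def by blast

lemma x_funcset: "t \<le> length xs \<Longrightarrow> (!) xs \<in> {..<t} \<rightarrow> carrier R"
  using xs_carrier nth_mem by (intro funcsetI) (simp, blast dest: less_le_trans)

lemma e_carrier: "e \<in> carrier T"
  using gr.H_carrier e by blast

lemma e_notin: "e \<notin> comb T ((!) xs) {..<length xs} (carrier T)"
  using colon[OF one_closed] proper smult_one[OF e_carrier] by simp

lemma e_nonzero: "e \<noteq> \<zero>\<^bsub>T\<^esub>"
  using e_notin submod_zero[OF comb_submodule[OF carrier_is_submodule x_funcset[OF order_refl]]] by blast

definition complementary :: "'b set \<Rightarrow> 'b set \<Rightarrow> bool" where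
  "complementary K L \<longleftrightarrow> graded_submodule K \<and> graded_submodule L \<and> e \<in> K \<and>
     K \<inter> L = {\<zero>\<^bsub>T\<^esub>} \<and> K <+>\<^bsub>T\<^esub> L = carrier T"

text \<open>The decomposition T = K + L splits (xs)T into (xs)K and (xs)L. For an element of K the
  part from L lies in both K and L, so it is zero.\<close>

lemma comb_summand:
  assumes KL: "complementary K L" and t: "t \<le> length xs"
    and v: "v \<in> K" "v \<in> comb T ((!) xs) {..<t} (carrier T)"
  shows "v \<in> comb T ((!) xs) {..<t} K"
proof -
  have K: "submodule K R T" and L: "submodule L R T"
    using KL unfolding complementary_def graded_submodule_def by auto
  note cK = comb_submodule[OF K x_funcset[OF t]] and cL = comb_submodule[OF L x_funcset[OF t]]
  have "comb T ((!) xs) {..<t} (carrier T) \<subseteq> comb T ((!) xs) {..<t} K <+>\<^bsub>T\<^esub> comb T ((!) xs) {..<t} L"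
  proof (rule comb_subset[OF submod_sum[OF cK cL]])
    fix j w assume j: "j \<in> {..<t}" and "w \<in> carrier T"
    then have "w \<in> K <+>\<^bsub>T\<^esub> L" using KL unfolding complementary_def by simp
    then obtain k l where kl: "k \<in> K" "l \<in> L" "w = k \<oplus>\<^bsub>T\<^esub> l" unfolding submod_sum_eq by blast
    have xj: "xs ! j \<in> carrier R" using x_funcset[OF t] j by blast
    have "(xs ! j) \<odot>\<^bsub>T\<^esub> w = (xs ! j) \<odot>\<^bsub>T\<^esub> k \<oplus>\<^bsub>T\<^esub> (xs ! j) \<odot>\<^bsub>T\<^esub> l"
      unfolding kl(3) by (rule smult_r_distr[OF xj submod_carrier[OF K kl(1)] submod_carrier[OF L kl(2)]])
    moreover have "(xs ! j) \<odot>\<^bsub>T\<^esub> k \<in> comb T ((!) xs) {..<t} K"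
      by (rule comb_gen[OF _ j K x_funcset[OF t] kl(1)]) simp
    moreover have "(xs ! j) \<odot>\<^bsub>T\<^esub> l \<in> comb T ((!) xs) {..<t} L"
      by (rule comb_gen[OF _ j L x_funcset[OF t] kl(2)]) simp
    ultimately show "(xs ! j) \<odot>\<^bsub>T\<^esub> w \<in> comb T ((!) xs) {..<t} K <+>\<^bsub>T\<^esub> comb T ((!) xs) {..<t} L"
      unfolding submod_sum_eq by blast
  qed
  with v(2) obtain p q where pq: "p \<in> comb T ((!) xs) {..<t} K" "q \<in> comb T ((!) xs) {..<t} L" "v = p \<oplus>\<^bsub>T\<^esub> q"
    unfolding submod_sum_eq by blast
  have pK: "p \<in> K" and qL: "q \<in> L"
    using pq comb_le[OF K x_funcset[OF t]] comb_le[OF L x_funcset[OF t]] by auto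
  have pc: "p \<in> carrier T" "q \<in> carrier T" using submod_carrier K L pK qL by auto
  have "v \<ominus>\<^bsub>T\<^esub> p = q" unfolding pq(3) by (rule M.add_diff_cancel_left'[OF pc])
  then have "q \<in> K" using submod(3)[OF K v(1) pK] by simp
  with qL KL have "q = \<zero>\<^bsub>T\<^esub>" unfolding complementary_def by blast
  then show ?thesis using pq pc by simp
qed

lemma summand_ideal_times:
  assumes KL: "complementary K L"
  shows "ideal_times_module xs (T\<lparr>carrier := K\<rparr>) = comb T ((!) xs) {..<length xs} K"
  using ideal_times_module_sub[OF _ xs_carrier order_refl] KL
  unfolding complementary_def graded_submodule_def by simp

text \<open>By \<open>comb_summand\<close> the sequence stays regular on K, and e, which lies in K
  but outside (xs)T, shows that (xs)K is not all of K. The upper bound on the depth is the general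
  one.\<close>

lemma summand_mcm:
  assumes KL: "complementary K L"
  shows "graded_mcm R G (T\<lparr>carrier := K\<rparr>) (\<lambda>i. K \<inter> Tg i)"
proof -
  have gK: "graded_submodule K" and K: "submodule K R T" and eK: "e \<in> K"
    using KL unfolding complementary_def graded_submodule_def by auto
  interpret N: module R "T\<lparr>carrier := K\<rparr>" by (rule sub_module[OF K])
  note it = ideal_times_module_sub[OF K xs_carrier]
  have "fg_module R (T\<lparr>carrier := K\<rparr>)"
  proof -
    obtain A where A: "A \<subseteq> carrier T" "finite A" "carrier T = lin R T A"
      using fg unfolding fg_module_iff_lin by blast
    then obtain B where B: "B \<subseteq> K" "finite B" "K = lin R T B"
      using submodule_of_lin_fg[OF noetherian_ring_axioms A(2,1) K] submod_carrier[OF K] by blast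
    then show ?thesis
      unfolding fg_module_iff_lin using lin_carrier_update[OF K B(1)] by (intro exI[of _ B]) simp
  qed
  moreover have "depth R (irrelevant_ideal R G) (T\<lparr>carrier := K\<rparr>) = krull_dim R"
  proof (rule antisym)
    show "depth R (irrelevant_ideal R G) (T\<lparr>carrier := K\<rparr>) \<le> krull_dim R"
      by (rule N.depth_le_krull_dim[OF noetherian_ring_axioms])
    have "regular_sequence R (T\<lparr>carrier := K\<rparr>) xs"
      unfolding regular_sequence_def
    proof (intro conjI xs_carrier allI impI ballI)
      fix j m assume j: "j < length xs" and m: "m \<in> carrier (T\<lparr>carrier := K\<rparr>)"
        "(xs ! j) \<odot>\<^bsub>T\<lparr>carrier := K\<rparr>\<^esub> m \<in> ideal_times_module (take j xs) (T\<lparr>carrier := K\<rparr>)"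
      have mK: "m \<in> K" using m(1) by simp
      have "(xs ! j) \<odot>\<^bsub>T\<^esub> m \<in> comb T ((!) xs) {..<j} K" using m(2) it[of j] j by simp
      also have "\<dots> \<subseteq> comb T ((!) xs) {..<j} (carrier T)" by (intro comb_mono submoduleE(1)[OF K])
      finally have "m \<in> comb T ((!) xs) {..<j} (carrier T)"
        by (rule regular[OF j submod_carrier[OF K mK]])
      then show "m \<in> ideal_times_module (take j xs) (T\<lparr>carrier := K\<rparr>)"
        using comb_summand[OF KL _ mK] it[of j] j by simp
    next
      have "comb T ((!) xs) {..<length xs} K \<subseteq> comb T ((!) xs) {..<length xs} (carrier T)"
        by (intro comb_mono submoduleE(1)[OF K])
      then have "e \<notin> comb T ((!) xs) {..<length xs} K" using e_notin by blast
      then show "ideal_times_module xs (T\<lparr>carrier := K\<rparr>) \<noteq> carrier (T\<lparr>carrier := K\<rparr>)"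
        using eK summand_ideal_times[OF KL] by auto
    qed
    then show "krull_dim R \<le> depth R (irrelevant_ideal R G) (T\<lparr>carrier := K\<rparr>)"
      unfolding depth_def dim using xs_irrelevant by (intro Sup_upper) blast
  qed
  ultimately show ?thesis
    unfolding graded_mcm_def using graded_submodule_is_graded[OF gK] RG.H_carrier by blast
qed

text \<open>The degree s components of the two parts of e are multiples of e by field elements. If
  the one from K is zero, e equals the one from L; otherwise dividing by its scalar puts e into
  K.\<close>

lemma e_in_summand:
  assumes gK: "graded_submodule K" "graded_submodule L" and eKL: "e \<in> K <+>\<^bsub>T\<^esub> L" and nL: "e \<notin> L"
  shows "e \<in> K"
proof -
  have K: "submodule K R T" and L: "submodule L R T" using gK unfolding graded_submodule_def by auto
  obtain p q where pq: "p \<in> K" "q \<in> L" "e = p \<oplus>\<^bsub>T\<^esub> q" using eKL unfolding submod_sum_eq by blast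
  have pc: "p \<in> carrier T" "q \<in> carrier T" using pq submod_carrier K L by auto
  have es: "e = hcomp T Tg p s \<oplus>\<^bsub>T\<^esub> hcomp T Tg q s"
    using gr.hcomp_homogeneous[OF e, of s] gr.hcomp_add[OF pc, of s] pq(3) by simp
  have pK: "hcomp T Tg p s \<in> K" and qL: "hcomp T Tg q s \<in> L" using pq gK unfolding graded_submodule_def by auto
  obtain r where r: "r \<in> G 0" "hcomp T Tg p s = r \<odot>\<^bsub>T\<^esub> e" using span[OF gr.hcomp_in[OF pc(1)]] by blast
  show ?thesis
  proof (cases "r = \<zero>")
    case True
    then have "hcomp T Tg p s = \<zero>\<^bsub>T\<^esub>" using r(2) e_carrier by simp
    then have "e = hcomp T Tg q s" using es pc by simp
    then show ?thesis using qL nL by simp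
  next
    case False
    then have "r \<in> G 0 - {\<zero>}" using r(1) by simp
    note inv = subfield_m_inv[OF degree_zero_field this]
    have c: "inv r \<in> carrier R" "r \<in> carrier R" using inv(1) r(1) RG.H_carrier by auto
    have "inv r \<odot>\<^bsub>T\<^esub> hcomp T Tg p s = (inv r \<otimes> r) \<odot>\<^bsub>T\<^esub> e"
      unfolding r(2) using smult_assoc1[OF c e_carrier] by simp
    also have "\<dots> = e" using inv(3) e_carrier by simp
    finally show ?thesis using submod(5)[OF K c(1) pK] by simp
  qed
qed

text \<open>K is chosen so that its complement L is as large as possible. If K split as K1 + K2 with
  e in K1, then K2 + L would be a larger complement, namely of K1.\<close>

theorem indecomposable_summand_exists:
  "\<exists>K L. complementary K L \<and> indecomposable_graded_mcm R G (T\<lparr>carrier := K\<rparr>) (\<lambda>i. K \<inter> Tg i)"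
proof -
  define \<A> where "\<A> = {L. \<exists>K. complementary K L}"
  have "carrier T <+>\<^bsub>T\<^esub> {\<zero>\<^bsub>T\<^esub>} = carrier T"
    using submod_sum_left[OF carrier_is_submodule zero_submodule]
      submod_sum_least[OF carrier_is_submodule order_refl, of "{\<zero>\<^bsub>T\<^esub>}"] by auto
  then have "complementary (carrier T) {\<zero>\<^bsub>T\<^esub>}"
    unfolding complementary_def using graded_submodule_zero graded_submodule_carrier e_carrier by auto
  then have "\<A> \<noteq> {}" unfolding \<A>_def by blast
  moreover have "submodule L R T" if "L \<in> \<A>" for L
    using that unfolding \<A>_def complementary_def graded_submodule_def by blast
  ultimately obtain L where LA: "L \<in> \<A>" and max: "\<forall>L'\<in>\<A>. L \<subseteq> L' \<longrightarrow> L' = L"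
    using maximal_submodule[OF noetherian_ring_axioms fg, of \<A>] by blast
  then obtain K where KL: "complementary K L" unfolding \<A>_def by blast
  have gK: "graded_submodule K" "graded_submodule L" "e \<in> K" "K \<inter> L = {\<zero>\<^bsub>T\<^esub>}" "K <+>\<^bsub>T\<^esub> L = carrier T"
    using KL unfolding complementary_def by auto
  have K: "submodule K R T" and L: "submodule L R T" using gK unfolding graded_submodule_def by auto
  have nosplit: False
    if K12: "graded_submodule K1" "graded_submodule K2" "K2 \<noteq> {\<zero>\<^bsub>T\<^esub>}"
      "K1 \<inter> K2 = {\<zero>\<^bsub>T\<^esub>}" "K1 <+>\<^bsub>T\<^esub> K2 = K" and e1: "e \<in> K1" for K1 K2
  proof -
    have K1: "submodule K1 R T" and K2: "submodule K2 R T" using K12 unfolding graded_submodule_def by auto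
    have s1: "K1 \<subseteq> K" "K2 \<subseteq> K" using submod_sum_left[OF K1 K2] submod_sum_right[OF K1 K2] K12(5) by auto
    define L' where "L' = K2 <+>\<^bsub>T\<^esub> L"
    have gL': "graded_submodule L'" unfolding L'_def by (rule graded_submodule_sum[OF K12(2) gK(2)])
    have L': "submodule L' R T" using gL' unfolding graded_submodule_def by auto
    have sub: "K2 \<subseteq> L'" "L \<subseteq> L'" unfolding L'_def using submod_sum_left[OF K2 L] submod_sum_right[OF K2 L] by auto
    have "K1 \<inter> L' = {\<zero>\<^bsub>T\<^esub>}"
    proof (intro equalityI subsetI)
      fix v assume "v \<in> K1 \<inter> L'"
      then obtain k l where v: "v \<in> K1" "k \<in> K2" "l \<in> L" "v = k \<oplus>\<^bsub>T\<^esub> l" unfolding L'_def submod_sum_eq by blast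
      have kc: "k \<in> carrier T" "l \<in> carrier T" using v submod_carrier K2 L by auto
      have "v \<ominus>\<^bsub>T\<^esub> k = l" unfolding v(4) by (rule M.add_diff_cancel_left'[OF kc])
      moreover have "v \<in> K" "k \<in> K" using v(1,2) s1 by auto
      ultimately have "l \<in> K" using submod(3)[OF K, of v k] by simp
      then have "l = \<zero>\<^bsub>T\<^esub>" using v(3) gK(4) by blast
      then have "v = k" using v(4) kc by simp
      then show "v \<in> {\<zero>\<^bsub>T\<^esub>}" using v K12(4) by blast
    qed (use submod_zero[OF K1] submod_zero[OF L'] in auto)
    moreover have "K1 <+>\<^bsub>T\<^esub> L' = carrier T"
    proof
      show "K1 <+>\<^bsub>T\<^esub> L' \<subseteq> carrier T"
        by (intro submod_sum_least carrier_is_submodule submoduleE(1)[OF K1] submoduleE(1)[OF L'])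
      note S = submod_sum[OF K1 L']
      have "K1 \<subseteq> K1 <+>\<^bsub>T\<^esub> L'" "L' \<subseteq> K1 <+>\<^bsub>T\<^esub> L'" by (rule submod_sum_left[OF K1 L'] submod_sum_right[OF K1 L'])+
      then have "K <+>\<^bsub>T\<^esub> L \<subseteq> K1 <+>\<^bsub>T\<^esub> L'"
        unfolding K12(5)[symmetric] using sub by (intro submod_sum_least S) auto
      then show "carrier T \<subseteq> K1 <+>\<^bsub>T\<^esub> L'" unfolding gK(5) .
    qed
    ultimately have "L' \<in> \<A>"
      unfolding \<A>_def complementary_def using K12(1) gL' e1 by blast
    then have "L' = L" using max sub(2) by blast
    then have "K2 \<subseteq> K \<inter> L" using sub(1) s1(2) by blast
    then have "K2 \<subseteq> {\<zero>\<^bsub>T\<^esub>}" unfolding gK(4) .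
    then show False using K12(3) submod_zero[OF K2] by blast
  qed
  have "indecomposable_graded_mcm R G (T\<lparr>carrier := K\<rparr>) (\<lambda>i. K \<inter> Tg i)"
    unfolding indecomposable_graded_mcm_def
  proof (intro conjI notI)
    show "graded_mcm R G (T\<lparr>carrier := K\<rparr>) (\<lambda>i. K \<inter> Tg i)" by (rule summand_mcm[OF KL])
    show False if "carrier (T\<lparr>carrier := K\<rparr>) = {\<zero>\<^bsub>T\<lparr>carrier := K\<rparr>\<^esub>}"
      using that gK(3) e_nonzero by auto
  next
    assume "\<exists>K' L'. submodule K' R (T\<lparr>carrier := K\<rparr>) \<and> submodule L' R (T\<lparr>carrier := K\<rparr>) \<and>
          graded_mcm R G ((T\<lparr>carrier := K\<rparr>)\<lparr>carrier := K'\<rparr>) (\<lambda>i. K' \<inter> (K \<inter> Tg i)) \<and>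
          graded_mcm R G ((T\<lparr>carrier := K\<rparr>)\<lparr>carrier := L'\<rparr>) (\<lambda>i. L' \<inter> (K \<inter> Tg i)) \<and>
          K' \<noteq> {\<zero>\<^bsub>T\<lparr>carrier := K\<rparr>\<^esub>} \<and> L' \<noteq> {\<zero>\<^bsub>T\<lparr>carrier := K\<rparr>\<^esub>} \<and>
          K' \<inter> L' = {\<zero>\<^bsub>T\<lparr>carrier := K\<rparr>\<^esub>} \<and>
          K' <+>\<^bsub>T\<lparr>carrier := K\<rparr>\<^esub> L' = carrier (T\<lparr>carrier := K\<rparr>)"
    then obtain K1 K2 where K12: "submodule K1 R (T\<lparr>carrier := K\<rparr>)" "submodule K2 R (T\<lparr>carrier := K\<rparr>)"
      "graded_mcm R G ((T\<lparr>carrier := K\<rparr>)\<lparr>carrier := K1\<rparr>) (\<lambda>i. K1 \<inter> (K \<inter> Tg i))"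
      "graded_mcm R G ((T\<lparr>carrier := K\<rparr>)\<lparr>carrier := K2\<rparr>) (\<lambda>i. K2 \<inter> (K \<inter> Tg i))"
      "K1 \<noteq> {\<zero>\<^bsub>T\<lparr>carrier := K\<rparr>\<^esub>}" "K2 \<noteq> {\<zero>\<^bsub>T\<lparr>carrier := K\<rparr>\<^esub>}" "K1 \<inter> K2 = {\<zero>\<^bsub>T\<lparr>carrier := K\<rparr>\<^esub>}"
      "K1 <+>\<^bsub>T\<lparr>carrier := K\<rparr>\<^esub> K2 = carrier (T\<lparr>carrier := K\<rparr>)" by blast
    have nz: "K1 \<noteq> {\<zero>\<^bsub>T\<^esub>}" "K2 \<noteq> {\<zero>\<^bsub>T\<^esub>}" "K1 \<inter> K2 = {\<zero>\<^bsub>T\<^esub>}" using K12(5,6,7) by auto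
    have sum: "K1 <+>\<^bsub>T\<^esub> K2 = K" using K12(8) by (simp add: set_add_def')
    have gr12: "graded_submodule K'"
      if K': "submodule K' R (T\<lparr>carrier := K\<rparr>)"
        "graded_mcm R G ((T\<lparr>carrier := K\<rparr>)\<lparr>carrier := K'\<rparr>) (\<lambda>i. K' \<inter> (K \<inter> Tg i))" for K'
    proof (rule graded_submoduleI)
      show "submodule K' R T" by (rule submodule_of_sub(2)[OF K K'(1)])
      have "K' \<inter> (K \<inter> Tg i) = K' \<inter> Tg i" for i using submodule_of_sub(1)[OF K K'(1)] by blast
      then show "graded_module R G (T\<lparr>carrier := K'\<rparr>) (\<lambda>i. K' \<inter> Tg i)"
        using K'(2) unfolding graded_mcm_def by simp
    qed
    note g1 = gr12[OF K12(1,3)] and g2 = gr12[OF K12(2,4)]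
    \<comment> \<open>By \<open>e_in_summand\<close>, e lies in K1 or in K2; the other part is moved
      into the complement.\<close>
    have eK: "e \<in> K1 <+>\<^bsub>T\<^esub> K2" using sum gK(3) by simp
    show False
    proof (cases "e \<in> K2")
      case True
      have "K2 <+>\<^bsub>T\<^esub> K1 = K"
        using g1 g2 sum submod_sum_comm unfolding graded_submodule_def by metis
      then show False using nosplit[OF g2 g1 nz(1)] nz(3) True by blast
    next
      case False
      then show False using nosplit[OF g1 g2 nz(2,3) sum] e_in_summand[OF g1 g2 eK] by blast
    qed
  qed
  with KL show ?thesis by blast
qed

end

section \<open>Recovering the ideal\<close>

text \<open>All elements of degree s are used in place of e, so that the ideal is determined by the
  graded module alone and can be compared along isomorphisms.\<close>

definition colon_ideal ::
    "('a, 'r) ring_scheme \<Rightarrow> 'a list \<Rightarrow> ('a, 'b, 'm) module_scheme \<Rightarrow> (int \<Rightarrow> 'b set) \<Rightarrow> int \<Rightarrow> 'a set" where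
  "colon_ideal R xs M Mg s = {r \<in> carrier R. \<forall>z\<in>Mg s. r \<odot>\<^bsub>M\<^esub> z \<in> ideal_times_module xs M}"

text \<open>By definition h only maps Mg i into Ng (i + n); that it maps onto it follows from
  bijectivity and uniqueness of components. The rest is transport of (xs)M along h.\<close>

lemma colon_ideal_isomorphic:
  fixes M :: "('a, 'b, 'm) module_scheme" and N :: "('a, 'c, 'n) module_scheme"
  assumes M: "graded_module R G M Mg" and N: "graded_module R G N Ng"
    and iso: "graded_isomorphic R M Mg N (shift_grading n Ng)" and xs: "set xs \<subseteq> carrier R"
  shows "colon_ideal R xs M Mg s = colon_ideal R xs N Ng (s + n)"
proof -
  obtain h where h: "h \<in> module_hom R M N" "\<And>i. h ` Mg i \<subseteq> Ng (i + n)" "bij_betw h (carrier M) (carrier N)"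
    using iso unfolding graded_isomorphic_def graded_hom_def shift_grading_def by blast
  interpret M: graded_module R G M Mg by (rule M)
  interpret N: graded_module R G N Ng by (rule N)
  interpret h: module_homomorphism R M N h
    by (intro module_homomorphism.intro module_homomorphism_axioms.intro h(1) M.module_axioms N.module_axioms)
  have inj: "inj_on h (carrier M)" and surj: "h ` carrier M = carrier N"
    using h(3) unfolding bij_betw_def by auto
  have comp: "hcomp N Ng (h z) (k + n) = h (hcomp M Mg z k)" if z: "z \<in> carrier M" for z k
  proof -
    define S where "S = {i. hcomp M Mg z i \<noteq> \<zero>\<^bsub>M\<^esub>}"
    have S: "finite S" "z = (\<Oplus>\<^bsub>M\<^esub>i\<in>S. hcomp M Mg z i)"
      unfolding S_def by (rule M.gr.hcomp_finite[OF z] M.gr.hcomp_sum[OF z])+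
    have zc: "hcomp M Mg z i \<in> carrier M" for i using M.gr.hcomp_closed[OF z] .
    have hz: "h z = (\<Oplus>\<^bsub>N\<^esub>i\<in>S. h (hcomp M Mg z i))"
      using h.finsum[of "hcomp M Mg z" S] zc S(2) by auto
    have "hcomp N Ng (h z) (k + n) = (\<Oplus>\<^bsub>N\<^esub>i\<in>S. hcomp N Ng (h (hcomp M Mg z i)) (k + n))"
      unfolding hz by (rule N.gr.hcomp_finsum) (use zc in auto)
    also have "\<dots> = (\<Oplus>\<^bsub>N\<^esub>i\<in>S. if k = i then h (hcomp M Mg z i) else \<zero>\<^bsub>N\<^esub>)"
    proof (intro N.M.finsum_cong' refl funcsetI)
      fix i
      have "h (hcomp M Mg z i) \<in> Ng (i + n)" using h(2) M.gr.hcomp_in[OF z] by blast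
      from N.gr.hcomp_homogeneous[OF this]
      show "hcomp N Ng (h (hcomp M Mg z i)) (k + n) = (if k = i then h (hcomp M Mg z i) else \<zero>\<^bsub>N\<^esub>)" by simp
    qed (use zc in auto)
    also have "\<dots> = h (hcomp M Mg z k)"
    proof (cases "k \<in> S")
      case True
      then show ?thesis using S zc by (intro N.M.add.finprod_singleton) auto
    next
      case False
      then have "(\<Oplus>\<^bsub>N\<^esub>i\<in>S. if k = i then h (hcomp M Mg z i) else \<zero>\<^bsub>N\<^esub>) = \<zero>\<^bsub>N\<^esub>"
        by (intro N.M.add.finprod_one_eqI) auto
      then show ?thesis using False by (simp add: S_def)
    qed
    finally show ?thesis .
  qed
  have "Ng (s + n) \<subseteq> h ` Mg s"
  proof
    fix y assume y: "y \<in> Ng (s + n)"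
    then obtain z where z: "z \<in> carrier M" "y = h z" using surj N.gr.H_carrier[OF y] by blast
    have "y = hcomp N Ng y (s + n)" using N.gr.hcomp_homogeneous[OF y] by simp
    then have "y = h (hcomp M Mg z s)" using comp[OF z(1)] z(2) by simp
    then show "y \<in> h ` Mg s" using M.gr.hcomp_in[OF z(1)] by blast
  qed
  with h(2) have im: "Ng (s + n) = h ` Mg s" by blast
  have x: "(!) xs \<in> {..<length xs} \<rightarrow> carrier R" using xs nth_mem by auto
  have it: "ideal_times_module xs N = h ` ideal_times_module xs M"
    unfolding ideal_times_module_eq_comb using h.comb_image[OF order_refl x] surj by simp
  have sub: "ideal_times_module xs M \<subseteq> carrier M"
    unfolding ideal_times_module_eq_comb
    by (rule M.submoduleE(1)[OF M.comb_submodule[OF M.carrier_is_submodule x]])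
  have "r \<odot>\<^bsub>N\<^esub> h z \<in> ideal_times_module xs N \<longleftrightarrow> r \<odot>\<^bsub>M\<^esub> z \<in> ideal_times_module xs M"
    if "r \<in> carrier R" "z \<in> Mg s" for r z
  proof -
    have zc: "z \<in> carrier M" using M.gr.H_carrier that(2) by blast
    have "r \<odot>\<^bsub>N\<^esub> h z = h (r \<odot>\<^bsub>M\<^esub> z)" using h.smult[OF that(1) zc] by simp
    then show ?thesis
      unfolding it using inj_on_image_mem_iff[OF inj _ sub] M.smult_closed[OF that(1) zc] by simp
  qed
  then show ?thesis unfolding colon_ideal_def im by auto
qed

text \<open>In degree s every element is a scalar multiple of e, so the condition on all of them
  reduces to the condition on e; \<open>comb_summand\<close> replaces (xs)T by (xs)K.\<close>

lemma (in pointed_cm_module) summand_colon_ideal: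
  assumes KL: "complementary K L" and J: "J \<subseteq> carrier R"
  shows "colon_ideal R xs (T\<lparr>carrier := K\<rparr>) (\<lambda>i. K \<inter> Tg i) s = J"
proof
  have K: "submodule K R T" and eK: "e \<in> K"
    using KL unfolding complementary_def graded_submodule_def by auto
  note it = summand_ideal_times[OF KL]
  show "colon_ideal R xs (T\<lparr>carrier := K\<rparr>) (\<lambda>i. K \<inter> Tg i) s \<subseteq> J"
  proof
    fix r assume "r \<in> colon_ideal R xs (T\<lparr>carrier := K\<rparr>) (\<lambda>i. K \<inter> Tg i) s"
    then have r: "r \<in> carrier R" "r \<odot>\<^bsub>T\<^esub> e \<in> comb T ((!) xs) {..<length xs} K"
      using eK e unfolding colon_ideal_def it by auto
    then have "r \<odot>\<^bsub>T\<^esub> e \<in> comb T ((!) xs) {..<length xs} (carrier T)"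
      using comb_mono[OF submoduleE(1)[OF K]] by blast
    then show "r \<in> J" using colon[OF r(1)] by simp
  qed
  show "J \<subseteq> colon_ideal R xs (T\<lparr>carrier := K\<rparr>) (\<lambda>i. K \<inter> Tg i) s"
  proof
    fix r assume rJ: "r \<in> J"
    then have r: "r \<in> carrier R" using J by blast
    have "r \<odot>\<^bsub>T\<^esub> z \<in> comb T ((!) xs) {..<length xs} K" if z: "z \<in> K" "z \<in> Tg s" for z
    proof (rule comb_summand[OF KL order_refl submod(5)[OF K r z(1)]])
      obtain q where q: "q \<in> G 0" "z = q \<odot>\<^bsub>T\<^esub> e" using span[OF z(2)] by blast
      have qc: "q \<in> carrier R" using RG.H_carrier q(1) by blast
      have "r \<odot>\<^bsub>T\<^esub> z = q \<odot>\<^bsub>T\<^esub> (r \<odot>\<^bsub>T\<^esub> e)"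
        unfolding q(2) using smult_assoc1[OF r qc e_carrier] smult_assoc1[OF qc r e_carrier] m_comm[OF r qc] by simp
      then show "r \<odot>\<^bsub>T\<^esub> z \<in> comb T ((!) xs) {..<length xs} (carrier T)"
        using submod(5)[OF comb_submodule[OF carrier_is_submodule x_funcset[OF order_refl]] qc] colon[OF r] rJ by simp
    qed
    then show "r \<in> colon_ideal R xs (T\<lparr>carrier := K\<rparr>) (\<lambda>i. K \<inter> Tg i) s"
      unfolding colon_ideal_def it using r by auto
  qed
qed

context standard_graded_ring
begin

lemma free_graded_module: "graded_module R G (free_module R n) (vdeg ds n)"
proof (intro graded_module.intro graded_module_axioms.intro free_module free_grading)
  fix r i v j assume r: "r \<in> G i" and v: "v \<in> vdeg ds n j"
  have "r \<otimes> v l \<in> Gz (int i + j - ds l)" for l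
  proof -
    have "r \<otimes> v l \<in> Gz (int i + (j - ds l))" using r vdeg_coord[OF v] by (intro Gz_mult) auto
    moreover have "int i + (j - ds l) = int i + j - ds l" by simp
    ultimately show ?thesis by metis
  qed
  then show "r \<odot>\<^bsub>free_module R n\<^esub> v \<in> vdeg ds n (int i + j)"
    using v RG.H_carrier[OF r] unfolding vdeg_def free_mem by simp
qed

lemma homogeneous_in_irrelevant:
  assumes "r \<in> G i" "0 < i"
  shows "r \<in> irrelevant_ideal R G"
  unfolding irrelevant_ideal_def
  using RG.hcomp_decomposition[of r] RG.H_carrier[OF assms(1)] RG.hcomp_homogeneous[OF assms(1), of 0] assms(2)
  by auto

lemma one_in_G0: "\<one> \<in> G 0"
  using subringE(3)[OF subfieldE(1)[OF degree_zero_field]] .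

lemma one_neq_zero: "\<one> \<noteq> \<zero>"
  using subfieldE(6)[OF degree_zero_field] .

text \<open>The inductive notion of dimension gives 0 for the zero space and 1 for a line. As
  neither describes the component, it contains the nonzero class of some u and the class of some v
  off the line through it.\<close>

lemma two_independent_elements:
  assumes I: "ideal I R"
    and big: "\<not> (\<exists>m\<le>1. ring.dimension (R Quot I) m (quotient_component R G I 0) (quotient_component R G I i))"
  shows "\<exists>u\<in>G i. \<exists>v\<in>G i. u \<notin> I \<and> (\<forall>k\<in>G 0. v \<ominus> k \<otimes> u \<notin> I)"
proof -
  interpret I: ideal I R by (rule I)
  interpret Q: ring "R Quot I" by (rule I.quotient_is_ring)
  define K where "K = quotient_component R G I 0"
  define E where "E = quotient_component R G I i"
  have no: "\<not> Q.dimension m K E" if "m \<le> 1" for m using big that unfolding K_def E_def by blast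
  have zero: "\<zero>\<^bsub>R Quot I\<^esub> = I +> \<zero>" "\<zero>\<^bsub>R Quot I\<^esub> = I"
    using a_rcos_zero[OF I I.zero_closed] by (simp_all add: FactRing_def)
  have in_zero: "I +> r = \<zero>\<^bsub>R Quot I\<^esub> \<longleftrightarrow> r \<in> I" if "r \<in> carrier R" for r
    using quotient_eq_iff_same_a_r_cos[OF I that zero_closed] that zero(1) by (simp add: a_minus_def)
  have closed: "I +> r \<in> carrier (R Quot I)" if "r \<in> carrier R" for r
    using that by (auto simp: FactRing_def A_RCOSETS_def')
  note hm = ring_hom_mult[OF I.rcos_ring_hom] and ha = ring_hom_add[OF I.rcos_ring_hom]
  have "E \<noteq> {\<zero>\<^bsub>R Quot I\<^esub>}" using no[of 0] Q.zero_dim by auto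
  moreover have "\<zero>\<^bsub>R Quot I\<^esub> \<in> E" unfolding E_def quotient_component_def zero(1) by simp
  ultimately obtain u where u: "u \<in> G i" "I +> u \<noteq> \<zero>\<^bsub>R Quot I\<^esub>" unfolding E_def quotient_component_def by blast
  have uc: "u \<in> carrier R" using RG.H_carrier u(1) by blast
  have line: "Q.line_extension K (I +> u) {\<zero>\<^bsub>R Quot I\<^esub>} = {I +> (k \<otimes> u) | k. k \<in> G 0}"
  proof -
    have "(I +> k) \<otimes>\<^bsub>R Quot I\<^esub> (I +> u) \<oplus>\<^bsub>R Quot I\<^esub> \<zero>\<^bsub>R Quot I\<^esub> = I +> (k \<otimes> u)" if "k \<in> G 0" for k
      using hm[of k u] closed[of "k \<otimes> u"] RG.H_carrier[OF that] uc by simp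
    then show ?thesis
      unfolding Q.line_extension_def K_def quotient_component_def set_add_def' r_coset_def
      by (auto; metis)
  qed
  have "Q.dimension (Suc 0) K (Q.line_extension K (I +> u) {\<zero>\<^bsub>R Quot I\<^esub>})"
    using u(2) closed[OF uc] by (intro Q.Suc_dim Q.zero_dim) auto
  then have "E \<noteq> {I +> (k \<otimes> u) | k. k \<in> G 0}" using no[of "Suc 0"] unfolding line by auto
  moreover have "{I +> (k \<otimes> u) | k. k \<in> G 0} \<subseteq> E"
    using mult_graded[of _ 0 u i] u(1) unfolding E_def quotient_component_def by auto
  ultimately obtain v where v: "v \<in> G i" "\<And>k. k \<in> G 0 \<Longrightarrow> I +> v \<noteq> I +> (k \<otimes> u)"
    unfolding E_def quotient_component_def by blast
  have "v \<ominus> k \<otimes> u \<notin> I" if "k \<in> G 0" for k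
    using v(2)[OF that] quotient_eq_iff_same_a_r_cos[OF I, of v "k \<otimes> u"] v(1) uc RG.H_carrier that by auto
  then show ?thesis using u v in_zero[OF uc] by blast
qed

end

context regular_parameters
begin

text \<open>At the last stage U is zero, so V itself is the module. It is carried over to the
  element type in which \<open>graded_countable_cm_type\<close> counts modules.\<close>

lemma pointed_cm_module_exists:
  assumes xs: "length xs = d" "x = (!) xs" and dim: "krull_dim R = enat d" and d: "0 < d"
    and apos: "\<And>j. j < d \<Longrightarrow> 0 < a j"
    and J: "ideal J R" "gen_ideal x {..<d} \<subseteq> J" "\<And>r j. r \<in> J \<Longrightarrow> cz j r \<in> J" "\<one> \<notin> J"
    and J_low: "\<And>r j. r \<in> J \<Longrightarrow> r \<in> Gz j \<Longrightarrow> j < c \<Longrightarrow> r \<in> gen_ideal x {..<d}"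
    and c: "int (\<Sum>j<d. a j) < c + int d - 1"
  shows "\<exists>(T :: ('a, (nat \<Rightarrow> 'a) set) module) Tg e.
    pointed_cm_module R G T Tg xs (int (\<Sum>j<d. a j)) e J"
proof -
  obtain n ds V e where "stage R G x a d c J d n ds V e"
    using final_stage_exists[of J c] J(1-3) J_low d by blast
  then interpret st: stage R G x a d c J d n ds V e .
  let ?F = "free_module R n"
  interpret F: graded_module R G ?F "vdeg ds n" by (rule free_graded_module)
  define s where "s = int (\<Sum>j<d. a j)"
  have U0: "comb ?F x {d..<d} (carrier ?F) = {\<zero>\<^bsub>?F\<^esub>}"
    unfolding atLeastLessThan_empty[OF order_refl] by (rule st.F.comb_empty)
  have plusU: "A <+>\<^bsub>?F\<^esub> {\<zero>\<^bsub>?F\<^esub>} = A" if A: "submodule A R ?F" for A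
  proof
    show "A <+>\<^bsub>?F\<^esub> {\<zero>\<^bsub>?F\<^esub>} \<subseteq> A" using st.F.submod_zero[OF A] by (intro st.F.submod_sum_least A) auto
    show "A \<subseteq> A <+>\<^bsub>?F\<^esub> {\<zero>\<^bsub>?F\<^esub>}" by (rule st.F.submod_sum_left[OF A st.F.zero_submodule])
  qed
  have cs: "submodule (comb ?F x {..<t} V) R ?F" if "t \<le> d" for t
    using that by (intro st.F.comb_submodule st.V x_funcset) auto
  define M where "M = ?F\<lparr>carrier := V\<rparr>"
  define Mg where "Mg i = V \<inter> vdeg ds n i" for i
  have "F.graded_submodule V"
    unfolding F.graded_submodule_def using st.V st.V_comp free_hcomp[OF st.V_carrier] by simp
  then have gM: "graded_module R G M Mg"
    unfolding M_def Mg_def[abs_def] by (rule F.graded_submodule_is_graded) (use RG.H_carrier in blast)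
  interpret M: graded_module R G M Mg by (rule gM)
  have combM: "comb M x {..<t} V = comb ?F x {..<t} V" if "t \<le> d" for t
    unfolding M_def using that by (intro st.F.comb_carrier_update st.V x_funcset) auto
  have Mc: "carrier M = V" and Msm: "r \<odot>\<^bsub>M\<^esub> v = r \<odot>\<^bsub>?F\<^esub> v" for r v by (simp_all add: M_def)
  \<comment> \<open>Vectors become singleton sets, which is an injection into the required element
    type.\<close>
  define \<phi> :: "(nat \<Rightarrow> 'a) \<Rightarrow> (nat \<Rightarrow> 'a) set" where "\<phi> v = {v}" for v
  have inj: "inj_on \<phi> (carrier M)" by (simp add: inj_on_def \<phi>_def)
  define T where "T = transport_module \<phi> M"
  define Tg where "Tg i = \<phi> ` Mg i" for i
  note ts = M.transport_simps[OF inj, folded T_def]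
  have gT: "graded_module R G T Tg"
    unfolding T_def Tg_def[abs_def] by (rule M.transport_is_graded[OF inj])
  interpret T: graded_module R G T Tg by (rule gT)
  interpret h: module_homomorphism R M T \<phi>
  proof (intro module_homomorphism.intro module_homomorphism_axioms.intro M.module_axioms T.module_axioms)
    show "\<phi> \<in> module_hom R M T" unfolding module_hom_def using ts by auto
  qed
  have Tc: "carrier T = \<phi> ` V" using ts(1) Mc by simp
  have combT: "comb T x {..<t} (carrier T) = \<phi> ` comb ?F x {..<t} V" if "t \<le> d" for t
  proof -
    have "\<phi> ` comb M x {..<t} V = comb T x {..<t} (\<phi> ` V)"
      using that Mc by (intro h.comb_image x_funcset) auto
    then show ?thesis unfolding Tc combM[OF that] by simp
  qed
  have phi_mem: "\<phi> v \<in> \<phi> ` A \<longleftrightarrow> v \<in> A" for v A by (auto simp: \<phi>_def)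
  have sm: "r \<odot>\<^bsub>T\<^esub> \<phi> v = \<phi> (r \<odot>\<^bsub>?F\<^esub> v)" if "r \<in> carrier R" "v \<in> V" for r v
    using h.smult[of r v] that Mc Msm by simp
  have "pointed_cm_module R G T Tg xs s (\<phi> e) J"
  proof (intro pointed_cm_module.intro pointed_cm_module_axioms.intro standard_graded_ring_axioms gT)
    obtain B where B: "B \<subseteq> V" "finite B" "V = lin R ?F B"
      using free_submodule_fg[OF noetherian_ring_axioms st.V] by blast
    then have BM: "B \<subseteq> carrier M" "carrier M = lin R M B"
      using st.F.lin_carrier_update[OF st.V B(1)] unfolding M_def by auto
    have lT: "carrier T = lin R T (\<phi> ` B)" using h.lin_image[OF B(2) BM] Tc Mc by simp
    show "fg_module R T"
      unfolding fg_module_iff_lin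
    proof (intro exI[of _ "\<phi> ` B"] conjI)
      show "\<phi> ` B \<subseteq> carrier T" unfolding Tc using B(1) by (rule image_mono)
      show "finite (\<phi> ` B)" using B(2) by (rule finite_imageI)
      show "carrier T = lin R T (\<phi> ` B)" by (rule lT)
    qed
    show "krull_dim R = enat (length xs)" using dim xs(1) by simp
    show "set xs \<subseteq> irrelevant_ideal R G"
    proof
      fix y assume "y \<in> set xs"
      then obtain j where "j < d" "y = x j" using xs unfolding in_set_conv_nth by auto
      then show "y \<in> irrelevant_ideal R G" using homogeneous_in_irrelevant x_degree apos by blast
    qed
    show "\<phi> e \<in> Tg s" unfolding Tg_def Mg_def s_def using st.e by blast
    show "\<one> \<notin> J" by (rule J(4))
  next
    fix t w assume t: "t < length xs" and w: "w \<in> carrier T"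
      and m: "(xs ! t) \<odot>\<^bsub>T\<^esub> w \<in> comb T ((!) xs) {..<t} (carrier T)"
    obtain v where v: "v \<in> V" "w = \<phi> v" using w Tc by blast
    have td: "t < d" "t \<le> d" using t xs(1) by auto
    have "\<phi> (x t \<odot>\<^bsub>?F\<^esub> v) \<in> \<phi> ` comb ?F x {..<t} V"
      using m sm[OF x_closed[OF td(1)] v(1)] combT[OF td(2)] unfolding v(2) xs(2)[symmetric] by simp
    then have "x t \<odot>\<^bsub>?F\<^esub> v \<in> comb ?F x {..<t} V" unfolding phi_mem .
    then have "v \<in> comb ?F x {..<t} V"
      using st.reg[OF td(1) v(1)] unfolding U0 plusU[OF cs[OF td(2)]] by blast
    then show "w \<in> comb T ((!) xs) {..<t} (carrier T)"
      unfolding xs(2)[symmetric] combT[OF td(2)] v(2) by (rule imageI)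
  next
    fix z assume "z \<in> Tg s"
    then obtain v where v: "v \<in> V" "v \<in> vdeg ds n s" "z = \<phi> v" unfolding Tg_def Mg_def by blast
    \<comment> \<open>Degree s lies below the bound for the generators other than e, so only
      multiples of e occur in it.\<close>
    have "s < c + int d - 1" using c unfolding s_def .
    then obtain r u where r: "r \<in> carrier R" "u \<in> {\<zero>\<^bsub>?F\<^esub>}" "v = r \<odot>\<^bsub>?F\<^esub> e \<oplus>\<^bsub>?F\<^esub> u"
      using st.low[OF v(1,2)] unfolding U0 by blast
    have ec: "e \<in> carrier ?F" by (rule st.V_carrier[OF st.e(1)])
    have ve: "v = r \<odot>\<^bsub>?F\<^esub> e" using r st.F.M.r_zero[OF st.F.smult_closed[OF r(1) ec]] by blast
    \<comment> \<open>Both v and e have degree s, so the coefficient r may be replaced by its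
      component of degree zero, which lies in the field.\<close>
    have "v = vcomp ds s v" using vcomp_homogeneous[OF v(2), of s] by simp
    also have "\<dots> = cz (s - s) r \<odot>\<^bsub>?F\<^esub> e"
      unfolding ve s_def by (rule vcomp_smult[OF st.e(2) r(1)])
    finally have "v = cz 0 r \<odot>\<^bsub>?F\<^esub> e" by simp
    moreover have G0: "cz 0 r \<in> G 0" using cz_in[OF r(1), of 0] Gz_nat[of 0] by simp
    ultimately have "z = cz 0 r \<odot>\<^bsub>T\<^esub> \<phi> e"
      using sm[OF RG.H_carrier[OF G0] st.e(1)] v(3) by simp
    with G0 show "\<exists>r\<in>G 0. z = r \<odot>\<^bsub>T\<^esub> \<phi> e" by blast
  next
    fix r assume r: "r \<in> carrier R"
    have "r \<odot>\<^bsub>T\<^esub> \<phi> e \<in> comb T x {..<d} (carrier T) \<longleftrightarrow> r \<odot>\<^bsub>?F\<^esub> e \<in> comb ?F x {..<d} V"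
      unfolding sm[OF r st.e(1)] combT[OF order_refl] phi_mem ..
    also have "\<dots> \<longleftrightarrow> r \<in> J" using st.colon[OF r] unfolding U0 plusU[OF cs[OF order_refl]] .
    finally show "r \<odot>\<^bsub>T\<^esub> \<phi> e \<in> comb T ((!) xs) {..<length xs} (carrier T) \<longleftrightarrow> r \<in> J"
      unfolding xs(1) xs(2)[symmetric] .
  qed
  then show ?thesis unfolding s_def by blast
qed

end

text \<open>Each index is assigned its class together with the shift relating it to a chosen member
  of the class. These pairs range over a countable set, so two indices share both, and one module is
  isomorphic to both of theirs with the same shift n.\<close>

lemma countable_classes_imp_isomorphic:
  fixes N :: "'i \<Rightarrow> 'a rep_graded_module"
  assumes count: "graded_countable_cm_type R G" and unc: "uncountable A"
    and N: "\<And>\<alpha>. \<alpha> \<in> A \<Longrightarrow> indecomposable_graded_mcm R G (fst (N \<alpha>)) (snd (N \<alpha>))"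
  shows "\<exists>\<alpha>\<in>A. \<exists>\<beta>\<in>A. \<alpha> \<noteq> \<beta> \<and> (\<exists>\<gamma>\<in>A. \<exists>n.
    graded_isomorphic R (fst (N \<gamma>)) (snd (N \<gamma>)) (fst (N \<alpha>)) (shift_grading n (snd (N \<alpha>))) \<and>
    graded_isomorphic R (fst (N \<gamma>)) (snd (N \<gamma>)) (fst (N \<beta>)) (shift_grading n (snd (N \<beta>))))"
proof -
  define \<I> where "\<I> = {(M :: ('a, (nat \<Rightarrow> 'a) set) module, Mg). indecomposable_graded_mcm R G M Mg}"
  define rel where "rel = {((M :: ('a, (nat \<Rightarrow> 'a) set) module, Mg), (N :: ('a, (nat \<Rightarrow> 'a) set) module, Ng)).
    indecomposable_graded_mcm R G M Mg \<and> indecomposable_graded_mcm R G N Ng \<and> isomorphic_up_to_shift R M Mg N Ng}"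
  have cX: "countable (\<I> // rel)" using count unfolding graded_countable_cm_type_def \<I>_def rel_def .
  define cls where "cls \<alpha> = rel `` {N \<alpha>}" for \<alpha>
  have NX: "N \<alpha> \<in> \<I>" if "\<alpha> \<in> A" for \<alpha> using N[OF that] by (auto simp: \<I>_def split: prod.split)
  then have clsX: "cls \<alpha> \<in> \<I> // rel" if "\<alpha> \<in> A" for \<alpha>
    using that unfolding cls_def by (auto intro: quotientI)
  have refl: "N \<alpha> \<in> cls \<alpha>" if "\<alpha> \<in> A" for \<alpha>
  proof -
    have "graded_isomorphic R (fst (N \<alpha>)) (snd (N \<alpha>)) (fst (N \<alpha>)) (shift_grading 0 (snd (N \<alpha>)))"
      unfolding graded_isomorphic_def graded_hom_def module_hom_def shift_grading_def
      by (rule bexI[of _ "\<lambda>v. v"]) (auto simp: bij_betw_def)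
    then have "isomorphic_up_to_shift R (fst (N \<alpha>)) (snd (N \<alpha>)) (fst (N \<alpha>)) (snd (N \<alpha>))"
      unfolding isomorphic_up_to_shift_def by blast
    then show ?thesis using N[OF that] unfolding cls_def rel_def by (auto simp: case_prod_beta)
  qed
  \<comment> \<open>The representative is chosen among the indices in A and depends only on the
    class, so indices with equal class get the same one.\<close>
  define rep where "rep q = (SOME \<gamma>. \<gamma> \<in> A \<and> cls \<gamma> = q)" for q
  have rep: "rep (cls \<alpha>) \<in> A \<and> cls (rep (cls \<alpha>)) = cls \<alpha>" if "\<alpha> \<in> A" for \<alpha>
    unfolding rep_def by (rule someI[of _ \<alpha>]) (use that in simp)
  have "\<exists>n. graded_isomorphic R (fst (N (rep (cls \<alpha>)))) (snd (N (rep (cls \<alpha>)))) (fst (N \<alpha>)) (shift_grading n (snd (N \<alpha>)))"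
    if "\<alpha> \<in> A" for \<alpha>
  proof -
    have "N \<alpha> \<in> cls (rep (cls \<alpha>))" using rep[OF that] refl[OF that] by simp
    then have "(N (rep (cls \<alpha>)), N \<alpha>) \<in> rel" unfolding cls_def by blast
    then show ?thesis unfolding rel_def isomorphic_up_to_shift_def by (auto simp: case_prod_beta)
  qed
  then obtain n where n: "\<And>\<alpha>. \<alpha> \<in> A \<Longrightarrow>
    graded_isomorphic R (fst (N (rep (cls \<alpha>)))) (snd (N (rep (cls \<alpha>)))) (fst (N \<alpha>)) (shift_grading (n \<alpha>) (snd (N \<alpha>)))"
    by metis
  define h where "h \<alpha> = (cls \<alpha>, n \<alpha> :: int)" for \<alpha>
  have "h ` A \<subseteq> (\<I> // rel) \<times> UNIV" using clsX by (auto simp: h_def)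
  then have "countable (h ` A)" using cX by (intro countable_subset[of "h ` A"]) auto
  then have "\<not> inj_on h A" using unc countable_image_inj_on by blast
  then obtain \<alpha> \<beta> where ab: "\<alpha> \<in> A" "\<beta> \<in> A" "\<alpha> \<noteq> \<beta>" "h \<alpha> = h \<beta>" unfolding inj_on_def by blast
  then have "cls \<alpha> = cls \<beta>" "n \<alpha> = n \<beta>" by (auto simp: h_def)
  then show ?thesis using ab(1-3) n[OF ab(1)] n[OF ab(2)] rep[OF ab(1)] by metis
qed

section \<open>The ideals obtained by adjoining one form, and the pencil spanned by two
  forms\<close>

context regular_parameters
begin

lemma gen_ideal_all: "ideal (gen_ideal x {..<d}) R"
  by (rule gen_ideal_ideal[OF x_funcset[OF order_refl]])

context
  fixes i :: nat and f :: 'a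
  assumes apos: "\<And>j. j < d \<Longrightarrow> 0 < a j" and ipos: "0 < i" and f: "f \<in> G i"
begin

abbreviation "J \<equiv> gen_ideal x {..<d} <+>\<^bsub>R\<^esub> PIdl f"

lemma f_carrier: "f \<in> carrier R"
  using f RG.H_carrier by blast

lemma J_mem: "r \<in> J \<longleftrightarrow> (\<exists>p\<in>gen_ideal x {..<d}. \<exists>q\<in>carrier R. r = p \<oplus> q \<otimes> f)"
  by (rule ideal_adjoin(4)[OF gen_ideal_all f_carrier])

lemma J_comp:
  assumes "p \<in> gen_ideal x {..<d}" "q \<in> carrier R"
  shows "cz j (p \<oplus> q \<otimes> f) = cz j p \<oplus> cz (j - int i) q \<otimes> f"
proof -
  have pc: "p \<in> carrier R" using ideal.Icarr[OF gen_ideal_all assms(1)] .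
  have "cz j (f \<otimes> q) = f \<otimes> cz (j - int i) q" by (rule cz_mult) (use f assms(2) in simp_all)
  then show ?thesis using pc assms(2) f_carrier by (simp add: cz_add m_comm)
qed

lemma J_cz: "r \<in> J \<Longrightarrow> cz j r \<in> J"
  unfolding J_mem using J_comp gen_ideal_cz[OF order_refl] cz_closed by metis

text \<open>In degree below i the multiple q f contributes through a component of q in negative
  degree, which is zero.\<close>

lemma J_low:
  assumes "r \<in> J" "r \<in> Gz j" "j < int i"
  shows "r \<in> gen_ideal x {..<d}"
proof -
  obtain p q where pq: "p \<in> gen_ideal x {..<d}" "q \<in> carrier R" "r = p \<oplus> q \<otimes> f" using assms(1) unfolding J_mem by blast
  have pc: "p \<in> carrier R" using ideal.Icarr[OF gen_ideal_all pq(1)] .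
  have "r = cz j r" using cz_homogeneous[OF assms(2), of j] by simp
  also have "\<dots> = cz j p \<oplus> cz (j - int i) q \<otimes> f" unfolding pq(3) by (rule J_comp[OF pq(1,2)])
  also have "cz (j - int i) q = \<zero>" using assms(3) by (simp add: int_comp_def)
  finally show ?thesis using gen_ideal_cz[OF order_refl pq(1), of j] f_carrier pc by simp
qed

text \<open>Degree 0 is below i, so 1 would lie in I. But the generators of I have positive degree,
  so the coefficients in an expression of degree 0 would have negative degree and vanish.\<close>

lemma one_notin_J: "\<one> \<notin> J"
proof
  assume "\<one> \<in> J"
  then have "\<one> \<in> gen_ideal x {..<d}" using one_in_G0 Gz_nat[of 0] ipos by (intro J_low[of _ 0]) simp_all
  then obtain t where t: "\<forall>j\<in>{..<d}. t j \<in> Gz (0 - int (a j))" "cz 0 \<one> = (\<Oplus>j\<in>{..<d}. x j \<otimes> t j)"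
    using cz_gen_ideal[of "{..<d}" x "\<lambda>j. int (a j)" \<one> 0] x_degree by auto
  have "x j \<otimes> t j = \<zero>" if "j \<in> {..<d}" for j
  proof -
    have "t j = \<zero>" using t(1) that apos Gz_neg[of "0 - int (a j)"] by auto
    then show ?thesis using that x_closed by simp
  qed
  then have "(\<Oplus>j\<in>{..<d}. x j \<otimes> t j) = \<zero>" by (rule add.finprod_one_eqI)
  moreover have "cz 0 \<one> = \<one>" using cz_homogeneous[of \<one> 0 0] one_in_G0 Gz_nat[of 0] by simp
  ultimately show False using t(2) one_neq_zero by simp
qed

lemma indecomposable_module_exists:
  assumes xs: "length xs = d" "x = (!) xs" and dim: "krull_dim R = enat d" and d: "0 < d"
    and s: "int (\<Sum>j<d. a j) < int i + int d - 1"
  shows "\<exists>p :: 'a rep_graded_module. indecomposable_graded_mcm R G (fst p) (snd p) \<and>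
    colon_ideal R xs (fst p) (snd p) (int (\<Sum>j<d. a j)) = J"
proof -
  note adj = ideal_adjoin[OF gen_ideal_all f_carrier]
  obtain T :: "('a, (nat \<Rightarrow> 'a) set) module" and Tg e
    where "pointed_cm_module R G T Tg xs (int (\<Sum>j<d. a j)) e J"
    using pointed_cm_module_exists[of xs J "int i"] xs dim d apos adj(1,2) J_cz one_notin_J J_low s by blast
  then interpret pointed_cm_module R G T Tg xs "int (\<Sum>j<d. a j)" e J .
  obtain K L where KL: "complementary K L" "indecomposable_graded_mcm R G (T\<lparr>carrier := K\<rparr>) (\<lambda>i. K \<inter> Tg i)"
    using indecomposable_summand_exists by blast
  have "J \<subseteq> carrier R" using ideal.Icarr[OF adj(1)] by blast
  from summand_colon_ideal[OF KL(1) this] KL(2) show ?thesis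
    by (intro exI[of _ "(T\<lparr>carrier := K\<rparr>, \<lambda>i. K \<inter> Tg i)"]) simp
qed

end

text \<open>Equality of the ideals gives, in degree i, u + \<alpha> v = l (u + \<beta> v) modulo I
  with l in the field. Independence of u and v modulo I then forces l = 1 and \<alpha> = l
  \<beta>.\<close>

lemma pencil_inj:
  assumes u: "u \<in> G i" "u \<notin> gen_ideal x {..<d}" and v: "v \<in> G i"
    and indep: "\<And>k. k \<in> G 0 \<Longrightarrow> v \<ominus> k \<otimes> u \<notin> gen_ideal x {..<d}"
    and ab: "\<alpha> \<in> G 0" "\<beta> \<in> G 0"
    and eq: "gen_ideal x {..<d} <+>\<^bsub>R\<^esub> PIdl (u \<oplus> \<alpha> \<otimes> v) = gen_ideal x {..<d} <+>\<^bsub>R\<^esub> PIdl (u \<oplus> \<beta> \<otimes> v)"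
  shows "\<alpha> = \<beta>"
proof -
  define I where "I = gen_ideal x {..<d}"
  interpret I: ideal I R unfolding I_def by (rule gen_ideal_all)
  have G0: "subring (G 0) R" by (rule subfieldE(1)[OF degree_zero_field])
  have c: "u \<in> carrier R" "v \<in> carrier R" "\<alpha> \<in> carrier R" "\<beta> \<in> carrier R" using u v ab RG.H_carrier by auto
  have fG: "u \<oplus> k \<otimes> v \<in> G i" if "k \<in> G 0" for k
    using RG.H_add[OF u(1) mult_graded[OF that v, simplified]] .
  have "u \<oplus> \<alpha> \<otimes> v \<in> I <+>\<^bsub>R\<^esub> PIdl (u \<oplus> \<alpha> \<otimes> v)"
    by (rule ideal_adjoin(3)[OF I.is_ideal]) (use c in simp)
  then have "u \<oplus> \<alpha> \<otimes> v \<in> I <+>\<^bsub>R\<^esub> PIdl (u \<oplus> \<beta> \<otimes> v)" using eq unfolding I_def by simp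
  then obtain p q where pq: "p \<in> I" "q \<in> carrier R" "u \<oplus> \<alpha> \<otimes> v = p \<oplus> q \<otimes> (u \<oplus> \<beta> \<otimes> v)"
    using ideal_adjoin(4)[OF I.is_ideal, of "u \<oplus> \<beta> \<otimes> v"] c by auto
  \<comment> \<open>Both forms have degree i, so only the degree zero part of the multiplier q
    enters the component of degree i.\<close>
  define l where "l = cz 0 q"
  define p' where "p' = cz (int i) p"
  have l: "l \<in> G 0" "l \<in> carrier R" unfolding l_def using cz_in[OF pq(2), of 0] Gz_nat[of 0] pq(2) by auto
  have p': "p' \<in> I" unfolding p'_def using pq(1) gen_ideal_cz[OF order_refl] unfolding I_def by blast
  have p'c: "p' \<in> carrier R" using I.Icarr[OF p'] .
  have pc: "p \<in> carrier R" using I.Icarr[OF pq(1)] .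
  have "cz (int i) (u \<oplus> \<alpha> \<otimes> v) = u \<oplus> \<alpha> \<otimes> v" using cz_homogeneous[of "u \<oplus> \<alpha> \<otimes> v" "int i" "int i"] fG[OF ab(1)] by simp
  moreover have "cz (int i) (p \<oplus> q \<otimes> (u \<oplus> \<beta> \<otimes> v)) = p' \<oplus> l \<otimes> (u \<oplus> \<beta> \<otimes> v)"
  proof -
    have "cz (int i) ((u \<oplus> \<beta> \<otimes> v) \<otimes> q) = (u \<oplus> \<beta> \<otimes> v) \<otimes> cz (int i - int i) q"
      by (rule cz_mult) (use fG[OF ab(2)] pq(2) in simp_all)
    then show ?thesis using c pc pq(2) l(2) by (simp add: cz_add m_comm p'_def l_def)
  qed
  ultimately have e1: "u \<oplus> \<alpha> \<otimes> v = p' \<oplus> l \<otimes> (u \<oplus> \<beta> \<otimes> v)" using pq(3) by simp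
  define m where "m = \<alpha> \<ominus> l \<otimes> \<beta>"
  have m: "m \<in> G 0" "m \<in> carrier R"
    using G0 ab l(1) c l(2) unfolding m_def a_minus_def by (auto intro: subringE(5,6,7))
  have rel: "m \<otimes> v \<oplus> (\<one> \<ominus> l) \<otimes> u = p'"
  proof -
    have "m \<otimes> v \<oplus> (\<one> \<ominus> l) \<otimes> u = (u \<oplus> \<alpha> \<otimes> v) \<ominus> l \<otimes> (u \<oplus> \<beta> \<otimes> v)"
      unfolding m_def using c l(2) by algebra
    also have "\<dots> = p'" unfolding e1 using c l(2) p'c by (simp add: a_minus_def a_assoc r_neg)
    finally show ?thesis .
  qed
  have m0: "m = \<zero>"
  proof (rule ccontr)
    assume "m \<noteq> \<zero>"
    then have "m \<in> G 0 - {\<zero>}" using m(1) by simp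
    note inv = subfield_m_inv[OF degree_zero_field this]
    have ic: "inv m \<in> carrier R" using inv(1) RG.H_carrier by auto
    \<comment> \<open>Dividing m v + (1 - l) u by m gives v - k u with this k, an element of I that
      \<open>indep\<close> excludes.\<close>
    define k where "k = inv m \<otimes> (l \<ominus> \<one>)"
    have "l \<ominus> \<one> \<in> G 0" using G0 l(1) one_in_G0 unfolding a_minus_def by (auto intro: subringE(5,7))
    then have k: "k \<in> G 0" unfolding k_def using inv(1) subringE(6)[OF G0] by blast
    have "inv m \<otimes> p' = (inv m \<otimes> m) \<otimes> v \<ominus> k \<otimes> u"
      unfolding rel[symmetric] k_def using ic m(2) c l(2) by algebra
    also have "\<dots> = v \<ominus> k \<otimes> u" using inv(3) c by simp
    finally show False using indep[OF k] I.I_l_closed[OF p' ic] unfolding I_def by simp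
  qed
  have "\<one> \<ominus> l = \<zero>"
  proof (rule ccontr)
    assume nz: "\<one> \<ominus> l \<noteq> \<zero>"
    have "\<one> \<ominus> l \<in> G 0" using G0 l(1) one_in_G0 unfolding a_minus_def by (auto intro: subringE(5,7))
    with nz have "\<one> \<ominus> l \<in> G 0 - {\<zero>}" by simp
    note inv = subfield_m_inv[OF degree_zero_field this]
    have ic: "inv (\<one> \<ominus> l) \<in> carrier R" using inv(1) RG.H_carrier by auto
    have "(\<one> \<ominus> l) \<otimes> u = p'" using rel m0 c l(2) by simp
    then have "inv (\<one> \<ominus> l) \<otimes> p' = (inv (\<one> \<ominus> l) \<otimes> (\<one> \<ominus> l)) \<otimes> u" using ic c l(2) by (simp add: m_assoc)
    then have "inv (\<one> \<ominus> l) \<otimes> p' = u" using inv(3) c by simp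
    then show False using u(2) I.I_l_closed[OF p' ic] unfolding I_def by simp
  qed
  then have "l = \<one>" using l(2) by simp
  then have "\<alpha> \<ominus> \<beta> = \<zero>" using m0 c unfolding m_def by simp
  then show ?thesis using c by simp
qed

end

text \<open>Cohen-Macaulayness turns the dimension d into the depth along the irrelevant ideal,
  which supplies the regular sequence behind \<open>sop_permutably_regular\<close>.\<close>

lemma (in standard_graded_ring) sop_regular_parameters:
  assumes cm: "graded_cohen_macaulay R G" and dim: "krull_dim R = enat d" and d: "0 < d"
    and sop: "homogeneous_sop R G es xs"
  shows "regular_parameters R G ((!) xs) ((!) es) d" "length xs = d"
    "gen_ideal ((!) xs) {..<d} = Idl (set xs)"
proof -
  have deg: "\<And>j. j < d \<Longrightarrow> xs ! j \<in> G (es ! j)" "\<And>j. j < d \<Longrightarrow> 0 < es ! j"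
    and dim0: "krull_dim (R Quot Idl (set xs)) = 0" and len: "length xs = d"
    using sop dim unfolding homogeneous_sop_def by (auto simp: Suc_le_eq)
  show "length xs = d" by (rule len)
  have "(!) xs ` {..<d} = set xs" using len by (auto simp: set_conv_nth)
  then show I: "gen_ideal ((!) xs) {..<d} = Idl (set xs)"
    using gen_ideal_eq_Idl[of "{..<d}" "(!) xs"] deg(1) RG.H_carrier by auto
  have dep: "depth R (irrelevant_ideal R G) (self_module R) = enat d"
    using cm dim unfolding graded_cohen_macaulay_def by simp
  have dimI: "krull_dim (R Quot gen_ideal ((!) xs) {..<d}) = 0" using dim0 unfolding I .
  show "regular_parameters R G ((!) xs) ((!) es) d"
    using sop_permutably_regular[where x = "(!) xs" and a = "(!) es" and d = d, OF deg(1) dimI d dep deg(2)] deg(1)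
    by unfold_locales blast+
qed

theorem theorem4p2:
  fixes R :: "('a, 'r) ring_scheme" and G :: "nat \<Rightarrow> 'a set" and d :: nat
  assumes "standard_graded_ring R G"
    and "graded_cohen_macaulay R G"
    and "krull_dim R = enat d"
    and "d > 0"
    and "uncountable (G 0)"
    and "graded_countable_cm_type R G"
  shows "super_stretched R G"
proof -
  interpret standard_graded_ring R G by fact
  show ?thesis
    unfolding super_stretched_def Let_def
  proof (intro allI impI)
    fix es xs and i :: nat
    assume sop: "homogeneous_sop R G es xs" and i: "int (sum_list es) - int (length xs) + 2 \<le> int i"
    note rp = sop_regular_parameters[OF assms(2,3,4) sop]
    interpret P: regular_parameters R G "(!) xs" "(!) es" d by (rule rp(1))
    have es: "length es = d" "\<And>j. j < d \<Longrightarrow> 0 < es ! j"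
      using sop rp(2) unfolding homogeneous_sop_def by auto
    have sum: "sum_list es = (\<Sum>j<d. es ! j)"
      using es(1) by (simp add: sum_list_sum_nth atLeast0LessThan)
    \<comment> \<open>Every parameter has degree at least one, so i is at least 2, and positivity of
      i keeps 1 out of the ideals J. The summand 2 in the bound makes the sum of the degrees
      strictly smaller than i + d - 1.\<close>
    have "d \<le> (\<Sum>j<d. es ! j)"
      using sum_mono[of "{..<d}" "\<lambda>_. 1" "(!) es"] es(2) by (simp add: Suc_le_eq)
    then have ipos: "0 < i" and s: "int (\<Sum>j<d. es ! j) < int i + int d - 1"
      using i unfolding rp(2) sum by linarith+
    show "\<exists>n\<le>1. ring.dimension (R Quot Idl\<^bsub>R\<^esub> set xs) n
        (quotient_component R G (Idl\<^bsub>R\<^esub> set xs) 0) (quotient_component R G (Idl\<^bsub>R\<^esub> set xs) i)"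
    proof (rule ccontr)
      assume neg: "\<not> ?thesis"
      have "ideal (Idl\<^bsub>R\<^esub> (set xs)) R" using P.gen_ideal_all unfolding rp(3) .
      from two_independent_elements[OF this neg] obtain u v where uv: "u \<in> G i" "v \<in> G i"
        "u \<notin> Idl\<^bsub>R\<^esub> (set xs)" "\<And>k. k \<in> G 0 \<Longrightarrow> v \<ominus>\<^bsub>R\<^esub> k \<otimes>\<^bsub>R\<^esub> u \<notin> Idl\<^bsub>R\<^esub> (set xs)" by blast
      define J where "J \<alpha> = gen_ideal ((!) xs) {..<d} <+>\<^bsub>R\<^esub> PIdl\<^bsub>R\<^esub> (u \<oplus>\<^bsub>R\<^esub> \<alpha> \<otimes>\<^bsub>R\<^esub> v)" for \<alpha>
      have "\<exists>p :: 'a rep_graded_module. indecomposable_graded_mcm R G (fst p) (snd p) \<and>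
          colon_ideal R xs (fst p) (snd p) (int (\<Sum>j<d. es ! j)) = J \<alpha>" if \<alpha>: "\<alpha> \<in> G 0" for \<alpha>
      proof -
        have f: "u \<oplus>\<^bsub>R\<^esub> \<alpha> \<otimes>\<^bsub>R\<^esub> v \<in> G i" using RG.H_add[OF uv(1) mult_graded[OF \<alpha> uv(2), simplified]] .
        show ?thesis
          unfolding J_def by (rule P.indecomposable_module_exists[OF es(2) ipos f rp(2) refl assms(3,4) s])
      qed
      then obtain N :: "'a \<Rightarrow> 'a rep_graded_module" where
        N: "\<And>\<alpha>. \<alpha> \<in> G 0 \<Longrightarrow> indecomposable_graded_mcm R G (fst (N \<alpha>)) (snd (N \<alpha>))"
          "\<And>\<alpha>. \<alpha> \<in> G 0 \<Longrightarrow> colon_ideal R xs (fst (N \<alpha>)) (snd (N \<alpha>)) (int (\<Sum>j<d. es ! j)) = J \<alpha>" by metis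
      obtain \<alpha> \<beta> \<gamma> n where ab: "\<alpha> \<in> G 0" "\<beta> \<in> G 0" "\<alpha> \<noteq> \<beta>" and \<gamma>: "\<gamma> \<in> G 0" and iso:
        "graded_isomorphic R (fst (N \<gamma>)) (snd (N \<gamma>)) (fst (N \<alpha>)) (shift_grading n (snd (N \<alpha>)))"
        "graded_isomorphic R (fst (N \<gamma>)) (snd (N \<gamma>)) (fst (N \<beta>)) (shift_grading n (snd (N \<beta>)))"
        using countable_classes_imp_isomorphic[OF assms(6,5), of N] N(1) by blast
      have gr: "graded_module R G (fst (N \<delta>)) (snd (N \<delta>))" if "\<delta> \<in> G 0" for \<delta>
        using N(1)[OF that] unfolding indecomposable_graded_mcm_def graded_mcm_def by blast
      have xs: "set xs \<subseteq> carrier R" using P.x_closed rp(2) unfolding in_set_conv_nth subset_iff by blast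
      \<comment> \<open>The isomorphism shifts degrees by n, so the colon ideal of N \<delta> in the
        degree of e is that of N \<gamma> in this degree minus n; the right-hand side does not
        involve \<delta>.\<close>
      have "J \<delta> = colon_ideal R xs (fst (N \<gamma>)) (snd (N \<gamma>)) (int (\<Sum>j<d. es ! j) - n)"
        if "\<delta> \<in> G 0" "graded_isomorphic R (fst (N \<gamma>)) (snd (N \<gamma>)) (fst (N \<delta>)) (shift_grading n (snd (N \<delta>)))" for \<delta>
        using colon_ideal_isomorphic[OF gr[OF \<gamma>] gr[OF that(1)] that(2) xs, of "int (\<Sum>j<d. es ! j) - n"] N(2)[OF that(1)]
        by simp
      then have "J \<alpha> = J \<beta>" using ab iso by metis
      then have "\<alpha> = \<beta>"
        using P.pencil_inj[OF uv(1) _ uv(2) _ ab(1,2)] uv(3,4) unfolding J_def rp(3) by blast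
      with ab(3) show False by blast
    qed
  qed
qed

end
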